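(* There are positive constants $C$ and $\bar\epsilon$ such that the following holds. If $M>0$, $|a|\le\bar\epsilon M$, and $f:\mathcal C^+\to[0,\infty)$ is a smooth solution of the massless Vlasov equation $\mathcal X f=0$ on the exterior of the Kerr spacetime with parameters $(M,a)$, then for all $t\in\mathbb R$, $$E_{\mathrm{model},3}[f](t)\le C\,E_{\mathrm{model},3}[f](0).$$
   Context: Kerr exterior. For $M>0$, $|a|\le M$, set $r_+=M+\sqrt{M^2-a^2}$, $\Delta=r^2-2Mr+a^2$, $\Sigma=r^2+a^2\cos^2\theta$, $\Pi=(r^2+a^2)^2-a^2\Delta\sin^2\theta$. The Kerr exterior is $\mathcal M=\mathbb R_t\times(r_+,\infty)_r\times S^2_{(\theta,\phi)}$ with the Lorentzian metric $$g=-\Big(1-\frac{2Mr}{\Sigma}\Big)dt^2-\frac{4Mar\sin^2\theta}{\Sigma}\,dt\,d\phi+\frac{\Pi\sin^2\theta}{\Sigma}d\phi^2+\frac{\Sigma}{\Delta}dr^2+\Sigma\,d\theta^2 .$$ It is time oriented by declaring the timelike vector field $T_\perp=\partial_t+\frac{2aMr}{\Pi}\partial_\phi$ (which is normal to the surfaces of constant $t$) to be future directed. $\Sigma_t$ denotes the hypersurface of constant $t$. Cone bundle and Vlasov equation. $\mathcal C^+=\bigcup_{x\in\mathcal M}\mathcal C^+_x$, where $\mathcal C^+_x=\{(x,v): v\in T_x\mathcal M,\ g(v,v)=0,\ g(v,T_\perp)<0\}$ is the future light cone at $x$. With natural coordinates $(x^a,v^a)$ on $T\mathcal M$ (where $v=v^a\partial_{x^a}$),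 the geodesic spray is $\mathcal X=v^a\big(\partial_{x^a}-v^b\Gamma^c{}_{ab}\partial_{v^c}\big)$; it is tangent to $\mathcal C^+$. The massless Vlasov equation for $f:\mathcal C^+\to\mathbb R$ is $\mathcal Xf=0$. Indices are lowered with $g$: $v_t,v_r,v_\theta,v_\phi$ are the components of $g(v,\cdot)$ in the coordinates $(t,r,\theta,\phi)$. Energy. $$E_{\mathrm{model},3}[f](t)=\int_{\Sigma_t}\int_{\mathcal C^+_x}\Big(\frac{(r^2+a^2)^2}{\Delta}v_t^2+\Delta v_r^2+v_\theta^2+\frac{1}{\sin^2\theta}v_\phi^2\Big)|f|_2\;d^3v\,d^3x,$$ where $|f|_2=\big|M^2v_t^2+v_\theta^2+\frac1{\sin^2\theta}v_\phi^2\big|^2 f$, $d^3x=\sin\theta\,dr\,d\theta\,d\phi$, and $d^3v=\frac{1}{|v_t|}r^2\sin\theta\,dv^r\,dv^\theta\,dv^\phi$ is the measure on $\mathcal C^+_x$ expressed in the local coordinates $(v^r,v^\theta,v^\phi)$ on $\mathcal C_x^+$. Integrals of nonnegative functions take values in $[0,\infty]$. *)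

theory Defs
  imports "HOL-Analysis.Analysis"
begin

text \<open>For open \<open>S\<close>, \<open>Ck_on k f S\<close> says that \<open>f\<close> is \<open>k\<close> times continuously differentiable on \<open>S\<close>.\<close>

primrec Ck_on ::
  "nat \<Rightarrow> ('a::real_normed_vector \<Rightarrow> 'b::real_normed_vector) \<Rightarrow> 'a set \<Rightarrow> bool" where
  "Ck_on 0 f S \<longleftrightarrow> continuous_on S f"
| "Ck_on (Suc k) f S \<longleftrightarrow>
     (\<forall>x\<in>S. f differentiable (at x)) \<and>
     (\<forall>v. Ck_on k (\<lambda>x. frechet_derivative f (at x) v) S)"

text \<open>Smoothness on an embedded submanifold \<open>S\<close>: locally the restriction of a smooth function
  on an open subset of the ambient space. Values of \<open>f\<close> outside \<open>S\<close> are irrelevant.\<close>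

definition smooth_on_submanifold ::
  "('a::real_normed_vector \<Rightarrow> 'b::real_normed_vector) \<Rightarrow> 'a set \<Rightarrow> bool" where
  "smooth_on_submanifold f S \<longleftrightarrow>
     (\<forall>p\<in>S. \<exists>U F. open U \<and> p \<in> U \<and> (\<forall>k. Ck_on k F U) \<and> (\<forall>q\<in>U \<inter> S. F q = f q))"

text \<open>Boyer--Lindquist coordinates \<open>(t, r, \<theta>, \<phi>)\<close> degenerate on the axis. The manifold
  \<open>\<real> \<times> (r\<^sub>+, \<infinity>) \<times> S\<^sup>2\<close> is therefore represented by the global chart
  \<open>(t, r, \<omega>) \<mapsto> (t, r \<omega>)\<close>, whose image is an open subset of \<open>real ^ 4\<close>; tangent vectors are
  elements of \<open>real ^ 4\<close>, and the tangent bundle lies in \<open>(real ^ 4) \<times> (real ^ 4)\<close>.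
  In \<open>kerr_Sigma\<close> and \<open>kerr_Pi\<close> the argument \<open>c\<close> stands for \<open>cos \<theta>\<close>.\<close>

definition r_plus :: "real \<Rightarrow> real \<Rightarrow> real" where
  "r_plus M a = M + sqrt (M\<^sup>2 - a\<^sup>2)"

definition kerr_Delta :: "real \<Rightarrow> real \<Rightarrow> real \<Rightarrow> real" where
  "kerr_Delta M a r = r\<^sup>2 - 2 * M * r + a\<^sup>2"

definition kerr_Sigma :: "real \<Rightarrow> real \<Rightarrow> real \<Rightarrow> real" where
  "kerr_Sigma a r c = r\<^sup>2 + a\<^sup>2 * c\<^sup>2"

definition kerr_Pi :: "real \<Rightarrow> real \<Rightarrow> real \<Rightarrow> real \<Rightarrow> real" where
  "kerr_Pi M a r c = (r\<^sup>2 + a\<^sup>2)\<^sup>2 - a\<^sup>2 * kerr_Delta M a r * (1 - c\<^sup>2)"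

definition rad :: "real ^ 4 \<Rightarrow> real" where
  "rad x = sqrt ((x $ 2)\<^sup>2 + (x $ 3)\<^sup>2 + (x $ 4)\<^sup>2)"

definition cos_polar :: "real ^ 4 \<Rightarrow> real" where
  "cos_polar x = x $ 4 / rad x"

definition kerr_exterior :: "real \<Rightarrow> real \<Rightarrow> (real ^ 4) set" where
  "kerr_exterior M a = {x. r_plus M a < rad x}"

text \<open>The covectors \<open>dr\<close> and \<open>sin\<^sup>2\<theta> d\<phi>\<close> and the round metric
  \<open>d\<theta>\<^sup>2 + sin\<^sup>2\<theta> d\<phi>\<^sup>2\<close> of the unit sphere; all are smooth across the axis.\<close>

definition dr_form :: "real ^ 4 \<Rightarrow> real ^ 4 \<Rightarrow> real" where
  "dr_form x v = (x $ 2 * v $ 2 + x $ 3 * v $ 3 + x $ 4 * v $ 4) / rad x"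

definition sin2_dphi_form :: "real ^ 4 \<Rightarrow> real ^ 4 \<Rightarrow> real" where
  "sin2_dphi_form x v = (x $ 2 * v $ 3 - x $ 3 * v $ 2) / (rad x)\<^sup>2"

definition round_metric :: "real ^ 4 \<Rightarrow> real ^ 4 \<Rightarrow> real ^ 4 \<Rightarrow> real" where
  "round_metric x v w =
     (v $ 2 * w $ 2 + v $ 3 * w $ 3 + v $ 4 * w $ 4 - dr_form x v * dr_form x w) / (rad x)\<^sup>2"

text \<open>The angular part \<open>\<Sigma> d\<theta>\<^sup>2 + (\<Pi> sin\<^sup>2\<theta> / \<Sigma>) d\<phi>\<^sup>2\<close> is rewritten with
  \<open>\<Pi> = \<Sigma>\<^sup>2 + a\<^sup>2 sin\<^sup>2\<theta> (\<Sigma> + 2 M r)\<close> so that the formula also makes sense on the axis;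
  lemma \<open>kerr_metric_boyer_lindquist\<close> below recovers the usual coordinate expression.\<close>

definition kerr_metric :: "real \<Rightarrow> real \<Rightarrow> real ^ 4 \<Rightarrow> real ^ 4 \<Rightarrow> real ^ 4 \<Rightarrow> real" where
  "kerr_metric M a x v w =
    (let r = rad x; S = kerr_Sigma a r (cos_polar x); D = kerr_Delta M a r in
       - (1 - 2 * M * r / S) * (v $ 1 * w $ 1)
       - (2 * M * a * r / S) * (v $ 1 * sin2_dphi_form x w + sin2_dphi_form x v * w $ 1)
       + (S / D) * (dr_form x v * dr_form x w)
       + S * round_metric x v w
       + a\<^sup>2 * (1 + 2 * M * r / S) * (sin2_dphi_form x v * sin2_dphi_form x w))"

definition d_phi :: "real ^ 4 \<Rightarrow> real ^ 4" where
  "d_phi x = vector [0, - (x $ 3), x $ 2, 0]"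

definition T_perp :: "real \<Rightarrow> real \<Rightarrow> real ^ 4 \<Rightarrow> real ^ 4" where
  "T_perp M a x =
     axis 1 1 + (2 * a * M * rad x / kerr_Pi M a (rad x) (cos_polar x)) *\<^sub>R d_phi x"

definition future_cone :: "real \<Rightarrow> real \<Rightarrow> ((real ^ 4) \<times> (real ^ 4)) set" where
  "future_cone M a =
     {(x, v). x \<in> kerr_exterior M a \<and> kerr_metric M a x v v = 0 \<and>
              kerr_metric M a x v (T_perp M a x) < 0}"

definition metric_matrix :: "real \<Rightarrow> real \<Rightarrow> real ^ 4 \<Rightarrow> real ^ 4 ^ 4" where
  "metric_matrix M a x = (\<chi> i j. kerr_metric M a x (axis i 1) (axis j 1))"

definition metric_partial :: "real \<Rightarrow> real \<Rightarrow> real ^ 4 \<Rightarrow> 4 \<Rightarrow> 4 \<Rightarrow> 4 \<Rightarrow> real" where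
  "metric_partial M a x k i j =
     frechet_derivative (\<lambda>y. metric_matrix M a y $ i $ j) (at x) (axis k 1)"

definition christoffel :: "real \<Rightarrow> real \<Rightarrow> real ^ 4 \<Rightarrow> 4 \<Rightarrow> 4 \<Rightarrow> 4 \<Rightarrow> real" where
  "christoffel M a x c i j =
     (\<Sum>d\<in>UNIV. matrix_inv (metric_matrix M a x) $ c $ d *
        (metric_partial M a x i j d + metric_partial M a x j i d - metric_partial M a x d i j)) / 2"

definition geodesic_spray ::
  "real \<Rightarrow> real \<Rightarrow> (real ^ 4) \<times> (real ^ 4) \<Rightarrow> (real ^ 4) \<times> (real ^ 4)" where
  "geodesic_spray M a p =
     (case p of (x, v) \<Rightarrow>
       (v, \<chi> c. - (\<Sum>i\<in>UNIV. \<Sum>j\<in>UNIV. christoffel M a x c i j * v $ i * v $ j)))"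

text \<open>A derivative of \<open>f\<close> within the cone is not unique as a linear map on the ambient space,
  but its values on vectors tangent to the cone are; the spray is such a vector.\<close>

definition massless_vlasov :: "real \<Rightarrow> real \<Rightarrow> ((real ^ 4) \<times> (real ^ 4) \<Rightarrow> real) \<Rightarrow> bool" where
  "massless_vlasov M a f \<longleftrightarrow>
     (\<forall>p\<in>future_cone M a.
        frechet_derivative f (at p within future_cone M a) (geodesic_spray M a p) = 0)"

definition bl_point :: "real ^ 4 \<Rightarrow> real ^ 4" where
  "bl_point q = vector [q $ 1, q $ 2 * sin (q $ 3) * cos (q $ 4),
                        q $ 2 * sin (q $ 3) * sin (q $ 4), q $ 2 * cos (q $ 3)]"

text \<open>The tangent vector at \<open>bl_point q\<close> with components \<open>c = (v\<^sup>t, v\<^sup>r, v\<^sup>\<theta>, v\<^sup>\<phi>)\<close>.\<close>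

definition bl_vec :: "real ^ 4 \<Rightarrow> real ^ 4 \<Rightarrow> real ^ 4" where
  "bl_vec q c = frechet_derivative bl_point (at q) c"

text \<open>The lowered components: \<open>i = 1, 2, 3, 4\<close> give \<open>v\<^sub>t\<close>, \<open>v\<^sub>r\<close>, \<open>v\<^sub>\<theta>\<close>, \<open>v\<^sub>\<phi>\<close>.\<close>

definition bl_lower :: "real \<Rightarrow> real \<Rightarrow> real ^ 4 \<Rightarrow> real ^ 4 \<Rightarrow> 4 \<Rightarrow> real" where
  "bl_lower M a q c i = kerr_metric M a (bl_point q) (bl_vec q c) (bl_vec q (axis i 1))"

lemma vector_4 [simp]:
  "(vector [x, y, z, w] :: 'a::zero ^ 4) $ 1 = x"
  "(vector [x, y, z, w] :: 'a ^ 4) $ 2 = y"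
  "(vector [x, y, z, w] :: 'a ^ 4) $ 3 = z"
  "(vector [x, y, z, w] :: 'a ^ 4) $ 4 = w"
  by (simp_all add: vector_def)

lemma bl_vec_eq:
  "bl_vec q c = vector
     [c $ 1,
      c $ 2 * sin (q $ 3) * cos (q $ 4) + q $ 2 * (c $ 3 * cos (q $ 3)) * cos (q $ 4)
        - q $ 2 * sin (q $ 3) * (c $ 4 * sin (q $ 4)),
      c $ 2 * sin (q $ 3) * sin (q $ 4) + q $ 2 * (c $ 3 * cos (q $ 3)) * sin (q $ 4)
        + q $ 2 * sin (q $ 3) * (c $ 4 * cos (q $ 4)),
      c $ 2 * cos (q $ 3) - q $ 2 * (c $ 3 * sin (q $ 3))]" (is "_ = ?R c")
proof -
  have nth: "((\<lambda>q::real^4. q $ i) has_derivative (\<lambda>c. c $ i)) (at q)" for i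
    by (intro bounded_linear.has_derivative[OF bounded_linear_vec_nth] has_derivative_ident)
  note sn = has_derivative_sin[OF nth] and cs = has_derivative_cos[OF nth]
  have "((\<lambda>q. bl_point q $ i) has_derivative (\<lambda>c. ?R c $ i)) (at q)" for i :: 4
  proof -
    have 1: "((\<lambda>q. bl_point q $ 1) has_derivative (\<lambda>c. ?R c $ 1)) (at q)"
      unfolding bl_point_def vector_4 by (rule nth)
    have 2: "((\<lambda>q. bl_point q $ 2) has_derivative (\<lambda>c. ?R c $ 2)) (at q)"
      unfolding bl_point_def vector_4
      by (rule has_derivative_eq_rhs, rule has_derivative_mult[OF has_derivative_mult[OF nth sn] cs])
        (simp add: fun_eq_iff algebra_simps)
    have 3: "((\<lambda>q. bl_point q $ 3) has_derivative (\<lambda>c. ?R c $ 3)) (at q)"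
      unfolding bl_point_def vector_4
      by (rule has_derivative_eq_rhs, rule has_derivative_mult[OF has_derivative_mult[OF nth sn] sn])
        (simp add: fun_eq_iff algebra_simps)
    have 4: "((\<lambda>q. bl_point q $ 4) has_derivative (\<lambda>c. ?R c $ 4)) (at q)"
      unfolding bl_point_def vector_4
      by (rule has_derivative_eq_rhs, rule has_derivative_mult[OF nth cs])
        (simp add: fun_eq_iff algebra_simps)
    show ?thesis
      using exhaust_4[of i] by (elim disjE) (simp_all only: 1 2 3 4)
  qed
  then have "(bl_point has_derivative ?R) (at q)"
    by (subst has_derivative_componentwise_within)
      (auto simp: Basis_vec_def inner_axis)
  then have "frechet_derivative bl_point (at q) = ?R"
    by (rule frechet_derivative_at[symmetric])
  then show ?thesis
    unfolding bl_vec_def by (rule fun_cong)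
qed

lemma bl_d_phi: "bl_vec q (axis 4 1) = d_phi (bl_point q)"
  by (simp add: bl_vec_eq d_phi_def bl_point_def axis_def)

lemma rad_bl: "0 < q $ 2 \<Longrightarrow> rad (bl_point q) = q $ 2"
proof -
  assume r: "0 < q $ 2"
  have "(bl_point q $ 2)\<^sup>2 + (bl_point q $ 3)\<^sup>2 + (bl_point q $ 4)\<^sup>2
      = (q $ 2)\<^sup>2 * ((sin (q $ 3))\<^sup>2 * ((cos (q $ 4))\<^sup>2 + (sin (q $ 4))\<^sup>2) + (cos (q $ 3))\<^sup>2)"
    by (simp add: bl_point_def power_mult_distrib algebra_simps del: sin_cos_squared_add2)
  then show ?thesis
    using r by (simp add: rad_def)
qed

lemma kerr_metric_boyer_lindquist:
  fixes M a :: real and q c d :: "real ^ 4"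
  defines "r \<equiv> q $ 2" and "\<theta> \<equiv> q $ 3"
  defines "S \<equiv> kerr_Sigma a r (cos \<theta>)"
  assumes r: "0 < r"
  shows "kerr_metric M a (bl_point q) (bl_vec q c) (bl_vec q d) =
      - (1 - 2 * M * r / S) * (c $ 1 * d $ 1)
      - (2 * M * a * r * (sin \<theta>)\<^sup>2 / S) * (c $ 1 * d $ 4 + c $ 4 * d $ 1)
      + (kerr_Pi M a r (cos \<theta>) * (sin \<theta>)\<^sup>2 / S) * (c $ 4 * d $ 4)
      + (S / kerr_Delta M a r) * (c $ 2 * d $ 2)
      + S * (c $ 3 * d $ 3)"
proof -
  define st ct sp cp where "st = sin \<theta>" and "ct = cos \<theta>" and "sp = sin (q $ 4)" and "cp = cos (q $ 4)"
  have T: "st\<^sup>2 = 1 - ct\<^sup>2" and P: "sp\<^sup>2 = 1 - cp\<^sup>2"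
    by (simp_all add: st_def ct_def sp_def cp_def sin_squared_eq)
  have rad: "rad (bl_point q) = r"
    using rad_bl r by (simp add: r_def)
  have cp: "cos_polar (bl_point q) = ct"
    using r by (simp add: cos_polar_def rad) (simp add: bl_point_def r_def ct_def \<theta>_def)
  have S0: "S > 0"
    unfolding S_def kerr_Sigma_def using r by (simp add: add_pos_nonneg)
  note ev = bl_vec_eq bl_point_def vector_4 r_def[symmetric] \<theta>_def[symmetric]
    st_def[symmetric] ct_def[symmetric] sp_def[symmetric] cp_def[symmetric]
  have dr: "dr_form (bl_point q) (bl_vec q c) = c $ 2" for c
  proof -
    have "r * st * cp * (c $ 2 * st * cp + r * (c $ 3 * ct) * cp - r * st * (c $ 4 * sp))
        + r * st * sp * (c $ 2 * st * sp + r * (c $ 3 * ct) * sp + r * st * (c $ 4 * cp))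
        + r * ct * (c $ 2 * ct - r * (c $ 3 * st)) = c $ 2 * r"
      (is "?L = _")
    proof -
      have "?L = c $ 2 * r * (st\<^sup>2 * (cp\<^sup>2 + sp\<^sup>2) + ct\<^sup>2) + r\<^sup>2 * (c $ 3) * st * ct * (cp\<^sup>2 + sp\<^sup>2 - 1)"
        by (simp add: algebra_simps power2_eq_square)
      then show ?thesis by (simp add: T P)
    qed
    then show ?thesis
      using r unfolding dr_form_def rad by (simp add: ev)
  qed
  have dp: "sin2_dphi_form (bl_point q) (bl_vec q c) = st\<^sup>2 * c $ 4" for c
  proof -
    have "r * st * cp * (c $ 2 * st * sp + r * (c $ 3 * ct) * sp + r * st * (c $ 4 * cp))
        - r * st * sp * (c $ 2 * st * cp + r * (c $ 3 * ct) * cp - r * st * (c $ 4 * sp))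
        = st\<^sup>2 * c $ 4 * r\<^sup>2"
      (is "?L = _")
    proof -
      have "?L = st\<^sup>2 * c $ 4 * r\<^sup>2 * (cp\<^sup>2 + sp\<^sup>2)"
        by (simp add: algebra_simps power2_eq_square)
      then show ?thesis by (simp add: P)
    qed
    then show ?thesis
      using r unfolding sin2_dphi_form_def rad by (simp add: ev)
  qed
  have rm: "round_metric (bl_point q) (bl_vec q c) (bl_vec q d) = c $ 3 * d $ 3 + st\<^sup>2 * c $ 4 * d $ 4"
  proof -
    have "(c $ 2 * st * cp + r * (c $ 3 * ct) * cp - r * st * (c $ 4 * sp)) *
          (d $ 2 * st * cp + r * (d $ 3 * ct) * cp - r * st * (d $ 4 * sp))
        + (c $ 2 * st * sp + r * (c $ 3 * ct) * sp + r * st * (c $ 4 * cp)) *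
          (d $ 2 * st * sp + r * (d $ 3 * ct) * sp + r * st * (d $ 4 * cp))
        + (c $ 2 * ct - r * (c $ 3 * st)) * (d $ 2 * ct - r * (d $ 3 * st))
        - c $ 2 * d $ 2 = (c $ 3 * d $ 3 + st\<^sup>2 * c $ 4 * d $ 4) * r\<^sup>2"
      (is "?L = _")
    proof -
      have "?L = c $ 2 * d $ 2 * (st\<^sup>2 * (cp\<^sup>2 + sp\<^sup>2) + ct\<^sup>2 - 1)
          + (c $ 2 * d $ 3 + c $ 3 * d $ 2) * r * st * ct * (cp\<^sup>2 + sp\<^sup>2 - 1)
          + c $ 3 * d $ 3 * r\<^sup>2 * (ct\<^sup>2 * (cp\<^sup>2 + sp\<^sup>2) + st\<^sup>2)
          + c $ 4 * d $ 4 * r\<^sup>2 * st\<^sup>2 * (cp\<^sup>2 + sp\<^sup>2)"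
        by (simp add: algebra_simps power2_eq_square)
      then show ?thesis by (simp add: T P algebra_simps)
    qed
    then show ?thesis
      using r unfolding round_metric_def dr rad by (simp add: ev)
  qed
  have vt: "bl_vec q c $ 1 = c $ 1" for c
    by (simp add: bl_vec_eq)
  have Seq: "S = r\<^sup>2 + a\<^sup>2 * ct\<^sup>2"
    by (simp add: S_def kerr_Sigma_def ct_def)
  have "kerr_Pi M a r ct = S\<^sup>2 + a\<^sup>2 * st\<^sup>2 * (S + 2 * M * r)"
    unfolding kerr_Pi_def kerr_Delta_def Seq T by (simp add: algebra_simps power2_eq_square)
  then have Pi: "kerr_Pi M a r ct * st\<^sup>2 / S = S * st\<^sup>2 + a\<^sup>2 * (1 + 2 * M * r / S) * (st\<^sup>2 * st\<^sup>2)"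
    using S0 by (simp add: field_simps power2_eq_square)
  show ?thesis
    unfolding kerr_metric_def Let_def rad cp dr dp rm vt
      st_def[symmetric] ct_def[symmetric] Pi
    by (simp add: S_def[folded ct_def, symmetric] algebra_simps)
qed

text \<open>The integral of \<open>h\<close>, a function of the components \<open>c\<close>, over the future light cone at
  \<open>bl_point q\<close> with respect to \<open>d\<^sup>3v = |v\<^sub>t|\<^sup>-\<^sup>1 r\<^sup>2 sin \<theta> dv\<^sup>r dv\<^sup>\<theta> dv\<^sup>\<phi>\<close>. The functions
  \<open>(v\<^sup>r, v\<^sup>\<theta>, v\<^sup>\<phi>)\<close> are only local coordinates on the cone: in the ergoregion they are
  generically two-to-one onto their image, so both sheets have to be counted, which is the
  role of the inner integral. The folding locus \<open>v\<^sub>t = 0\<close> is a null set.\<close>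

definition cone_nn_integral ::
  "real \<Rightarrow> real \<Rightarrow> real ^ 4 \<Rightarrow> (real ^ 4 \<Rightarrow> real) \<Rightarrow> ennreal" where
  "cone_nn_integral M a q h =
     (\<integral>\<^sup>+ (vr, v\<theta>, v\<phi>). 
        (\<integral>\<^sup>+ vt. (let c = vector [vt, vr, v\<theta>, v\<phi>] in
             ennreal (h c * ((q $ 2)\<^sup>2 * sin (q $ 3) / \<bar>bl_lower M a q c 1\<bar>)))
          \<partial>count_space {vt. (bl_point q, bl_vec q (vector [vt, vr, v\<theta>, v\<phi>])) \<in> future_cone M a})
      \<partial>(lborel :: (real \<times> real \<times> real) measure))"

definition weighted_norm_2 ::
  "real \<Rightarrow> real \<Rightarrow> ((real ^ 4) \<times> (real ^ 4) \<Rightarrow> real) \<Rightarrow> real ^ 4 \<Rightarrow> real ^ 4 \<Rightarrow> real" where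
  "weighted_norm_2 M a f q c =
     \<bar>M\<^sup>2 * (bl_lower M a q c 1)\<^sup>2 + (bl_lower M a q c 3)\<^sup>2
        + 1 / (sin (q $ 3))\<^sup>2 * (bl_lower M a q c 4)\<^sup>2\<bar>\<^sup>2 * f (bl_point q, bl_vec q c)"

definition model_weight :: "real \<Rightarrow> real \<Rightarrow> real ^ 4 \<Rightarrow> real ^ 4 \<Rightarrow> real" where
  "model_weight M a q c =
     ((q $ 2)\<^sup>2 + a\<^sup>2)\<^sup>2 / kerr_Delta M a (q $ 2) * (bl_lower M a q c 1)\<^sup>2
     + kerr_Delta M a (q $ 2) * (bl_lower M a q c 2)\<^sup>2
     + (bl_lower M a q c 3)\<^sup>2
     + 1 / (sin (q $ 3))\<^sup>2 * (bl_lower M a q c 4)\<^sup>2"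

definition E_model_3 ::
  "real \<Rightarrow> real \<Rightarrow> ((real ^ 4) \<times> (real ^ 4) \<Rightarrow> real) \<Rightarrow> real \<Rightarrow> ennreal" where
  "E_model_3 M a f t =
     (\<integral>\<^sup>+ (r, \<theta>, \<phi>) \<in> {r_plus M a<..} \<times> {0<..<pi} \<times> {0<..<2 * pi}.
        (let q = vector [t, r, \<theta>, \<phi>] in
           ennreal (sin \<theta>) *
           cone_nn_integral M a q (\<lambda>c. model_weight M a q c * weighted_norm_2 M a f q c))
      \<partial>(lborel :: (real \<times> real \<times> real) measure))"

end

theory Submission
  imports Defs
begin

text \<open>In Boyer--Lindquist coordinates with lowered velocity components the null geodesic flow,
  parametrised by \<open>t\<close>, is a Hamiltonian flow on phase space whose Hamiltonian is \<open>- v\<^sub>t\<close>; hence it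
  preserves \<open>dr d\<theta> d\<phi> dv\<^sub>r dv\<^sub>\<theta> dv\<^sub>\<phi>\<close>, and the energy at time \<open>t\<close> is the integral of a weight times \<open>f\<close>
  over phase space. The quantities \<open>v\<^sub>t\<close>, \<open>v\<^sub>\<phi>\<close> and Carter's constant are conserved, and for
  \<open>\<bar>a\<bar> \<le> M / 1000\<close> the weight is pointwise comparable to a function of them, so no decay information
  is needed. For \<open>r \<ge> 5 M / 2\<close> the angular momentum barrier bounds \<open>\<bar>v\<^sub>\<phi>\<bar>\<close> by \<open>r \<bar>v\<^sub>t\<bar>\<close>, and
  the leading factor of the weight is comparable to \<open>- v\<^sub>t\<close>. Closer to the horizon this fails for
  null vectors of small or negative energy, and there it is comparable to
  \<open>- v\<^sub>t + a\<^sup>2 v\<^sub>\<phi>\<^sup>2 / (M\<^sup>2 \<delta>)\<close>, where \<open>\<delta> > 0\<close> is the value of \<open>- (r\<^sup>2 + a\<^sup>2) v\<^sub>t - a v\<^sub>\<phi>\<close> on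
  the horizon (up to powers of \<open>M\<close>).

  Instead of constructing the flow, one multiplies the conserved density by compactly supported
  cut-offs that decrease along the flow, differentiates under the integral, uses that the
  Hamiltonian vector field is divergence free, and lets the cut-offs exhaust phase space.\<close>

section \<open>Continuously differentiable functions\<close>

text \<open>Since \<open>L\<close> = v_phi is constant along the flow, it is frozen as a parameter,
  and the dynamics live on a phase space with the four coordinates of \<open>phase_dom\<close>. The
  value \<open>L\<close> = 0 is left out as a null set of parameters: for \<open>L\<close> different
  from 0 the square root in \<open>ham\<close> has a positive radicand, so \<open>ham\<close> is C1.

  The factor 1/|v_t| in d^3v is singular in the ergoregion. On each sheet of the cone, replacing
  v^phi by v_phi costs a Jacobian proportional to |v_t| / \<open>ham_root\<close>, so the
  singularity disappears and both sheets merge into one integral over all \<open>L\<close> with a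
  positive density. The 1/Delta in the energy cancels at the same time. Up to bounded factors the
  weight is then \<open>weight_num\<close> / \<open>ham_root\<close> times the square of a conserved
  form, so that the whole estimate rests on comparing this one quotient with a conserved function.

  Only C1 regularity is ever used: the cut-offs are squares of positive parts, and the divergence is
  computed from explicit first derivatives.\<close>

lemma C1_iff:
  "Ck_on (Suc 0) f S \<longleftrightarrow> (\<exists>f'. (\<forall>x\<in>S. (f has_derivative f' x) (at x)) \<and> (\<forall>v. continuous_on S (\<lambda>x. f' x v)))"
proof
  assume "Ck_on (Suc 0) f S"
  then show "\<exists>f'. (\<forall>x\<in>S. (f has_derivative f' x) (at x)) \<and> (\<forall>v. continuous_on S (\<lambda>x. f' x v))"
    by (intro exI[of _ "\<lambda>x. frechet_derivative f (at x)"]) (auto simp: frechet_derivative_works)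
next
  assume "\<exists>f'. (\<forall>x\<in>S. (f has_derivative f' x) (at x)) \<and> (\<forall>v. continuous_on S (\<lambda>x. f' x v))"
  then obtain f' where f': "\<And>x. x \<in> S \<Longrightarrow> (f has_derivative f' x) (at x)" "\<And>v. continuous_on S (\<lambda>x. f' x v)"
    by blast
  have "continuous_on S (\<lambda>x. frechet_derivative f (at x) v)" for v
    using f'(2)[of v] by (rule continuous_on_eq) (metis frechet_derivative_at f'(1))
  then show "Ck_on (Suc 0) f S"
    using f'(1) by (auto simp: differentiable_def)
qed

lemma C1_I:
  assumes "\<And>x. x \<in> S \<Longrightarrow> (f has_derivative f' x) (at x)" "\<And>v. continuous_on S (\<lambda>x. f' x v)"
  shows "Ck_on (Suc 0) f S"
  unfolding C1_iff using assms by blast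

lemma C1_has_derivative:
  "Ck_on (Suc 0) f S \<Longrightarrow> x \<in> S \<Longrightarrow> (f has_derivative frechet_derivative f (at x)) (at x)"
  by (auto simp: frechet_derivative_works)

lemma C1_continuous_derivative:
  "Ck_on (Suc 0) f S \<Longrightarrow> continuous_on S (\<lambda>x. frechet_derivative f (at x) v)"
  by auto

lemma C1_continuous_on: "Ck_on (Suc 0) f S \<Longrightarrow> continuous_on S f"
  by (metis C1_has_derivative continuous_at_imp_continuous_on has_derivative_continuous)

lemma C1_subset: "Ck_on (Suc 0) f S \<Longrightarrow> T \<subseteq> S \<Longrightarrow> Ck_on (Suc 0) f T"
  by (auto intro: continuous_on_subset)

lemma C1_cong:
  assumes "open S" "\<And>x. x \<in> S \<Longrightarrow> f x = g x" "Ck_on (Suc 0) f S"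
  shows "Ck_on (Suc 0) g S"
proof -
  from assms(3) obtain f' where f': "\<And>x. x \<in> S \<Longrightarrow> (f has_derivative f' x) (at x)" "\<And>v. continuous_on S (\<lambda>x. f' x v)"
    unfolding C1_iff by blast
  show ?thesis
    by (rule C1_I[of _ _ f'])
      (use f' assms(1,2) in \<open>auto intro: has_derivative_transform_within_open\<close>)
qed

text \<open>Glues local descriptions. It serves the zero extensions, the piecewise function
  \<open>cons\<close>, and \<open>f\<close> itself, which is known only through local extensions off
  the cone.\<close>

lemma C1_local:
  assumes "\<And>x. x \<in> S \<Longrightarrow> \<exists>T. open T \<and> x \<in> T \<and> Ck_on (Suc 0) f T"
  shows "Ck_on (Suc 0) f S"
proof -
  have "continuous_on S (\<lambda>x. frechet_derivative f (at x) v)" for v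
  proof (rule continuous_at_imp_continuous_on, rule ballI)
    fix x assume "x \<in> S"
    then obtain T where T: "open T" "x \<in> T" "Ck_on (Suc 0) f T" using assms by blast
    then show "isCont (\<lambda>x. frechet_derivative f (at x) v) x"
      using C1_continuous_derivative[OF T(3)] continuous_on_eq_continuous_at by blast
  qed
  then show ?thesis using assms by fastforce
qed

lemma C1_Un:
  assumes "open S" "open T" "Ck_on (Suc 0) f S" "Ck_on (Suc 0) f T"
  shows "Ck_on (Suc 0) f (S \<union> T)"
  by (rule C1_local) (use assms in blast)

named_theorems C1_intros

lemma C1_const [C1_intros]: "Ck_on (Suc 0) (\<lambda>x. c) S"
  by (rule C1_I[of _ _ "\<lambda>x v. 0"]) auto

lemma C1_bounded_linear: "bounded_linear f \<Longrightarrow> Ck_on (Suc 0) f S"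
  by (rule C1_I[of _ _ "\<lambda>x. f"]) (auto simp: bounded_linear_imp_has_derivative)

lemma C1_linear_compose:
  assumes L: "bounded_linear L" and g: "Ck_on (Suc 0) g S"
  shows "Ck_on (Suc 0) (\<lambda>x. L (g x)) S"
proof -
  from g obtain g' where g': "\<And>x. x \<in> S \<Longrightarrow> (g has_derivative g' x) (at x)" "\<And>v. continuous_on S (\<lambda>x. g' x v)"
    unfolding C1_iff by blast
  show ?thesis
    by (rule C1_I[of _ _ "\<lambda>x v. L (g' x v)"])
      (auto intro!: bounded_linear.has_derivative[OF L] g' bounded_linear.continuous_on[OF L])
qed

lemma C1_id [C1_intros]: "Ck_on (Suc 0) (\<lambda>x. x) S"
  by (rule C1_bounded_linear) (rule bounded_linear_ident)

lemmas C1_fst [C1_intros] = C1_linear_compose[OF bounded_linear_fst]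
  and C1_snd [C1_intros] = C1_linear_compose[OF bounded_linear_snd]
  and C1_vec_nth [C1_intros] = C1_linear_compose[OF bounded_linear_vec_nth]
  and C1_minus [C1_intros] = C1_linear_compose[OF bounded_linear_minus[OF bounded_linear_ident]]

lemma C1_add [C1_intros]:
  assumes f: "Ck_on (Suc 0) f S" and g: "Ck_on (Suc 0) g S"
  shows "Ck_on (Suc 0) (\<lambda>x. f x + g x) S"
proof -
  from f obtain f' where f': "\<And>x. x \<in> S \<Longrightarrow> (f has_derivative f' x) (at x)" "\<And>v. continuous_on S (\<lambda>x. f' x v)"
    unfolding C1_iff by blast
  from g obtain g' where g': "\<And>x. x \<in> S \<Longrightarrow> (g has_derivative g' x) (at x)" "\<And>v. continuous_on S (\<lambda>x. g' x v)"
    unfolding C1_iff by blast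
  show ?thesis
    by (rule C1_I[of _ _ "\<lambda>x v. f' x v + g' x v"])
      (auto intro!: has_derivative_add f' g' continuous_intros)
qed

lemma C1_diff [C1_intros]:
  assumes f: "Ck_on (Suc 0) f S" and g: "Ck_on (Suc 0) g S"
  shows "Ck_on (Suc 0) (\<lambda>x. f x - g x) S"
  using C1_add[OF f C1_minus[OF g]] by simp

lemma C1_scaleR:
  fixes f :: "'a::real_normed_vector \<Rightarrow> real"
  assumes f: "Ck_on (Suc 0) f S" and g: "Ck_on (Suc 0) g S"
  shows "Ck_on (Suc 0) (\<lambda>x. f x *\<^sub>R g x) S"
proof -
  from f obtain f' where f': "\<And>x. x \<in> S \<Longrightarrow> (f has_derivative f' x) (at x)" "\<And>v. continuous_on S (\<lambda>x. f' x v)"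
    unfolding C1_iff by blast
  from g obtain g' where g': "\<And>x. x \<in> S \<Longrightarrow> (g has_derivative g' x) (at x)" "\<And>v. continuous_on S (\<lambda>x. g' x v)"
    unfolding C1_iff by blast
  show ?thesis
    by (rule C1_I[of _ _ "\<lambda>x v. f x *\<^sub>R g' x v + f' x v *\<^sub>R g x"])
      (auto intro!: has_derivative_scaleR f' g' continuous_intros C1_continuous_on[OF f] C1_continuous_on[OF g])
qed

lemma C1_mult [C1_intros]:
  fixes f g :: "'a::real_normed_vector \<Rightarrow> real"
  assumes "Ck_on (Suc 0) f S" "Ck_on (Suc 0) g S"
  shows "Ck_on (Suc 0) (\<lambda>x. f x * g x) S"
  using C1_scaleR[OF assms] by simp

lemma C1_power [C1_intros]:
  fixes f :: "'a::real_normed_vector \<Rightarrow> real"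
  assumes "Ck_on (Suc 0) f S"
  shows "Ck_on (Suc 0) (\<lambda>x. f x ^ n) S"
  by (induction n) (auto intro: C1_intros assms simp del: Ck_on.simps)

lemma C1_real_compose:
  fixes g :: "'a::real_normed_vector \<Rightarrow> real" and f :: "real \<Rightarrow> real"
  assumes g: "Ck_on (Suc 0) g S" and gT: "\<And>x. x \<in> S \<Longrightarrow> g x \<in> T"
    and f: "\<And>y. y \<in> T \<Longrightarrow> (f has_real_derivative f' y) (at y)" and f': "continuous_on T f'"
  shows "Ck_on (Suc 0) (\<lambda>x. f (g x)) S"
proof -
  from g obtain g' where g': "\<And>x. x \<in> S \<Longrightarrow> (g has_derivative g' x) (at x)" "\<And>v. continuous_on S (\<lambda>x. g' x v)"
    unfolding C1_iff by blast
  have "((\<lambda>x. f (g x)) has_derivative (\<lambda>v. f' (g x) * g' x v)) (at x)" if "x \<in> S" for x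
    using has_derivative_compose[OF g'(1)[OF that], of f "(*) (f' (g x))"] f[OF gT[OF that]]
    by (simp add: has_field_derivative_def)
  moreover have "continuous_on S (\<lambda>x. f' (g x) * g' x v)" for v
    by (intro continuous_on_mult g' continuous_on_compose2[OF f' C1_continuous_on[OF g]]) (use gT in auto)
  ultimately show ?thesis
    by (rule C1_I[where f'="\<lambda>x v. f' (g x) * g' x v"])
qed

lemma C1_sin [C1_intros]: "Ck_on (Suc 0) g S \<Longrightarrow> Ck_on (Suc 0) (\<lambda>x. sin (g x :: real)) S"
  by (rule C1_real_compose[where T=UNIV and f'=cos]) (auto simp del: Ck_on.simps intro!: derivative_eq_intros continuous_intros)

lemma C1_cos [C1_intros]: "Ck_on (Suc 0) g S \<Longrightarrow> Ck_on (Suc 0) (\<lambda>x. cos (g x :: real)) S"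
  by (rule C1_real_compose[where T=UNIV and f'="\<lambda>x. - sin x"]) (auto simp del: Ck_on.simps intro!: derivative_eq_intros continuous_intros)

lemma C1_inverse:
  "Ck_on (Suc 0) g S \<Longrightarrow> (\<And>x. x \<in> S \<Longrightarrow> g x \<noteq> 0) \<Longrightarrow> Ck_on (Suc 0) (\<lambda>x. inverse (g x :: real)) S"
  by (rule C1_real_compose[where T="-{0}" and f'="\<lambda>x. - (inverse x ^ 2)"])
    (auto simp del: Ck_on.simps intro!: derivative_eq_intros continuous_intros simp: power2_eq_square)

lemma C1_divide [C1_intros]:
  "Ck_on (Suc 0) f S \<Longrightarrow> Ck_on (Suc 0) g S \<Longrightarrow> (\<And>x. x \<in> S \<Longrightarrow> g x \<noteq> 0) \<Longrightarrow> Ck_on (Suc 0) (\<lambda>x. f x / g x :: real) S"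
  unfolding divide_inverse by (intro C1_mult C1_inverse)

lemma C1_sqrt [C1_intros]:
  "Ck_on (Suc 0) g S \<Longrightarrow> (\<And>x. x \<in> S \<Longrightarrow> g x > 0) \<Longrightarrow> Ck_on (Suc 0) (\<lambda>x. sqrt (g x)) S"
  by (rule C1_real_compose[where T="{0<..}" and f'="\<lambda>x. inverse (sqrt x) / 2"])
    (auto simp del: Ck_on.simps intro!: derivative_eq_intros continuous_intros)

lemma C1_ln [C1_intros]:
  "Ck_on (Suc 0) g S \<Longrightarrow> (\<And>x. x \<in> S \<Longrightarrow> g x > 0) \<Longrightarrow> Ck_on (Suc 0) (\<lambda>x. ln (g x :: real)) S"
  by (rule C1_real_compose[where T="{0<..}" and f'="\<lambda>x. 1 / x"])
    (auto simp del: Ck_on.simps intro!: derivative_eq_intros continuous_intros)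

text \<open>This is the profile of the cut-offs and of the correction term in
  \<open>near_cons\<close>. Only x = 0 needs an argument: there the difference quotient is at most
  |h|.\<close>

lemma has_real_derivative_pos_square:
  "((\<lambda>x::real. (max 0 x)\<^sup>2) has_real_derivative 2 * max 0 x) (at x)"
proof -
  have "((\<lambda>x::real. (max 0 x)\<^sup>2) has_real_derivative 2 * max 0 x) (at x)" if "x < 0"
    by (rule has_field_derivative_transform_within_open[of "\<lambda>x. 0" _ _ "{..<0}"]) (use that in auto)
  moreover have "((\<lambda>x::real. (max 0 x)\<^sup>2) has_real_derivative 2 * max 0 x) (at x)" if "x > 0"
    by (rule has_field_derivative_transform_within_open[of "\<lambda>x. x\<^sup>2" _ _ "{0<..}"])
      (use that in \<open>auto intro!: derivative_eq_intros\<close>)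
  moreover have "((\<lambda>x::real. (max 0 x)\<^sup>2) has_real_derivative 2 * max 0 x) (at x)" if "x = 0"
  proof -
    have "(\<lambda>h. ((max 0 (0 + h))\<^sup>2 - (max 0 0)\<^sup>2) / h) \<midarrow>0\<rightarrow> (0::real)"
    proof (rule Lim_null_comparison[where g="\<lambda>h::real. \<bar>h\<bar>"])
      show "\<forall>\<^sub>F h in at 0. norm (((max 0 (0 + h))\<^sup>2 - (max 0 0)\<^sup>2) / h) \<le> \<bar>h::real\<bar>"
        by (auto simp: eventually_at_filter max_def power2_eq_square intro!: always_eventually)
      show "(\<lambda>h::real. \<bar>h\<bar>) \<midarrow>0\<rightarrow> 0"
        using tendsto_rabs[OF tendsto_ident_at, of 0] by simp
    qed
    then show ?thesis using that by (simp add: DERIV_def)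
  qed
  ultimately show ?thesis by linarith
qed

lemma C1_pos_square [C1_intros]:
  "Ck_on (Suc 0) g S \<Longrightarrow> Ck_on (Suc 0) (\<lambda>x. (max 0 (g x :: real))\<^sup>2) S"
  by (rule C1_real_compose[where T=UNIV and f="\<lambda>x. (max 0 x)\<^sup>2" and f'="\<lambda>x. 2 * max 0 x"])
    (auto simp del: Ck_on.simps intro!: has_real_derivative_pos_square continuous_intros)

text \<open>The notion of C1 only gives continuity of the derivative in each fixed direction. In
  finite dimension that suffices, because the moving direction \<open>f' x v\<close> can be expanded
  in the basis.\<close>

lemma C1_compose:
  fixes f :: "'a::real_normed_vector \<Rightarrow> 'b::euclidean_space" and g :: "'b \<Rightarrow> 'c::real_normed_vector"
  assumes f: "Ck_on (Suc 0) f S" and g: "Ck_on (Suc 0) g T" and ST: "\<And>x. x \<in> S \<Longrightarrow> f x \<in> T"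
  shows "Ck_on (Suc 0) (\<lambda>x. g (f x)) S"
proof -
  from f obtain f' where f': "\<And>x. x \<in> S \<Longrightarrow> (f has_derivative f' x) (at x)" "\<And>v. continuous_on S (\<lambda>x. f' x v)"
    unfolding C1_iff by blast
  from g obtain g' where g': "\<And>x. x \<in> T \<Longrightarrow> (g has_derivative g' x) (at x)" "\<And>v. continuous_on T (\<lambda>x. g' x v)"
    unfolding C1_iff by blast
  have eq: "g' y w = (\<Sum>b\<in>Basis. (w \<bullet> b) *\<^sub>R g' y b)" if "y \<in> T" for y w
  proof -
    interpret bounded_linear "g' y" using g'(1)[OF that] by (rule has_derivative_bounded_linear)
    show ?thesis by (subst euclidean_representation[of w, symmetric]) (simp add: sum scaleR)
  qed
  show ?thesis
  proof (rule C1_I[where f'="\<lambda>x v. g' (f x) (f' x v)"])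
    fix x assume "x \<in> S"
    then show "((\<lambda>x. g (f x)) has_derivative (\<lambda>v. g' (f x) (f' x v))) (at x)"
      using has_derivative_compose[OF f'(1) g'(1)] ST by blast
  next
    fix v
    have "continuous_on S (\<lambda>x. \<Sum>b\<in>Basis. (f' x v \<bullet> b) *\<^sub>R g' (f x) b)"
      by (intro continuous_intros f' continuous_on_compose2[OF g'(2) C1_continuous_on[OF f]]) (use ST in auto)
    then show "continuous_on S (\<lambda>x. g' (f x) (f' x v))"
      by (rule continuous_on_eq) (use eq ST in auto)
  qed
qed

lemma C1_Pair [C1_intros]:
  assumes f: "Ck_on (Suc 0) f S" and g: "Ck_on (Suc 0) g S"
  shows "Ck_on (Suc 0) (\<lambda>x. (f x, g x)) S"
proof -
  from f obtain f' where f': "\<And>x. x \<in> S \<Longrightarrow> (f has_derivative f' x) (at x)" "\<And>v. continuous_on S (\<lambda>x. f' x v)"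
    unfolding C1_iff by blast
  from g obtain g' where g': "\<And>x. x \<in> S \<Longrightarrow> (g has_derivative g' x) (at x)" "\<And>v. continuous_on S (\<lambda>x. g' x v)"
    unfolding C1_iff by blast
  show ?thesis
    by (rule C1_I[of _ _ "\<lambda>x v. (f' x v, g' x v)"])
      (auto intro!: has_derivative_Pair f' g' continuous_intros)
qed

lemma C1_sum [C1_intros]:
  "(\<And>i. i \<in> A \<Longrightarrow> Ck_on (Suc 0) (f i) S) \<Longrightarrow> Ck_on (Suc 0) (\<lambda>x. \<Sum>i\<in>A. f i x) S"
  by (induction A rule: infinite_finite_induct) (auto intro: C1_intros simp del: Ck_on.simps)

lemma C1_componentwise:
  fixes f :: "'a::real_normed_vector \<Rightarrow> 'b::euclidean_space"
  assumes "\<And>b. b \<in> Basis \<Longrightarrow> Ck_on (Suc 0) (\<lambda>x. f x \<bullet> b) S"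
  shows "Ck_on (Suc 0) f S"
proof -
  have "Ck_on (Suc 0) (\<lambda>x. \<Sum>b\<in>Basis. (f x \<bullet> b) *\<^sub>R b) S"
    by (intro C1_sum C1_scaleR assms C1_const)
  then show ?thesis by (simp add: euclidean_representation)
qed

lemma C1_vec4 [C1_intros]:
  fixes f :: "'a::real_normed_vector \<Rightarrow> real"
  assumes "Ck_on (Suc 0) f S" "Ck_on (Suc 0) g S" "Ck_on (Suc 0) h S" "Ck_on (Suc 0) k S"
  shows "Ck_on (Suc 0) (\<lambda>x. vector [f x, g x, h x, k x] :: real^4) S"
proof -
  have "Ck_on (Suc 0) (\<lambda>x. (vector [f x, g x, h x, k x] :: real^4) $ i) S" for i
    using exhaust_4[of i] assms by (elim disjE) (simp_all only: vector_4)
  then have *: "Ck_on (Suc 0) (\<lambda>x. (vector [f x, g x, h x, k x] :: real^4) \<bullet> axis i 1) S" for i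
    by (simp only: inner_axis) simp
  show ?thesis
  proof (rule C1_componentwise)
    fix b :: "real^4" assume "b \<in> Basis"
    then obtain i where "b = axis i 1" unfolding Basis_vec_def by auto
    then show "Ck_on (Suc 0) (\<lambda>x. (vector [f x, g x, h x, k x] :: real^4) \<bullet> b) S"
      using * by (simp only:)
  qed
qed

lemma frechet_derivative_eqI: "(f has_derivative f') (at x) \<Longrightarrow> frechet_derivative f (at x) = f'"
  by (rule frechet_derivative_at[symmetric])

text \<open>\<open>D\<close> and the complement of \<open>K\<close> are open and cover the space; on
  the second set the extension vanishes identically.\<close>

lemma C1_extend_zero:
  assumes D: "open D" and K: "compact K" "K \<subseteq> D" and f: "Ck_on (Suc 0) f D"
    and 0: "\<And>x. x \<in> D - K \<Longrightarrow> f x = 0"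
  shows "Ck_on (Suc 0) (\<lambda>x. if x \<in> D then f x else 0) UNIV"
proof -
  have "Ck_on (Suc 0) (\<lambda>x. if x \<in> D then f x else 0) (D \<union> - K)"
  proof (rule C1_Un)
    show "open (- K)" using K(1) by (simp add: compact_imp_closed open_Compl)
    show "Ck_on (Suc 0) (\<lambda>x. if x \<in> D then f x else 0) D"
      by (rule C1_cong[OF D _ f]) simp
    show "Ck_on (Suc 0) (\<lambda>x. if x \<in> D then f x else 0) (- K)"
      by (rule C1_cong[OF \<open>open (- K)\<close> _ C1_const[of 0]]) (use 0 in auto)
  qed (rule D)
  moreover have "D \<union> - K = UNIV" using K(2) by blast
  ultimately show ?thesis by simp
qed

section \<open>Transport by a divergence-free field\<close>

lemma lborel_integral_compact_support:
  fixes g :: "'a::euclidean_space \<Rightarrow> real"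
  assumes g: "continuous_on UNIV g" and 0: "\<And>x. x \<notin> cbox lo hi \<Longrightarrow> g x = 0"
  shows "integrable lborel g" "integral\<^sup>L lborel g = integral (cbox lo hi) g"
proof -
  have eq: "(\<lambda>x. indicator (cbox lo hi) x *\<^sub>R g x) = g"
    using 0 by (auto simp: indicator_def fun_eq_iff)
  have i: "set_integrable lborel (cbox lo hi) g"
    unfolding set_integrable_def
    by (rule borel_integrable_compact) (auto intro: continuous_on_subset[OF g])
  then show "integrable lborel g" by (simp only: set_integrable_def eq)
  show "integral\<^sup>L lborel g = integral (cbox lo hi) g"
    using set_borel_integral_eq_integral(2)[OF i] by (simp only: set_lebesgue_integral_def eq)
qed

lemma lborel_integral_shift:
  fixes g :: "'a::euclidean_space \<Rightarrow> real"
  assumes g: "continuous_on UNIV g"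
  shows "(\<integral>x. g (c + x) \<partial>lborel) = integral\<^sup>L lborel g"
proof -
  have "integral\<^sup>L lborel g = integral\<^sup>L (distr lborel borel ((+) c)) g"
    by (simp add: lborel_distr_plus)
  also have "\<dots> = (\<integral>x. g (c + x) \<partial>lborel)"
    using g by (intro integral_distr) (auto intro: borel_measurable_continuous_onI)
  finally show ?thesis by simp
qed

text \<open>Translation invariance makes the integral of \<open>g (h *\<^sub>R v + x)\<close> over x
  independent of h; differentiating at h = 0 under the integral gives the claim. This replaces an
  integration by parts in coordinates.\<close>

lemma integral_derivative_compact_support:
  fixes g :: "'a::euclidean_space \<Rightarrow> real"
  assumes g: "Ck_on (Suc 0) g UNIV" and K: "compact K" and 0: "\<And>x. x \<notin> K \<Longrightarrow> g x = 0"
  shows "(\<integral>x. frechet_derivative g (at x) v \<partial>lborel) = 0"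
    and "integrable lborel (\<lambda>x. frechet_derivative g (at x) v)"
proof -
  \<comment> \<open>Enlarging by every shift of length at most \<open>norm v\<close> yields one box
    that contains the supports of all translates with |h| <= 1.\<close>
  let ?K = "{x + y |x y. x \<in> K \<and> y \<in> cball 0 (norm v)}"
  have "compact ?K" using K by (intro compact_sums) auto
  then obtain hi where hi: "?K \<subseteq> cbox (- hi) hi"
    using bounded_subset_cbox_symmetric compact_imp_bounded by blast
  define B where "B = cbox (- hi) hi"
  let ?dg = "\<lambda>x. frechet_derivative g (at x) v"
  have gc: "continuous_on UNIV g" using g by (rule C1_continuous_on)
  have dgc: "continuous_on UNIV ?dg" using g by (rule C1_continuous_derivative)
  have B0: "g (h *\<^sub>R v + x) = 0" if "x \<notin> B" "\<bar>h\<bar> \<le> 1" for x h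
  proof (rule ccontr)
    assume "g (h *\<^sub>R v + x) \<noteq> 0"
    then have "h *\<^sub>R v + x \<in> K" using 0 by blast
    moreover have "- (h *\<^sub>R v) \<in> cball 0 (norm v)"
      using that(2) by (auto simp: mult_left_le_one_le)
    moreover have "x = (h *\<^sub>R v + x) + (- (h *\<^sub>R v))" by simp
    ultimately have "x \<in> ?K" by blast
    with hi that(1) show False by (auto simp: B_def)
  qed
  have KB: "K \<subseteq> B" using B0[of _ 0] hi by (force simp: B_def)
  have dg0: "?dg x = 0" if "x \<notin> B" for x
  proof -
    have "open (- B)" unfolding B_def by (rule open_Compl) (rule closed_cbox)
    have "(g has_derivative (\<lambda>_. 0)) (at x)"
    proof (rule has_derivative_transform_within_open[OF has_derivative_const \<open>open (- B)\<close>])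
      show "x \<in> - B" using that by simp
      fix y assume "y \<in> - B"
      then have "y \<notin> K" using KB by blast
      from 0[OF this] show "0 = g y" by (rule sym)
    qed
    from frechet_derivative_eqI[OF this] show ?thesis by (rule fun_cong)
  qed
  have der: "((\<lambda>h. integral B (\<lambda>x. g (h *\<^sub>R v + x))) has_field_derivative integral B (\<lambda>x. ?dg (0 *\<^sub>R v + x))) (at 0 within {-1..1})"
    unfolding B_def
  proof (rule leibniz_rule_field_derivative)
    fix h x
    have "((\<lambda>h. h *\<^sub>R v + x) has_derivative (\<lambda>k. k *\<^sub>R v)) (at h within {-1..1})"
      by (auto intro!: derivative_eq_intros)
    from has_derivative_compose[OF this, of g "frechet_derivative g (at (h *\<^sub>R v + x))"]
    have "((\<lambda>h. g (h *\<^sub>R v + x)) has_derivative (\<lambda>k. frechet_derivative g (at (h *\<^sub>R v + x)) (k *\<^sub>R v))) (at h within {-1..1})"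
      using C1_has_derivative[OF g] by auto
    moreover have "(\<lambda>k. frechet_derivative g (at (h *\<^sub>R v + x)) (k *\<^sub>R v)) = (*) (?dg (h *\<^sub>R v + x))"
    proof
      fix k show "frechet_derivative g (at (h *\<^sub>R v + x)) (k *\<^sub>R v) = ?dg (h *\<^sub>R v + x) * k"
        using linear_scale[OF has_derivative_linear[OF C1_has_derivative[OF g]]] by simp
    qed
    ultimately show "((\<lambda>h. g (h *\<^sub>R v + x)) has_field_derivative ?dg (h *\<^sub>R v + x)) (at h within {-1..1})"
      by (simp only: has_field_derivative_def)
  next
    show "(\<lambda>x. g (h *\<^sub>R v + x)) integrable_on cbox (- hi) hi" for h
      by (intro integrable_continuous continuous_on_compose2[OF gc] continuous_intros) auto
    show "continuous_on ({- 1..1} \<times> cbox (- hi) hi) (\<lambda>(h, x). ?dg (h *\<^sub>R v + x))"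
      unfolding case_prod_unfold
      by (intro continuous_on_compose2[OF dgc] continuous_intros) auto
  qed auto
  have const: "integral B (\<lambda>x. g (h *\<^sub>R v + x)) = integral\<^sup>L lborel g" if "h \<in> {-1..1}" for h
  proof -
    have "integral B (\<lambda>x. g (h *\<^sub>R v + x)) = (\<integral>x. g (h *\<^sub>R v + x) \<partial>lborel)"
      unfolding B_def
      by (intro lborel_integral_compact_support(2)[symmetric] continuous_on_compose2[OF gc] continuous_intros)
        (use B0 that B_def in auto)
    then show ?thesis by (simp add: lborel_integral_shift[OF gc])
  qed
  have "((\<lambda>h. integral\<^sup>L lborel g) has_field_derivative integral B (\<lambda>x. ?dg (0 *\<^sub>R v + x))) (at 0 within {-1..1})"
    unfolding has_field_derivative_def
    by (rule has_derivative_transform[OF _ _ der[unfolded has_field_derivative_def]])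
      (simp, rule const[symmetric])
  moreover have "at (0::real) within {-1..1} = at 0"
    by (rule at_within_interior) (simp add: interior_atLeastAtMost_real)
  ultimately have "((\<lambda>h. integral\<^sup>L lborel g) has_field_derivative integral B ?dg) (at (0::real))"
    by simp
  from DERIV_unique[OF this DERIV_const] have "integral B ?dg = 0" .
  with lborel_integral_compact_support[OF dgc dg0[unfolded B_def]]
  show "(\<integral>x. ?dg x \<partial>lborel) = 0" "integrable lborel ?dg" by (auto simp: B_def)
qed

text \<open>For \<open>Y\<close> of zero divergence the integral of the time derivative of
  \<open>G\<close> equals that of the derivative along (1, \<open>Y\<close>), since the two differ
  by the divergence of \<open>G Y\<close>, which has compact support. The latter is nonpositive by
  assumption. The margin \<open>\<delta>\<close> makes the derivative at time 0 two-sided.\<close>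

lemma transport_nonincreasing:
  fixes G :: "real \<times> 'a::euclidean_space \<Rightarrow> real" and Y :: "'a \<Rightarrow> 'a"
  assumes D: "open D" and K: "compact K" "K \<subseteq> D" and T: "0 \<le> T" and \<delta>: "0 < \<delta>"
    and G: "Ck_on (Suc 0) G ({-\<delta><..} \<times> D)"
    and supp: "\<And>t z. -\<delta> < t \<Longrightarrow> z \<in> D - K \<Longrightarrow> G (t, z) = 0"
    and Y: "Ck_on (Suc 0) Y D"
    and div: "\<And>z. z \<in> D \<Longrightarrow> (\<Sum>b\<in>Basis. frechet_derivative Y (at z) b \<bullet> b) = 0"
    and le: "\<And>t z. 0 \<le> t \<Longrightarrow> z \<in> D \<Longrightarrow> frechet_derivative G (at (t, z)) (1, Y z) \<le> 0"
    and nonneg: "\<And>t z. 0 \<le> t \<Longrightarrow> z \<in> D \<Longrightarrow> 0 \<le> G (t, z)"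
  shows "(\<integral>\<^sup>+z\<in>D. G (T, z) \<partial>lborel) \<le> (\<integral>\<^sup>+z\<in>D. G (0, z) \<partial>lborel)"
proof -
  obtain hi where hi: "K \<subseteq> cbox (- hi) hi"
    using bounded_subset_cbox_symmetric compact_imp_bounded[OF K(1)] by blast
  define g where "g = (\<lambda>t z. if z \<in> D then G (t, z) else 0)"
  define g' where "g' = (\<lambda>t z. if z \<in> D then frechet_derivative G (at (t, z)) (1, 0) else 0)"
  define m where "m = (\<lambda>t. integral (cbox (-hi) hi) (g t))"
  let ?I = "{-\<delta><..}"
  have opI: "open (?I \<times> D)" using D by (intro open_Times) auto
  have opK: "open (- K)" using K(1) by (simp add: compact_imp_closed open_Compl)
  have Gd: "(G has_derivative frechet_derivative G (at (t, z))) (at (t, z))" if "t \<in> ?I" "z \<in> D" for t z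
    using C1_has_derivative[OF G] that by auto
  have dsupp: "frechet_derivative G (at (t, z)) v = 0" if "t \<in> ?I" "z \<in> D - K" for t z v
  proof -
    have "(G has_derivative (\<lambda>_. 0)) (at (t, z))"
      by (rule has_derivative_transform_within_open[of "\<lambda>_. 0" _ _ _ "?I \<times> (D - K)"])
        (use that supp D opK in \<open>auto intro!: open_Times simp: Diff_eq\<close>)
    then show ?thesis by (simp add: frechet_derivative_eqI)
  qed
  have g'c: "continuous_on (?I \<times> UNIV) (\<lambda>(t, z). g' t z)"
  proof -
    have 1: "continuous_on (?I \<times> D) (\<lambda>(t, z). g' t z)"
      by (rule continuous_on_eq[OF C1_continuous_derivative[OF G, of "(1, 0)"]]) (auto simp: g'_def)
    have 2: "continuous_on (?I \<times> (- K)) (\<lambda>(t, z). g' t z)"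
      by (rule continuous_on_eq[of _ "\<lambda>_. 0"]) (auto simp: g'_def dsupp)
    have "continuous_on ((?I \<times> D) \<union> (?I \<times> (- K))) (\<lambda>(t, z). g' t z)"
      by (rule continuous_on_open_Un[OF opI _ 1 2]) (auto intro!: open_Times opK)
    moreover have "(?I \<times> D) \<union> (?I \<times> (- K)) = ?I \<times> UNIV" using K(2) by auto
    ultimately show ?thesis by simp
  qed
  have GD: "((\<lambda>z. G (t, z)) has_derivative (\<lambda>v. frechet_derivative G (at (t, z)) (0, v))) (at z)"
    if "t \<in> ?I" "z \<in> D" for t z
  proof -
    have "((\<lambda>z. (t, z)) has_derivative (\<lambda>v. (0, v))) (at z)" by (auto intro!: derivative_eq_intros)
    from has_derivative_compose[OF this Gd[OF that]] show ?thesis .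
  qed
  have C1G: "Ck_on (Suc 0) (\<lambda>z. G (t, z)) D" if "t \<in> ?I" for t
    by (rule C1_compose[OF _ G]) (use that in \<open>auto intro!: C1_intros simp del: Ck_on.simps\<close>)
  have g1: "Ck_on (Suc 0) (g t) UNIV" if "t \<in> ?I" for t
    unfolding g_def by (rule C1_extend_zero[OF D K C1G[OF that]]) (use supp that in auto)
  have gc: "continuous_on UNIV (g t)" if "t \<in> ?I" for t
    using g1[OF that] by (rule C1_continuous_on)
  have g'ct: "continuous_on UNIV (g' t)" if "t \<in> ?I" for t
  proof -
    have "continuous_on UNIV (\<lambda>z. case (t, z) of (t, z) \<Rightarrow> g' t z)"
      by (rule continuous_on_compose2[OF g'c]) (use that in \<open>auto intro!: continuous_intros\<close>)
    then show ?thesis by simp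
  qed
  have box0: "g t z = 0 \<and> g' t z = 0" if "t \<in> ?I" "z \<notin> cbox (-hi) hi" for t z
  proof -
    have "z \<notin> K" using that(2) hi by blast
    then show ?thesis using that(1) supp dsupp by (auto simp: g_def g'_def)
  qed
  have mder: "(m has_field_derivative integral (cbox (-hi) hi) (g' t)) (at t within ?I)" if "t \<in> ?I" for t
    unfolding m_def
  proof (rule leibniz_rule_field_derivative)
    fix s z assume s: "s \<in> ?I"
    show "((\<lambda>s. g s z) has_field_derivative g' s z) (at s within ?I)"
    proof (cases "z \<in> D")
      case True
      have "((\<lambda>s. (s, z)) has_derivative (\<lambda>v. (v, 0))) (at s within ?I)" by (auto intro!: derivative_eq_intros)
      from has_derivative_compose[OF this Gd[OF s True]]
      have "((\<lambda>s. G (s, z)) has_derivative (\<lambda>v. frechet_derivative G (at (s, z)) (v, 0))) (at s within ?I)" .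
      moreover have "(\<lambda>v. frechet_derivative G (at (s, z)) (v, 0)) = (*) (frechet_derivative G (at (s, z)) (1, 0))"
      proof
        fix v show "frechet_derivative G (at (s, z)) (v, 0) = frechet_derivative G (at (s, z)) (1, 0) * v"
          using linear_scale[OF has_derivative_linear[OF Gd[OF s True]], of v "(1, 0)"] by simp
      qed
      ultimately show ?thesis using True
        by (simp only: has_field_derivative_def g_def g'_def if_True)
    qed (simp add: g_def g'_def)
    show "g s integrable_on cbox (- hi) hi"
      by (intro integrable_continuous continuous_on_subset[OF gc[OF s]]) auto
  next
    show "continuous_on (?I \<times> cbox (- hi) hi) (\<lambda>(t, z). g' t z)"
      by (rule continuous_on_subset[OF g'c]) auto
  qed (use that in auto)
  have mle: "integral (cbox (-hi) hi) (g' t) \<le> 0" if t: "0 \<le> t" for t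
  proof -
    have tI: "t \<in> ?I" using t \<delta> by auto
    let ?d = "\<lambda>b z. if z \<in> D then (Y z \<bullet> b) * G (t, z) else 0"
    have Yb: "Ck_on (Suc 0) (\<lambda>z. Y z \<bullet> b) D" for b
      by (rule C1_linear_compose[OF bounded_linear_inner_left Y])
    have d1: "Ck_on (Suc 0) (?d b) UNIV" for b
      by (rule C1_extend_zero[OF D K]) (use supp tI in \<open>auto intro!: C1_mult Yb C1G simp del: Ck_on.simps\<close>)
    have d0: "?d b z = 0" if "z \<notin> K" for b z using that supp tI by auto
    note z = integral_derivative_compact_support[OF d1 K(1) d0]
    \<comment> \<open>This is div (\<open>G Y\<close>) = \<open>Y\<close> . grad \<open>G\<close> +
      \<open>G\<close> div \<open>Y\<close>, with the last term gone.\<close>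
    have s: "(\<Sum>b\<in>Basis. frechet_derivative (?d b) (at z) b) = frechet_derivative G (at (t, z)) (0, Y z)"
      if "z \<in> D" for z
    proof -
      have 1: "(Y has_derivative frechet_derivative Y (at z)) (at z)" using C1_has_derivative[OF Y that] .
      have "((\<lambda>z. (Y z \<bullet> b) * G (t, z)) has_derivative
          (\<lambda>v. (Y z \<bullet> b) * frechet_derivative G (at (t, z)) (0, v) + (frechet_derivative Y (at z) v \<bullet> b) * G (t, z))) (at z)" for b
        by (intro has_derivative_mult GD[OF tI that] bounded_linear.has_derivative[OF bounded_linear_inner_left 1])
      then have "(?d b has_derivative
          (\<lambda>v. (Y z \<bullet> b) * frechet_derivative G (at (t, z)) (0, v) + (frechet_derivative Y (at z) v \<bullet> b) * G (t, z))) (at z)" for b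
        by (rule has_derivative_transform_within_open[OF _ D that]) simp
      then have "frechet_derivative (?d b) (at z) =
          (\<lambda>v. (Y z \<bullet> b) * frechet_derivative G (at (t, z)) (0, v) + (frechet_derivative Y (at z) v \<bullet> b) * G (t, z))" for b
        by (rule frechet_derivative_eqI)
      then have "(\<Sum>b\<in>Basis. frechet_derivative (?d b) (at z) b) =
        (\<Sum>b\<in>Basis. (Y z \<bullet> b) * frechet_derivative G (at (t, z)) (0, b))
         + (\<Sum>b\<in>Basis. frechet_derivative Y (at z) b \<bullet> b) * G (t, z)"
        by (simp only: sum.distrib sum_distrib_right)
      also have "\<dots> = (\<Sum>b\<in>Basis. (Y z \<bullet> b) * frechet_derivative G (at (t, z)) (0, b))"
        using div[OF that] by simp
      also have "\<dots> = frechet_derivative G (at (t, z)) (0, Y z)"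
        using linear_sum[OF has_derivative_linear[OF GD[OF tI that]], of "\<lambda>b. (Y z \<bullet> b) *\<^sub>R b" Basis]
        by (simp add: linear_scale[OF has_derivative_linear[OF GD[OF tI that]]] euclidean_representation)
      finally show ?thesis .
    qed
    have "integral (cbox (-hi) hi) (g' t) = (\<integral>z. g' t z \<partial>lborel)"
      by (rule lborel_integral_compact_support(2)[symmetric]) (use g'ct tI box0 in auto)
    also have "\<dots> \<le> (\<integral>z. - (\<Sum>b\<in>Basis. frechet_derivative (?d b) (at z) b) \<partial>lborel)"
    proof (rule integral_mono)
      show "integrable lborel (g' t)"
        by (rule lborel_integral_compact_support(1)) (use g'ct tI box0 in auto)
      show "integrable lborel (\<lambda>z. - (\<Sum>b\<in>Basis. frechet_derivative (?d b) (at z) b))"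
        by (intro Bochner_Integration.integrable_minus Bochner_Integration.integrable_sum z(2))
      fix z
      show "g' t z \<le> - (\<Sum>b\<in>Basis. frechet_derivative (?d b) (at z) b)"
      proof (cases "z \<in> D")
        case True
        have "frechet_derivative G (at (t, z)) (1, 0) + frechet_derivative G (at (t, z)) (0, Y z) \<le> 0"
          using le[OF t True] linear_add[OF has_derivative_linear[OF Gd[OF tI True]], of "(1, 0)" "(0, Y z)"] by simp
        then show ?thesis using True s[OF True] by (simp add: g'_def)
      next
        case False
        then have "z \<in> - K" using K(2) by auto
        have "(?d b has_derivative (\<lambda>_. 0)) (at z)" for b
        proof (rule has_derivative_transform_within_open[OF _ opK \<open>z \<in> - K\<close>])
          show "((\<lambda>_. 0) has_derivative (\<lambda>_. 0)) (at z)" by (rule has_derivative_const)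
          fix x assume "x \<in> - K"
          then have "x \<notin> K" by simp
          from d0[OF this] show "0 = ?d b x" by (rule sym)
        qed
        then have "frechet_derivative (?d b) (at z) = (\<lambda>_. 0)" for b by (rule frechet_derivative_eqI)
        then show ?thesis using False by (simp only: g'_def if_False sum.neutral_const minus_zero order_refl)
      qed
    qed
    also have "\<dots> = 0" using z by simp
    finally show ?thesis .
  qed
  have mT: "m T \<le> m 0"
  proof (rule DERIV_nonpos_imp_nonincreasing[OF T])
    fix t :: real assume t: "0 \<le> t" "t \<le> T"
    with \<delta> have "t \<in> ?I" by auto
    have "(m has_real_derivative integral (cbox (-hi) hi) (g' t)) (at t)"
      using mder[OF \<open>t \<in> ?I\<close>] unfolding at_within_open[OF \<open>t \<in> ?I\<close> open_greaterThan] .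
    then show "\<exists>y. (m has_real_derivative y) (at t) \<and> y \<le> 0" using mle[OF t(1)] by blast
  qed
  have eq: "(\<integral>\<^sup>+z\<in>D. G (t, z) \<partial>lborel) = ennreal (m t)" if "0 \<le> t" for t
  proof -
    have tI: "t \<in> ?I" using that \<delta> by auto
    have "(\<integral>\<^sup>+z\<in>D. G (t, z) \<partial>lborel) = (\<integral>\<^sup>+z. g t z \<partial>lborel)"
      by (intro nn_integral_cong) (auto simp: g_def)
    also have "\<dots> = ennreal (\<integral>z. g t z \<partial>lborel)"
      by (rule nn_integral_eq_integral)
        (use nonneg that gc[OF tI] box0[OF tI] in \<open>auto simp: g_def intro: lborel_integral_compact_support(1)\<close>)
    also have "(\<integral>z. g t z \<partial>lborel) = m t"
      unfolding m_def by (rule lborel_integral_compact_support(2)) (use gc[OF tI] box0[OF tI] in auto)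
    finally show ?thesis .
  qed
  show ?thesis
    unfolding eq[OF T] eq[OF order_refl] using mT by (rule ennreal_leI)
qed

section \<open>The Hamiltonian form of the null geodesic flow\<close>

text \<open>The bound \<open>M / 2\<close> is much weaker than the slow rotation of the final
  estimate. It keeps \<open>rp\<close> above \<open>3 / 2 * M\<close>, hence well away from the
  inner root \<open>2 * M - rp\<close> of Delta.\<close>

locale kerr_bl =
  fixes M a :: real
  assumes M_pos: "0 < M" and a_le: "\<bar>a\<bar> \<le> M / 2"
begin

abbreviation "De r \<equiv> kerr_Delta M a r"
abbreviation "Sg r \<theta> \<equiv> kerr_Sigma a r (cos \<theta>)"
abbreviation "PI r \<theta> \<equiv> kerr_Pi M a r (cos \<theta>)"
abbreviation "rp \<equiv> r_plus M a"

lemma a2_le: "a\<^sup>2 \<le> M\<^sup>2 / 4"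
  using power_mono[OF a_le abs_ge_zero, of 2] by (simp add: power_divide)

lemma rp_root: "rp\<^sup>2 - 2 * M * rp + a\<^sup>2 = 0"
proof -
  have "a\<^sup>2 \<le> M\<^sup>2" using a2_le zero_le_power2[of M] by linarith
  then have "(sqrt (M\<^sup>2 - a\<^sup>2))\<^sup>2 = M\<^sup>2 - a\<^sup>2" by simp
  then show ?thesis by (simp add: r_plus_def power2_eq_square algebra_simps)
qed

lemma rp_bounds: "3 / 2 * M \<le> rp" "rp \<le> 2 * M"
proof -
  have "(M / 2)\<^sup>2 = M\<^sup>2 / 4" by (simp add: power_divide)
  then have "(M / 2)\<^sup>2 \<le> M\<^sup>2 - a\<^sup>2" using a2_le zero_le_power2[of M] by linarith
  then have "sqrt ((M / 2)\<^sup>2) \<le> sqrt (M\<^sup>2 - a\<^sup>2)" by (rule real_sqrt_le_mono)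
  then show "3 / 2 * M \<le> rp" using M_pos by (simp add: r_plus_def)
  have "sqrt (M\<^sup>2 - a\<^sup>2) \<le> sqrt (M\<^sup>2)" by (intro real_sqrt_le_mono) simp
  then show "rp \<le> 2 * M" using M_pos by (simp add: r_plus_def)
qed

lemma Delta_factor: "De r = (r - rp) * (r - (2 * M - rp))"
  using rp_root by (simp add: kerr_Delta_def algebra_simps power2_eq_square)

lemma Delta_ge: "rp < r \<Longrightarrow> (r - rp)\<^sup>2 \<le> De r"
  unfolding Delta_factor power2_eq_square using rp_bounds M_pos by (intro mult_left_mono) auto

lemma ext_pos:
  assumes "rp < r"
  shows "0 < De r" "0 < r" "M < r"
proof -
  show r: "0 < r" "M < r" using rp_bounds M_pos assms by auto
  have "0 < (r - rp)\<^sup>2" using assms by simp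
  then show "0 < De r" using Delta_ge[OF assms] by linarith
qed

lemma Sigma_pos: "rp < r \<Longrightarrow> 0 < Sg r \<theta>"
  using ext_pos(2)[of r] by (simp add: kerr_Sigma_def add_pos_nonneg)

lemma Pi_ge:
  assumes "rp < r"
  shows "r ^ 4 \<le> PI r \<theta>"
proof -
  have "PI r \<theta> = r ^ 4 + a\<^sup>2 * r\<^sup>2 + 2 * M * a\<^sup>2 * r + a\<^sup>2 * De r * (cos \<theta>)\<^sup>2"
    by (simp add: kerr_Pi_def kerr_Delta_def algebra_simps power2_eq_square power4_eq_xxxx)
  moreover have "0 \<le> a\<^sup>2 * r\<^sup>2 + 2 * M * a\<^sup>2 * r + a\<^sup>2 * De r * (cos \<theta>)\<^sup>2"
    using ext_pos[OF assms] M_pos by simp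
  ultimately show ?thesis by linarith
qed

lemma Pi_pos: "rp < r \<Longrightarrow> 0 < PI r \<theta>"
  using Pi_ge[of r \<theta>] ext_pos(2)[of r] by (smt (verit) zero_less_power)

text \<open>A point \<open>(r, \<theta>, p, b)\<close> of \<open>phase_dom\<close> has momenta \<open>p = v\<^sub>r\<close> and \<open>b = v\<^sub>\<theta>\<close>, and \<open>L\<close> stands for
  \<open>v\<^sub>\<phi>\<close>. On the future cone \<open>ham L z\<close> is \<open>E = - v\<^sub>t\<close>, the larger root \<open>E\<close> of
  \<open>null_form L r \<theta> p b E = \<Sigma> g(v,v)\<close>.\<close>

definition phase_dom :: "(real \<times> real \<times> real \<times> real) set" where
  "phase_dom = {rp<..} \<times> {0<..<pi} \<times> UNIV \<times> UNIV"

lemma open_phase_dom: "open phase_dom" unfolding phase_dom_def by (intro open_Times) auto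

lemma phase_dom_iff: "(r, \<theta>, p, b) \<in> phase_dom \<longleftrightarrow> rp < r \<and> 0 < \<theta> \<and> \<theta> < pi"
  by (auto simp: phase_dom_def)

abbreviation "zr z \<equiv> fst z"
abbreviation "z\<theta> z \<equiv> fst (snd z)"
abbreviation "zp z \<equiv> fst (snd (snd z))"
abbreviation "zb z \<equiv> snd (snd (snd z))"

definition ham_root :: "real \<Rightarrow> real \<times> real \<times> real \<times> real \<Rightarrow> real" where
  "ham_root L z = sqrt (De (zr z) * ((Sg (zr z) (z\<theta> z))\<^sup>2 * L\<^sup>2 / (sin (z\<theta> z))\<^sup>2
     + PI (zr z) (z\<theta> z) * (De (zr z) * (zp z)\<^sup>2 + (zb z)\<^sup>2)))"

definition ham :: "real \<Rightarrow> real \<times> real \<times> real \<times> real \<Rightarrow> real" where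
  "ham L z = (2 * M * a * zr z * L + ham_root L z) / PI (zr z) (z\<theta> z)"

text \<open>Carter's separated form of the null condition: for fixed \<open>E\<close> and
  \<open>L\<close> it is a function of (r, p) plus a function of (theta, b) plus a constant. The
  (theta, b) part is \<open>carter\<close>.\<close>

definition null_form :: "real \<Rightarrow> real \<Rightarrow> real \<Rightarrow> real \<Rightarrow> real \<Rightarrow> real \<Rightarrow> real" where
  "null_form L r \<theta> p b E = De r * p\<^sup>2 - ((r\<^sup>2 + a\<^sup>2) * E - a * L)\<^sup>2 / De r + b\<^sup>2
     + L\<^sup>2 / (sin \<theta>)\<^sup>2 + a\<^sup>2 * (sin \<theta>)\<^sup>2 * E\<^sup>2 - 2 * a * E * L"

text \<open>Partial derivative of \<open>null_form\<close> in r, with \<open>E\<close> an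
  independent variable; \<open>null_form_\<theta>\<close> is the one in theta.\<close>

definition null_form_r :: "real \<Rightarrow> real \<Rightarrow> real \<Rightarrow> real \<Rightarrow> real" where
  "null_form_r L r p E = (2 * r - 2 * M) * p\<^sup>2 - 4 * r * E * ((r\<^sup>2 + a\<^sup>2) * E - a * L) / De r
     + ((r\<^sup>2 + a\<^sup>2) * E - a * L)\<^sup>2 * (2 * r - 2 * M) / (De r)\<^sup>2"

definition null_form_\<theta> :: "real \<Rightarrow> real \<Rightarrow> real \<Rightarrow> real" where
  "null_form_\<theta> L \<theta> E = 2 * a\<^sup>2 * sin \<theta> * cos \<theta> * E\<^sup>2 - 2 * L\<^sup>2 * cos \<theta> / (sin \<theta>) ^ 3"

lemma ham_root_radicand_nonneg:
  assumes "rp < r"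
  shows "0 \<le> De r * ((Sg r \<theta>)\<^sup>2 * L\<^sup>2 / (sin \<theta>)\<^sup>2 + PI r \<theta> * (De r * p\<^sup>2 + b\<^sup>2))"
  using ext_pos[OF assms] Sigma_pos[OF assms, of \<theta>] Pi_pos[OF assms, of \<theta>] by simp

lemma ham_root_radicand_pos:
  assumes "rp < r" "0 < \<theta>" "\<theta> < pi" "L \<noteq> 0"
  shows "0 < De r * ((Sg r \<theta>)\<^sup>2 * L\<^sup>2 / (sin \<theta>)\<^sup>2 + PI r \<theta> * (De r * p\<^sup>2 + b\<^sup>2))"
proof -
  have "0 < (Sg r \<theta>)\<^sup>2 * L\<^sup>2 / (sin \<theta>)\<^sup>2" "0 \<le> PI r \<theta> * (De r * p\<^sup>2 + b\<^sup>2)"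
    using ext_pos[OF assms(1)] Sigma_pos[OF assms(1), of \<theta>] Pi_pos[OF assms(1), of \<theta>] assms sin_gt_zero[of \<theta>] by auto
  then show ?thesis using ext_pos[OF assms(1)] by simp
qed

lemma ham_root_pos: "(r, \<theta>, p, b) \<in> phase_dom \<Longrightarrow> L \<noteq> 0 \<Longrightarrow> 0 < ham_root L (r, \<theta>, p, b)"
  using ham_root_radicand_pos by (simp add: ham_root_def phase_dom_iff)

lemma ham_root_eq: "rp < r \<Longrightarrow> ham_root L (r, \<theta>, p, b) = PI r \<theta> * ham L (r, \<theta>, p, b) - 2 * M * a * r * L"
  using Pi_pos[of r \<theta>] by (simp add: ham_def)

text \<open>Completing the square in \<open>E\<close>. The remaining terms are the radicand of
  \<open>ham_root\<close>, so that \<open>PI r \<theta> * E - 2 * M * a * r * L\<close> is plus or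
  minus \<open>ham_root\<close> exactly at null covectors.\<close>

lemma null_form_quadratic:
  assumes "De r \<noteq> 0" "sin \<theta> \<noteq> 0"
  shows "De r * PI r \<theta> * null_form L r \<theta> p b E = 
    De r * ((Sg r \<theta>)\<^sup>2 * L\<^sup>2 / (sin \<theta>)\<^sup>2 + PI r \<theta> * (De r * p\<^sup>2 + b\<^sup>2)) - (PI r \<theta> * E - 2 * M * a * r * L)\<^sup>2"
proof -
  define s2 where "s2 = (sin \<theta>)\<^sup>2"
  have c2: "(cos \<theta>)\<^sup>2 = 1 - s2" by (simp add: s2_def cos_squared_eq)
  have s0: "s2 \<noteq> 0" using assms by (simp add: s2_def)
  \<comment> \<open>The determinant identity of the (t, phi) block of the metric; it makes the
    coefficient of L^2 in the discriminant manifestly positive.\<close>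
  have id1: "4 * M\<^sup>2 * a\<^sup>2 * r\<^sup>2 * s2 + PI r \<theta> * (De r - a\<^sup>2 * s2) = De r * (Sg r \<theta>)\<^sup>2"
    unfolding kerr_Pi_def kerr_Sigma_def kerr_Delta_def c2 by algebra
  have "De r * null_form L r \<theta> p b E = - PI r \<theta> * E\<^sup>2 + 4 * M * a * r * E * L + (De r - a\<^sup>2 * s2) * L\<^sup>2 / s2
      + De r * (De r * p\<^sup>2 + b\<^sup>2)"
    using assms s0 unfolding null_form_def s2_def[symmetric] kerr_Pi_def c2
    by (simp add: field_simps) (simp add: kerr_Delta_def, algebra)
  then have "De r * PI r \<theta> * null_form L r \<theta> p b E = PI r \<theta> * (- PI r \<theta> * E\<^sup>2 + 4 * M * a * r * E * L + (De r - a\<^sup>2 * s2) * L\<^sup>2 / s2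
      + De r * (De r * p\<^sup>2 + b\<^sup>2))"
    by (metis (no_types, lifting) mult.assoc mult.commute)
  also have "\<dots> = - (PI r \<theta> * E)\<^sup>2 + 4 * M * a * r * (PI r \<theta> * E) * L
      + (PI r \<theta> * (De r - a\<^sup>2 * s2)) * L\<^sup>2 / s2 + De r * PI r \<theta> * (De r * p\<^sup>2 + b\<^sup>2)"
    using s0 by (simp add: field_simps power2_eq_square)
  also have "PI r \<theta> * (De r - a\<^sup>2 * s2) = De r * (Sg r \<theta>)\<^sup>2 - 4 * M\<^sup>2 * a\<^sup>2 * r\<^sup>2 * s2"
    using id1 by simp
  finally show ?thesis using s0 unfolding s2_def[symmetric]
    by (simp add: field_simps) algebra
qed

lemma null_form_zero:
  assumes "rp < r" "0 < \<theta>" "\<theta> < pi"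
  shows "null_form L r \<theta> p b (ham L (r, \<theta>, p, b)) = 0"
proof -
  have s: "sin \<theta> \<noteq> 0" using assms sin_gt_zero[of \<theta>] by simp
  have "(ham_root L (r, \<theta>, p, b))\<^sup>2 = De r * ((Sg r \<theta>)\<^sup>2 * L\<^sup>2 / (sin \<theta>)\<^sup>2 + PI r \<theta> * (De r * p\<^sup>2 + b\<^sup>2))"
    using ham_root_radicand_nonneg[OF assms(1)] by (simp add: ham_root_def)
  then have "De r * PI r \<theta> * null_form L r \<theta> p b (ham L (r, \<theta>, p, b)) = 0"
    using null_form_quadratic[of r \<theta> L p b "ham L (r, \<theta>, p, b)"] s ext_pos[OF assms(1)] Sigma_pos[OF assms(1), of \<theta>] Pi_pos[OF assms(1), of \<theta>] ham_root_eq[OF assms(1)] by simp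
  then show ?thesis using ext_pos[OF assms(1)] Sigma_pos[OF assms(1), of \<theta>] Pi_pos[OF assms(1), of \<theta>] by simp
qed

text \<open>Says that the derivative of \<open>null_form\<close> in \<open>E\<close> is -2
  \<open>ham_root\<close> / Delta, which is the denominator in the implicit differentiation of
  \<open>ham\<close>.\<close>

lemma ham_root_P:
  assumes "rp < r"
  shows "ham_root L (r, \<theta>, p, b) = (r\<^sup>2 + a\<^sup>2) * ((r\<^sup>2 + a\<^sup>2) * ham L (r, \<theta>, p, b) - a * L)
    - De r * (a\<^sup>2 * (sin \<theta>)\<^sup>2 * ham L (r, \<theta>, p, b) - a * L)"
  unfolding ham_root_eq[OF assms] kerr_Pi_def kerr_Delta_def cos_squared_eq by (simp add: algebra_simps power2_eq_square)

lemma C1_Delta [C1_intros]: "Ck_on (Suc 0) f S \<Longrightarrow> Ck_on (Suc 0) (\<lambda>x. De (f x)) S"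
  unfolding kerr_Delta_def by (intro C1_intros)

lemma C1_Sigma_Pi [C1_intros]:
  assumes "Ck_on (Suc 0) f S" "Ck_on (Suc 0) g S"
  shows "Ck_on (Suc 0) (\<lambda>x. Sg (f x) (g x)) S" "Ck_on (Suc 0) (\<lambda>x. PI (f x) (g x)) S"
  unfolding kerr_Delta_def kerr_Sigma_def kerr_Pi_def
  by (intro C1_intros assms)+

lemma C1_ham_root: 
  assumes L: "L \<noteq> 0" shows "Ck_on (Suc 0) (ham_root L) phase_dom"
proof -
  have "sin (z\<theta> z) \<noteq> 0" if "z \<in> phase_dom" for z :: "real \<times> real \<times> real \<times> real"
    using that sin_gt_zero[of "z\<theta> z"] by (cases z) (auto simp: phase_dom_iff)
  moreover have "0 < De (zr z) * ((Sg (zr z) (z\<theta> z))\<^sup>2 * L\<^sup>2 / (sin (z\<theta> z))\<^sup>2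
     + PI (zr z) (z\<theta> z) * (De (zr z) * (zp z)\<^sup>2 + (zb z)\<^sup>2))" if "z \<in> phase_dom" for z
    using that ham_root_radicand_pos[OF _ _ _ L] by (cases z) (auto simp: phase_dom_iff)
  ultimately show ?thesis
    unfolding ham_root_def[abs_def] by (intro C1_intros) auto
qed

lemma C1_ham: 
  assumes L: "L \<noteq> 0" shows "Ck_on (Suc 0) (ham L) phase_dom"
proof -
  have "PI (zr z) (z\<theta> z) \<noteq> 0" if "z \<in> phase_dom" for z
    using that Pi_pos[of "zr z" "z\<theta> z"] by (cases z) (auto simp: phase_dom_iff)
  then show ?thesis
    unfolding ham_def[abs_def] by (intro C1_intros C1_ham_root L) auto
qed

text \<open>Implicit differentiation of \<open>null_form\<close> = 0 along \<open>E\<close> =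
  \<open>ham L z\<close>. Differentiability of \<open>ham\<close> is already known, so only the
  value of the derivative has to be solved for.\<close>

lemma ham_has_derivative:
  assumes z: "(r, \<theta>, p, b) \<in> phase_dom" and L: "L \<noteq> 0"
  defines "E \<equiv> ham L (r, \<theta>, p, b)" and "c \<equiv> De r / (2 * ham_root L (r, \<theta>, p, b))"
  shows "(ham L has_derivative (\<lambda>h. c * (null_form_r L r p E * zr h + null_form_\<theta> L \<theta> E * z\<theta> h + 2 * De r * p * zp h + 2 * b * zb h)))
    (at (r, \<theta>, p, b))"
proof -
  have r: "rp < r" "0 < \<theta>" "\<theta> < pi" using z by (auto simp: phase_dom_iff)
  note pos = ext_pos[OF r(1)] Sigma_pos[OF r(1), of \<theta>] Pi_pos[OF r(1), of \<theta>] 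
  have s: "0 < sin \<theta>" using r sin_gt_zero by simp
  let ?D = "frechet_derivative (ham L) (at (r, \<theta>, p, b))"
  have H: "(ham L has_derivative ?D) (at (r, \<theta>, p, b))"
    using C1_has_derivative[OF C1_ham[OF L] z] .
  let ?N = "\<lambda>z. null_form L (zr z) (z\<theta> z) (zp z) (zb z) (ham L z)"
  let ?z = "(r, \<theta>, p, b)"
  define P where "P = (r\<^sup>2 + a\<^sup>2) * E - a * L"
  define dP where "dP h = 2 * r * E * zr h + (r\<^sup>2 + a\<^sup>2) * ?D h" for h
  have De0: "De r \<noteq> 0" using pos by simp
  have dDe: "((\<lambda>z. De (zr z)) has_derivative (\<lambda>h. (2 * r - 2 * M) * zr h)) (at ?z)"
    unfolding kerr_Delta_def by (auto intro!: derivative_eq_intros simp: algebra_simps)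
  have dP: "((\<lambda>z. ((zr z)\<^sup>2 + a\<^sup>2) * ham L z - a * L) has_derivative dP) (at ?z)"
    unfolding dP_def by (rule has_derivative_eq_rhs, (rule derivative_eq_intros refl H)+) (simp add: E_def algebra_simps)
  have d1: "((\<lambda>z. De (zr z) * (zp z)\<^sup>2) has_derivative (\<lambda>h. De r * (2 * p * zp h) + (2 * r - 2 * M) * zr h * p\<^sup>2)) (at ?z)"
    by (rule has_derivative_eq_rhs, (rule derivative_eq_intros refl dDe)+) (simp add: mult.commute mult.left_commute)
  have d2: "((\<lambda>z. (((zr z)\<^sup>2 + a\<^sup>2) * ham L z - a * L)\<^sup>2 / De (zr z)) has_derivative
      (\<lambda>h. 2 * P * dP h / De r - P\<^sup>2 * ((2 * r - 2 * M) * zr h) / (De r)\<^sup>2)) (at ?z)"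
    by (rule has_derivative_eq_rhs, (rule derivative_eq_intros refl dDe dP)+)
      (use De0 in \<open>simp_all add: P_def E_def field_simps power2_eq_square\<close>)
  have d3: "((\<lambda>z. L\<^sup>2 / (sin (z\<theta> z))\<^sup>2) has_derivative (\<lambda>h. - 2 * L\<^sup>2 * cos \<theta> / (sin \<theta>) ^ 3 * z\<theta> h)) (at ?z)"
    by (rule has_derivative_eq_rhs, (rule derivative_eq_intros refl)+)
      (use s in \<open>simp_all add: field_simps power2_eq_square power3_eq_cube\<close>)
  have d4: "((\<lambda>z. a\<^sup>2 * (sin (z\<theta> z))\<^sup>2 * (ham L z)\<^sup>2 - 2 * a * ham L z * L) has_derivative
      (\<lambda>h. 2 * a\<^sup>2 * sin \<theta> * cos \<theta> * E\<^sup>2 * z\<theta> h + (2 * a\<^sup>2 * (sin \<theta>)\<^sup>2 * E - 2 * a * L) * ?D h)) (at ?z)"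
    by (rule has_derivative_eq_rhs, (rule derivative_eq_intros refl H)+)
      (simp add: E_def algebra_simps power2_eq_square)
  have d5: "((\<lambda>z. (zb z)\<^sup>2) has_derivative (\<lambda>h. 2 * b * zb h)) (at ?z)"
    by (rule has_derivative_eq_rhs, (rule derivative_eq_intros refl)+) (simp add: mult.commute mult.left_commute)
  have Neq: "?N = (\<lambda>z. De (zr z) * (zp z)\<^sup>2 - (((zr z)\<^sup>2 + a\<^sup>2) * ham L z - a * L)\<^sup>2 / De (zr z)
      + (zb z)\<^sup>2 + L\<^sup>2 / (sin (z\<theta> z))\<^sup>2 + (a\<^sup>2 * (sin (z\<theta> z))\<^sup>2 * (ham L z)\<^sup>2 - 2 * a * ham L z * L))"
    by (simp add: null_form_def fun_eq_iff)
  have SP: "ham_root L ?z = (r\<^sup>2 + a\<^sup>2) * P - De r * (a\<^sup>2 * (sin \<theta>)\<^sup>2 * E - a * L)"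
    unfolding P_def E_def by (rule ham_root_P[OF r(1)])
  have N1: "(?N has_derivative (\<lambda>h. null_form_r L r p E * zr h + null_form_\<theta> L \<theta> E * z\<theta> h + 2 * De r * p * zp h + 2 * b * zb h
      - 2 * ham_root L ?z / De r * ?D h)) (at ?z)"
    unfolding Neq
    by (rule has_derivative_eq_rhs, rule has_derivative_add[OF has_derivative_add[OF has_derivative_add[OF
        has_derivative_diff[OF d1 d2] d5] d3] d4])
      (use De0 in \<open>simp only: fun_eq_iff SP null_form_r_def null_form_\<theta>_def dP_def P_def[symmetric]\<close>,
       use De0 in \<open>simp add: diff_divide_distrib add_divide_distrib algebra_simps\<close>)
  \<comment> \<open>\<open>?N\<close> vanishes identically near the point; comparing with
    \<open>N1\<close> gives one linear equation for \<open>?D h\<close>.\<close>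
  have N2: "(?N has_derivative (\<lambda>h. 0)) (at (r, \<theta>, p, b))"
  proof (rule has_derivative_transform_within_open[OF has_derivative_const open_phase_dom z])
    fix z assume "z \<in> phase_dom"
    then show "0 = ?N z" by (cases z) (simp add: null_form_zero phase_dom_iff)
  qed
  have "?D h = c * (null_form_r L r p E * zr h + null_form_\<theta> L \<theta> E * z\<theta> h + 2 * De r * p * zp h + 2 * b * zb h)" for h
    using fun_cong[OF has_derivative_unique[OF N1 N2], of h] pos(1) ham_root_pos[OF z L] by (simp add: c_def field_simps)
  then have "?D = (\<lambda>h. c * (null_form_r L r p E * zr h + null_form_\<theta> L \<theta> E * z\<theta> h + 2 * De r * p * zp h + 2 * b * zb h))" by blast
  then show ?thesis using H by simp
qed


text \<open>The Hamiltonian vector field \<open>(\<partial>H/\<partial>p, \<partial>H/\<partial>b, - \<partial>H/\<partial>r, - \<partial>H/\<partial>\<theta>)\<close> of \<open>H = ham L\<close>, written with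
  the derivatives of \<open>null_form\<close> at fixed \<open>E\<close>.\<close>

definition ham_field :: "real \<Rightarrow> real \<times> real \<times> real \<times> real \<Rightarrow> real \<times> real \<times> real \<times> real" where
  "ham_field L z = (let c = De (zr z) / ham_root L z in
     (c * De (zr z) * zp z, c * zb z, - c * null_form_r L (zr z) (zp z) (ham L z) / 2, - c * null_form_\<theta> L (z\<theta> z) (ham L z) / 2))"

lemma phase_dom_simps:
  assumes "z \<in> phase_dom"
  shows "De (zr z) > 0" "sin (z\<theta> z) > 0" "Sg (zr z) (z\<theta> z) > 0" "PI (zr z) (z\<theta> z) > 0" "zr z > 0" "zr z > rp"
    "L \<noteq> 0 \<Longrightarrow> ham_root L z > 0"
  using assms ext_pos[of "zr z"] Sigma_pos[of "zr z" "z\<theta> z"] Pi_pos[of "zr z" "z\<theta> z"] sin_gt_zero[of "z\<theta> z"]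
    ham_root_pos[of "zr z" "z\<theta> z" "zp z" "zb z" L]
  by (auto simp: phase_dom_def)

lemma C1_ham_field:
  assumes L: "L \<noteq> 0" shows "Ck_on (Suc 0) (ham_field L) phase_dom"
proof -
  have "De (zr z) \<noteq> 0" "sin (z\<theta> z) \<noteq> 0" "ham_root L z \<noteq> 0" "(De (zr z))\<^sup>2 \<noteq> 0" "sin (z\<theta> z) ^ 3 \<noteq> 0" if "z \<in> phase_dom" for z
    using phase_dom_simps(1-6)[OF that] phase_dom_simps(7)[OF that L] by auto
  then show ?thesis
    unfolding ham_field_def[abs_def] Let_def null_form_r_def null_form_\<theta>_def
    by (intro C1_intros C1_ham_root C1_ham L) auto
qed

lemma ham_conserved:
  assumes z: "z \<in> phase_dom" and L: "L \<noteq> 0"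
  shows "frechet_derivative (ham L) (at z) (ham_field L z) = 0"
proof -
  obtain r \<theta> p b where z': "z = (r, \<theta>, p, b)" by (cases z)
  show ?thesis
    unfolding z' frechet_derivative_eqI[OF ham_has_derivative[OF z[unfolded z'] L]]
    by (simp add: ham_field_def Let_def algebra_simps)
qed

definition carter :: "real \<Rightarrow> real \<times> real \<times> real \<times> real \<Rightarrow> real" where
  "carter L z = (zb z)\<^sup>2 + L\<^sup>2 / (sin (z\<theta> z))\<^sup>2 + a\<^sup>2 * (sin (z\<theta> z))\<^sup>2 * (ham L z)\<^sup>2"

lemma C1_carter:
  assumes L: "L \<noteq> 0" shows "Ck_on (Suc 0) (carter L) phase_dom"
proof -
  have "(sin (z\<theta> z))\<^sup>2 \<noteq> 0" if "z \<in> phase_dom" for z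
    using phase_dom_simps(1-6)[OF that] phase_dom_simps(7)[OF that L] by auto
  then show ?thesis
    unfolding carter_def[abs_def] by (intro C1_intros C1_ham L) auto
qed

text \<open>At fixed energy the (theta, b) part of \<open>null_form\<close> drives the motion in
  theta and b alone, as a Hamiltonian up to the common factor c, and is therefore constant; the
  variation of the energy itself drops out by \<open>ham_conserved\<close>.\<close>

lemma carter_conserved:
  assumes z: "z \<in> phase_dom" and L: "L \<noteq> 0"
  shows "frechet_derivative (carter L) (at z) (ham_field L z) = 0"
proof -
  obtain r \<theta> p b where z': "z = (r, \<theta>, p, b)" by (cases z)
  let ?D = "frechet_derivative (ham L) (at z)"
  have s: "sin \<theta> > 0" using phase_dom_simps[OF z] by (simp add: z')
  have H: "(ham L has_derivative ?D) (at (r, \<theta>, p, b))"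
    using C1_has_derivative[OF C1_ham[OF L] z] by (simp only: z')
  have d3: "((\<lambda>z. L\<^sup>2 / (sin (z\<theta> z))\<^sup>2) has_derivative (\<lambda>h. - 2 * L\<^sup>2 * cos \<theta> / (sin \<theta>) ^ 3 * z\<theta> h)) (at (r, \<theta>, p, b))"
    by (rule has_derivative_eq_rhs, (rule derivative_eq_intros refl)+)
      (use s in \<open>simp_all add: field_simps power2_eq_square power3_eq_cube\<close>)
  have "(carter L has_derivative (\<lambda>h. 2 * b * zb h + null_form_\<theta> L \<theta> (ham L (r, \<theta>, p, b)) * z\<theta> h
      + 2 * a\<^sup>2 * (sin \<theta>)\<^sup>2 * ham L (r, \<theta>, p, b) * ?D h)) (at (r, \<theta>, p, b))"
    unfolding carter_def
    by (rule has_derivative_eq_rhs, (rule derivative_eq_intros refl d3 H)+)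
      (simp add: fun_eq_iff null_form_\<theta>_def power2_eq_square algebra_simps)
  from frechet_derivative_eqI[OF this]
  show ?thesis using ham_conserved[OF z L] unfolding z'
    by (simp add: ham_field_def Let_def algebra_simps)
qed

lemma ham_has_real_derivative:
  assumes z: "(r, \<theta>, p, b) \<in> phase_dom" and L: "L \<noteq> 0"
  defines "E \<equiv> ham L (r, \<theta>, p, b)" and "c \<equiv> De r / (2 * ham_root L (r, \<theta>, p, b))"
  shows "((\<lambda>r. ham L (r, \<theta>, p, b)) has_real_derivative c * null_form_r L r p E) (at r)"
    "((\<lambda>\<theta>. ham L (r, \<theta>, p, b)) has_real_derivative c * null_form_\<theta> L \<theta> E) (at \<theta>)"
    "((\<lambda>p. ham L (r, \<theta>, p, b)) has_real_derivative c * (2 * De r * p)) (at p)"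
    "((\<lambda>b. ham L (r, \<theta>, p, b)) has_real_derivative c * (2 * b)) (at b)"
proof -
  note H = ham_has_derivative[OF z L, folded E_def c_def]
  have 1: "((\<lambda>r. (r, \<theta>, p, b)) has_derivative (\<lambda>h. (h, 0, 0, 0))) (at r)"
    and 2: "((\<lambda>\<theta>. (r, \<theta>, p, b)) has_derivative (\<lambda>h. (0, h, 0, 0))) (at \<theta>)"
    and 3: "((\<lambda>p. (r, \<theta>, p, b)) has_derivative (\<lambda>h. (0, 0, h, 0))) (at p)"
    and 4: "((\<lambda>b. (r, \<theta>, p, b)) has_derivative (\<lambda>h. (0, 0, 0, h))) (at b)"
    by (auto intro!: derivative_eq_intros simp: zero_prod_def)
  show "((\<lambda>r. ham L (r, \<theta>, p, b)) has_real_derivative c * null_form_r L r p E) (at r)"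
    unfolding has_field_derivative_def
    by (rule has_derivative_eq_rhs[OF has_derivative_compose[OF 1 H]]) (simp add: fun_eq_iff)
  show "((\<lambda>\<theta>. ham L (r, \<theta>, p, b)) has_real_derivative c * null_form_\<theta> L \<theta> E) (at \<theta>)"
    unfolding has_field_derivative_def
    by (rule has_derivative_eq_rhs[OF has_derivative_compose[OF 2 H]]) (simp add: fun_eq_iff)
  show "((\<lambda>p. ham L (r, \<theta>, p, b)) has_real_derivative c * (2 * De r * p)) (at p)"
    unfolding has_field_derivative_def
    by (rule has_derivative_eq_rhs[OF has_derivative_compose[OF 3 H]]) (simp add: fun_eq_iff)
  show "((\<lambda>b. ham L (r, \<theta>, p, b)) has_real_derivative c * (2 * b)) (at b)"
    unfolding has_field_derivative_def
    by (rule has_derivative_eq_rhs[OF has_derivative_compose[OF 4 H]]) (simp add: fun_eq_iff)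
qed

text \<open>The two summands are the r-derivative of the r-component and the p-derivative of the
  p-component of \<open>ham_field\<close>. \<open>NrE\<close> stands for the mixed derivative of
  \<open>null_form\<close> in r and \<open>E\<close>, \<open>SrE\<close> for the r-derivative of
  \<open>ham_root\<close> at fixed \<open>E\<close>, \<open>Sr\<close> and \<open>Sp\<close> for its
  total derivatives along \<open>E\<close> = \<open>ham\<close>.\<close>

lemma divergence_r_cancel:
  fixes D :: real
  assumes "D \<noteq> 0" "S \<noteq> 0" and N: "NrE = - 2 * SrE / D + 2 * S * D' / D\<^sup>2"
    and "Sr = SrE + PP * (D / (2 * S) * Nr)" "Sp = PP * (D / (2 * S) * (2 * D * p))"
  shows "p * (2 * D * D' / S - D\<^sup>2 * Sr / S\<^sup>2) +
    - (D / 2) * ((2 * D' * p + NrE * (D / (2 * S) * (2 * D * p))) / S - Nr * Sp / S\<^sup>2) = 0"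
  unfolding N assms(4,5) using assms(1,2)
  by (simp add: field_simps power2_eq_square)

lemma divergence_\<theta>_cancel:
  fixes D :: real
  assumes "D \<noteq> 0" "S \<noteq> 0" and N: "NtE = - 2 * StE / D"
    and "St = StE + PP * (D / (2 * S) * Nt)" "Sb = PP * (D / (2 * S) * (2 * b))"
  shows "D * b * (- St / S\<^sup>2) +
    - (D / 2) * (NtE * (D / (2 * S) * (2 * b)) / S - Nt * Sb / S\<^sup>2) = 0"
  unfolding N assms(4,5) using assms(1,2)
  by (simp add: field_simps power2_eq_square)

text \<open>In each conjugate pair (r, p) and (theta, b) the two diagonal entries are mixed second
  derivatives of \<open>ham\<close> with opposite signs. They are computed from the explicit first
  derivatives, so no second-order smoothness of \<open>ham\<close> is invoked.\<close>

lemma ham_field_divergence_free: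
  assumes z: "z \<in> phase_dom" and L: "L \<noteq> 0"
  shows "(\<Sum>b\<in>Basis. frechet_derivative (ham_field L) (at z) b \<bullet> b) = 0"
proof -
  obtain r \<theta> p b where z': "z = (r, \<theta>, p, b)" by (cases z)
  note zz = z[unfolded z']
  have r: "rp < r" "0 < \<theta>" "\<theta> < pi" using zz by (auto simp: phase_dom_iff)
  let ?E = "ham L (r, \<theta>, p, b)" and ?S = "ham_root L (r, \<theta>, p, b)"
  define c where "c = De r / (2 * ?S)"
  let ?D = "frechet_derivative (ham_field L) (at (r, \<theta>, p, b))"
  have D: "(ham_field L has_derivative ?D) (at (r, \<theta>, p, b))"
    using C1_has_derivative[OF C1_ham_field[OF L] zz] .
  note H = ham_has_real_derivative[OF zz L, folded c_def]
  have pos: "De r \<noteq> 0" "sin \<theta> \<noteq> 0" "?S \<noteq> 0" "(De r)\<^sup>2 \<noteq> 0" "sin \<theta> ^ 3 \<noteq> 0"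
    using phase_dom_simps(1,2)[OF zz] phase_dom_simps(7)[OF zz L] by auto
  let ?P = "(r\<^sup>2 + a\<^sup>2) * ?E - a * L" and ?D' = "2 * r - 2 * M"
  define SrE where "SrE = (4 * r * (r\<^sup>2 + a\<^sup>2) - a\<^sup>2 * ?D' * (sin \<theta>)\<^sup>2) * ?E - 2 * M * a * L"
  define StE where "StE = - 2 * a\<^sup>2 * De r * sin \<theta> * cos \<theta> * ?E"
  define Sr where "Sr = SrE + PI r \<theta> * (c * null_form_r L r p ?E)"
  define St where "St = StE + PI r \<theta> * (c * null_form_\<theta> L \<theta> ?E)"
  define Sp where "Sp = PI r \<theta> * (c * (2 * De r * p))"
  define Sb where "Sb = PI r \<theta> * (c * (2 * b))"
  define NrE where "NrE = - 4 * r * ?P / De r - 4 * r * ?E * (r\<^sup>2 + a\<^sup>2) / De r + 2 * ?P * (r\<^sup>2 + a\<^sup>2) * ?D' / (De r)\<^sup>2"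
  define NtE where "NtE = 4 * a\<^sup>2 * sin \<theta> * cos \<theta> * ?E"
  have dDe: "(kerr_Delta M a has_real_derivative ?D') (at r)"
    unfolding kerr_Delta_def[abs_def] by (auto intro!: derivative_eq_intros)
  have dPr: "((\<lambda>r. PI r \<theta>) has_real_derivative 4 * r * (r\<^sup>2 + a\<^sup>2) - a\<^sup>2 * ?D' * (sin \<theta>)\<^sup>2) (at r)"
    unfolding kerr_Pi_def kerr_Delta_def sin_squared_eq by (auto intro!: derivative_eq_intros simp: algebra_simps)
  have dPt: "((\<lambda>\<theta>. PI r \<theta>) has_real_derivative - 2 * a\<^sup>2 * De r * sin \<theta> * cos \<theta>) (at \<theta>)"
    unfolding kerr_Pi_def by (auto intro!: derivative_eq_intros simp: algebra_simps)
  have dSr: "((\<lambda>r. ham_root L (r, \<theta>, p, b)) has_real_derivative Sr) (at r)"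
    by (rule has_field_derivative_transform_within_open[of "\<lambda>r. PI r \<theta> * ham L (r, \<theta>, p, b) - 2 * M * a * r * L" _ _ "{rp<..}"])
      (use r in \<open>auto intro!: derivative_eq_intros dPr H(1) simp: ham_root_eq Sr_def SrE_def algebra_simps\<close>)
  have dSt: "((\<lambda>\<theta>. ham_root L (r, \<theta>, p, b)) has_real_derivative St) (at \<theta>)"
    unfolding ham_root_eq[OF r(1)] by (auto intro!: derivative_eq_intros dPt H(2) simp: St_def StE_def algebra_simps)
  have dSp: "((\<lambda>p. ham_root L (r, \<theta>, p, b)) has_real_derivative Sp) (at p)"
    unfolding ham_root_eq[OF r(1)] by (auto intro!: derivative_eq_intros H(3) simp: Sp_def algebra_simps)
  have dSb: "((\<lambda>b. ham_root L (r, \<theta>, p, b)) has_real_derivative Sb) (at b)"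
    unfolding ham_root_eq[OF r(1)] by (auto intro!: derivative_eq_intros H(4) simp: Sb_def algebra_simps)
  have dN: "((\<lambda>p. null_form_r L r p (ham L (r, \<theta>, p, b))) has_real_derivative 2 * ?D' * p + NrE * (c * (2 * De r * p))) (at p)"
    unfolding null_form_r_def
    apply (rule derivative_eq_intros refl H(3) | (rule pos))+
    using pos by (simp_all add: NrE_def field_simps power2_eq_square)
  have dNt: "((\<lambda>b. null_form_\<theta> L \<theta> (ham L (r, \<theta>, p, b))) has_real_derivative NtE * (c * (2 * b))) (at b)"
    unfolding null_form_\<theta>_def
    apply (rule derivative_eq_intros refl H(4) | (rule pos))+
    using pos by (simp_all add: NtE_def)
  have 1: "((\<lambda>r. fst (ham_field L (r, \<theta>, p, b))) has_real_derivative p * (2 * De r * ?D' / ?S - (De r)\<^sup>2 * Sr / ?S\<^sup>2)) (at r)"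
    unfolding ham_field_def Let_def fst_conv snd_conv
    by (rule derivative_eq_intros refl dDe dSr | rule pos)+ (use pos in \<open>simp_all add: field_simps power2_eq_square\<close>)
  have 2: "((\<lambda>\<theta>. fst (snd (ham_field L (r, \<theta>, p, b)))) has_real_derivative De r * b * (- St / ?S\<^sup>2)) (at \<theta>)"
    unfolding ham_field_def Let_def fst_conv snd_conv
    by (rule derivative_eq_intros refl dSt | rule pos)+ (use pos in \<open>simp_all add: field_simps power2_eq_square\<close>)
  have 3: "((\<lambda>p. fst (snd (snd (ham_field L (r, \<theta>, p, b))))) has_real_derivative
      - (De r / 2) * ((2 * ?D' * p + NrE * (c * (2 * De r * p))) / ?S - null_form_r L r p ?E * Sp / ?S\<^sup>2)) (at p)"
    unfolding ham_field_def Let_def fst_conv snd_conv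
    by (rule derivative_eq_intros refl dSp dN | rule pos)+ (use pos in \<open>simp_all add: field_simps power2_eq_square\<close>)
  have 4: "((\<lambda>b. snd (snd (snd (ham_field L (r, \<theta>, p, b))))) has_real_derivative
      - (De r / 2) * (NtE * (c * (2 * b)) / ?S - null_form_\<theta> L \<theta> ?E * Sb / ?S\<^sup>2)) (at b)"
    unfolding ham_field_def Let_def fst_conv snd_conv
    by (rule derivative_eq_intros refl dSb dNt | rule pos)+ (use pos in \<open>simp_all add: field_simps power2_eq_square\<close>)
  have c1: "((\<lambda>r. (r, \<theta>, p, b)) has_derivative (\<lambda>h. (h, 0, 0, 0))) (at r)"
    and c2: "((\<lambda>\<theta>. (r, \<theta>, p, b)) has_derivative (\<lambda>h. (0, h, 0, 0))) (at \<theta>)"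
    and c3: "((\<lambda>p. (r, \<theta>, p, b)) has_derivative (\<lambda>h. (0, 0, h, 0))) (at p)"
    and c4: "((\<lambda>b. (r, \<theta>, p, b)) has_derivative (\<lambda>h. (0, 0, 0, h))) (at b)"
    by (auto intro!: derivative_eq_intros simp: zero_prod_def)
  \<comment> \<open>Reads a diagonal entry of the full derivative off a derivative along a
    coordinate line.\<close>
  have val: "K (?D (e 1)) = d" 
    if "bounded_linear K" "(g has_derivative e) (at x)" "g x = (r, \<theta>, p, b)" "((\<lambda>x. K (ham_field L (g x))) has_real_derivative d) (at x)"
    for K :: "real \<times> real \<times> real \<times> real \<Rightarrow> real" and e :: "real \<Rightarrow> real \<times> real \<times> real \<times> real" and d x g
  proof -
    have "((\<lambda>x. K (ham_field L (g x))) has_derivative (\<lambda>h. K (?D (e h)))) (at x)"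
      by (rule bounded_linear.has_derivative[OF that(1) has_derivative_compose[OF that(2)]]) (simp add: that(3) D)
    from has_derivative_unique[OF this that(4)[unfolded has_field_derivative_def]] show ?thesis
      by (metis mult.right_neutral)
  qed
  have v: "fst (?D (1, 0, 0, 0)) = p * (2 * De r * ?D' / ?S - (De r)\<^sup>2 * Sr / ?S\<^sup>2)"
    "fst (snd (?D (0, 1, 0, 0))) = De r * b * (- St / ?S\<^sup>2)"
    "fst (snd (snd (?D (0, 0, 1, 0)))) = - (De r / 2) * ((2 * ?D' * p + NrE * (c * (2 * De r * p))) / ?S - null_form_r L r p ?E * Sp / ?S\<^sup>2)"
    "snd (snd (snd (?D (0, 0, 0, 1)))) = - (De r / 2) * (NtE * (c * (2 * b)) / ?S - null_form_\<theta> L \<theta> ?E * Sb / ?S\<^sup>2)"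
    by (rule val[OF bounded_linear_fst c1 _ 1], simp)
      (rule val[OF bounded_linear_compose[OF bounded_linear_fst bounded_linear_snd, unfolded o_def] c2 _ 2], simp,
       rule val[OF bounded_linear_compose[OF bounded_linear_fst bounded_linear_compose[OF bounded_linear_snd bounded_linear_snd], unfolded o_def] c3 _ 3], simp,
       rule val[OF bounded_linear_compose[OF bounded_linear_snd bounded_linear_compose[OF bounded_linear_snd bounded_linear_snd], unfolded o_def] c4 _ 4], simp)
  \<comment> \<open>Equality of the mixed derivatives of \<open>null_form\<close> in r and
    \<open>E\<close>: the right-hand side is the r-derivative, at fixed \<open>E\<close>, of -2
    \<open>ham_root\<close> / Delta.\<close>
  have N1: "NrE = - 2 * SrE / De r + 2 * ?S * ?D' / (De r)\<^sup>2"
  proof -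
    have "NrE * (De r)\<^sup>2 = - 2 * SrE * De r + 2 * ?S * ?D'"
      using pos unfolding NrE_def SrE_def ham_root_P[OF r(1)] by (simp add: field_simps power2_eq_square)
    then have "NrE = (- 2 * SrE * De r + 2 * ?S * ?D') / (De r)\<^sup>2"
      using pos by (simp only: eq_divide_eq not_False_eq_True if_True)
    also have "\<dots> = - 2 * SrE / De r + 2 * ?S * ?D' / (De r)\<^sup>2"
      using pos(1) by (simp add: add_divide_distrib diff_divide_distrib power2_eq_square)
    finally show ?thesis .
  qed
  have N2: "NtE = - 2 * StE / De r" using pos by (simp add: NtE_def StE_def)
  note A1 = divergence_r_cancel[OF pos(1) pos(3) N1 Sr_def[unfolded c_def] Sp_def[unfolded c_def], folded c_def]
  note A2 = divergence_\<theta>_cancel[OF pos(1) pos(3) N2 St_def[unfolded c_def] Sb_def[unfolded c_def], folded c_def]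
  have "(\<Sum>b\<in>Basis. ?D b \<bullet> b) = fst (?D (1, 0, 0, 0)) + fst (snd (?D (0, 1, 0, 0)))
      + fst (snd (snd (?D (0, 0, 1, 0)))) + snd (snd (snd (?D (0, 0, 0, 1))))"
  proof -
    have "(\<Sum>b\<in>Basis. f b \<bullet> b) = fst (f (1, 0, 0, 0)) + fst (snd (f (0, 1, 0, 0)))
      + fst (snd (snd (f (0, 0, 1, 0)))) + snd (snd (snd (f (0, 0, 0, 1))))"
      for f :: "real \<times> real \<times> real \<times> real \<Rightarrow> real \<times> real \<times> real \<times> real"
    proof -
      have B: "(Basis :: (real \<times> real \<times> real \<times> real) set) = {(1, 0, 0, 0), (0, 1, 0, 0), (0, 0, 1, 0), (0, 0, 0, 1)}"
        by (auto simp: Basis_prod_def zero_prod_def)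
      show ?thesis unfolding B by (simp add: inner_prod_def)
    qed
    then show ?thesis .
  qed
  then show ?thesis using A1 A2 unfolding z' v by linarith
qed

end

section \<open>Comparison of the weight with a conserved quantity\<close>

text \<open>Units \<open>M = 1\<close>; \<open>D\<close> is \<open>\<Delta>\<close>, \<open>s2\<close> is \<open>sin\<^sup>2\<theta>\<close> and \<open>S\<close> is \<open>ham_root\<close>. In \<open>J3\<close> the cut-off at
  \<open>\<bar>L\<bar> / 40\<close> makes the extra term vanish for \<open>r \<ge> 5/2\<close>, and \<open>230400 = 144 * 40\<^sup>2\<close>.\<close>

locale kerr_ineq =
  fixes r a E L S D s2 rp :: real
  assumes a: "\<bar>a\<bar> \<le> 1 / 1000" and rp: "3 / 2 \<le> rp" "rp \<le> 2" and rp_root: "rp\<^sup>2 - 2 * rp + a\<^sup>2 = 0"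
    and r: "rp < r" and D: "D = r\<^sup>2 - 2 * r + a\<^sup>2" and s2: "0 \<le> s2" "s2 \<le> 1"
    and S: "S = ((r\<^sup>2 + a\<^sup>2)\<^sup>2 - a\<^sup>2 * D * s2) * E - 2 * a * r * L" and Spos: "0 < S"
    and SL: "D * r ^ 4 * L\<^sup>2 \<le> S\<^sup>2"
begin

definition R where "R = r\<^sup>2 + a\<^sup>2"
definition Q where "Q = R\<^sup>2 - a\<^sup>2 * D * s2"
definition y where "y = a * L"
definition P where "P = R * E - y"
definition NW where "NW = 2 * R\<^sup>2 * E\<^sup>2 - 4 * a * r * E * L + a\<^sup>2 * L\<^sup>2 - D * a\<^sup>2 * s2 * E\<^sup>2"
definition \<delta> where "\<delta> = 2 * rp * E - y"
definition J3 where "J3 = E + 230400 * a\<^sup>2 * (max 0 (\<bar>L\<bar> / 40 - E))\<^sup>2 / \<delta>"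

lemma r_gt: "3 / 2 < r" using rp r by linarith

lemma a2: "0 \<le> a\<^sup>2" "a\<^sup>2 \<le> 1 / 1000000"
  using power_mono[OF a abs_ge_zero, of 2] by (simp_all add: power2_eq_square)

lemma r2: "9 / 4 \<le> r\<^sup>2" "r \<le> r\<^sup>2" "1 \<le> r\<^sup>2"
proof -
  have "(3 / 2)\<^sup>2 \<le> r\<^sup>2" using r_gt by (intro power_mono) auto
  then show 1: "9 / 4 \<le> r\<^sup>2" by (simp add: power2_eq_square)
  then show "1 \<le> r\<^sup>2" by linarith
  show "r \<le> r\<^sup>2" using r_gt by (simp add: power2_eq_square)
qed

lemma D_factor: "D = (r - rp) * (r - (2 - rp))"
  using rp_root D by (simp add: algebra_simps power2_eq_square)

lemma D_pos: "0 < D" unfolding D_factor using r rp by (intro mult_pos_pos) auto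

lemma D_le: "D \<le> r\<^sup>2" "D \<le> R"
  using D a2 r_gt by (auto simp: R_def)

lemma DL: "D * \<bar>L\<bar> * r \<le> S"
proof (rule power2_le_imp_le)
  have "(D * \<bar>L\<bar> * r)\<^sup>2 = D * r\<^sup>2 * (D * L\<^sup>2)"
    by (simp add: power_mult_distrib power2_eq_square)
  also have "\<dots> \<le> r\<^sup>2 * r\<^sup>2 * (D * L\<^sup>2)"
    using D_le D_pos by (intro mult_right_mono) auto
  also have "\<dots> = D * r ^ 4 * L\<^sup>2" by (simp add: power4_eq_xxxx power2_eq_square)
  finally show "(D * \<bar>L\<bar> * r)\<^sup>2 \<le> S\<^sup>2" using SL by simp
qed (use Spos in simp)

lemma DL': "D * \<bar>L\<bar> \<le> S"
proof -
  have "D * \<bar>L\<bar> * 1 \<le> D * \<bar>L\<bar> * r" using r_gt D_pos by (intro mult_left_mono) auto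
  then show ?thesis using DL by simp
qed

text \<open>Slow rotation enters here: the factor a in y = a L makes frame dragging a small
  perturbation relative to \<open>S\<close>, after multiplication by \<open>D\<close>.\<close>

lemma Dy: "D * \<bar>y\<bar> \<le> S / 1000"
proof -
  have "\<bar>a\<bar> * (D * \<bar>L\<bar>) \<le> 1 / 1000 * S" using a DL' D_pos by (intro mult_mono) auto
  then show ?thesis by (simp add: y_def abs_mult mult_ac)
qed

lemma S_eq: "S = Q * E - 2 * r * y" by (simp add: S Q_def R_def y_def)

lemma r4: "r ^ 4 = r\<^sup>2 * r\<^sup>2" by (simp add: power4_eq_xxxx power2_eq_square)

lemma R_bounds: "r\<^sup>2 \<le> R" "R \<le> 1001 / 1000 * r\<^sup>2"
  using a2 r2 by (auto simp: R_def)

lemma Q_bounds: "r ^ 4 \<le> Q" "Q \<le> R\<^sup>2" "Q \<le> 101 / 100 * r ^ 4"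
proof -
  have "Q = r ^ 4 + a\<^sup>2 * r\<^sup>2 + a\<^sup>2 * (2 * r) + a\<^sup>2 * D * (1 - s2)"
    unfolding Q_def R_def unfolding D by (simp add: algebra_simps power2_eq_square power4_eq_xxxx)
  moreover have "0 \<le> a\<^sup>2 * r\<^sup>2 + a\<^sup>2 * (2 * r) + a\<^sup>2 * D * (1 - s2)"
    using r_gt D_pos s2 by simp
  ultimately show "r ^ 4 \<le> Q" by linarith
  have "0 \<le> a\<^sup>2 * D * s2" using D_pos s2 by simp
  then show 1: "Q \<le> R\<^sup>2" by (simp add: Q_def)
  have "R\<^sup>2 \<le> (1001 / 1000 * r\<^sup>2)\<^sup>2" using R_bounds r2 by (intro power_mono) auto
  also have "\<dots> = (1001 / 1000)\<^sup>2 * r ^ 4" by (simp add: power_mult_distrib r4 power2_eq_square)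
  also have "\<dots> \<le> 101 / 100 * r ^ 4" by (intro mult_right_mono) (auto simp: power2_eq_square)
  finally show "Q \<le> 101 / 100 * r ^ 4" using 1 by linarith
qed

lemma r4_pos: "0 < r ^ 4" "1 \<le> r ^ 4" "r \<le> r ^ 4"
proof -
  have "1 \<le> r\<^sup>2 * r\<^sup>2" using mult_mono[OF r2(3) r2(3)] by simp
  then show 1: "1 \<le> r ^ 4" by (simp only: r4)
  then show "0 < r ^ 4" by linarith
  have "r \<le> r\<^sup>2 * r\<^sup>2" using mult_mono[OF r2(2) r2(3)] by simp
  then show "r \<le> r ^ 4" by (simp only: r4)
qed

text \<open>Solve \<open>S_eq\<close> for E and use \<open>Q\<close> >= r^4. The factor
  \<open>D\<close> on the left is needed because the available bound for \<open>L\<close> in terms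
  of \<open>S\<close> carries it.\<close>

lemma DE: "D * \<bar>E\<bar> \<le> 2 * S"
proof -
  have "Q * \<bar>E\<bar> = \<bar>S + 2 * r * y\<bar>" using S_eq Q_bounds(1) r4_pos by (simp add: abs_mult)
  also have "\<dots> \<le> S + 2 * r * \<bar>y\<bar>" using Spos r_gt by (simp add: abs_mult abs_triangle_ineq[THEN order_trans])
  finally have 1: "Q * \<bar>E\<bar> \<le> S + 2 * r * \<bar>y\<bar>" .
  have "r ^ 4 * (D * \<bar>E\<bar>) \<le> Q * (D * \<bar>E\<bar>)" using Q_bounds D_pos by (intro mult_right_mono) auto
  also have "\<dots> = D * (Q * \<bar>E\<bar>)" by simp
  also have "\<dots> \<le> D * (S + 2 * r * \<bar>y\<bar>)" using 1 D_pos by (intro mult_left_mono) auto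
  also have "\<dots> = D * S + 2 * r * (D * \<bar>y\<bar>)" by (simp add: algebra_simps)
  also have "\<dots> \<le> r ^ 4 * S + 2 * r ^ 4 * (S / 1000)"
  proof (intro add_mono mult_mono Dy)
    have "r\<^sup>2 \<le> r\<^sup>2 * r\<^sup>2" using mult_left_mono[OF r2(3), of "r\<^sup>2"] by simp
    then show "D \<le> r ^ 4" using D_le unfolding r4 by linarith
  qed (use Spos D_pos r4_pos r_gt in auto)
  also have "\<dots> \<le> r ^ 4 * (2 * S)"
    using mult_pos_pos[OF r4_pos(1) Spos] by (simp add: algebra_simps)
  finally show ?thesis using r4_pos(1) by simp
qed

text \<open>The difference is exactly \<open>D * (y - a\<^sup>2 * s2 * E)\<close>, which the two
  previous estimates make small against \<open>S\<close>. Hence \<open>S\<close> may be replaced by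
  \<open>R * P\<close> everywhere, and \<open>P\<close> has a direct meaning at the horizon.\<close>

lemma S_RP: "\<bar>S - R * P\<bar> \<le> 2 / 1000 * S"
proof -
  have "S - R * P = D * (y - a\<^sup>2 * s2 * E)"
    unfolding S_eq Q_def P_def R_def unfolding D by (simp add: algebra_simps power2_eq_square)
  then have "\<bar>S - R * P\<bar> \<le> D * \<bar>y\<bar> + D * \<bar>a\<^sup>2 * s2 * E\<bar>"
    using D_pos abs_triangle_ineq4[of y "a\<^sup>2 * s2 * E"]
    by (simp only: abs_mult[of D] distrib_left[symmetric] abs_of_pos mult_left_mono less_imp_le)
  moreover have "D * \<bar>a\<^sup>2 * s2 * E\<bar> \<le> S / 1000"
  proof -
    have "a\<^sup>2 * s2 \<le> 1 / 1000000 * 1" using a2 s2 by (intro mult_mono) auto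
    from mult_mono[OF this DE] have "(a\<^sup>2 * s2) * (D * \<bar>E\<bar>) \<le> (1 / 1000000 * 1) * (2 * S)"
      using D_pos by simp
    moreover have eq: "D * \<bar>a\<^sup>2 * s2 * E\<bar> = (a\<^sup>2 * s2) * (D * \<bar>E\<bar>)" using s2 by (simp add: abs_mult)
    ultimately show ?thesis using Spos unfolding eq by linarith
  qed
  ultimately show ?thesis using Dy by linarith
qed

text \<open>In x = \<open>R * E\<close> and y the form is 2x^2 + y^2 with a cross term of size at
  most 2|xy|, because 2r <= \<open>R\<close> is just \<open>D\<close> > 0. So it remains positive
  definite up to the horizon and for every sign of \<open>E\<close>.\<close>

lemma NW_bounds: "(R * E)\<^sup>2 + y\<^sup>2 \<le> 5 * NW" "NW \<le> 4 * ((R * E)\<^sup>2 + y\<^sup>2)"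
proof -
  define x where "x = R * E"
  have R: "0 < R" using R_bounds r2 by linarith
  have "2 * r \<le> R" using D D_pos by (simp add: R_def)
  then have "2 * r * (2 * \<bar>E * y\<bar>) \<le> R * (2 * \<bar>E * y\<bar>)" by (intro mult_right_mono) auto
  then have 1: "\<bar>4 * a * r * E * L\<bar> \<le> 2 * \<bar>x * y\<bar>"
    using R r_gt by (simp add: x_def y_def abs_mult mult_ac)
  have "D * a\<^sup>2 * s2 * E\<^sup>2 = (a\<^sup>2 * s2) * (D * E\<^sup>2)" by simp
  also have "\<dots> \<le> 1 / 1000000 * (R * E\<^sup>2)"
  proof (intro mult_mono)
    have "a\<^sup>2 * s2 \<le> 1 / 1000000 * 1" using a2 s2 by (intro mult_mono) auto
    then show "a\<^sup>2 * s2 \<le> 1 / 1000000" by simp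
  qed (use D_le D_pos s2 in auto)
  also have "\<dots> \<le> 1 / 1000000 * (R * R * E\<^sup>2)"
    using R_bounds r2 by (intro mult_left_mono mult_right_mono) auto
  finally have 2: "D * a\<^sup>2 * s2 * E\<^sup>2 \<le> 1 / 1000000 * x\<^sup>2" by (simp add: x_def power2_eq_square mult_ac)
  have 3: "0 \<le> D * a\<^sup>2 * s2 * E\<^sup>2" using D_pos s2 by simp
  have N: "NW = 2 * x\<^sup>2 - 4 * a * r * E * L + y\<^sup>2 - D * a\<^sup>2 * s2 * E\<^sup>2"
    by (simp add: NW_def x_def y_def power_mult_distrib)
  \<comment> \<open>The weights 25/16 < 2 and 16/25 < 1 leave a definite part of both squares, more
    than 1/5 of each.\<close>
  have "0 \<le> (5 / 4 * \<bar>x\<bar> - 4 / 5 * \<bar>y\<bar>)\<^sup>2" by simp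
  then have 4: "2 * \<bar>x * y\<bar> \<le> 25 / 16 * x\<^sup>2 + 16 / 25 * y\<^sup>2"
    by (simp add: power2_diff power_mult_distrib power2_eq_square abs_mult algebra_simps)
  have 5: "0 \<le> x\<^sup>2" "0 \<le> y\<^sup>2" by auto
  define t where "t = 4 * a * r * E * L"
  define u where "u = D * a\<^sup>2 * s2 * E\<^sup>2"
  note 1 = 1[folded t_def] and 2 = 2[folded u_def] and 3 = 3[folded u_def] and N = N[folded t_def u_def]
  have key1: "t \<le> 2 * m \<Longrightarrow> u \<le> 1 / 1000000 * X \<Longrightarrow> 2 * m \<le> 25 / 16 * X + 16 / 25 * Y \<Longrightarrow> 0 \<le> X \<Longrightarrow> 0 \<le> Y \<Longrightarrow>
      X + Y \<le> 5 * (2 * X - t + Y - u)"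
    and key2: "- t \<le> 2 * m \<Longrightarrow> 0 \<le> u \<Longrightarrow> 2 * m \<le> 25 / 16 * X + 16 / 25 * Y \<Longrightarrow> 0 \<le> X \<Longrightarrow> 0 \<le> Y \<Longrightarrow>
      2 * X - t + Y - u \<le> 4 * (X + Y)" for t u m X Y :: real
    by (simp_all add: field_simps)
  show "(R * E)\<^sup>2 + y\<^sup>2 \<le> 5 * NW" unfolding x_def[symmetric] N using abs_le_D1[OF 1] 2 4 5 by (rule key1)
  show "NW \<le> 4 * ((R * E)\<^sup>2 + y\<^sup>2)" unfolding x_def[symmetric] N using abs_le_D2[OF 1] 3 4 5 by (rule key2)
qed

text \<open>Away from the horizon \<open>D\<close> is comparable to r^2, so \<open>SL\<close> bounds
  \<open>L\<close> by \<open>S\<close> without loss. The dragging term in \<open>S_eq\<close> is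
  then a small fraction of \<open>S\<close>, which forces \<open>E\<close> > 0 and \<open>S\<close>
  close to \<open>Q * E\<close>.\<close>

lemma far_region:
  assumes "5 / 2 \<le> r"
  shows "0 < E" "\<bar>L\<bar> \<le> 3 * r * E" "NW \<le> 6 * S * E" "S * E \<le> 6 * NW"
proof -
  have "5 / 2 * r \<le> r * r" using assms r_gt by (intro mult_right_mono) auto
  then have "5 / 2 * r \<le> r\<^sup>2" by (simp add: power2_eq_square)
  \<comment> \<open>In fact \<open>D\<close> >= r^2 / 5; the smaller constant 4/25 is a perfect
    square, convenient for taking the root.\<close>
  then have "4 / 25 * r\<^sup>2 \<le> D" using D a2 r2 by linarith
  then have "4 / 25 * r\<^sup>2 * (r ^ 4 * L\<^sup>2) \<le> D * (r ^ 4 * L\<^sup>2)" by (intro mult_right_mono) auto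
  moreover have "(2 / 5 * (r ^ 3 * \<bar>L\<bar>))\<^sup>2 = 4 / 25 * r\<^sup>2 * (r ^ 4 * L\<^sup>2)"
    by (simp add: power_mult_distrib power2_eq_square power3_eq_cube power4_eq_xxxx)
  ultimately have "(2 / 5 * (r ^ 3 * \<bar>L\<bar>))\<^sup>2 \<le> S\<^sup>2" using SL by (simp add: mult.assoc)
  then have L: "2 / 5 * (r ^ 3 * \<bar>L\<bar>) \<le> S" by (rule power2_le_imp_le) (use Spos in simp)
  have r3: "r * \<bar>L\<bar> \<le> r ^ 3 * \<bar>L\<bar>"
    using r2 r_gt by (intro mult_right_mono) (auto simp: power3_eq_cube power2_eq_square)
  have "\<bar>a\<bar> * (r * \<bar>L\<bar>) \<le> 1 / 1000 * (5 / 2 * S)"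
    by (rule mult_mono) (use a L r3 r_gt in auto)
  then have ry: "\<bar>2 * r * y\<bar> \<le> S / 100" using r_gt Spos by (simp add: y_def abs_mult mult_ac)
  from abs_le_D1[OF ry] abs_le_D2[OF ry] S_eq
  have QE: "99 / 100 * S \<le> Q * E" "Q * E \<le> 101 / 100 * S" by linarith+
  have Q0: "0 < Q" using Q_bounds r4_pos by linarith
  have "0 < Q * E" using QE Spos by linarith
  then show E: "0 < E" using Q0 by (simp add: zero_less_mult_iff)
  have "2 / 5 * (r ^ 3 * \<bar>L\<bar>) \<le> 100 / 99 * (Q * E)" using L QE by linarith
  also have "\<dots> \<le> 100 / 99 * (101 / 100 * r ^ 4 * E)"
    using Q_bounds E by (intro mult_left_mono mult_right_mono) auto
  finally have "2 / 5 * (r ^ 3 * \<bar>L\<bar>) \<le> 100 / 99 * (101 / 100 * r ^ 4 * E)" .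
  then have "r ^ 3 * \<bar>L\<bar> \<le> 3 * (r ^ 4 * E)" using E r4_pos(1) mult_pos_pos[OF r4_pos(1) E] by linarith
  also have "\<dots> = r ^ 3 * (3 * r * E)" by (simp add: power4_eq_xxxx power3_eq_cube)
  finally show L3: "\<bar>L\<bar> \<le> 3 * r * E" using r_gt by simp
  have "\<bar>a\<bar> * \<bar>L\<bar> \<le> 1 / 1000 * (3 * r * E)" using a L3 by (intro mult_mono) auto
  also have "\<dots> \<le> 3 / 1000 * (R * E)" using R_bounds r2 E by simp
  finally have "\<bar>y\<bar> \<le> 3 / 1000 * (R * E)" by (simp add: y_def abs_mult)
  then have "\<bar>y\<bar>\<^sup>2 \<le> (3 / 1000 * (R * E))\<^sup>2" by (intro power_mono) auto
  then have y2: "y\<^sup>2 \<le> 9 / 1000000 * (R * E)\<^sup>2" by (simp add: power_mult_distrib power2_eq_square)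
  have RE: "(R * E)\<^sup>2 = (R\<^sup>2 * E) * E" by (simp add: power2_eq_square)
  have "R\<^sup>2 \<le> (1001 / 1000 * r\<^sup>2)\<^sup>2" using R_bounds r2 by (intro power_mono) auto
  also have "\<dots> = (1001 / 1000)\<^sup>2 * r ^ 4" by (simp add: power_mult_distrib r4 power2_eq_square)
  also have "\<dots> \<le> 101 / 100 * Q" using Q_bounds(1) r4_pos by (simp add: power2_eq_square)
  finally have "R\<^sup>2 * E \<le> 101 / 100 * Q * E" using E by (intro mult_right_mono) auto
  then have "R\<^sup>2 * E \<le> 11 / 10 * S" using QE Spos by linarith
  then have "(R * E)\<^sup>2 \<le> 11 / 10 * S * E" unfolding RE using E by (intro mult_right_mono) auto
  then show "NW \<le> 6 * S * E" using NW_bounds(2) y2 mult_pos_pos[OF Spos E] by simp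
  have "Q * E \<le> R\<^sup>2 * E" using Q_bounds E by (intro mult_right_mono) auto
  then have "S \<le> 11 / 10 * (R\<^sup>2 * E)" using QE Spos by linarith
  then have "S * E \<le> 11 / 10 * (R\<^sup>2 * E) * E" using E by (intro mult_right_mono) auto
  then have "S * E \<le> 11 / 10 * (R * E)\<^sup>2" unfolding RE by (simp only: mult.assoc)
  with NW_bounds(1) zero_le_power2[of y] zero_le_power2[of "R * E"]
  show "S * E \<le> 6 * NW" by linarith
qed

text \<open>For \<open>E\<close> <= 0 positivity of \<open>S\<close> forces \<open>- E\<close> to be
  smaller than the dragging term. So either the energy dominates y, or it is bounded by y, and both
  regimes can be estimated separately.\<close>

lemma dichotomy: "(0 < E \<and> \<bar>y\<bar> \<le> E / 2) \<or> \<bar>E\<bar> \<le> 2 * \<bar>y\<bar>"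
proof (cases "0 < E")
  case False
  have Q0: "r ^ 4 \<le> Q" by (rule Q_bounds)
  have "Q * (- E) < - (2 * r * y)" using Spos S_eq by simp
  also have "\<dots> \<le> 2 * r * \<bar>y\<bar>" using r_gt mult_left_mono[of "- y" "\<bar>y\<bar>" "2 * r"] by simp
  also have "\<dots> \<le> r ^ 4 * (2 * \<bar>y\<bar>)" using mult_right_mono[OF r4_pos(3), of "2 * \<bar>y\<bar>"] by simp
  also have "\<dots> \<le> Q * (2 * \<bar>y\<bar>)" using Q0 by (intro mult_right_mono) auto
  finally have "Q * (- E) < Q * (2 * \<bar>y\<bar>)" .
  moreover have "0 < Q" using Q0 r4_pos by linarith
  ultimately have "- E < 2 * \<bar>y\<bar>" by (simp only: mult_less_cancel_left_pos)
  then show ?thesis using False by auto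
qed auto

lemma P_pos: "0 < P" "S \<le> 101 / 100 * (R * P)" "R * P \<le> 101 / 100 * S"
proof -
  from abs_le_D1[OF S_RP] abs_le_D2[OF S_RP] Spos
  show 1: "S \<le> 101 / 100 * (R * P)" "R * P \<le> 101 / 100 * S" by linarith+
  then have "0 < R * P" using Spos by linarith
  moreover have "0 < R" using R_bounds r2 by linarith
  ultimately show "0 < P" by (simp add: zero_less_mult_iff)
qed

text \<open>\<open>\<delta>\<close> is \<open>P\<close> with r replaced by \<open>rp\<close>, since
  rp^2 + a^2 = 2 rp there. The factor r - rp of the difference is at most \<open>D\<close>, because
  the other root of Delta is at distance at least 1.\<close>

lemma P_\<delta>:
  assumes "r < 3"
  shows "\<bar>P - \<delta>\<bar> \<le> 6 * (D * \<bar>E\<bar>)"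
proof -
  have "P - \<delta> = (r - rp) * ((r + rp) * E) + (rp\<^sup>2 - 2 * rp + a\<^sup>2) * E"
    by (simp add: P_def \<delta>_def R_def algebra_simps power2_eq_square)
  then have 1: "P - \<delta> = (r - rp) * ((r + rp) * E)" using rp_root by simp
  have "r - rp \<le> D"
    using mult_left_mono[of 1 "r - (2 - rp)" "r - rp"] r rp unfolding D_factor by simp
  then have "(r - rp) * ((r + rp) * \<bar>E\<bar>) \<le> D * (6 * \<bar>E\<bar>)"
    by (rule mult_mono) (use assms r rp D_pos in \<open>auto intro!: mult_right_mono\<close>)
  then show ?thesis unfolding 1 using r rp by (simp add: abs_mult)
qed

text \<open>Up to the factor 2 rp, \<open>\<delta>\<close> is -g(v, K) for the Killing field K = d_t
  + (a / (2 rp)) d_phi, which generates the horizon. In the regime of small energy \<open>P\<close>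
  and \<open>\<delta>\<close> differ by a small fraction of \<open>P\<close>, so positivity of
  \<open>P\<close> carries over.\<close>

lemma \<delta>_pos:
  assumes "r < 3"
  shows "0 < \<delta>"
proof -
  consider "0 < E" "\<bar>y\<bar> \<le> E / 2" | "\<bar>E\<bar> \<le> 2 * \<bar>y\<bar>" using dichotomy by blast
  then show ?thesis
  proof cases
    case 1
    have "3 * E \<le> 2 * rp * E" using rp 1 by (intro mult_right_mono) auto
    then show ?thesis using 1 abs_ge_self[of y] unfolding \<delta>_def by linarith
  next
    case 2
    have "D * \<bar>E\<bar> \<le> D * (2 * \<bar>y\<bar>)" using 2 D_pos by (intro mult_left_mono) auto
    then have 3: "\<bar>P - \<delta>\<bar> \<le> 12 / 1000 * S" using P_\<delta>[OF assms] Dy by simp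
    have "r\<^sup>2 \<le> 3\<^sup>2" using assms r_gt by (intro power_mono) auto
    then have "R \<le> 10" using R_bounds by simp
    then have "R * P \<le> 10 * P" using P_pos by (intro mult_right_mono) auto
    then show ?thesis using 3 P_pos by linarith
  qed
qed

text \<open>By \<open>S_RP\<close> the quotient \<open>NW / S\<close> behaves like ((R E)^2 + y^2) /
  P. If the energy dominates, this is of size \<open>E\<close>; otherwise \<open>P\<close> is close
  to \<open>\<delta>\<close> and it is of size y^2 / \<open>\<delta>\<close>. \<open>J3\<close>
  reproduces both behaviours using conserved quantities only.\<close>

lemma near_region:
  assumes r3: "r < 3"
  shows "NW \<le> 30 * S * J3" "S * J3 \<le> 15000 * NW" "0 < J3"
proof -
  have d: "0 < \<delta>" by (rule \<delta>_pos[OF r3])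
  have "r\<^sup>2 \<le> 3\<^sup>2" using r3 r_gt by (intro power_mono) auto
  then have R: "9 / 4 \<le> R" "R \<le> 10" using R_bounds r2 by auto
  define k where "k = max 0 (\<bar>L\<bar> / 40 - E)"
  have k0: "0 \<le> k" by (simp add: k_def)
  have y2: "y\<^sup>2 = a\<^sup>2 * L\<^sup>2" by (simp add: y_def power_mult_distrib)
  consider "0 < E" "\<bar>y\<bar> \<le> E / 2" | "\<bar>E\<bar> \<le> 2 * \<bar>y\<bar>" using dichotomy by blast
  then have "NW \<le> 30 * S * J3 \<and> S * J3 \<le> 15000 * NW \<and> 0 < J3"
  proof cases
    case 1
    have "\<bar>y\<bar>\<^sup>2 \<le> (E / 2)\<^sup>2" using 1 by (intro power_mono) auto
    then have yE: "y\<^sup>2 \<le> E\<^sup>2 / 4" by (simp add: power_divide)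
    have RE: "9 / 4 * E \<le> R * E" "R * E \<le> 10 * E" using R 1 by (auto intro: mult_right_mono)
    then have P: "7 / 4 * E \<le> P" "P \<le> 21 / 2 * E" using 1 abs_ge_self[of y] abs_ge_minus_self[of y] unfolding P_def by linarith+
    have "3 * E \<le> 2 * rp * E" using rp 1 by (intro mult_right_mono) auto
    then have dE: "5 / 2 * E \<le> \<delta>" using 1 abs_ge_self[of y] unfolding \<delta>_def by linarith
    have "R * (7 / 4 * E) \<le> R * P" "R * P \<le> R * (21 / 2 * E)" using P R by (auto intro!: mult_left_mono)
    then have "7 / 4 * (R * E) \<le> R * P" "R * P \<le> 21 / 2 * (R * E)" by simp_all
    moreover have "0 \<le> R * E" using R 1 by simp
    ultimately have S1: "17 / 10 * (R * E) \<le> S" "S \<le> 11 * (R * E)" using P_pos by linarith+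
    have "k \<le> \<bar>L\<bar> / 40" using 1 unfolding k_def by (intro max.boundedI) auto
    then have "k\<^sup>2 \<le> (\<bar>L\<bar> / 40)\<^sup>2" using k0 by (intro power_mono) auto
    then have "a\<^sup>2 * k\<^sup>2 \<le> a\<^sup>2 * (L\<^sup>2 / 1600)" by (intro mult_left_mono) (auto simp: power_divide)
    \<comment> \<open>230400 / 1600 = 144, and y^2 <= E^2 / 4 turns it into 36. As
      \<open>\<delta>\<close> >= 5/2 E, the correction is at most 15 E.\<close>
    then have "230400 * a\<^sup>2 * k\<^sup>2 \<le> 36 * E\<^sup>2" using yE y2 by simp
    also have "\<dots> = 36 * E * E" by (simp add: power2_eq_square)
    also have "\<dots> \<le> 15 * E * \<delta>" using mult_left_mono[OF dE, of "15 * E"] 1 by simp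
    finally have J: "J3 \<le> 16 * E" "E \<le> J3" "0 < J3"
      using d 1 unfolding J3_def k_def[symmetric] by (auto simp: pos_divide_le_eq add_pos_nonneg)
    have SE: "S * E \<le> 11 * ((R * E) * E)" "17 / 10 * ((R * E) * E) \<le> S * E"
      using S1 mult_right_mono[OF S1(1), of E] mult_right_mono[OF S1(2), of E] 1 by (simp_all add: mult.assoc)
    have REE: "9 / 4 * ((R * E) * E) \<le> (R * E)\<^sup>2" "(R * E)\<^sup>2 \<le> 10 * ((R * E) * E)" "9 / 4 * E\<^sup>2 \<le> (R * E) * E" "0 \<le> E\<^sup>2"
      using RE R 1 mult_left_mono[OF RE(1), of "R * E"] mult_left_mono[OF RE(2), of "R * E"] mult_right_mono[OF RE(1), of E]
      by (simp_all add: power2_eq_square mult_ac)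
    have SJ: "S * E \<le> S * J3" "S * J3 \<le> 16 * (S * E)" using J Spos mult_left_mono[of J3 "16 * E" S] by auto
    have "NW \<le> 4 * ((R * E)\<^sup>2 + y\<^sup>2)" "(R * E)\<^sup>2 + y\<^sup>2 \<le> 5 * NW" by (rule NW_bounds)+
    moreover have "N \<le> 30 * J \<and> J \<le> 15000 * N"
      if "N \<le> 4 * (W + Y)" "W + Y \<le> 5 * N" "T \<le> J" "J \<le> 16 * T" "T \<le> 11 * X" "17 / 10 * X \<le> T"
        "9 / 4 * X \<le> W" "W \<le> 10 * X" "9 / 4 * F \<le> X" "0 \<le> F" "Y \<le> F / 4" "0 \<le> Y"
      for N J W Y T X F :: real
      using that by auto
    ultimately have "NW \<le> 30 * (S * J3)" "S * J3 \<le> 15000 * NW"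
      using SJ SE REE yE zero_le_power2[of y] by blast+
    then show ?thesis using J by (simp add: mult.assoc)
  next
    case 2
    have "D * \<bar>E\<bar> \<le> D * (2 * \<bar>y\<bar>)" using 2 D_pos by (intro mult_left_mono) auto
    then have 3: "\<bar>P - \<delta>\<bar> \<le> 12 / 1000 * S" using P_\<delta>[OF r3] Dy by simp
    have "R * P \<le> 10 * P" "9 / 4 * P \<le> R * P" using P_pos R by (auto intro!: mult_right_mono)
    then have S1: "S \<le> 12 * \<delta>" "3 / 2 * \<delta> \<le> S" 
      using abs_le_D1[OF 3] abs_le_D2[OF 3] P_pos by linarith+
    have y0: "y \<noteq> 0"
    proof
      assume "y = 0"
      then have "E = 0" using 2 by simp
      then show False using Spos S_eq \<open>y = 0\<close> by simp
    qed
    have "(R * E)\<^sup>2 \<le> (10 * (2 * \<bar>y\<bar>))\<^sup>2"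
      unfolding power2_abs[of "R * E", symmetric] abs_mult using R 2 by (intro power_mono mult_mono) auto
    then have x2: "(R * E)\<^sup>2 \<le> 400 * y\<^sup>2" by (simp add: power_mult_distrib)
    have aL: "\<bar>y\<bar> \<le> \<bar>L\<bar> / 1000" using mult_right_mono[OF a, of "\<bar>L\<bar>"] by (simp add: y_def abs_mult)
    \<comment> \<open>Here |E| <= |L| / 500 perturbs |L| / 40 only slightly. The numerator of the
      correction is therefore between 92 y^2 and 189 y^2, and outweighs |E| \<open>\<delta>\<close>
      <= 18 y^2 even for negative \<open>E\<close>.\<close>
    have "\<bar>L\<bar> / 50 \<le> k" "k \<le> \<bar>L\<bar> / 35" using aL 2 abs_ge_self[of E] abs_ge_minus_self[of E] unfolding k_def by linarith+
    then have "(\<bar>L\<bar> / 50)\<^sup>2 \<le> k\<^sup>2" "k\<^sup>2 \<le> (\<bar>L\<bar> / 35)\<^sup>2" using k0 by (auto intro!: power_mono)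
    from mult_left_mono[OF this(1), of "a\<^sup>2"] mult_left_mono[OF this(2), of "a\<^sup>2"]
    have "a\<^sup>2 * (L\<^sup>2 / 2500) \<le> a\<^sup>2 * k\<^sup>2" "a\<^sup>2 * k\<^sup>2 \<le> a\<^sup>2 * (L\<^sup>2 / 1225)"
      by (simp_all add: power_divide)
    then have T: "92 * y\<^sup>2 \<le> 230400 * a\<^sup>2 * k\<^sup>2" "230400 * a\<^sup>2 * k\<^sup>2 \<le> 189 * y\<^sup>2"
      using zero_le_power2[of y] unfolding y2 by linarith+
    have "\<bar>2 * rp * E\<bar> \<le> 4 * (2 * \<bar>y\<bar>)" using 2 rp unfolding abs_mult by (intro mult_mono) auto
    then have dy: "\<delta> \<le> 9 * \<bar>y\<bar>" using abs_ge_self[of "2 * rp * E"] abs_ge_minus_self[of y] unfolding \<delta>_def by linarith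
    have "\<bar>E\<bar> * \<delta> \<le> (2 * \<bar>y\<bar>) * (9 * \<bar>y\<bar>)" using 2 dy d by (intro mult_mono) auto
    then have Ed: "\<bar>E\<bar> * \<delta> \<le> 18 * y\<^sup>2" by (simp add: power2_eq_square)
    have E2: "E * \<delta> \<le> 18 * y\<^sup>2" "- (18 * y\<^sup>2) \<le> E * \<delta>"
      using Ed d by (simp_all add: abs_le_iff abs_mult[of E \<delta>, simplified, symmetric] abs_mult_pos)
    have JD: "J3 * \<delta> = E * \<delta> + 230400 * a\<^sup>2 * k\<^sup>2" using d by (simp add: J3_def k_def field_simps)
    have J: "74 * y\<^sup>2 \<le> J3 * \<delta>" "J3 * \<delta> \<le> 207 * y\<^sup>2" using JD T E2 by linarith+
    have "0 < y\<^sup>2" using y0 by simp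
    then have "0 < J3 * \<delta>" using J by linarith
    then have Jp: "0 < J3" using d by (simp add: zero_less_mult_iff)
    have SJ: "S * J3 \<le> 12 * (J3 * \<delta>)" "3 / 2 * (J3 * \<delta>) \<le> S * J3"
      using mult_right_mono[OF S1(1), of J3] mult_right_mono[OF S1(2), of J3] Jp by (simp_all add: mult_ac)
    have "NW \<le> 4 * ((R * E)\<^sup>2 + y\<^sup>2)" "(R * E)\<^sup>2 + y\<^sup>2 \<le> 5 * NW" by (rule NW_bounds)+
    moreover have "N \<le> 30 * T \<and> T \<le> 15000 * N"
      if "N \<le> 4 * (W + Y)" "W + Y \<le> 5 * N" "T \<le> 12 * J" "3 / 2 * J \<le> T" "74 * Y \<le> J" "J \<le> 207 * Y"
        "W \<le> 400 * Y" "0 \<le> W"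
      for N J W Y T :: real
      using that by auto
    ultimately have "NW \<le> 30 * (S * J3)" "S * J3 \<le> 15000 * NW"
      using SJ J x2 zero_le_power2[of "R * E"] by blast+
    then show ?thesis using Jp by (simp add: mult.assoc)
  qed
  then show "NW \<le> 30 * S * J3" "S * J3 \<le> 15000 * NW" "0 < J3" by blast+
qed

end

context kerr_bl begin

section \<open>Null vectors in lowered components\<close>

text \<open>The components of \<open>v\<close> along the Carter tetrad, which diagonalises the metric.\<close>

abbreviation "frame_t r \<theta> c \<equiv> c $ 1 - a * (sin \<theta>)\<^sup>2 * c $ 4"
abbreviation "frame_\<phi> r c \<equiv> (r\<^sup>2 + a\<^sup>2) * c $ 4 - a * c $ 1"

lemma metric_carter:
  fixes q c d :: "real^4"
  assumes "rp < q $ 2"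
  shows "kerr_metric M a (bl_point q) (bl_vec q c) (bl_vec q d) =
    (- De (q $ 2) * frame_t (q $ 2) (q $ 3) c * frame_t (q $ 2) (q $ 3) d + (sin (q $ 3))\<^sup>2 * frame_\<phi> (q $ 2) c * frame_\<phi> (q $ 2) d) / Sg (q $ 2) (q $ 3)
    + Sg (q $ 2) (q $ 3) / De (q $ 2) * (c $ 2 * d $ 2) + Sg (q $ 2) (q $ 3) * (c $ 3 * d $ 3)"
proof -
  define r \<theta> where "r = q $ 2" and "\<theta> = q $ 3"
  have r: "0 < r" and S: "Sg r \<theta> \<noteq> 0" using ext_pos(2)[of r] Sigma_pos[of r \<theta>] assms by (auto simp: r_def)
  define s2 where "s2 = (sin \<theta>)\<^sup>2"
  have c2: "(cos \<theta>)\<^sup>2 = 1 - s2" by (simp add: s2_def cos_squared_eq)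
  have Sg: "Sg r \<theta> = r\<^sup>2 + a\<^sup>2 - a\<^sup>2 * s2" by (simp add: kerr_Sigma_def c2 algebra_simps)
  have 1: "- (1 - 2 * M * r / Sg r \<theta>) = (- De r + a\<^sup>2 * s2) / Sg r \<theta>"
    using S unfolding kerr_Delta_def by (simp add: field_simps) (simp add: Sg algebra_simps)
  have 2: "- (2 * M * a * r * s2 / Sg r \<theta>) = (De r * a * s2 - s2 * (r\<^sup>2 + a\<^sup>2) * a) / Sg r \<theta>"
    using S unfolding kerr_Delta_def by (simp add: field_simps power2_eq_square)
  have 3: "PI r \<theta> * s2 / Sg r \<theta> = (- De r * (a * s2)\<^sup>2 + s2 * (r\<^sup>2 + a\<^sup>2)\<^sup>2) / Sg r \<theta>"
    using S unfolding kerr_Pi_def c2 by (simp add: field_simps power2_eq_square)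
  have "kerr_metric M a (bl_point q) (bl_vec q c) (bl_vec q d) =
    (- (1 - 2 * M * r / Sg r \<theta>)) * (c $ 1 * d $ 1) + (- (2 * M * a * r * s2 / Sg r \<theta>)) * (c $ 1 * d $ 4 + c $ 4 * d $ 1)
    + (PI r \<theta> * s2 / Sg r \<theta>) * (c $ 4 * d $ 4) + Sg r \<theta> / De r * (c $ 2 * d $ 2) + Sg r \<theta> * (c $ 3 * d $ 3)"
    using kerr_metric_boyer_lindquist[of q M a c d] r by (simp add: r_def \<theta>_def s2_def)
  also have "\<dots> = (- De r * frame_t r \<theta> c * frame_t r \<theta> d + s2 * frame_\<phi> r c * frame_\<phi> r d) / Sg r \<theta>
    + Sg r \<theta> / De r * (c $ 2 * d $ 2) + Sg r \<theta> * (c $ 3 * d $ 3)"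
    unfolding 1 2 3 unfolding s2_def[symmetric] by (simp add: add_divide_distrib diff_divide_distrib algebra_simps power2_eq_square)
  finally show ?thesis unfolding r_def \<theta>_def s2_def .
qed

text \<open>Components (v^t, v^r, v^theta, v^phi) of the vector obtained by raising the covector
  (-\<open>ham L z\<close>, p, b, L).\<close>

definition bl_comp :: "real \<Rightarrow> real \<times> real \<times> real \<times> real \<Rightarrow> real^4" where
  "bl_comp L z = vector [ham_root L z / (De (zr z) * Sg (zr z) (z\<theta> z)), De (zr z) * zp z / Sg (zr z) (z\<theta> z), zb z / Sg (zr z) (z\<theta> z),
    (a * (((zr z)\<^sup>2 + a\<^sup>2) * ham L z - a * L) / De (zr z) + L / (sin (z\<theta> z))\<^sup>2 - a * ham L z) / Sg (zr z) (z\<theta> z)]"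

lemma Sigma_s: "Sg r \<theta> = r\<^sup>2 + a\<^sup>2 - a\<^sup>2 * (sin \<theta>)\<^sup>2"
  by (simp add: kerr_Sigma_def cos_squared_eq algebra_simps)

lemma frame_t_bl_comp:
  assumes z: "(r, \<theta>, p, b) \<in> phase_dom"
  shows "frame_t r \<theta> (bl_comp L (r, \<theta>, p, b)) = ((r\<^sup>2 + a\<^sup>2) * ham L (r, \<theta>, p, b) - a * L) / De r"
    "frame_\<phi> r (bl_comp L (r, \<theta>, p, b)) = L / (sin \<theta>)\<^sup>2 - a * ham L (r, \<theta>, p, b)"
proof -
  have r: "rp < r" using z by (simp add: phase_dom_iff)
  have pos: "De r \<noteq> 0" "sin \<theta> \<noteq> 0" "Sg r \<theta> \<noteq> 0" using phase_dom_simps[OF z] by auto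
  define E where "E = ham L (r, \<theta>, p, b)"
  define \<tau> where "\<tau> = ((r\<^sup>2 + a\<^sup>2) * E - a * L) / De r"
  define \<sigma> where "\<sigma> = L / (sin \<theta>)\<^sup>2 - a * E"
  have 4: "bl_comp L (r, \<theta>, p, b) $ 4 = (a * \<tau> + \<sigma>) / Sg r \<theta>"
    by (simp add: bl_comp_def \<tau>_def \<sigma>_def E_def)
  have "ham_root L (r, \<theta>, p, b) = De r * ((r\<^sup>2 + a\<^sup>2) * \<tau> + a * (sin \<theta>)\<^sup>2 * \<sigma>)"
    using pos unfolding ham_root_P[OF r] \<tau>_def \<sigma>_def E_def by (simp add: field_simps power2_eq_square)
  then have 1: "bl_comp L (r, \<theta>, p, b) $ 1 = ((r\<^sup>2 + a\<^sup>2) * \<tau> + a * (sin \<theta>)\<^sup>2 * \<sigma>) / Sg r \<theta>"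
    using pos by (simp add: bl_comp_def)
  have "frame_t r \<theta> (bl_comp L (r, \<theta>, p, b)) = Sg r \<theta> * \<tau> / Sg r \<theta>"
    unfolding 1 4 by (simp add: Sigma_s[of r \<theta>] add_divide_distrib[symmetric] diff_divide_distrib[symmetric] algebra_simps power2_eq_square)
  then show "frame_t r \<theta> (bl_comp L (r, \<theta>, p, b)) = ((r\<^sup>2 + a\<^sup>2) * ham L (r, \<theta>, p, b) - a * L) / De r"
    using pos by (simp add: \<tau>_def E_def)
  have "frame_\<phi> r (bl_comp L (r, \<theta>, p, b)) = Sg r \<theta> * \<sigma> / Sg r \<theta>"
    unfolding 1 4 by (simp add: Sigma_s[of r \<theta>] add_divide_distrib[symmetric] diff_divide_distrib[symmetric] algebra_simps power2_eq_square)
  then show "frame_\<phi> r (bl_comp L (r, \<theta>, p, b)) = L / (sin \<theta>)\<^sup>2 - a * ham L (r, \<theta>, p, b)"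
    using pos by (simp add: \<sigma>_def E_def)
qed

text \<open>Confirms that lowering undoes \<open>bl_comp\<close>; evaluated against the coordinate
  vectors, the tetrad components of \<open>frame_t_bl_comp\<close> recombine through Sigma = r^2 +
  a^2 - a^2 sin^2 theta.\<close>

lemma bl_comp_lower:
  fixes q :: "real^4" and L :: real
  assumes z: "(q $ 2, q $ 3, p, b) \<in> phase_dom"
  defines "c \<equiv> bl_comp L (q $ 2, q $ 3, p, b)"
  shows "bl_lower M a q c 1 = - ham L (q $ 2, q $ 3, p, b)" "bl_lower M a q c 2 = p"
    "bl_lower M a q c 3 = b" "bl_lower M a q c 4 = L"
proof -
  define r \<theta> where "r = q $ 2" and "\<theta> = q $ 3"
  note z = z[folded r_def \<theta>_def] 
  have r: "rp < r" using z by (simp add: phase_dom_iff)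
  have pos: "De r \<noteq> 0" "sin \<theta> \<noteq> 0" "Sg r \<theta> \<noteq> 0" using phase_dom_simps[OF z] by auto
  note car = metric_carter[of q, folded r_def \<theta>_def, OF r]
  note c = frame_t_bl_comp[OF z, of L, folded c_def[folded r_def \<theta>_def]]
  let ?E = "ham L (r, \<theta>, p, b)"
  have 2: "c $ 2 = De r * p / Sg r \<theta>" "c $ 3 = b / Sg r \<theta>" by (auto simp: c_def bl_comp_def r_def \<theta>_def)
  show "bl_lower M a q c 1 = - ham L (q $ 2, q $ 3, p, b)"
    unfolding bl_lower_def car c unfolding r_def[symmetric] \<theta>_def[symmetric]
    using pos by (simp add: axis_def field_simps power2_eq_square) (simp add: Sigma_s power2_eq_square algebra_simps)
  show "bl_lower M a q c 2 = p" "bl_lower M a q c 3 = b"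
    unfolding bl_lower_def car c 2 using pos by (simp_all add: axis_def)
  show "bl_lower M a q c 4 = L"
    unfolding bl_lower_def car c unfolding r_def[symmetric] \<theta>_def[symmetric]
    using pos by (simp add: axis_def field_simps power2_eq_square) (simp add: Sigma_s power2_eq_square algebra_simps)
qed

lemma lower_inverse:
  fixes q c :: "real^4"
  assumes z: "(q $ 2, q $ 3, p, b) \<in> phase_dom"
  shows "De (q $ 2) * Sg (q $ 2) (q $ 3) * c $ 1 = - PI (q $ 2) (q $ 3) * bl_lower M a q c 1 - 2 * M * a * q $ 2 * bl_lower M a q c 4"
    "De (q $ 2) * frame_t (q $ 2) (q $ 3) c = - ((q $ 2)\<^sup>2 + a\<^sup>2) * bl_lower M a q c 1 - a * bl_lower M a q c 4"
    "(sin (q $ 3))\<^sup>2 * frame_\<phi> (q $ 2) c = bl_lower M a q c 4 + a * (sin (q $ 3))\<^sup>2 * bl_lower M a q c 1"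
    "c $ 2 = De (q $ 2) * bl_lower M a q c 2 / Sg (q $ 2) (q $ 3)" "c $ 3 = bl_lower M a q c 3 / Sg (q $ 2) (q $ 3)"
proof -
  define r \<theta> where "r = q $ 2" and "\<theta> = q $ 3"
  note z = z[folded r_def \<theta>_def] 
  have r: "rp < r" using z by (simp add: phase_dom_iff)
  have pos: "De r \<noteq> 0" "sin \<theta> \<noteq> 0" "Sg r \<theta> \<noteq> 0" using phase_dom_simps[OF z] by auto
  note car = metric_carter[of q, folded r_def \<theta>_def, OF r]
  have l1: "Sg r \<theta> * bl_lower M a q c 1 = - De r * frame_t r \<theta> c - a * (sin \<theta>)\<^sup>2 * frame_\<phi> r c"
    unfolding bl_lower_def car using pos by (simp add: axis_def)
  have l4: "Sg r \<theta> * bl_lower M a q c 4 = De r * frame_t r \<theta> c * (a * (sin \<theta>)\<^sup>2) + (sin \<theta>)\<^sup>2 * frame_\<phi> r c * (r\<^sup>2 + a\<^sup>2)"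
    unfolding bl_lower_def car using pos by (simp add: axis_def)
  show "c $ 2 = De (q $ 2) * bl_lower M a q c 2 / Sg (q $ 2) (q $ 3)" "c $ 3 = bl_lower M a q c 3 / Sg (q $ 2) (q $ 3)"
    unfolding bl_lower_def car unfolding r_def[symmetric] \<theta>_def[symmetric] using pos by (simp_all add: axis_def)
  have "Sg r \<theta> * (De r * frame_t r \<theta> c) = Sg r \<theta> * (- (r\<^sup>2 + a\<^sup>2) * bl_lower M a q c 1 - a * bl_lower M a q c 4)"
    using l1 l4 unfolding Sigma_s by algebra
  then show 1: "De (q $ 2) * frame_t (q $ 2) (q $ 3) c = - ((q $ 2)\<^sup>2 + a\<^sup>2) * bl_lower M a q c 1 - a * bl_lower M a q c 4"
    using pos by (simp add: r_def \<theta>_def)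
  have "Sg r \<theta> * ((sin \<theta>)\<^sup>2 * frame_\<phi> r c) = Sg r \<theta> * (bl_lower M a q c 4 + a * (sin \<theta>)\<^sup>2 * bl_lower M a q c 1)"
    using l1 l4 unfolding Sigma_s by algebra
  then show 2: "(sin (q $ 3))\<^sup>2 * frame_\<phi> (q $ 2) c = bl_lower M a q c 4 + a * (sin (q $ 3))\<^sup>2 * bl_lower M a q c 1"
    using pos by (simp add: r_def \<theta>_def)
  have "De r * Sg r \<theta> * c $ 1 = (r\<^sup>2 + a\<^sup>2) * (De r * frame_t r \<theta> c) + a * De r * ((sin \<theta>)\<^sup>2 * frame_\<phi> r c)"
    unfolding Sigma_s by (simp add: algebra_simps power2_eq_square)
  also have "\<dots> = (r\<^sup>2 + a\<^sup>2) * (- (r\<^sup>2 + a\<^sup>2) * bl_lower M a q c 1 - a * bl_lower M a q c 4)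
      + a * De r * (bl_lower M a q c 4 + a * (sin \<theta>)\<^sup>2 * bl_lower M a q c 1)"
    using 1 2 by (simp only: r_def \<theta>_def)
  also have "\<dots> = - PI r \<theta> * bl_lower M a q c 1 - 2 * M * a * r * bl_lower M a q c 4"
    unfolding kerr_Pi_def cos_squared_eq kerr_Delta_def by (simp add: algebra_simps power2_eq_square)
  finally show "De (q $ 2) * Sg (q $ 2) (q $ 3) * c $ 1 = - PI (q $ 2) (q $ 3) * bl_lower M a q c 1 - 2 * M * a * q $ 2 * bl_lower M a q c 4"
    by (simp only: r_def \<theta>_def)
qed

lemma metric_self_lower:
  fixes q c :: "real^4"
  assumes z: "(q $ 2, q $ 3, p, b) \<in> phase_dom"
  shows "Sg (q $ 2) (q $ 3) * kerr_metric M a (bl_point q) (bl_vec q c) (bl_vec q c)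
    = null_form (bl_lower M a q c 4) (q $ 2) (q $ 3) (bl_lower M a q c 2) (bl_lower M a q c 3) (- bl_lower M a q c 1)"
proof -
  define r \<theta> where "r = q $ 2" and "\<theta> = q $ 3"
  have r: "rp < r" using z by (simp add: phase_dom_iff r_def)
  have pos: "De r \<noteq> 0" "sin \<theta> \<noteq> 0" "Sg r \<theta> \<noteq> 0" using phase_dom_simps[OF z] by (auto simp: r_def \<theta>_def)
  note inv = lower_inverse[OF z, of c, folded r_def \<theta>_def]
  note car = metric_carter[of q, folded r_def \<theta>_def, OF r]
  let ?E = "- bl_lower M a q c 1" and ?L = "bl_lower M a q c 4"
  have 1: "frame_t r \<theta> c = ((r\<^sup>2 + a\<^sup>2) * ?E - a * ?L) / De r" using inv(2) pos by (simp add: field_simps)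
  have 2: "frame_\<phi> r c = (?L - a * (sin \<theta>)\<^sup>2 * ?E) / (sin \<theta>)\<^sup>2" using inv(3) pos by (simp add: field_simps)
  have A: "De r * (X / De r) * (X / De r) = X\<^sup>2 / De r" for X using pos by (simp add: power2_eq_square)
  have B: "(sin \<theta>)\<^sup>2 * ((?L - a * (sin \<theta>)\<^sup>2 * ?E) / (sin \<theta>)\<^sup>2) * ((?L - a * (sin \<theta>)\<^sup>2 * ?E) / (sin \<theta>)\<^sup>2)
     = ?L\<^sup>2 / (sin \<theta>)\<^sup>2 + a\<^sup>2 * (sin \<theta>)\<^sup>2 * ?E\<^sup>2 - 2 * a * ?E * ?L"
    using pos by (simp add: field_simps power2_eq_square)
  have "Sg r \<theta> * (Sg r \<theta> / De r * (c $ 2 * c $ 2)) = De r * (bl_lower M a q c 2)\<^sup>2"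
    "Sg r \<theta> * (Sg r \<theta> * (c $ 3 * c $ 3)) = (bl_lower M a q c 3)\<^sup>2"
    unfolding inv(4,5) using pos by (simp_all add: power2_eq_square)
  then show ?thesis
    unfolding r_def[symmetric] \<theta>_def[symmetric] car 1 2 distrib_left null_form_def mult_minus_left A B
    using pos by simp
qed

lemma bl_exterior: "rp < q $ 2 \<Longrightarrow> bl_point q \<in> kerr_exterior M a"
  using rad_bl[of q] ext_pos(2)[of "q $ 2"] by (simp add: kerr_exterior_def)

lemma T_perp_bl:
  fixes q :: "real^4"
  assumes "rp < q $ 2"
  shows "T_perp M a (bl_point q) = bl_vec q (vector [1, 0, 0, 2 * M * a * q $ 2 / PI (q $ 2) (q $ 3)])"
proof -
  have r: "0 < q $ 2" using ext_pos(2)[OF assms] .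
  have "cos_polar (bl_point q) = cos (q $ 3)"
    using r by (simp add: cos_polar_def rad_bl) (simp add: bl_point_def)
  moreover have "rad (bl_point q) = q $ 2" using r by (rule rad_bl)
  ultimately show ?thesis
    unfolding T_perp_def by (simp only:)
      (simp add: bl_vec_eq d_phi_def bl_point_def vec_eq_iff forall_4 axis_def)
qed

lemma bl_vec_linear: "linear (bl_vec q)"
  by (rule linearI) (simp_all add: bl_vec_eq vec_eq_iff forall_4 algebra_simps)

text \<open>\<open>T_perp\<close> is normal to the surfaces of constant t, so its product with v
  sees only v^t. Time orientation thus becomes the sign of v^t, as used in
  \<open>cone_iff\<close>.\<close>

lemma metric_T_perp:
  fixes q c :: "real^4"
  assumes z: "(q $ 2, q $ 3, p, b) \<in> phase_dom"
  shows "PI (q $ 2) (q $ 3) * kerr_metric M a (bl_point q) (bl_vec q c) (T_perp M a (bl_point q)) = - (De (q $ 2) * Sg (q $ 2) (q $ 3) * c $ 1)"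
proof -
  define r \<theta> where "r = q $ 2" and "\<theta> = q $ 3"
  have r: "rp < r" using z by (simp add: phase_dom_iff r_def)
  have pos: "PI r \<theta> \<noteq> 0" using phase_dom_simps[OF z] by (auto simp: r_def \<theta>_def)
  note car = metric_carter[of q, folded r_def \<theta>_def, OF r]
  have "kerr_metric M a (bl_point q) (bl_vec q c) (T_perp M a (bl_point q))
     = bl_lower M a q c 1 + 2 * M * a * r / PI r \<theta> * bl_lower M a q c 4"
    unfolding T_perp_bl[OF r[unfolded r_def]] bl_lower_def car unfolding r_def[symmetric] \<theta>_def[symmetric]
    by (simp add: axis_def algebra_simps add_divide_distrib diff_divide_distrib)
  then show ?thesis
    using pos unfolding lower_inverse(1)[OF z] r_def \<theta>_def by (simp add: field_simps)
qed

lemma cone_iff: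
  fixes q c :: "real^4"
  assumes z: "(q $ 2, q $ 3, p, b) \<in> phase_dom"
  shows "(bl_point q, bl_vec q c) \<in> future_cone M a \<longleftrightarrow>
    kerr_metric M a (bl_point q) (bl_vec q c) (bl_vec q c) = 0 \<and> 0 < c $ 1"
proof -
  have "rp < q $ 2" using z by (simp add: phase_dom_iff)
  note pos = phase_dom_simps(1,3,4)[OF z, simplified]
  have "kerr_metric M a (bl_point q) (bl_vec q c) (T_perp M a (bl_point q)) < 0 \<longleftrightarrow>
    PI (q $ 2) (q $ 3) * kerr_metric M a (bl_point q) (bl_vec q c) (T_perp M a (bl_point q)) < 0"
    using pos by (simp add: mult_less_0_iff)
  also have "\<dots> \<longleftrightarrow> 0 < c $ 1" 
    unfolding metric_T_perp[OF z] neg_less_0_iff_less using mult_pos_pos[OF pos(1,2)]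
    by (meson mult_pos_pos zero_less_mult_pos)
  finally show ?thesis
    using bl_exterior[OF \<open>rp < q $ 2\<close>] by (auto simp: future_cone_def)
qed

lemma bl_comp_cone:
  fixes q :: "real^4"
  assumes z: "(q $ 2, q $ 3, p, b) \<in> phase_dom" and S: "0 < ham_root L (q $ 2, q $ 3, p, b)"
  shows "(bl_point q, bl_vec q (bl_comp L (q $ 2, q $ 3, p, b))) \<in> future_cone M a"
proof -
  note pos = phase_dom_simps(1,3,4)[OF z, simplified]
  have "Sg (q $ 2) (q $ 3) * kerr_metric M a (bl_point q) (bl_vec q (bl_comp L (q $ 2, q $ 3, p, b))) (bl_vec q (bl_comp L (q $ 2, q $ 3, p, b))) = 0"
    unfolding metric_self_lower[OF z] bl_comp_lower[OF z] using z by (simp add: null_form_zero phase_dom_iff)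
  then show ?thesis unfolding cone_iff[OF z] using pos S by (simp add: bl_comp_def)
qed

text \<open>The sign of v^t selects the root: Delta Sigma v^t = \<open>PI\<close> E - 2 M a r L is
  one of the two square roots of the radicand, and v^t > 0 makes it the positive one. This also
  covers \<open>L\<close> = 0, where positivity of \<open>ham_root\<close> is a conclusion.\<close>

lemma cone_bl_comp:
  fixes q c :: "real^4"
  assumes z: "(q $ 2, q $ 3, p, b) \<in> phase_dom" and c: "(bl_point q, bl_vec q c) \<in> future_cone M a"
  defines "z' \<equiv> (q $ 2, q $ 3, bl_lower M a q c 2, bl_lower M a q c 3)" and "L \<equiv> bl_lower M a q c 4"
  shows "c = bl_comp L z'" "0 < ham_root L z'" "ham L z' = - bl_lower M a q c 1"
proof -
  have z': "(q $ 2, q $ 3, bl_lower M a q c 2, bl_lower M a q c 3) \<in> phase_dom" using z by (simp add: phase_dom_iff)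
  have r: "rp < q $ 2" using z by (simp add: phase_dom_iff)
  note pos = phase_dom_simps(1-4)[OF z, simplified]
  let ?E = "- bl_lower M a q c 1"
  have c0: "null_form L (q $ 2) (q $ 3) (bl_lower M a q c 2) (bl_lower M a q c 3) ?E = 0" and c1: "0 < c $ 1"
    using c metric_self_lower[OF z, of c] unfolding cone_iff[OF z] by (auto simp: L_def)
  define S' where "S' = PI (q $ 2) (q $ 3) * ?E - 2 * M * a * q $ 2 * L"
  have S': "S' = De (q $ 2) * Sg (q $ 2) (q $ 3) * c $ 1"
    using lower_inverse(1)[OF z, of c] by (simp add: S'_def L_def)
  then have "0 < S'" using pos c1 by simp
  moreover have "S'\<^sup>2 = De (q $ 2) * ((Sg (q $ 2) (q $ 3))\<^sup>2 * L\<^sup>2 / (sin (q $ 3))\<^sup>2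
      + PI (q $ 2) (q $ 3) * (De (q $ 2) * (bl_lower M a q c 2)\<^sup>2 + (bl_lower M a q c 3)\<^sup>2))"
    using null_form_quadratic[of "q $ 2" "q $ 3" L "bl_lower M a q c 2" "bl_lower M a q c 3" ?E] c0 pos by (simp add: S'_def)
  ultimately have ham_root: "ham_root L z' = S'" by (simp add: ham_root_def z'_def real_sqrt_unique)
  then show "0 < ham_root L z'" using \<open>0 < S'\<close> by simp
  have "PI (q $ 2) (q $ 3) * ham L z' = PI (q $ 2) (q $ 3) * ?E"
    using ham_root_eq[OF r, of L "q $ 3" "bl_lower M a q c 2" "bl_lower M a q c 3"] ham_root unfolding z'_def S'_def by simp
  moreover have "PI (q $ 2) (q $ 3) \<noteq> 0" using pos by simp
  ultimately show H: "ham L z' = ?E" by (metis mult_left_cancel)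
  have "bl_comp L z' $ 1 = c $ 1" using pos ham_root S' by (simp add: bl_comp_def z'_def)
  moreover have "bl_comp L z' $ 2 = c $ 2" "bl_comp L z' $ 3 = c $ 3"
    using lower_inverse(4,5)[OF z, of c] by (simp_all add: bl_comp_def z'_def)
  moreover have "bl_comp L z' $ 4 = c $ 4"
  proof -
    have "frame_\<phi> (q $ 2) (bl_comp L z') = frame_\<phi> (q $ 2) c"
      unfolding z'_def frame_t_bl_comp(2)[OF z'] using lower_inverse(3)[OF z, of c] pos H
      by (simp add: z'_def L_def field_simps)
    then have "((q $ 2)\<^sup>2 + a\<^sup>2) * bl_comp L z' $ 4 = ((q $ 2)\<^sup>2 + a\<^sup>2) * c $ 4"
      using \<open>bl_comp L z' $ 1 = c $ 1\<close> by simp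
    moreover have "(q $ 2)\<^sup>2 + a\<^sup>2 \<noteq> 0" using ext_pos(2)[OF r] by (simp add: sum_power2_eq_zero_iff)
    ultimately show ?thesis by (metis mult_left_cancel)
  qed
  ultimately show "c = bl_comp L z'" by (simp add: vec_eq_iff forall_4)
qed

end

section \<open>The geodesic spray\<close>

lemma has_vector_derivative_vecI:
  fixes f :: "real \<Rightarrow> real^'n"
  assumes "\<And>i. ((\<lambda>s. f s $ i) has_real_derivative f' $ i) (at s)"
  shows "(f has_vector_derivative f') (at s)"
proof -
  have "((\<lambda>s. f s \<bullet> b) has_derivative (\<lambda>h. (h *\<^sub>R f') \<bullet> b)) (at s)" if B: "b \<in> Basis" for b
  proof -
    from B obtain i where b: "b = axis i 1" unfolding Basis_vec_def by auto
    show ?thesis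
      using assms[of i] unfolding b inner_axis has_field_derivative_def
      by (auto elim!: has_derivative_eq_rhs simp: fun_eq_iff)
  qed
  then show ?thesis
    unfolding has_vector_derivative_def by (subst has_derivative_componentwise_within) blast
qed

lemma has_vector_derivative_vec_nth:
  "(f has_vector_derivative f') (at s) \<Longrightarrow> ((\<lambda>s. f s $ i) has_real_derivative f' $ i) (at s)"
  using bounded_linear.has_vector_derivative[OF bounded_linear_vec_nth, of f f' "at s" i]
  by (simp add: has_real_derivative_iff_has_vector_derivative)

lemma has_derivative_curve:
  assumes "(f has_derivative f') (at y)"
  shows "((\<lambda>s::real. f (y + s *\<^sub>R w)) has_vector_derivative f' w) (at 0)"
proof -
  have "((\<lambda>s::real. y + s *\<^sub>R w) has_derivative (\<lambda>h. h *\<^sub>R w)) (at 0)"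
    by (auto intro!: derivative_eq_intros)
  from has_derivative_compose[OF this, of f f'] assms
  have "((\<lambda>s::real. f (y + s *\<^sub>R w)) has_derivative (\<lambda>h. f' (h *\<^sub>R w))) (at 0)" by simp
  then show ?thesis
    unfolding has_vector_derivative_def by (simp add: linear_scale[OF has_derivative_linear[OF assms]])
qed

lemma kerr_metric_linear: "linear (\<lambda>v. kerr_metric M a x v w)" "linear (\<lambda>w. kerr_metric M a x v w)"
  by (rule linearI; simp add: kerr_metric_def Let_def dr_form_def sin2_dphi_form_def round_metric_def
      add_divide_distrib diff_divide_distrib algebra_simps)+

lemma kerr_metric_sym: "kerr_metric M a x v w = kerr_metric M a x w v"
  by (simp add: kerr_metric_def Let_def round_metric_def algebra_simps)

lemma vec_axis_sum: "(v :: real^'n) = (\<Sum>i\<in>UNIV. v $ i *\<^sub>R axis i 1)"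
  using basis_expansion[of v] by (simp add: scalar_mult_eq_scaleR)

lemma linear_axis_sum:
  fixes f :: "real^'n \<Rightarrow> 'b::real_vector"
  assumes "linear f" shows "f v = (\<Sum>i\<in>UNIV. v $ i *\<^sub>R f (axis i 1))"
  using linear_sum[OF assms, of "\<lambda>i. v $ i *\<^sub>R axis i 1" UNIV] vec_axis_sum[of v] by (simp add: linear_scale[OF assms])

lemma kerr_metric_expand:
  "kerr_metric M a x v w = (\<Sum>k\<in>UNIV. \<Sum>l\<in>UNIV. metric_matrix M a x $ k $ l * v $ k * w $ l)"
proof -
  have "kerr_metric M a x v w = (\<Sum>k\<in>UNIV. v $ k * kerr_metric M a x (axis k 1) w)"
    using linear_axis_sum[of "\<lambda>v. kerr_metric M a x v w" v] kerr_metric_linear(1) by simp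
  also have "\<dots> = (\<Sum>k\<in>UNIV. v $ k * (\<Sum>l\<in>UNIV. w $ l * kerr_metric M a x (axis k 1) (axis l 1)))"
    by (intro sum.cong refl arg_cong2[where f="(*)"]) (subst linear_axis_sum[OF kerr_metric_linear(2)], simp)
  finally show ?thesis by (simp add: metric_matrix_def sum_distrib_left mult_ac)
qed

lemma matrix_mult_metric: "(metric_matrix M a x *v v) $ k = kerr_metric M a x v (axis k 1)"
  unfolding kerr_metric_sym[of M a x v] 
  by (subst linear_axis_sum[OF kerr_metric_linear(2)]) (simp add: matrix_vector_mult_def metric_matrix_def mult.commute)

text \<open>Derivative of the metric in direction u, evaluated on v and w as constant vectors of the
  ambient chart.\<close>

definition dmetric :: "real \<Rightarrow> real \<Rightarrow> real^4 \<Rightarrow> real^4 \<Rightarrow> real^4 \<Rightarrow> real^4 \<Rightarrow> real" where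
  "dmetric M a x u v w = (\<Sum>k\<in>UNIV. \<Sum>l\<in>UNIV. (\<Sum>i\<in>UNIV. u $ i * metric_partial M a x i k l) * v $ k * w $ l)"

text \<open>The geodesic equation in Euler-Lagrange form: lowering the acceleration removes the
  inverse matrix and leaves the Christoffel symbols of the first kind, contracted with v
  twice.\<close>

lemma geodesic_spray_lower:
  assumes inv: "invertible (metric_matrix M a x)"
  shows "kerr_metric M a x (snd (geodesic_spray M a (x, v))) w = dmetric M a x w v v / 2 - dmetric M a x v v w"
proof -
  let ?G = "metric_matrix M a x" and ?P = "metric_partial M a x" and ?B = "snd (geodesic_spray M a (x, v))"
  define T where "T = (\<chi> d. \<Sum>i\<in>UNIV. \<Sum>j\<in>UNIV. (?P i j d + ?P j i d - ?P d i j) / 2 * v $ i * v $ j)"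
  have "?B = - (matrix_inv ?G *v T)"
  proof (rule vec_eq_iff[THEN iffD2], rule allI)
    fix c
    have "?B $ c = - (\<Sum>i\<in>UNIV. \<Sum>j\<in>UNIV. \<Sum>d\<in>UNIV. matrix_inv ?G $ c $ d * ((?P i j d + ?P j i d - ?P d i j) / 2 * v $ i * v $ j))"
      by (simp add: geodesic_spray_def christoffel_def sum_distrib_right sum_divide_distrib mult.assoc)
    also have "\<dots> = - (\<Sum>d\<in>UNIV. \<Sum>i\<in>UNIV. \<Sum>j\<in>UNIV. matrix_inv ?G $ c $ d * ((?P i j d + ?P j i d - ?P d i j) / 2 * v $ i * v $ j))"
    proof -
      have "(\<Sum>i\<in>UNIV. \<Sum>j\<in>UNIV. \<Sum>d\<in>UNIV. X i j d) = (\<Sum>i\<in>UNIV. \<Sum>d\<in>UNIV. \<Sum>j\<in>UNIV. X i j d)"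
        for X :: "4 \<Rightarrow> 4 \<Rightarrow> 4 \<Rightarrow> real"
        by (intro sum.cong refl sum.swap)
      also have "(\<Sum>i\<in>UNIV. \<Sum>d\<in>UNIV. \<Sum>j\<in>UNIV. X i j d) = (\<Sum>d\<in>UNIV. \<Sum>i\<in>UNIV. \<Sum>j\<in>UNIV. X i j d)"
        for X :: "4 \<Rightarrow> 4 \<Rightarrow> 4 \<Rightarrow> real"
        by (rule sum.swap)
      finally show ?thesis by (rule arg_cong)
    qed
    also have "\<dots> = - ((matrix_inv ?G *v T) $ c)"
      by (simp only: matrix_vector_mult_def T_def vec_lambda_beta sum_distrib_left)
    finally show "?B $ c = (- (matrix_inv ?G *v T)) $ c" by simp
  qed
  then have "?G *v ?B = - (?G *v (matrix_inv ?G *v T))"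
    by (simp add: matrix_vector_mult_def vec_eq_iff sum_negf)
  also have "\<dots> = - ((?G ** matrix_inv ?G) *v T)" by (simp only: matrix_vector_mul_assoc)
  also have "\<dots> = - T" 
  proof -
    \<comment> \<open>\<open>matrix_inv\<close> is a choice; invertibility guarantees that what is
      chosen really is an inverse.\<close>
    have "\<exists>A'. ?G ** A' = mat 1 \<and> A' ** ?G = mat 1" using inv by (simp add: invertible_def)
    from someI_ex[OF this] have "?G ** matrix_inv ?G = mat 1" unfolding matrix_inv_def by blast
    then show ?thesis by simp
  qed
  finally have GB: "?G *v ?B = - T" .
  have "kerr_metric M a x ?B w = (\<Sum>d\<in>UNIV. w $ d * (?G *v ?B) $ d)"
    unfolding matrix_mult_metric by (subst linear_axis_sum[OF kerr_metric_linear(2)]) simp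
  also have "\<dots> = - (\<Sum>d\<in>UNIV. \<Sum>i\<in>UNIV. \<Sum>j\<in>UNIV. w $ d * ((?P i j d + ?P j i d - ?P d i j) / 2 * v $ i * v $ j))"
    unfolding GB by (simp add: T_def sum_distrib_left sum_negf)
  also have "\<dots> = - ((\<Sum>d\<in>UNIV. \<Sum>i\<in>UNIV. \<Sum>j\<in>UNIV. w $ d * ?P i j d * v $ i * v $ j) / 2
      + (\<Sum>d\<in>UNIV. \<Sum>i\<in>UNIV. \<Sum>j\<in>UNIV. w $ d * ?P j i d * v $ i * v $ j) / 2
      - (\<Sum>d\<in>UNIV. \<Sum>i\<in>UNIV. \<Sum>j\<in>UNIV. w $ d * ?P d i j * v $ i * v $ j) / 2)"
    by (simp add: sum_divide_distrib sum.distrib[symmetric] sum_subtractf[symmetric] add_divide_distrib diff_divide_distrib algebra_simps)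
  also have "(\<Sum>d\<in>UNIV. \<Sum>i\<in>UNIV. \<Sum>j\<in>UNIV. w $ d * ?P i j d * v $ i * v $ j) = dmetric M a x v v w"
  proof -
    have "dmetric M a x v v w = (\<Sum>k\<in>UNIV. \<Sum>l\<in>UNIV. \<Sum>i\<in>UNIV. w $ l * ?P i k l * v $ i * v $ k)"
      by (simp add: dmetric_def sum_distrib_left sum_distrib_right mult_ac)
    also have "\<dots> = (\<Sum>l\<in>UNIV. \<Sum>k\<in>UNIV. \<Sum>i\<in>UNIV. w $ l * ?P i k l * v $ i * v $ k)"
      by (rule sum.swap)
    also have "\<dots> = (\<Sum>l\<in>UNIV. \<Sum>i\<in>UNIV. \<Sum>k\<in>UNIV. w $ l * ?P i k l * v $ i * v $ k)"
      by (intro sum.cong refl sum.swap)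
    finally show ?thesis by simp
  qed
  also have "(\<Sum>d\<in>UNIV. \<Sum>i\<in>UNIV. \<Sum>j\<in>UNIV. w $ d * ?P j i d * v $ i * v $ j) = dmetric M a x v v w"
  proof -
    have "dmetric M a x v v w = (\<Sum>k\<in>UNIV. \<Sum>l\<in>UNIV. \<Sum>i\<in>UNIV. w $ l * ?P i k l * v $ k * v $ i)"
      by (simp add: dmetric_def sum_distrib_left sum_distrib_right mult_ac)
    also have "\<dots> = (\<Sum>l\<in>UNIV. \<Sum>k\<in>UNIV. \<Sum>i\<in>UNIV. w $ l * ?P i k l * v $ k * v $ i)"
      by (rule sum.swap)
    finally show ?thesis by simp
  qed
  also have "(\<Sum>d\<in>UNIV. \<Sum>i\<in>UNIV. \<Sum>j\<in>UNIV. w $ d * ?P d i j * v $ i * v $ j) = dmetric M a x w v v"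
  proof -
    have "dmetric M a x w v v = (\<Sum>k\<in>UNIV. \<Sum>l\<in>UNIV. \<Sum>i\<in>UNIV. w $ i * ?P i k l * v $ k * v $ l)"
      by (simp add: dmetric_def sum_distrib_left sum_distrib_right mult_ac)
    also have "\<dots> = (\<Sum>k\<in>UNIV. \<Sum>i\<in>UNIV. \<Sum>l\<in>UNIV. w $ i * ?P i k l * v $ k * v $ l)"
      by (intro sum.cong refl sum.swap)
    also have "\<dots> = (\<Sum>i\<in>UNIV. \<Sum>k\<in>UNIV. \<Sum>l\<in>UNIV. w $ i * ?P i k l * v $ k * v $ l)"
      by (rule sum.swap)
    finally show ?thesis by simp
  qed
  finally show ?thesis by simp
qed

section \<open>Derivatives of the coordinate map and of the metric along curves\<close>

lemma C1_bl_point: "Ck_on (Suc 0) bl_point S"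
  unfolding bl_point_def[abs_def] by (intro C1_intros)

lemma bl_point_derivative: "(bl_point has_derivative bl_vec q) (at q)"
proof -
  have "bl_vec q = frechet_derivative bl_point (at q)" by (simp add: bl_vec_def fun_eq_iff)
  then show ?thesis using C1_has_derivative[OF C1_bl_point[of UNIV]] by simp
qed

lemma C1_bl_vec:
  assumes "Ck_on (Suc 0) q S" "Ck_on (Suc 0) c S"
  shows "Ck_on (Suc 0) (\<lambda>x. bl_vec (q x) (c x)) S"
  unfolding bl_vec_eq by (intro C1_intros assms)

text \<open>Second derivative of \<open>bl_point\<close>. Its symmetry cancels the terms caused by
  the coordinate frame turning within the ambient chart.\<close>

definition bl_hessian :: "real^4 \<Rightarrow> real^4 \<Rightarrow> real^4 \<Rightarrow> real^4" where
  "bl_hessian q d u = (let r = q $ 2; st = sin (q $ 3); ct = cos (q $ 3); sp = sin (q $ 4); cp = cos (q $ 4) in vector [0,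
    d $ 2 * (ct * u $ 3 * cp - st * sp * u $ 4) + d $ 3 * (u $ 2 * ct * cp - r * st * u $ 3 * cp - r * ct * sp * u $ 4)
      - d $ 4 * (u $ 2 * st * sp + r * ct * u $ 3 * sp + r * st * cp * u $ 4),
    d $ 2 * (ct * u $ 3 * sp + st * cp * u $ 4) + d $ 3 * (u $ 2 * ct * sp - r * st * u $ 3 * sp + r * ct * cp * u $ 4)
      + d $ 4 * (u $ 2 * st * cp + r * ct * u $ 3 * cp - r * st * sp * u $ 4),
    - d $ 2 * st * u $ 3 - d $ 3 * (u $ 2 * st + r * ct * u $ 3)])"

lemma bl_hessian_sym: "bl_hessian q d u = bl_hessian q u d"
  by (simp add: bl_hessian_def Let_def vec_eq_iff forall_4 algebra_simps)

lemma bl_vec_curve: "((\<lambda>s. bl_vec (q + s *\<^sub>R u) d) has_vector_derivative bl_hessian q d u) (at 0)"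
proof (rule has_vector_derivative_vecI)
  fix i :: 4
  show "((\<lambda>s. bl_vec (q + s *\<^sub>R u) d $ i) has_real_derivative bl_hessian q d u $ i) (at 0)"
    using exhaust_4[of i] unfolding bl_vec_eq bl_hessian_def Let_def
    by (elim disjE; simp only: vector_4 vector_add_component vector_scaleR_component)
      (auto intro!: derivative_eq_intros simp: algebra_simps)
qed

context kerr_bl begin

lemma C1_metric: "Ck_on (Suc 0) (\<lambda>x. kerr_metric M a x v w) (kerr_exterior M a)"
proof -
  have pos: "rp < rad x" "0 < rad x" "De (rad x) \<noteq> 0" "(rad x)\<^sup>2 \<noteq> 0" "kerr_Sigma a (rad x) c \<noteq> 0"
    "0 < (x $ 2)\<^sup>2 + (x $ 3)\<^sup>2 + (x $ 4)\<^sup>2"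
    if "x \<in> kerr_exterior M a" for x :: "real^4" and c
  proof -
    show r: "rp < rad x" using that by (simp add: kerr_exterior_def)
    show 0: "0 < rad x" "De (rad x) \<noteq> 0" using ext_pos[OF r] by auto
    then show "(rad x)\<^sup>2 \<noteq> 0" by simp
    show "kerr_Sigma a (rad x) c \<noteq> 0" using 0(1)
      by (simp add: kerr_Sigma_def) (smt (verit) mult_nonneg_nonneg zero_le_power2 zero_less_power)
    show "0 < (x $ 2)\<^sup>2 + (x $ 3)\<^sup>2 + (x $ 4)\<^sup>2" using 0(1) by (simp add: rad_def)
  qed
  have rad: "Ck_on (Suc 0) rad (kerr_exterior M a)"
    unfolding rad_def[abs_def] by (intro C1_intros pos(6))
  have dr: "Ck_on (Suc 0) (\<lambda>x. dr_form x u) (kerr_exterior M a)"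
    and dp: "Ck_on (Suc 0) (\<lambda>x. sin2_dphi_form x u) (kerr_exterior M a)" for u
    unfolding dr_form_def sin2_dphi_form_def using pos(2,4) by (intro C1_intros rad; force)+
  have rm: "Ck_on (Suc 0) (\<lambda>x. round_metric x v w) (kerr_exterior M a)"
    unfolding round_metric_def using pos(4) by (intro C1_intros rad dr)
  have cp: "Ck_on (Suc 0) cos_polar (kerr_exterior M a)"
    unfolding cos_polar_def[abs_def] using pos(2) by (intro C1_intros rad) force
  have Sg: "Ck_on (Suc 0) (\<lambda>x. kerr_Sigma a (rad x) (cos_polar x)) (kerr_exterior M a)"
    unfolding kerr_Sigma_def by (intro C1_intros rad cp)
  show ?thesis
    unfolding kerr_metric_def Let_def
    by (intro C1_intros rad dr dp rm Sg pos(3,5))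
qed

lemma metric_curve:
  assumes X: "(X has_vector_derivative u) (at 0)" and V: "(V has_vector_derivative v') (at 0)"
    and W: "(W has_vector_derivative w') (at 0)" and ext: "X 0 \<in> kerr_exterior M a"
  shows "((\<lambda>s. kerr_metric M a (X s) (V s) (W s)) has_real_derivative
    dmetric M a (X 0) u (V 0) (W 0) + kerr_metric M a (X 0) v' (W 0) + kerr_metric M a (X 0) (V 0) w') (at 0)"
proof -
  let ?x = "X 0"
  have G: "((\<lambda>s. metric_matrix M a (X s) $ k $ l) has_real_derivative (\<Sum>i\<in>UNIV. u $ i * metric_partial M a ?x i k l)) (at 0)" for k l
  proof -
    let ?g = "\<lambda>x. metric_matrix M a x $ k $ l"
    have g: "(?g has_derivative frechet_derivative ?g (at ?x)) (at ?x)"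
      using C1_has_derivative[OF C1_metric ext, of "axis k 1" "axis l 1"] by (simp add: metric_matrix_def)
    from has_derivative_compose[OF X[unfolded has_vector_derivative_def] g]
    have "((\<lambda>s. ?g (X s)) has_derivative (\<lambda>h. frechet_derivative ?g (at ?x) (h *\<^sub>R u))) (at 0)" .
    moreover have "(\<lambda>h. frechet_derivative ?g (at ?x) (h *\<^sub>R u)) = (*) (\<Sum>i\<in>UNIV. u $ i * metric_partial M a ?x i k l)"
      using linear_scale[OF has_derivative_linear[OF g]] linear_axis_sum[OF has_derivative_linear[OF g], of u]
      by (simp add: fun_eq_iff metric_partial_def)
    ultimately show ?thesis by (simp only: has_field_derivative_def)
  qed
  show ?thesis
    unfolding kerr_metric_expand dmetric_def
    by (rule DERIV_cong, (rule DERIV_sum)+, (rule DERIV_mult)+, rule G, rule has_vector_derivative_vec_nth[OF V],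
        rule has_vector_derivative_vec_nth[OF W])
      (simp add: sum.distrib[symmetric] algebra_simps)
qed

end

section \<open>Hamilton's equations as the geodesic equation\<close>

context kerr_bl begin

text \<open>In terms of the two tetrad components \<open>\<tau>\<close> and \<open>\<sigma>\<close>
  the null condition and the raised and lowered components become polynomial relations, which the
  two derivative computations below substitute.\<close>

lemma bl_comp_relations:
  fixes L :: real
  assumes z: "(r, \<theta>, p, b) \<in> phase_dom"
  defines "c \<equiv> bl_comp L (r, \<theta>, p, b)" and "E \<equiv> ham L (r, \<theta>, p, b)"
  defines "\<tau> \<equiv> frame_t r \<theta> c" and "\<sigma> \<equiv> frame_\<phi> r c"
  shows "Sg r \<theta> * c $ 4 = a * \<tau> + \<sigma>" "c $ 2 = De r * p / Sg r \<theta>" "Sg r \<theta> * c $ 3 = b"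
    "Sg r \<theta> * E = De r * \<tau> + a * (sin \<theta>)\<^sup>2 * \<sigma>" "L = (sin \<theta>)\<^sup>2 * (\<sigma> + a * E)"
    "De r * \<tau> = (r\<^sup>2 + a\<^sup>2) * E - a * L"
    "b\<^sup>2 = De r * \<tau>\<^sup>2 - (sin \<theta>)\<^sup>2 * \<sigma>\<^sup>2 - De r * p\<^sup>2"
proof -
  have r: "rp < r" "0 < \<theta>" "\<theta> < pi" using z by (auto simp: phase_dom_iff)
  have pos: "De r \<noteq> 0" "sin \<theta> \<noteq> 0" "Sg r \<theta> \<noteq> 0" using phase_dom_simps[OF z] by auto
  have t: "\<tau> = ((r\<^sup>2 + a\<^sup>2) * E - a * L) / De r" and s: "\<sigma> = L / (sin \<theta>)\<^sup>2 - a * E"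
    unfolding \<tau>_def \<sigma>_def c_def E_def by (rule frame_t_bl_comp[OF z])+
  show "Sg r \<theta> * c $ 4 = a * \<tau> + \<sigma>"
    unfolding \<tau>_def \<sigma>_def Sigma_s by (simp add: algebra_simps power2_eq_square)
  show "c $ 2 = De r * p / Sg r \<theta>" "Sg r \<theta> * c $ 3 = b" using pos by (simp_all add: c_def bl_comp_def)
  show L: "L = (sin \<theta>)\<^sup>2 * (\<sigma> + a * E)" using pos by (simp add: s)
  show D: "De r * \<tau> = (r\<^sup>2 + a\<^sup>2) * E - a * L" using pos by (simp add: t)
  show "Sg r \<theta> * E = De r * \<tau> + a * (sin \<theta>)\<^sup>2 * \<sigma>"
    unfolding D Sigma_s using L by (simp add: algebra_simps power2_eq_square)
  have "((r\<^sup>2 + a\<^sup>2) * E - a * L)\<^sup>2 / De r = De r * \<tau>\<^sup>2" using pos by (simp add: t power2_eq_square)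
  moreover have "(sin \<theta>)\<^sup>2 * \<sigma>\<^sup>2 = L\<^sup>2 / (sin \<theta>)\<^sup>2 + a\<^sup>2 * (sin \<theta>)\<^sup>2 * E\<^sup>2 - 2 * a * E * L"
    using pos by (simp add: s field_simps power2_eq_square)
  ultimately show "b\<^sup>2 = De r * \<tau>\<^sup>2 - (sin \<theta>)\<^sup>2 * \<sigma>\<^sup>2 - De r * p\<^sup>2"
    using null_form_zero[OF r, of L p b] unfolding null_form_def E_def[symmetric] by linarith
qed

text \<open>The Legendre relation: the derivative of g(c, c) in a coordinate at fixed velocity is
  minus that of the dual form \<open>null_form\<close> / Sigma at fixed momenta. On null covectors
  the derivative of 1 / Sigma contributes nothing, since \<open>null_form\<close> vanishes.\<close>

lemma lagrangian_r:
  fixes L :: real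
  assumes z: "(r, \<theta>, p, b) \<in> phase_dom"
  defines "c \<equiv> bl_comp L (r, \<theta>, p, b)"
  shows "((\<lambda>\<rho>. (- De \<rho> * frame_t r \<theta> c * frame_t r \<theta> c + (sin \<theta>)\<^sup>2 * frame_\<phi> \<rho> c * frame_\<phi> \<rho> c) / Sg \<rho> \<theta>
      + Sg \<rho> \<theta> / De \<rho> * (c $ 2 * c $ 2) + Sg \<rho> \<theta> * (c $ 3 * c $ 3)) has_real_derivative
      - null_form_r L r p (ham L (r, \<theta>, p, b)) / Sg r \<theta>) (at r)"
proof -
  have pos: "De r \<noteq> 0" "sin \<theta> \<noteq> 0" "Sg r \<theta> \<noteq> 0" using phase_dom_simps[OF z] by auto
  define E where "E = ham L (r, \<theta>, p, b)"
  define \<tau> where "\<tau> = frame_t r \<theta> c"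
  define \<sigma> where "\<sigma> = frame_\<phi> r c"
  note rel = bl_comp_relations[OF z, of L, folded c_def E_def, folded \<tau>_def \<sigma>_def]
  let ?D' = "2 * r - 2 * M"
  have dDe: "(kerr_Delta M a has_real_derivative ?D') (at r)"
    unfolding kerr_Delta_def[abs_def] by (auto intro!: derivative_eq_intros)
  have dSg: "((\<lambda>\<rho>. Sg \<rho> \<theta>) has_real_derivative 2 * r) (at r)"
    unfolding kerr_Sigma_def by (auto intro!: derivative_eq_intros)
  have dbs: "((\<lambda>\<rho>. frame_\<phi> \<rho> c) has_real_derivative 2 * r * c $ 4) (at r)"
    by (auto intro!: derivative_eq_intros)
  have 1: "((\<lambda>\<rho>. (- De \<rho> * \<tau> * \<tau> + (sin \<theta>)\<^sup>2 * frame_\<phi> \<rho> c * frame_\<phi> \<rho> c) / Sg \<rho> \<theta>) has_real_derivative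
      ((- ?D' * \<tau>\<^sup>2 + 4 * r * (sin \<theta>)\<^sup>2 * \<sigma> * c $ 4) * Sg r \<theta> - (- De r * \<tau>\<^sup>2 + (sin \<theta>)\<^sup>2 * \<sigma>\<^sup>2) * (2 * r)) / (Sg r \<theta>)\<^sup>2) (at r)"
    by (rule DERIV_cong, (rule derivative_intros dDe dSg dbs pos)+)
      (simp only: \<sigma>_def[symmetric], simp add: power2_eq_square algebra_simps)
  have 2: "((\<lambda>\<rho>. Sg \<rho> \<theta> / De \<rho> * (c $ 2 * c $ 2)) has_real_derivative
      (2 * r * De r - Sg r \<theta> * ?D') / (De r)\<^sup>2 * (c $ 2 * c $ 2)) (at r)"
    by (rule DERIV_cong, (rule derivative_intros dDe dSg dbs pos)+)
      (simp add: power2_eq_square algebra_simps)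
  have 3: "((\<lambda>\<rho>. Sg \<rho> \<theta> * (c $ 3 * c $ 3)) has_real_derivative 2 * r * (c $ 3 * c $ 3)) (at r)"
    by (rule DERIV_cong, (rule derivative_intros dDe dSg dbs pos)+) simp
  have c3: "c $ 3 = b / Sg r \<theta>" using rel(3) pos by (simp add: field_simps)
  have c4: "c $ 4 * Sg r \<theta> = a * \<tau> + \<sigma>" using rel(1) by (simp add: mult.commute)
  have e2: "(2 * r * De r - Sg r \<theta> * ?D') / (De r)\<^sup>2 * (c $ 2 * c $ 2) = (2 * r * De r - Sg r \<theta> * ?D') * p\<^sup>2 / (Sg r \<theta>)\<^sup>2"
    unfolding rel(2) using pos by (simp add: field_simps power2_eq_square)
  have e3: "2 * r * (c $ 3 * c $ 3) = 2 * r * b\<^sup>2 / (Sg r \<theta>)\<^sup>2"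
    unfolding c3 by (simp add: power2_eq_square)
  have e1: "(- ?D' * \<tau>\<^sup>2 + 4 * r * (sin \<theta>)\<^sup>2 * \<sigma> * c $ 4) * Sg r \<theta> = - ?D' * \<tau>\<^sup>2 * Sg r \<theta> + 4 * r * (sin \<theta>)\<^sup>2 * \<sigma> * (a * \<tau> + \<sigma>)"
    unfolding c4[symmetric] by (simp add: algebra_simps)
  have N: "null_form_r L r p E = ?D' * p\<^sup>2 - 4 * r * E * \<tau> + \<tau>\<^sup>2 * ?D'"
    using pos unfolding null_form_r_def rel(6)[symmetric] by (simp add: field_simps power2_eq_square)
  have "- ?D' * \<tau>\<^sup>2 * Sg r \<theta> + 4 * r * (sin \<theta>)\<^sup>2 * \<sigma> * (a * \<tau> + \<sigma>) - (- De r * \<tau>\<^sup>2 + (sin \<theta>)\<^sup>2 * \<sigma>\<^sup>2) * (2 * r)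
      + (2 * r * De r - Sg r \<theta> * ?D') * p\<^sup>2 + 2 * r * b\<^sup>2 = - ?D' * Sg r \<theta> * (\<tau>\<^sup>2 + p\<^sup>2) + 4 * r * \<tau> * (De r * \<tau> + a * (sin \<theta>)\<^sup>2 * \<sigma>)"
    unfolding rel(7) by (simp add: algebra_simps power2_eq_square)
  also have "\<dots> = - null_form_r L r p E * Sg r \<theta>"
    unfolding rel(4)[symmetric] N by (simp add: algebra_simps)
  finally have "((- ?D' * \<tau>\<^sup>2 + 4 * r * (sin \<theta>)\<^sup>2 * \<sigma> * c $ 4) * Sg r \<theta> - (- De r * \<tau>\<^sup>2 + (sin \<theta>)\<^sup>2 * \<sigma>\<^sup>2) * (2 * r)) / (Sg r \<theta>)\<^sup>2
      + (2 * r * De r - Sg r \<theta> * ?D') / (De r)\<^sup>2 * (c $ 2 * c $ 2) + 2 * r * (c $ 3 * c $ 3) = - null_form_r L r p E * Sg r \<theta> / (Sg r \<theta>)\<^sup>2"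
    unfolding e1 e2 e3 by (simp only: add_divide_distrib[symmetric])
  also have "\<dots> = - null_form_r L r p E / Sg r \<theta>" using pos by (simp add: power2_eq_square)
  finally show ?thesis
    using DERIV_add[OF DERIV_add[OF 1 2] 3] unfolding \<tau>_def E_def by (simp only:)
qed

text \<open>The same Legendre relation in the other variable on which the metric depends.\<close>

lemma lagrangian_theta:
  fixes L :: real
  assumes z: "(r, \<theta>, p, b) \<in> phase_dom"
  defines "c \<equiv> bl_comp L (r, \<theta>, p, b)"
  shows "((\<lambda>\<theta>. (- De r * frame_t r \<theta> c * frame_t r \<theta> c + (sin \<theta>)\<^sup>2 * frame_\<phi> r c * frame_\<phi> r c) / Sg r \<theta>
      + Sg r \<theta> / De r * (c $ 2 * c $ 2) + Sg r \<theta> * (c $ 3 * c $ 3)) has_real_derivative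
      - null_form_\<theta> L \<theta> (ham L (r, \<theta>, p, b)) / Sg r \<theta>) (at \<theta>)"
proof -
  have pos: "De r \<noteq> 0" "sin \<theta> \<noteq> 0" "Sg r \<theta> \<noteq> 0" using phase_dom_simps[OF z] by auto
  define E where "E = ham L (r, \<theta>, p, b)"
  define \<tau> where "\<tau> = frame_t r \<theta> c"
  define \<sigma> where "\<sigma> = frame_\<phi> r c"
  note rel = bl_comp_relations[OF z, of L, folded c_def E_def, folded \<tau>_def \<sigma>_def]
  define sc where "sc = sin \<theta> * cos \<theta>"
  have dSg: "((\<lambda>\<theta>. Sg r \<theta>) has_real_derivative - 2 * a\<^sup>2 * sc) (at \<theta>)"
    unfolding kerr_Sigma_def sc_def by (auto intro!: derivative_eq_intros)
  have dbt: "((\<lambda>\<theta>. frame_t r \<theta> c) has_real_derivative - 2 * a * sc * c $ 4) (at \<theta>)"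
    unfolding sc_def by (auto intro!: derivative_eq_intros)
  have dsin: "((\<lambda>\<theta>. (sin \<theta>)\<^sup>2) has_real_derivative 2 * sc) (at \<theta>)"
    unfolding sc_def by (auto intro!: derivative_eq_intros)
  have 1: "((\<lambda>\<theta>. (- De r * frame_t r \<theta> c * frame_t r \<theta> c + (sin \<theta>)\<^sup>2 * \<sigma> * \<sigma>) / Sg r \<theta>) has_real_derivative
      ((4 * De r * \<tau> * a * sc * c $ 4 + 2 * sc * \<sigma>\<^sup>2) * Sg r \<theta> - (- De r * \<tau>\<^sup>2 + (sin \<theta>)\<^sup>2 * \<sigma>\<^sup>2) * (- 2 * a\<^sup>2 * sc)) / (Sg r \<theta>)\<^sup>2) (at \<theta>)"
    by (rule DERIV_cong, (rule dSg dbt dsin DERIV_divide DERIV_add DERIV_mult DERIV_const pos)+)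
      (simp only: \<tau>_def[symmetric], simp add: power2_eq_square algebra_simps)
  have 2: "((\<lambda>\<theta>. Sg r \<theta> / De r * (c $ 2 * c $ 2)) has_real_derivative
      - 2 * a\<^sup>2 * sc / De r * (c $ 2 * c $ 2)) (at \<theta>)"
    by (rule DERIV_cong, (rule dSg DERIV_cdivide DERIV_mult DERIV_const)+) simp
  have 3: "((\<lambda>\<theta>. Sg r \<theta> * (c $ 3 * c $ 3)) has_real_derivative - 2 * a\<^sup>2 * sc * (c $ 3 * c $ 3)) (at \<theta>)"
    by (rule DERIV_cong, (rule dSg DERIV_mult DERIV_const)+) simp
  have c3: "c $ 3 = b / Sg r \<theta>" using rel(3) pos by (simp add: field_simps)
  have c4: "c $ 4 * Sg r \<theta> = a * \<tau> + \<sigma>" using rel(1) by (simp add: mult.commute)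
  have e2: "- 2 * a\<^sup>2 * sc / De r * (c $ 2 * c $ 2) = - 2 * a\<^sup>2 * sc * (De r * p\<^sup>2) / (Sg r \<theta>)\<^sup>2"
    unfolding rel(2) using pos by (simp add: field_simps power2_eq_square)
  have e3: "- 2 * a\<^sup>2 * sc * (c $ 3 * c $ 3) = - 2 * a\<^sup>2 * sc * b\<^sup>2 / (Sg r \<theta>)\<^sup>2"
    unfolding c3 by (simp add: power2_eq_square)
  have e1: "(4 * De r * \<tau> * a * sc * c $ 4 + 2 * sc * \<sigma>\<^sup>2) * Sg r \<theta> = 4 * De r * \<tau> * a * sc * (a * \<tau> + \<sigma>) + 2 * sc * \<sigma>\<^sup>2 * Sg r \<theta>"
    unfolding c4[symmetric] by (simp add: algebra_simps)
  have "L\<^sup>2 * cos \<theta> / (sin \<theta>) ^ 3 = sc * (\<sigma> + a * E)\<^sup>2"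
    using pos unfolding rel(5) sc_def by (simp add: power_mult_distrib field_simps power2_eq_square power3_eq_cube)
  moreover have "null_form_\<theta> L \<theta> E = 2 * a\<^sup>2 * sc * E\<^sup>2 - 2 * (L\<^sup>2 * cos \<theta> / (sin \<theta>) ^ 3)"
    by (simp add: null_form_\<theta>_def sc_def)
  ultimately have N: "null_form_\<theta> L \<theta> E = - 2 * sc * (\<sigma>\<^sup>2 + 2 * a * E * \<sigma>)"
    by (simp add: algebra_simps power2_eq_square)
  have "4 * De r * \<tau> * a * sc * (a * \<tau> + \<sigma>) + 2 * sc * \<sigma>\<^sup>2 * Sg r \<theta> - (- De r * \<tau>\<^sup>2 + (sin \<theta>)\<^sup>2 * \<sigma>\<^sup>2) * (- 2 * a\<^sup>2 * sc)
      + - 2 * a\<^sup>2 * sc * (De r * p\<^sup>2) + - 2 * a\<^sup>2 * sc * b\<^sup>2 = 2 * sc * (\<sigma>\<^sup>2 * Sg r \<theta> + 2 * a * \<sigma> * (De r * \<tau> + a * (sin \<theta>)\<^sup>2 * \<sigma>))"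
    unfolding rel(7) by (simp add: algebra_simps power2_eq_square)
  also have "\<dots> = - null_form_\<theta> L \<theta> E * Sg r \<theta>"
    unfolding rel(4)[symmetric] N by (simp add: algebra_simps)
  finally have "((4 * De r * \<tau> * a * sc * c $ 4 + 2 * sc * \<sigma>\<^sup>2) * Sg r \<theta> - (- De r * \<tau>\<^sup>2 + (sin \<theta>)\<^sup>2 * \<sigma>\<^sup>2) * (- 2 * a\<^sup>2 * sc)) / (Sg r \<theta>)\<^sup>2
      + - 2 * a\<^sup>2 * sc / De r * (c $ 2 * c $ 2) + - 2 * a\<^sup>2 * sc * (c $ 3 * c $ 3) = - null_form_\<theta> L \<theta> E * Sg r \<theta> / (Sg r \<theta>)\<^sup>2"
    unfolding e1 e2 e3 by (simp only: add_divide_distrib[symmetric])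
  also have "\<dots> = - null_form_\<theta> L \<theta> E / Sg r \<theta>" using pos by (simp add: power2_eq_square)
  finally show ?thesis
    using DERIV_add[OF DERIV_add[OF 1 2] 3] unfolding \<sigma>_def E_def by (simp only:)
qed

lemma bl_vec_surj:
  fixes q :: "real^4"
  assumes z: "(q $ 2, q $ 3, p, b) \<in> phase_dom"
  shows "surj (bl_vec q)"
proof (rule linear_inj_imp_surj[OF bl_vec_linear])
  have r: "q $ 2 \<noteq> 0" "sin (q $ 3) \<noteq> 0" using phase_dom_simps[OF z] by auto
  define st ct sp cp where "st = sin (q $ 3)" and "ct = cos (q $ 3)" and "sp = sin (q $ 4)" and "cp = cos (q $ 4)"
  have T: "st\<^sup>2 + ct\<^sup>2 = 1" "sp\<^sup>2 + cp\<^sup>2 = 1" by (simp_all add: st_def ct_def sp_def cp_def)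
  show "inj (bl_vec q)"
    unfolding linear_injective_0[OF bl_vec_linear]
  proof (intro allI impI)
    fix c assume "bl_vec q c = 0"
    then have e: "c $ 1 = 0"
      "c $ 2 * st * cp + q $ 2 * (c $ 3 * ct) * cp - q $ 2 * st * (c $ 4 * sp) = 0"
      "c $ 2 * st * sp + q $ 2 * (c $ 3 * ct) * sp + q $ 2 * st * (c $ 4 * cp) = 0"
      "c $ 2 * ct - q $ 2 * (c $ 3 * st) = 0"
      unfolding bl_vec_eq st_def ct_def sp_def cp_def by (simp_all add: vec_eq_iff forall_4)
    have 4: "q $ 2 * st * c $ 4 = 0" using e(2,3) T(2) by algebra
    have h: "c $ 2 * st + q $ 2 * (c $ 3 * ct) = 0" using e(2,3) T(2) by algebra
    have 2: "c $ 2 = 0" using h e(4) T(1) by algebra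
    have 3: "q $ 2 * c $ 3 = 0" using h e(4) T(1) by algebra
    show "c = 0" using e(1) 2 3 4 r by (simp add: vec_eq_iff forall_4 st_def)
  qed
qed

text \<open>Testing against the coordinate frame determines a vector, since
  \<open>lower_inverse\<close> recovers its components from the lowered ones. It provides both
  invertibility of the matrix and the final uniqueness in \<open>cone_chart_spray\<close>.\<close>

lemma metric_nondegenerate:
  fixes q :: "real^4"
  assumes z: "(q $ 2, q $ 3, p, b) \<in> phase_dom"
    and u: "\<And>j. kerr_metric M a (bl_point q) u (bl_vec q (axis j 1)) = 0"
  shows "u = 0"
proof -
  obtain d where d: "u = bl_vec q d" using bl_vec_surj[OF z] by (metis surjD)
  have l: "bl_lower M a q d j = 0" for j using u[of j] by (simp add: bl_lower_def d)
  have pos: "De (q $ 2) \<noteq> 0" "sin (q $ 3) \<noteq> 0" "Sg (q $ 2) (q $ 3) \<noteq> 0" "q $ 2 > 0" using phase_dom_simps[OF z] by auto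
  note inv = lower_inverse[OF z, of d, unfolded l]
  have "d $ 1 = 0" "d $ 2 = 0" "d $ 3 = 0" using inv(1,4,5) pos by auto
  moreover have "(q $ 2)\<^sup>2 + a\<^sup>2 \<noteq> 0" using pos(4) by (simp add: sum_power2_eq_zero_iff)
  then have "d $ 4 = 0" using inv(3) pos \<open>d $ 1 = 0\<close> by simp
  ultimately have "d = 0" by (simp add: vec_eq_iff forall_4)
  then show ?thesis using linear_0[OF bl_vec_linear] by (simp add: d)
qed

lemma metric_matrix_invertible:
  fixes q :: "real^4"
  assumes z: "(q $ 2, q $ 3, p, b) \<in> phase_dom"
  shows "invertible (metric_matrix M a (bl_point q))"
proof -
  have "u = 0" if "metric_matrix M a (bl_point q) *v u = 0" for u
  proof (rule metric_nondegenerate[OF z])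
    fix j
    have "kerr_metric M a (bl_point q) u w = (\<Sum>k\<in>UNIV. w $ k * (metric_matrix M a (bl_point q) *v u) $ k)" for w
      unfolding matrix_mult_metric by (subst linear_axis_sum[OF kerr_metric_linear(2)]) simp
    then show "kerr_metric M a (bl_point q) u (bl_vec q (axis j 1)) = 0" by (simp add: that)
  qed
  then show ?thesis
    by (simp add: invertible_left_inverse matrix_left_invertible_ker)
qed

definition bl_coord :: "(real \<times> real \<times> real \<times> real \<times> real) \<times> real \<Rightarrow> real^4" where
  "bl_coord y = vector [fst (fst y), zr (snd (fst y)), z\<theta> (snd (fst y)), snd y]"

text \<open>Parametrises the slice v_phi = \<open>L\<close> of the cone by ((t, r, theta, p, b),
  phi). The angle comes last so that it can be integrated out, and \<open>L\<close> is a parameter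
  because the spray is tangent to the slices.\<close>

definition cone_chart :: "real \<Rightarrow> (real \<times> real \<times> real \<times> real \<times> real) \<times> real \<Rightarrow> (real^4) \<times> (real^4)" where
  "cone_chart L y = (bl_point (bl_coord y), bl_vec (bl_coord y) (bl_comp L (snd (fst y))))"

lemma bl_coord_nth [simp]: "bl_coord y $ 1 = fst (fst y)" "bl_coord y $ 2 = zr (snd (fst y))" "bl_coord y $ 3 = z\<theta> (snd (fst y))" "bl_coord y $ 4 = snd y"
  by (simp_all add: bl_coord_def)

lemma C1_bl_comp:
  assumes L: "L \<noteq> 0" shows "Ck_on (Suc 0) (bl_comp L) phase_dom"
proof -
  have "De (zr z) * Sg (zr z) (z\<theta> z) \<noteq> 0" "De (zr z) \<noteq> 0" "Sg (zr z) (z\<theta> z) \<noteq> 0" "(sin (z\<theta> z))\<^sup>2 \<noteq> 0" if "z \<in> phase_dom" for z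
    using phase_dom_simps(1-4)[OF that] by auto
  then show ?thesis
    unfolding bl_comp_def[abs_def] by (intro C1_intros C1_ham_root C1_ham L) auto
qed

lemma C1_cone_chart:
  assumes L: "L \<noteq> 0" shows "Ck_on (Suc 0) (cone_chart L) ((UNIV \<times> phase_dom) \<times> UNIV)"
proof -
  have bl_coord: "Ck_on (Suc 0) bl_coord S" for S unfolding bl_coord_def[abs_def] by (intro C1_intros)
  have c: "Ck_on (Suc 0) (\<lambda>y. bl_comp L (snd (fst y))) ((UNIV \<times> phase_dom) \<times> UNIV)"
    by (rule C1_compose[OF _ C1_bl_comp[OF L]]) (auto intro!: C1_intros simp del: Ck_on.simps)
  show ?thesis
    unfolding cone_chart_def[abs_def]
    by (intro C1_Pair C1_bl_vec bl_coord c C1_compose[OF bl_coord C1_bl_point[of UNIV]]) simp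
qed

lemma cone_chart_cone:
  assumes "z \<in> phase_dom" "L \<noteq> 0"
  shows "cone_chart L ((t, z), \<phi>) \<in> future_cone M a"
  using bl_comp_cone[of "bl_coord ((t, z), \<phi>)" "zp z" "zb z" L] assms phase_dom_simps(7)[OF assms] by (simp add: cone_chart_def)

text \<open>The factor v^t = \<open>bl_comp L z $ 1\<close> passes from the time t to the affine
  parameter. The positions agree by construction; for the accelerations both sides are compared
  after pairing with the coordinate frame, where the Hamiltonian and Lagrangian forms of the
  equations meet.\<close>

lemma cone_chart_spray:
  assumes z: "z \<in> phase_dom" and L: "L \<noteq> 0"
  shows "frechet_derivative (cone_chart L) (at ((t, z), \<phi>)) (bl_comp L z $ 1 *\<^sub>R ((1, ham_field L z), bl_comp L z $ 4 / bl_comp L z $ 1)) = geodesic_spray M a (cone_chart L ((t, z), \<phi>))"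
proof -
  obtain r \<theta> p b where z': "z = (r, \<theta>, p, b)" by (cases z)
  note zz = z[unfolded z']
  define y where "y = ((t, z), \<phi>)"
  define q where "q = bl_coord y"
  define c where "c = bl_comp L z"
  define E where "E = ham L z"
  define w :: "(real \<times> real \<times> real \<times> real \<times> real) \<times> real" where "w = c $ 1 *\<^sub>R ((1, ham_field L z), c $ 4 / c $ 1)"
  define v where "v = bl_vec q c"
  define x where "x = bl_point q"
  have q: "q $ 2 = r" "q $ 3 = \<theta>" by (simp_all add: q_def y_def z')
  have zq: "(q $ 2, q $ 3, p, b) \<in> phase_dom" using zz by (simp add: q)
  have pos: "De r \<noteq> 0" "sin \<theta> \<noteq> 0" "Sg r \<theta> \<noteq> 0" "ham_root L z \<noteq> 0" "rp < r"
    using phase_dom_simps(1-6)[OF zz] phase_dom_simps(7)[OF z L] by auto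
  have c1: "c $ 1 \<noteq> 0" using pos by (simp add: c_def bl_comp_def z')
  \<comment> \<open>\<open>pd\<close> and \<open>bd\<close> are the rates of v_r and v_theta in the
    affine parameter: the square root in \<open>ham_field\<close> cancels against v^t.\<close>
  define pd where "pd = - null_form_r L r p E / (2 * Sg r \<theta>)"
  define bd where "bd = - null_form_\<theta> L \<theta> E / (2 * Sg r \<theta>)"
  have w: "w = ((c $ 1, c $ 2, c $ 3, pd, bd), c $ 4)"
    using pos c1 by (simp add: w_def ham_field_def Let_def z' c_def bl_comp_def pd_def bd_def E_def field_simps)
  have qs: "bl_coord (y + s *\<^sub>R w) = q + s *\<^sub>R c" for s
    by (simp add: q_def y_def w z' vec_eq_iff forall_4)
  let ?zs = "\<lambda>s. (r + s * c $ 2, \<theta> + s * c $ 3, p + s * pd, b + s * bd)"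
  have zs: "snd (fst (y + s *\<^sub>R w)) = ?zs s" for s
    by (simp add: y_def w z')
  have ym: "y \<in> (UNIV \<times> phase_dom) \<times> UNIV" using z by (simp add: y_def)
  have phase_dom_ev: "\<exists>U. open U \<and> 0 \<in> U \<and> (\<forall>s\<in>U. ?zs s \<in> phase_dom)"
  proof -
    have "open (?zs -` phase_dom)" by (rule open_vimage[OF open_phase_dom]) (intro continuous_intros)
    then show ?thesis using zz by (intro exI[of _ "?zs -` phase_dom"]) auto
  qed
  then obtain U where U: "open U" "0 \<in> U" "\<And>s. s \<in> U \<Longrightarrow> ?zs s \<in> phase_dom" by blast
  define A where "A = frechet_derivative (cone_chart L) (at y) w"
  have Acurve: "((\<lambda>s. cone_chart L (y + s *\<^sub>R w)) has_vector_derivative A) (at 0)"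
    unfolding A_def by (rule has_derivative_curve[OF C1_has_derivative[OF C1_cone_chart[OF L] ym]])
  have X: "((\<lambda>s. bl_point (q + s *\<^sub>R c)) has_vector_derivative v) (at 0)"
    unfolding v_def by (rule has_derivative_curve[OF bl_point_derivative])
  have "((\<lambda>s. bl_point (q + s *\<^sub>R c)) has_vector_derivative fst A) (at 0)"
    using bounded_linear.has_vector_derivative[OF bounded_linear_fst Acurve] by (simp add: cone_chart_def qs)
  then have A1: "fst A = v" using X by (rule vector_derivative_unique_at)
  have V: "((\<lambda>s. bl_vec (q + s *\<^sub>R c) (bl_comp L (?zs s))) has_vector_derivative snd A) (at 0)"
  proof -
    have "snd (cone_chart L (y + s *\<^sub>R w)) = bl_vec (q + s *\<^sub>R c) (bl_comp L (?zs s))" for s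
      unfolding cone_chart_def qs zs by simp
    then show ?thesis
      using bounded_linear.has_vector_derivative[OF bounded_linear_snd Acurve] by (simp only:)
  qed
  have ext: "x \<in> kerr_exterior M a" unfolding x_def by (rule bl_exterior) (simp add: q pos)
  let ?B = "snd (geodesic_spray M a (x, v))"
  \<comment> \<open>Two quantities are differentiated in two ways each: the j-th lowered component
    along the flow (\<open>m1\<close>, \<open>m2\<close>), and g(c, c) in direction j at fixed
    components (\<open>n1\<close>, \<open>n2\<close>). Eliminating the common
    \<open>bl_hessian\<close> term leaves the equation of
    \<open>geodesic_spray_lower\<close>.\<close>
  have key: "kerr_metric M a x (snd A - ?B) (bl_vec q (axis j 1)) = 0" for j
  proof -
    let ?e = "axis j 1 :: real^4"
    \<comment> \<open>The zeros express that v_t and v_phi are conserved.\<close>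
    define md where "md = (vector [0, pd, bd, 0] :: real^4) $ j"
    have W: "((\<lambda>s. bl_vec (q + s *\<^sub>R c) ?e) has_vector_derivative bl_hessian q ?e c) (at 0)"
      by (rule bl_vec_curve)
    have m1: "((\<lambda>s. kerr_metric M a (bl_point (q + s *\<^sub>R c)) (bl_vec (q + s *\<^sub>R c) (bl_comp L (?zs s))) (bl_vec (q + s *\<^sub>R c) ?e)) has_real_derivative
        dmetric M a x v v (bl_vec q ?e) + kerr_metric M a x (snd A) (bl_vec q ?e) + kerr_metric M a x v (bl_hessian q ?e c)) (at 0)"
      using metric_curve[OF X V W] ext by (simp add: x_def v_def c_def z')
    have m2: "((\<lambda>s. kerr_metric M a (bl_point (q + s *\<^sub>R c)) (bl_vec (q + s *\<^sub>R c) (bl_comp L (?zs s))) (bl_vec (q + s *\<^sub>R c) ?e)) has_real_derivative md) (at 0)"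
    proof (rule has_field_derivative_transform_within_open[OF _ U(1,2)])
      show "((\<lambda>s. (vector [- ham L (?zs s), p + s * pd, b + s * bd, L] :: real^4) $ j) has_real_derivative md) (at 0)"
      proof -
        have "((\<lambda>s. ham L (z + s *\<^sub>R (c $ 1 *\<^sub>R ham_field L z))) has_vector_derivative frechet_derivative (ham L) (at z) (c $ 1 *\<^sub>R ham_field L z)) (at 0)"
          by (rule has_derivative_curve[OF C1_has_derivative[OF C1_ham[OF L] z]])
        moreover have "frechet_derivative (ham L) (at z) (c $ 1 *\<^sub>R ham_field L z) = 0"
          using linear_scale[OF has_derivative_linear[OF C1_has_derivative[OF C1_ham[OF L] z]]] ham_conserved[OF z L] by simp
        moreover have "z + s *\<^sub>R (c $ 1 *\<^sub>R ham_field L z) = ?zs s" for s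
          using zs[of s] unfolding w_def y_def by simp
        ultimately have "((\<lambda>s. ham L (?zs s)) has_real_derivative 0) (at 0)"
          by (simp add: has_real_derivative_iff_has_vector_derivative)
        then show ?thesis
          using exhaust_4[of j] unfolding md_def
          by (elim disjE; simp only: vector_4) (auto intro!: derivative_eq_intros)
      qed
      fix s assume "s \<in> U"
      from U(3)[OF this] have "((q + s *\<^sub>R c) $ 2, (q + s *\<^sub>R c) $ 3, p + s * pd, b + s * bd) \<in> phase_dom" by (simp add: q)
      from bl_comp_lower[OF this, of L] 
      show "(vector [- ham L (?zs s), p + s * pd, b + s * bd, L] :: real^4) $ j =
          kerr_metric M a (bl_point (q + s *\<^sub>R c)) (bl_vec (q + s *\<^sub>R c) (bl_comp L (?zs s))) (bl_vec (q + s *\<^sub>R c) ?e)"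
        using exhaust_4[of j] unfolding bl_lower_def by (auto simp: q)
    qed
    have X2: "((\<lambda>s. bl_point (q + s *\<^sub>R ?e)) has_vector_derivative bl_vec q ?e) (at 0)"
      by (rule has_derivative_curve[OF bl_point_derivative])
    have V2: "((\<lambda>s. bl_vec (q + s *\<^sub>R ?e) c) has_vector_derivative bl_hessian q c ?e) (at 0)"
      by (rule bl_vec_curve)
    have n1: "((\<lambda>s. kerr_metric M a (bl_point (q + s *\<^sub>R ?e)) (bl_vec (q + s *\<^sub>R ?e) c) (bl_vec (q + s *\<^sub>R ?e) c)) has_real_derivative
        dmetric M a x (bl_vec q ?e) v v + 2 * kerr_metric M a x v (bl_hessian q ?e c)) (at 0)"
      using metric_curve[OF X2 V2 V2] ext kerr_metric_sym[of M a x v "bl_hessian q c ?e"] bl_hessian_sym[of q c ?e] by (simp add: x_def v_def add.commute)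
    have n2: "((\<lambda>s. kerr_metric M a (bl_point (q + s *\<^sub>R ?e)) (bl_vec (q + s *\<^sub>R ?e) c) (bl_vec (q + s *\<^sub>R ?e) c)) has_real_derivative 2 * md) (at 0)"
    proof -
      let ?f = "\<lambda>r \<theta>. (- De r * frame_t r \<theta> c * frame_t r \<theta> c + (sin \<theta>)\<^sup>2 * frame_\<phi> r c * frame_\<phi> r c) / Sg r \<theta>
        + Sg r \<theta> / De r * (c $ 2 * c $ 2) + Sg r \<theta> * (c $ 3 * c $ 3)"
      have eq: "kerr_metric M a (bl_point (q + s *\<^sub>R ?e)) (bl_vec (q + s *\<^sub>R ?e) c) (bl_vec (q + s *\<^sub>R ?e) c)
          = ?f (r + s * ?e $ 2) (\<theta> + s * ?e $ 3)" if "rp < r + s * ?e $ 2" for s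
        using metric_carter[of "q + s *\<^sub>R ?e" c c] that by (simp add: q)
      have op: "open {s. rp < r + s * ?e $ 2}" by (intro open_Collect_less continuous_intros)
      have z0: "0 \<in> {s. rp < r + s * ?e $ 2}" using pos by simp
      have d: "((\<lambda>s. ?f (r + s * ?e $ 2) (\<theta> + s * ?e $ 3)) has_real_derivative 2 * md) (at 0)"
      proof -
        consider "j = 1 \<or> j = 4" | "j = 2" | "j = 3" using exhaust_4[of j] by blast
        then show ?thesis
        proof cases
          case 1 then show ?thesis by (auto simp: md_def axis_def)
        next
          case 2
          have "((\<lambda>s. r + s) has_real_derivative 1) (at 0)" by (auto intro!: derivative_eq_intros)
          from DERIV_chain2[OF _ this, of "\<lambda>r. ?f r \<theta>"] lagrangian_r[OF zz, of L]
          have "((\<lambda>s. ?f (r + s) \<theta>) has_real_derivative - null_form_r L r p E / Sg r \<theta>) (at 0)"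
            by (simp add: c_def E_def z')
          then show ?thesis using 2 by (simp add: md_def axis_def pd_def)
        next
          case 3
          have "((\<lambda>s. \<theta> + s) has_real_derivative 1) (at 0)" by (auto intro!: derivative_eq_intros)
          from DERIV_chain2[OF _ this, of "\<lambda>\<theta>. ?f r \<theta>"] lagrangian_theta[OF zz, of L]
          have "((\<lambda>s. ?f r (\<theta> + s)) has_real_derivative - null_form_\<theta> L \<theta> E / Sg r \<theta>) (at 0)"
            by (simp add: c_def E_def z')
          then show ?thesis using 3 by (simp add: md_def axis_def bd_def)
        qed
      qed
      show ?thesis
        by (rule has_field_derivative_transform_within_open[OF d op z0]) (simp only: eq mem_Collect_eq)
    qed
    have "kerr_metric M a x (snd A) (bl_vec q ?e) = dmetric M a x (bl_vec q ?e) v v / 2 - dmetric M a x v v (bl_vec q ?e)"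
      using DERIV_unique[OF m1 m2] DERIV_unique[OF n1 n2] by simp
    also have "\<dots> = kerr_metric M a x ?B (bl_vec q ?e)"
      using geodesic_spray_lower[OF metric_matrix_invertible[OF zq], of v "bl_vec q ?e"] by (simp add: x_def)
    finally show ?thesis by (simp add: linear_diff[OF kerr_metric_linear(1)])
  qed
  have "snd A - ?B = 0" by (rule metric_nondegenerate[OF zq]) (use key in \<open>simp add: x_def\<close>)
  then have "A = (v, ?B)" using A1 by (simp add: prod_eq_iff)
  moreover have "geodesic_spray M a (cone_chart L y) = (v, ?B)"
  proof -
    have "cone_chart L y = (x, v)" by (simp add: cone_chart_def q_def x_def v_def c_def y_def)
    moreover have "geodesic_spray M a (x, v) = (v, ?B)" by (simp add: geodesic_spray_def)
    ultimately show ?thesis by simp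
  qed
  ultimately show ?thesis unfolding A_def w_def c_def y_def by simp
qed

end

section \<open>The transport equation\<close>

text \<open>Along a curve that stays in \<open>S\<close>, any derivative of \<open>f\<close> within
  \<open>S\<close> yields the same rate of change. This is how the chosen within-derivative in
  \<open>massless_vlasov\<close> becomes a usable equation.\<close>

lemma has_derivative_within_curve:
  fixes g :: "real \<Rightarrow> 'a::real_normed_vector"
  assumes f: "(f has_derivative f') (at (g 0) within S)" and g: "(g has_vector_derivative v) (at 0)"
    and U: "open U" "0 \<in> U" "\<And>s. s \<in> U \<Longrightarrow> g s \<in> S"
  shows "((\<lambda>s. f (g s)) has_vector_derivative f' v) (at 0)"
proof -
  have "(g has_derivative (\<lambda>h. h *\<^sub>R v)) (at 0 within U)"
    using g unfolding has_vector_derivative_def by (rule has_derivative_at_withinI)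
  moreover have "(f has_derivative f') (at (g 0) within g ` U)"
    by (rule has_derivative_subset[OF f]) (use U in auto)
  ultimately have "((\<lambda>s. f (g s)) has_derivative (\<lambda>h. f' (h *\<^sub>R v))) (at 0 within U)"
    by (rule has_derivative_in_compose)
  then show ?thesis
    unfolding has_vector_derivative_def at_within_open[OF U(2,1)]
    by (simp add: linear_scale[OF has_derivative_linear[OF f]])
qed

lemma smooth_on_submanifold_C1:
  assumes "smooth_on_submanifold f S" "p \<in> S"
  obtains U F where "open U" "p \<in> U" "Ck_on (Suc 0) F U" "\<And>q. q \<in> U \<Longrightarrow> q \<in> S \<Longrightarrow> F q = f q"
  using assms unfolding smooth_on_submanifold_def by (metis IntI)

text \<open>A local extension supplies some derivative within \<open>S\<close>; hence the one chosen
  by \<open>frechet_derivative\<close> is a derivative too, though possibly a different linear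
  map.\<close>

lemma smooth_on_submanifold_has_derivative:
  assumes "smooth_on_submanifold f S" "p \<in> S"
  shows "(f has_derivative frechet_derivative f (at p within S)) (at p within S)"
proof -
  obtain U F where U: "open U" "p \<in> U" "Ck_on (Suc 0) F U" "\<And>q. q \<in> U \<Longrightarrow> q \<in> S \<Longrightarrow> F q = f q"
    using smooth_on_submanifold_C1[OF assms] by blast
  have "(F has_derivative frechet_derivative F (at p)) (at p within S)"
    by (rule has_derivative_at_withinI[OF C1_has_derivative[OF U(3,2)]])
  moreover have "\<forall>\<^sub>F q in at p within S. F q = f q"
    using U(1,2,4) by (auto simp: eventually_at_topological)
  ultimately have "(f has_derivative frechet_derivative F (at p)) (at p within S)"
    using U(2,4) assms(2) by (auto elim: has_derivative_transform_eventually)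
  then show ?thesis unfolding frechet_derivative_works[symmetric] differentiable_def by blast
qed

lemma smooth_on_submanifold_compose:
  fixes g :: "'a::euclidean_space \<Rightarrow> 'b::euclidean_space"
  assumes f: "smooth_on_submanifold f S" and g: "Ck_on (Suc 0) g T" and T: "open T" and gT: "\<And>x. x \<in> T \<Longrightarrow> g x \<in> S"
  shows "Ck_on (Suc 0) (\<lambda>x. f (g x)) T"
proof (rule C1_local)
  fix x assume x: "x \<in> T"
  obtain U F where U: "open U" "g x \<in> U" "Ck_on (Suc 0) F U" "\<And>q. q \<in> U \<Longrightarrow> q \<in> S \<Longrightarrow> F q = f q"
    using smooth_on_submanifold_C1[OF f gT[OF x]] by blast
  have op: "open (g -` U \<inter> T)"
    using C1_continuous_on[OF g] T U(1) by (simp add: continuous_on_open_vimage)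
  have "Ck_on (Suc 0) (\<lambda>x. F (g x)) (g -` U \<inter> T)"
    by (rule C1_compose[OF C1_subset[OF g] U(3)]) auto
  then have "Ck_on (Suc 0) (\<lambda>x. f (g x)) (g -` U \<inter> T)"
    by (rule C1_cong[OF op, rotated]) (use U(4) gT in auto)
  then show "\<exists>V. open V \<and> x \<in> V \<and> Ck_on (Suc 0) (\<lambda>x. f (g x)) V"
    using op x U(2) by blast
qed

lemma C1_integral:
  fixes F :: "'a::euclidean_space \<times> real \<Rightarrow> real"
  assumes F: "Ck_on (Suc 0) F (U \<times> UNIV)" and U: "open U" "convex U"
  shows "Ck_on (Suc 0) (\<lambda>x. integral (cbox 0 b) (\<lambda>s. F (x, s))) U"
    and "x \<in> U \<Longrightarrow> frechet_derivative (\<lambda>x. integral (cbox 0 b) (\<lambda>s. F (x, s))) (at x) v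
      = integral (cbox 0 b) (\<lambda>s. frechet_derivative F (at (x, s)) (v, 0))"
proof -
  \<comment> \<open>As bounded operators the derivatives depend continuously on the point, which in
    finite dimension follows from continuity on each basis vector.\<close>
  define dF where "dF x s = Blinfun (\<lambda>h. frechet_derivative F (at (x, s)) (h, 0))" for x s
  have D: "((\<lambda>x. F (x, s)) has_derivative (\<lambda>h. frechet_derivative F (at (x, s)) (h, 0))) (at x)" if "x \<in> U" for x s
  proof -
    have "((\<lambda>x. (x, s)) has_derivative (\<lambda>h. (h, 0))) (at x)" by (auto intro!: derivative_eq_intros)
    from has_derivative_compose[OF this C1_has_derivative[OF F]] that show ?thesis by simp
  qed
  have ap: "blinfun_apply (dF x s) = (\<lambda>h. frechet_derivative F (at (x, s)) (h, 0))" if "x \<in> U" for x s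
    unfolding dF_def by (rule bounded_linear_Blinfun_apply[OF has_derivative_bounded_linear[OF D[OF that]]])
  have Dc: "continuous_on (U \<times> cbox 0 b) (\<lambda>(x, s). frechet_derivative F (at (x, s)) (v, 0))" for v
    using continuous_on_subset[OF C1_continuous_derivative[OF F, of "(v, 0)"], of "U \<times> cbox 0 b"] by (auto simp: case_prod_unfold)
  have dFc: "continuous_on (U \<times> cbox 0 b) (\<lambda>(x, s). dF x s)"
  proof (rule continuous_on_blinfun_componentwise)
    fix i :: 'a
    show "continuous_on (U \<times> cbox 0 b) (\<lambda>x. blinfun_apply (case x of (x, s) \<Rightarrow> dF x s) i)"
      using Dc[of i] by (rule continuous_on_eq) (auto simp: ap)
  qed
  have Fc: "continuous_on (cbox 0 b) (\<lambda>s. F (x, s))" if "x \<in> U" for x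
    by (intro continuous_on_compose2[OF C1_continuous_on[OF F]] continuous_intros) (use that in auto)
  have der: "((\<lambda>x. integral (cbox 0 b) (\<lambda>s. F (x, s))) has_derivative
      (\<lambda>v. integral (cbox 0 b) (\<lambda>s. frechet_derivative F (at (x, s)) (v, 0)))) (at x)" if x: "x \<in> U" for x
  proof -
    have "((\<lambda>x. integral (cbox 0 b) (\<lambda>s. F (x, s))) has_derivative integral (cbox 0 b) (dF x)) (at x within U)"
      by (rule leibniz_rule[OF _ _ dFc x U(2)])
        (simp_all only: ap has_derivative_at_withinI D integrable_continuous[OF Fc])
    moreover have "blinfun_apply (integral (cbox 0 b) (dF x)) v = integral (cbox 0 b) (\<lambda>s. frechet_derivative F (at (x, s)) (v, 0))" for v
    proof -
      have "continuous_on (cbox 0 b) (\<lambda>s. case (x, s) of (x, s) \<Rightarrow> dF x s)"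
        by (rule continuous_on_compose2[OF dFc]) (use x in \<open>auto intro!: continuous_intros\<close>)
      then have "dF x integrable_on cbox 0 b" by (intro integrable_continuous) simp
      then show ?thesis by (simp add: blinfun_apply_integral ap[OF x])
    qed
    ultimately show ?thesis unfolding at_within_open[OF x U(1)] by (auto elim!: has_derivative_eq_rhs)
  qed
  show "Ck_on (Suc 0) (\<lambda>x. integral (cbox 0 b) (\<lambda>s. F (x, s))) U"
    by (rule C1_I[OF der]) (use integral_continuous_on_param[OF Dc] in auto)
  show "frechet_derivative (\<lambda>x. integral (cbox 0 b) (\<lambda>s. F (x, s))) (at x) v
      = integral (cbox 0 b) (\<lambda>s. frechet_derivative F (at (x, s)) (v, 0))" if "x \<in> U"
    by (rule fun_cong[OF frechet_derivative_eqI[OF der[OF that]]])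
qed

locale kerr_vlasov = kerr_bl +
  fixes f :: "(real^4) \<times> (real^4) \<Rightarrow> real"
  assumes f_smooth: "smooth_on_submanifold f (future_cone M a)"
    and f_nonneg: "\<And>p. p \<in> future_cone M a \<Longrightarrow> 0 \<le> f p"
    and f_vlasov: "massless_vlasov M a f"
begin

definition F_cone :: "real \<Rightarrow> (real \<times> real \<times> real \<times> real \<times> real) \<times> real \<Rightarrow> real" where
  "F_cone L y = f (cone_chart L y)"

lemma open_chart: "open ((UNIV \<times> phase_dom) \<times> (UNIV :: real set))"
  using open_phase_dom by (intro open_Times) auto

lemma C1_F_cone:
  assumes L: "L \<noteq> 0" shows "Ck_on (Suc 0) (F_cone L) ((UNIV \<times> phase_dom) \<times> UNIV)"
  unfolding F_cone_def[abs_def]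
  by (rule smooth_on_submanifold_compose[OF f_smooth C1_cone_chart[OF L] open_chart]) (use cone_chart_cone[OF _ L] in auto)

text \<open>The vector is the flow in the parameter t, lifted to the angle by dphi/dt = v^phi / v^t.
  Dividing the spray equation by v^t, which is nonzero, gives it.\<close>

lemma F_cone_transport:
  assumes z: "z \<in> phase_dom" and L: "L \<noteq> 0"
  shows "frechet_derivative (F_cone L) (at ((t, z), \<phi>)) ((1, ham_field L z), bl_comp L z $ 4 / bl_comp L z $ 1) = 0"
proof -
  let ?y = "((t, z), \<phi>)"
  let ?u = "((1, ham_field L z), bl_comp L z $ 4 / bl_comp L z $ 1)"
  define w :: "(real \<times> real \<times> real \<times> real \<times> real) \<times> real" where "w = bl_comp L z $ 1 *\<^sub>R ?u"
  have ym: "?y \<in> (UNIV \<times> phase_dom) \<times> UNIV" using z by simp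
  have D: "(F_cone L has_derivative frechet_derivative (F_cone L) (at ?y)) (at ?y)"
    by (rule C1_has_derivative[OF C1_F_cone[OF L] ym])
  have 1: "((\<lambda>s. F_cone L (?y + s *\<^sub>R w)) has_vector_derivative frechet_derivative (F_cone L) (at ?y) w) (at 0)"
    by (rule has_derivative_curve[OF D])
  have cone: "cone_chart L ?y \<in> future_cone M a" by (rule cone_chart_cone[OF z L])
  let ?f' = "frechet_derivative f (at (cone_chart L ?y) within future_cone M a)"
  let ?U = "(\<lambda>s. ?y + s *\<^sub>R w) -` ((UNIV \<times> phase_dom) \<times> UNIV)"
  have "((\<lambda>s. f (cone_chart L (?y + s *\<^sub>R w))) has_vector_derivative ?f' (frechet_derivative (cone_chart L) (at ?y) w)) (at 0)"
  proof (rule has_derivative_within_curve[where U="?U" and f=f and S="future_cone M a" and f'="?f'"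
      and v="frechet_derivative (cone_chart L) (at ?y) w" and g="\<lambda>s. cone_chart L (?y + s *\<^sub>R w)"])
    show "(f has_derivative ?f') (at (cone_chart L (?y + 0 *\<^sub>R w)) within future_cone M a)"
      using smooth_on_submanifold_has_derivative[OF f_smooth cone] by simp
    show "((\<lambda>s. cone_chart L (?y + s *\<^sub>R w)) has_vector_derivative frechet_derivative (cone_chart L) (at ?y) w) (at 0)"
      by (rule has_derivative_curve[OF C1_has_derivative[OF C1_cone_chart[OF L] ym]])
    show "open ?U" by (rule open_vimage[OF open_chart]) (intro continuous_intros)
    show "0 \<in> ?U" using ym by simp
    fix s assume "s \<in> ?U"
    then have "snd (fst (?y + s *\<^sub>R w)) \<in> phase_dom" unfolding vimage_eq mem_Times_iff by blast
    from cone_chart_cone[OF this L, of "fst (fst (?y + s *\<^sub>R w))" "snd (?y + s *\<^sub>R w)"]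
    show "cone_chart L (?y + s *\<^sub>R w) \<in> future_cone M a" by (simp only: prod.collapse)
  qed
  moreover have "?f' (frechet_derivative (cone_chart L) (at ?y) w) = 0"
    unfolding w_def cone_chart_spray[OF z L] using f_vlasov cone by (simp add: massless_vlasov_def)
  ultimately have "((\<lambda>s. F_cone L (?y + s *\<^sub>R w)) has_vector_derivative 0) (at 0)"
    by (simp only: F_cone_def)
  from vector_derivative_unique_at[OF 1 this]
  have "bl_comp L z $ 1 *\<^sub>R frechet_derivative (F_cone L) (at ?y) ?u = 0"
    unfolding w_def linear_scale[OF has_derivative_linear[OF D]] .
  moreover have "bl_comp L z $ 1 \<noteq> 0" using phase_dom_simps(1-6)[OF z] phase_dom_simps(7)[OF z L] by (simp add: bl_comp_def)
  ultimately show ?thesis by simp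
qed

text \<open>Averaging over \<open>\<phi>\<close> removes the \<open>\<phi>\<close>-derivative from the transport equation.\<close>

definition F_avg :: "real \<Rightarrow> real \<times> real \<times> real \<times> real \<times> real \<Rightarrow> real" where
  "F_avg L x = integral (cbox 0 (2 * pi)) (\<lambda>\<phi>. F_cone L (x, \<phi>))"

lemma convex_phase_dom: "convex phase_dom"
  unfolding phase_dom_def by (intro convex_Times) auto

lemma C1_F_avg:
  assumes L: "L \<noteq> 0" shows "Ck_on (Suc 0) (F_avg L) (UNIV \<times> phase_dom)"
  unfolding F_avg_def[abs_def]
  by (rule C1_integral(1)[OF C1_F_cone[OF L]]) (auto intro!: open_Times open_phase_dom convex_Times convex_phase_dom)

lemma F_cone_continuous:
  assumes z: "z \<in> phase_dom" and L: "L \<noteq> 0"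
  shows "continuous_on S (\<lambda>\<phi>. F_cone L ((t, z), \<phi>))"
  by (rule continuous_on_compose2[OF C1_continuous_on[OF C1_F_cone[OF L]]]) (use z in \<open>auto intro!: continuous_intros\<close>)

lemma F_cone_nonneg: "z \<in> phase_dom \<Longrightarrow> L \<noteq> 0 \<Longrightarrow> 0 \<le> F_cone L ((t, z), \<phi>)"
  unfolding F_cone_def by (intro f_nonneg cone_chart_cone)

lemma F_avg_nonneg: "z \<in> phase_dom \<Longrightarrow> L \<noteq> 0 \<Longrightarrow> 0 \<le> F_avg L (t, z)"
  unfolding F_avg_def by (intro integral_nonneg integrable_continuous F_cone_continuous F_cone_nonneg)

text \<open>By axisymmetry the coefficient v^phi / v^t is independent of phi, so the phi-derivative
  integrates to a boundary term, which vanishes by periodicity of the chart.\<close>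

lemma F_avg_transport:
  assumes z: "z \<in> phase_dom" and L: "L \<noteq> 0"
  shows "frechet_derivative (F_avg L) (at (t, z)) (1, ham_field L z) = 0"
proof -
  let ?k = "bl_comp L z $ 4 / bl_comp L z $ 1"
  let ?D = "\<lambda>\<phi>. frechet_derivative (F_cone L) (at ((t, z), \<phi>))"
  have D: "(F_cone L has_derivative ?D \<phi>) (at ((t, z), \<phi>))" for \<phi>
    by (rule C1_has_derivative[OF C1_F_cone[OF L]]) (use z in simp)
  have eq: "?D \<phi> ((1, ham_field L z), 0) = - ?k * ?D \<phi> (0, 1)" for \<phi>
  proof -
    have "?D \<phi> ((1, ham_field L z), ?k) = ?D \<phi> ((1, ham_field L z), 0) + ?k * ?D \<phi> (0, 1)"
      using linear_add[OF has_derivative_linear[OF D], of \<phi> "((1, ham_field L z), 0)" "(0, ?k)"]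
        linear_scale[OF has_derivative_linear[OF D], of \<phi> ?k "(0, 1)"] by simp
    then show ?thesis using F_cone_transport[OF z L, of t \<phi>] by simp
  qed
  have per: "F_cone L ((t, z), 2 * pi) = F_cone L ((t, z), 0)"
  proof -
    have "bl_point (bl_coord ((t, z), 2 * pi)) = bl_point (bl_coord ((t, z), 0))" by (simp add: bl_point_def)
    moreover have "bl_vec (bl_coord ((t, z), 2 * pi)) c = bl_vec (bl_coord ((t, z), 0)) c" for c by (simp add: bl_vec_eq)
    ultimately show ?thesis by (simp add: F_cone_def cone_chart_def)
  qed
  have "((\<lambda>\<phi>. ?D \<phi> (0, 1)) has_integral (F_cone L ((t, z), 2 * pi) - F_cone L ((t, z), 0))) {0..2 * pi}"
  proof (rule fundamental_theorem_of_calculus[where f="\<lambda>\<phi>. F_cone L ((t, z), \<phi>)"])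
    fix \<phi>
    have "((\<lambda>\<phi>. ((t, z), \<phi>)) has_derivative (\<lambda>h. (0, h))) (at \<phi> within {0..2 * pi})"
      by (auto intro!: derivative_eq_intros)
    from has_derivative_compose[OF this D]
    have "((\<lambda>\<phi>. F_cone L ((t, z), \<phi>)) has_derivative (\<lambda>h. ?D \<phi> (0, h))) (at \<phi> within {0..2 * pi})" .
    moreover have "(\<lambda>h. ?D \<phi> (0, h)) = (\<lambda>h. h *\<^sub>R ?D \<phi> (0, 1))"
    proof
      fix h show "?D \<phi> (0, h) = h *\<^sub>R ?D \<phi> (0, 1)"
        using linear_scale[OF has_derivative_linear[OF D], of \<phi> h "(0, 1)"] by simp
    qed
    ultimately show "((\<lambda>\<phi>. F_cone L ((t, z), \<phi>)) has_vector_derivative ?D \<phi> (0, 1)) (at \<phi> within {0..2 * pi})"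
      by (simp only: has_vector_derivative_def)
  qed simp
  then have I: "integral (cbox 0 (2 * pi)) (\<lambda>\<phi>. ?D \<phi> (0, 1)) = 0"
    using per by (simp add: integral_unique)
  have "frechet_derivative (F_avg L) (at (t, z)) (1, ham_field L z) = integral (cbox 0 (2 * pi)) (\<lambda>\<phi>. ?D \<phi> ((1, ham_field L z), 0))"
    unfolding F_avg_def[abs_def]
    by (rule C1_integral(2)[OF C1_F_cone[OF L]]) (use z in \<open>auto intro!: open_Times open_phase_dom convex_Times convex_phase_dom\<close>)
  also have "\<dots> = - ?k * integral (cbox 0 (2 * pi)) (\<lambda>\<phi>. ?D \<phi> (0, 1))"
    unfolding eq by (rule integral_mult_right)
  finally show ?thesis using I by simp
qed

end

section \<open>Control of escape along the flow and compact level sets\<close>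

context kerr_bl begin

lemma ham_root_square:
  assumes "(r, \<theta>, p, b) \<in> phase_dom"
  shows "(ham_root L (r, \<theta>, p, b))\<^sup>2 = De r * ((Sg r \<theta>)\<^sup>2 * L\<^sup>2 / (sin \<theta>)\<^sup>2 + PI r \<theta> * (De r * p\<^sup>2 + b\<^sup>2))"
  using ham_root_radicand_nonneg[of r \<theta> L p b] assms by (simp add: ham_root_def phase_dom_iff)

lemma ham_root_ge_L:
  assumes z: "(r, \<theta>, p, b) \<in> phase_dom"
  shows "De r * r ^ 4 * L\<^sup>2 \<le> (ham_root L (r, \<theta>, p, b))\<^sup>2"
proof -
  note pos = phase_dom_simps(1-5)[OF z, simplified]
  have "r\<^sup>2 \<le> Sg r \<theta>" by (simp add: kerr_Sigma_def)
  then have "(r\<^sup>2)\<^sup>2 \<le> (Sg r \<theta>)\<^sup>2" by (intro power_mono) auto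
  then have "r ^ 4 \<le> (Sg r \<theta>)\<^sup>2" by (simp flip: power_mult)
  then have "r ^ 4 * L\<^sup>2 \<le> (Sg r \<theta>)\<^sup>2 * L\<^sup>2" by (intro mult_right_mono) auto
  also have "\<dots> \<le> (Sg r \<theta>)\<^sup>2 * L\<^sup>2 / (sin \<theta>)\<^sup>2"
  proof -
    have "(sin \<theta>)\<^sup>2 \<le> 1" "0 < (sin \<theta>)\<^sup>2" using pos by (simp_all add: abs_square_le_1)
    then show ?thesis by (simp only: pos_le_divide_eq) (intro mult_left_le mult_nonneg_nonneg; simp)
  qed
  also have "\<dots> \<le> (Sg r \<theta>)\<^sup>2 * L\<^sup>2 / (sin \<theta>)\<^sup>2 + PI r \<theta> * (De r * p\<^sup>2 + b\<^sup>2)" using pos by simp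
  finally show ?thesis
    unfolding ham_root_square[OF z] mult.assoc using pos by (intro mult_left_mono) auto
qed

text \<open>A bound on the coordinate speed of light: |dr/dt| = Delta^2 |p| /
  \<open>ham_root\<close> is at most Delta / r^2.\<close>

lemma ham_root_ge_p:
  assumes z: "(r, \<theta>, p, b) \<in> phase_dom"
  shows "De r * r\<^sup>2 * \<bar>p\<bar> \<le> ham_root L (r, \<theta>, p, b)"
proof (rule power2_le_imp_le)
  note pos = phase_dom_simps(1-6)[OF z, simplified]
  have "(De r * r\<^sup>2 * \<bar>p\<bar>)\<^sup>2 = De r * (r ^ 4 * (De r * p\<^sup>2))"
    by (simp add: power_mult_distrib power2_eq_square power4_eq_xxxx)
  also have "\<dots> \<le> De r * (PI r \<theta> * (De r * p\<^sup>2))"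
    using pos Pi_ge[of r \<theta>] by (intro mult_left_mono mult_right_mono) auto
  also have "\<dots> \<le> De r * ((Sg r \<theta>)\<^sup>2 * L\<^sup>2 / (sin \<theta>)\<^sup>2 + PI r \<theta> * (De r * p\<^sup>2 + b\<^sup>2))"
  proof (rule mult_left_mono)
    have "0 \<le> (Sg r \<theta>)\<^sup>2 * L\<^sup>2 / (sin \<theta>)\<^sup>2 + PI r \<theta> * b\<^sup>2" using pos by simp
    then show "PI r \<theta> * (De r * p\<^sup>2) \<le> (Sg r \<theta>)\<^sup>2 * L\<^sup>2 / (sin \<theta>)\<^sup>2 + PI r \<theta> * (De r * p\<^sup>2 + b\<^sup>2)"
      by (simp add: algebra_simps)
  qed (use pos in simp)
  finally show "(De r * r\<^sup>2 * \<bar>p\<bar>)\<^sup>2 \<le> (ham_root L (r, \<theta>, p, b))\<^sup>2" unfolding ham_root_square[OF z] .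
  show "0 \<le> ham_root L (r, \<theta>, p, b)" unfolding ham_root_def using ham_root_radicand_nonneg[OF pos(6)] by simp
qed

text \<open>Blows up at the horizon and at infinity but changes at a rate of at most \<open>2 / M\<close> along the
  flow. This replaces the completeness of the null geodesics in the parameter \<open>t\<close>.\<close>

definition escape :: "real \<times> real \<times> real \<times> real \<Rightarrow> real" where
  "escape z = (zr z - rp) / M - ln ((zr z - rp) / M)"

lemma escape_ge: "z \<in> phase_dom \<Longrightarrow> 1 \<le> escape z"
  using ln_le_minus_one[of "(zr z - rp) / M"] phase_dom_simps(6) M_pos by (simp add: escape_def)

lemma C1_escape: "Ck_on (Suc 0) escape phase_dom"
proof -
  have "M \<noteq> 0" using M_pos by simp
  moreover have "0 < (zr z - rp) / M" if "z \<in> phase_dom" for z :: "real \<times> real \<times> real \<times> real"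
    using phase_dom_simps(6)[OF that] M_pos by simp
  ultimately show ?thesis unfolding escape_def[abs_def] by (intro C1_intros)
qed

text \<open>The radial speed is at most Delta / r^2, which is below 1 and also at most (r - rp) / M.
  The second bound absorbs the 1 / (r - rp) from differentiating the logarithm, so each part of
  \<open>escape\<close> contributes at most 1 / M.\<close>

lemma escape_rate:
  assumes z: "z \<in> phase_dom" and L: "L \<noteq> 0"
  shows "\<bar>frechet_derivative escape (at z) (ham_field L z)\<bar> \<le> 2 / M"
proof -
  obtain r \<theta> p b where z': "z = (r, \<theta>, p, b)" by (cases z)
  note zz = z[unfolded z']
  have r: "rp < r" "0 < r" "M < r" "De r > 0" using zz ext_pos[of r] by (auto simp: phase_dom_iff)
  let ?S = "ham_root L (r, \<theta>, p, b)"
  have S: "0 < ?S" using ham_root_pos[OF zz L] .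
  have "((\<lambda>z. (zr z - rp) / M) has_derivative (\<lambda>h. zr h / M)) (at z)"
    using M_pos by (auto intro!: derivative_eq_intros simp: z')
  then have "(escape has_derivative (\<lambda>h. (1 / M - 1 / (r - rp)) * zr h)) (at z)"
    unfolding escape_def[abs_def] using r M_pos
    by (auto intro!: derivative_eq_intros has_derivative_ln simp: z' fun_eq_iff field_simps)
  then have D: "frechet_derivative escape (at z) (ham_field L z) = (1 / M - 1 / (r - rp)) * (De r * (De r * p) / ?S)"
    by (simp add: frechet_derivative_eqI ham_field_def Let_def z')
  have "De r * \<bar>p\<bar> / ?S \<le> 1 / r\<^sup>2"
    using ham_root_ge_p[OF zz, of L] S r by (simp add: field_simps)
  then have "De r * (De r * \<bar>p\<bar> / ?S) \<le> De r * (1 / r\<^sup>2)" using r by (intro mult_left_mono) auto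
  then have Y: "\<bar>De r * (De r * p) / ?S\<bar> \<le> De r / r\<^sup>2" using r S by (simp add: abs_mult)
  have 1: "De r / r\<^sup>2 \<le> 1"
  proof -
    have "a\<^sup>2 \<le> M\<^sup>2" using a2_le zero_le_power2[of M] by linarith
    moreover have "M\<^sup>2 \<le> M * r" using r M_pos by (simp add: power2_eq_square)
    moreover have "0 \<le> M * r" using r M_pos by simp
    ultimately have "De r \<le> r\<^sup>2" unfolding kerr_Delta_def by linarith
    then show ?thesis using r by simp
  qed
  have 2: "De r / r\<^sup>2 / (r - rp) \<le> 1 / M"
  proof -
    have "De r / r\<^sup>2 / (r - rp) = (r - (2 * M - rp)) / r\<^sup>2" unfolding Delta_factor using r by simp
    also have "\<dots> \<le> r / r\<^sup>2" using rp_bounds by (intro divide_right_mono) auto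
    also have "\<dots> = 1 / r" using r by (simp add: power2_eq_square)
    also have "\<dots> \<le> 1 / M" using r M_pos by (intro divide_left_mono) auto
    finally show ?thesis .
  qed
  have "\<bar>frechet_derivative escape (at z) (ham_field L z)\<bar> \<le> (1 / M + 1 / (r - rp)) * (De r / r\<^sup>2)"
    unfolding D abs_mult
  proof (rule mult_mono)
    show "\<bar>1 / M - 1 / (r - rp)\<bar> \<le> 1 / M + 1 / (r - rp)"
      using abs_triangle_ineq4[of "1 / M" "1 / (r - rp)"] r M_pos by simp
    show "\<bar>De r * (De r * p) / ?S\<bar> \<le> De r / r\<^sup>2" by (rule Y)
  qed (use r M_pos in auto)
  also have "\<dots> = 1 / M * (De r / r\<^sup>2) + De r / r\<^sup>2 / (r - rp)" by (simp add: algebra_simps)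
  also have "\<dots> \<le> 1 / M * 1 + 1 / M" using 1 2 M_pos by (intro add_mono mult_left_mono) auto
  finally show ?thesis by simp
qed

lemma carter_ge: 
  assumes z: "(r, \<theta>, p, b) \<in> phase_dom"
  shows "b\<^sup>2 \<le> carter L (r, \<theta>, p, b)" "L\<^sup>2 / (sin \<theta>)\<^sup>2 \<le> carter L (r, \<theta>, p, b)" "0 \<le> carter L (r, \<theta>, p, b)"
  by (simp_all add: carter_def)

text \<open>\<open>L \<noteq> 0\<close> keeps the level sets away from the axis.\<close>

lemma level_compact:
  assumes L: "L \<noteq> 0"
  obtains K where "compact K" "K \<subseteq> phase_dom"
    "\<And>z. z \<in> phase_dom \<Longrightarrow> escape z + carter L z + M\<^sup>2 * (ham L z)\<^sup>2 \<le> m \<Longrightarrow> z \<in> K"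
proof (cases "1 \<le> m")
  case False
  show thesis
  proof (rule that[of "{}"])
    fix z assume z: "z \<in> phase_dom" "escape z + carter L z + M\<^sup>2 * (ham L z)\<^sup>2 \<le> m"
    then have "0 \<le> carter L z" by (cases z) (simp add: carter_ge)
    moreover have "0 \<le> M\<^sup>2 * (ham L z)\<^sup>2" by simp
    ultimately show "z \<in> {}" using escape_ge[OF z(1)] z(2) False by linarith
  qed auto
next
  case m: True
  \<comment> \<open>With x = (r - rp) / M, the bound x - ln x <= m yields exp(-m) <= x <= 2m.
    \<open>t1\<close> comes from L^2 / sin^2 theta <= m, and \<open>B\<close> from inserting the
    bounds on r and \<open>ham\<close> into \<open>ham_root_ge_p\<close>.\<close>
  define r1 where "r1 = rp + M * exp (- m)"
  define r2 where "r2 = rp + 2 * m * M"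
  define t1 where "t1 = \<bar>L\<bar> / sqrt m"
  define B where "B = ((r2\<^sup>2 + a\<^sup>2)\<^sup>2 * (sqrt m / M) + 2 * M * \<bar>a\<bar> * r2 * \<bar>L\<bar>) / ((r1 - rp)\<^sup>2 * M\<^sup>2)"
  define K where "K = {r1..r2} \<times> {t1..pi - t1} \<times> {- B..B} \<times> {- sqrt m..sqrt m}"
  have d: "0 < r1 - rp" using M_pos by (simp add: r1_def)
  have t: "0 < t1" using L m by (simp add: t1_def)
  show thesis
  proof (rule that[of K])
    show "compact K" unfolding K_def by (intro compact_Times compact_Icc)
    show "K \<subseteq> phase_dom" using d t by (auto simp: K_def phase_dom_iff)
    fix z assume z: "z \<in> phase_dom" and le: "escape z + carter L z + M\<^sup>2 * (ham L z)\<^sup>2 \<le> m"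
    obtain r \<theta> p b where z': "z = (r, \<theta>, p, b)" by (cases z)
    note zz = z[unfolded z']
    have r: "rp < r" "0 < \<theta>" "\<theta> < pi" "0 < r" "M < r" "De r > 0" using zz ext_pos[of r] by (auto simp: phase_dom_iff)
    have H0: "0 \<le> M\<^sup>2 * (ham L z)\<^sup>2" by simp
    have K0: "0 \<le> carter L z" using carter_ge[OF zz] by (simp add: z')
    have ze: "escape z \<le> m" and Kle: "carter L z \<le> m" and Hle: "M\<^sup>2 * (ham L z)\<^sup>2 \<le> m"
      using le H0 K0 escape_ge[OF z] by linarith+
    define x where "x = (r - rp) / M"
    have x: "0 < x" using r M_pos by (simp add: x_def)
    have zx: "x - ln x \<le> m" using ze by (simp add: escape_def z' x_def)
    have "- m \<le> ln x" using zx x by linarith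
    then have x1: "exp (- m) \<le> x" using x by (metis exp_le_cancel_iff exp_ln)
    \<comment> \<open>Gives ln x <= x / 2, so x - ln x controls x / 2.\<close>
    have "ln x = ln (x / 2) + ln 2" using x by (simp add: ln_div)
    moreover have "ln (x / 2) \<le> x / 2 - 1" "ln (2::real) \<le> 2 - 1" using x by (rule_tac [!] ln_le_minus_one) auto
    ultimately have x2: "x \<le> 2 * m" using zx by linarith
    have rr: "r1 \<le> r" "r \<le> r2"
      using x1 x2 M_pos unfolding r1_def r2_def x_def by (simp_all add: field_simps)
    have s: "0 < sin \<theta>" using r sin_gt_zero by simp
    have "L\<^sup>2 / (sin \<theta>)\<^sup>2 \<le> m" using carter_ge(2)[OF zz, of L] Kle by (simp add: z')
    then have "L\<^sup>2 \<le> m * (sin \<theta>)\<^sup>2" using s by (simp add: pos_divide_le_eq)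
    then have "sqrt (L\<^sup>2) \<le> sqrt (m * (sin \<theta>)\<^sup>2)" by (rule real_sqrt_le_mono)
    then have "\<bar>L\<bar> \<le> sqrt m * sin \<theta>" using s by (simp add: real_sqrt_mult)
    then have ts: "t1 \<le> sin \<theta>" using m by (simp add: t1_def pos_divide_le_eq mult.commute)
    have "sin \<theta> \<le> \<theta>" using r by (intro sin_x_le_x) auto
    moreover have "sin (pi - \<theta>) \<le> pi - \<theta>" using r by (intro sin_x_le_x) auto
    ultimately have tt: "t1 \<le> \<theta>" "\<theta> \<le> pi - t1" using ts by auto
    have "b\<^sup>2 \<le> m" using carter_ge(1)[OF zz, of L] Kle by (simp add: z')
    then have "\<bar>b\<bar> \<le> sqrt m" by (metis real_sqrt_abs real_sqrt_le_mono)
    then have bb: "- sqrt m \<le> b" "b \<le> sqrt m" by auto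
    have "sqrt (M\<^sup>2 * (ham L z)\<^sup>2) \<le> sqrt m" using Hle by (rule real_sqrt_le_mono)
    then have H: "\<bar>ham L z\<bar> \<le> sqrt m / M" using M_pos by (simp add: real_sqrt_mult pos_le_divide_eq mult.commute)
    have Pi0: "0 \<le> PI r \<theta>" using Pi_pos[OF r(1), of \<theta>] by simp
    have "PI r \<theta> \<le> (r\<^sup>2 + a\<^sup>2)\<^sup>2"
      using r by (simp add: kerr_Pi_def cos_squared_eq)
    also have "\<dots> \<le> (r2\<^sup>2 + a\<^sup>2)\<^sup>2" using rr r by (intro power_mono add_right_mono) auto
    finally have Pi: "PI r \<theta> \<le> (r2\<^sup>2 + a\<^sup>2)\<^sup>2" .
    have "De r * r\<^sup>2 * \<bar>p\<bar> \<le> PI r \<theta> * ham L z - 2 * M * a * r * L"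
      using ham_root_ge_p[OF zz, of L] ham_root_eq[OF r(1), of L \<theta> p b] by (simp add: z')
    also have "\<dots> \<le> PI r \<theta> * \<bar>ham L z\<bar> + 2 * M * \<bar>a\<bar> * r * \<bar>L\<bar>"
    proof (rule order_trans[OF abs_ge_self order_trans[OF abs_triangle_ineq4]])
      show "\<bar>PI r \<theta> * ham L z\<bar> + \<bar>2 * M * a * r * L\<bar> \<le> PI r \<theta> * \<bar>ham L z\<bar> + 2 * M * \<bar>a\<bar> * r * \<bar>L\<bar>"
        using Pi0 M_pos r by (simp add: abs_mult)
    qed
    also have "\<dots> \<le> (r2\<^sup>2 + a\<^sup>2)\<^sup>2 * (sqrt m / M) + 2 * M * \<bar>a\<bar> * r2 * \<bar>L\<bar>"
      using Pi H rr M_pos Pi0 r by (intro add_mono mult_mono mult_nonneg_nonneg) auto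
    finally have p1: "De r * r\<^sup>2 * \<bar>p\<bar> \<le> (r2\<^sup>2 + a\<^sup>2)\<^sup>2 * (sqrt m / M) + 2 * M * \<bar>a\<bar> * r2 * \<bar>L\<bar>" .
    have "(r1 - rp)\<^sup>2 \<le> (r - rp)\<^sup>2" using rr d by (intro power_mono) auto
    then have "(r1 - rp)\<^sup>2 \<le> De r" using Delta_ge[OF r(1)] by linarith
    moreover have "M\<^sup>2 \<le> r\<^sup>2" using r M_pos by (intro power_mono) auto
    ultimately have "(r1 - rp)\<^sup>2 * M\<^sup>2 \<le> De r * r\<^sup>2" using r by (intro mult_mono) auto
    then have "(r1 - rp)\<^sup>2 * M\<^sup>2 * \<bar>p\<bar> \<le> De r * r\<^sup>2 * \<bar>p\<bar>" by (intro mult_right_mono) auto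
    with p1 have "(r1 - rp)\<^sup>2 * M\<^sup>2 * \<bar>p\<bar> \<le> (r2\<^sup>2 + a\<^sup>2)\<^sup>2 * (sqrt m / M) + 2 * M * \<bar>a\<bar> * r2 * \<bar>L\<bar>" by linarith
    then have "\<bar>p\<bar> \<le> B" using d M_pos by (simp add: B_def pos_le_divide_eq mult.commute)
    then show "z \<in> K" using rr tt bb by (auto simp: K_def z')
  qed
qed

end

section \<open>Integral estimate for conserved densities\<close>

context kerr_vlasov begin

text \<open>The term 2 t / M in \<open>u\<close> outweighs the rate of \<open>escape\<close> in
  either time direction, so \<open>u\<close> does not decrease along the flow and the cut-off does
  not increase. The sign \<open>\<sigma>\<close> reverses time, so a single argument serves t > 0
  and t < 0.\<close>

lemma conserved_estimate_cutoff:
  fixes n :: real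
  assumes L: "L \<noteq> 0" and J: "Ck_on (Suc 0) J phase_dom" and J0: "\<And>z. z \<in> phase_dom \<Longrightarrow> 0 \<le> J z"
    and JY: "\<And>z. z \<in> phase_dom \<Longrightarrow> frechet_derivative J (at z) (ham_field L z) = 0"
    and T: "0 \<le> T" and n: "0 < n" and \<sigma>: "\<bar>\<sigma>\<bar> = 1"
  defines "u \<equiv> \<lambda>x. escape (snd x) + 2 / M * fst x + carter L (snd x) + M\<^sup>2 * (ham L (snd x))\<^sup>2"
  shows "(\<integral>\<^sup>+z\<in>phase_dom. (J z * F_avg L (\<sigma> * T, z) * (max 0 (1 - u (T, z) / n))\<^sup>2) \<partial>lborel)
    \<le> (\<integral>\<^sup>+z\<in>phase_dom. (J z * F_avg L (0, z) * (max 0 (1 - u (0, z) / n))\<^sup>2) \<partial>lborel)"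
proof -
  \<comment> \<open>The level n + 1 instead of n leaves room for the slightly negative times t >
    -M/2, where 2 t / M > -1.\<close>
  obtain K where K: "compact K" "K \<subseteq> phase_dom"
    "\<And>z. z \<in> phase_dom \<Longrightarrow> escape z + carter L z + M\<^sup>2 * (ham L z)\<^sup>2 \<le> n + 1 \<Longrightarrow> z \<in> K"
    using level_compact[OF L] by blast
  define G where "G = (\<lambda>x. J (snd x) * F_avg L (\<sigma> * fst x, snd x) * (max 0 (1 - u x / n))\<^sup>2)"
  have sc: "Ck_on (Suc 0) (\<lambda>x. g (snd x)) (S \<times> phase_dom)" if "Ck_on (Suc 0) g phase_dom"
    for g :: "real \<times> real \<times> real \<times> real \<Rightarrow> real" and S :: "real set"
    by (rule C1_compose[OF _ that]) (auto intro!: C1_intros simp del: Ck_on.simps)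
  have C1u: "Ck_on (Suc 0) u (S \<times> phase_dom)" for S :: "real set"
    unfolding u_def by (intro C1_intros sc C1_escape C1_carter C1_ham L)
  have C1F: "Ck_on (Suc 0) (\<lambda>x. F_avg L (\<sigma> * fst x, snd x)) (S \<times> phase_dom)" for S :: "real set"
    by (rule C1_compose[OF _ C1_F_avg[OF L]]) (auto intro!: C1_intros simp del: Ck_on.simps)
  have C1G: "Ck_on (Suc 0) G (S \<times> phase_dom)" for S :: "real set"
    unfolding G_def using n by (intro C1_intros sc J C1F C1u) auto
  have "(\<integral>\<^sup>+z\<in>phase_dom. G (T, z) \<partial>lborel) \<le> (\<integral>\<^sup>+z\<in>phase_dom. G (0, z) \<partial>lborel)"
  proof (rule transport_nonincreasing[OF open_phase_dom K(1,2) T, of "M / 2" G "\<lambda>z. \<sigma> *\<^sub>R ham_field L z"])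
    show "0 < M / 2" using M_pos by simp
    show "Ck_on (Suc 0) G ({- (M / 2)<..} \<times> phase_dom)" by (rule C1G)
    show "G (t, z) = 0" if t: "- (M / 2) < t" and z: "z \<in> phase_dom - K" for t z
    proof -
      have "n + 1 < escape z + carter L z + M\<^sup>2 * (ham L z)\<^sup>2" using K(3)[of z] z by force
      moreover have "- 1 < 2 / M * t" using t M_pos by (simp add: field_simps)
      ultimately have "n < u (t, z)" by (simp add: u_def)
      then have "1 - u (t, z) / n \<le> 0" using n by simp
      then have "max 0 (1 - u (t, z) / n) = 0" by (rule max_absorb1)
      then show ?thesis unfolding G_def by simp
    qed
    show C1Y: "Ck_on (Suc 0) (\<lambda>z. \<sigma> *\<^sub>R ham_field L z) phase_dom" by (intro C1_scaleR C1_const C1_ham_field L)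
    show "(\<Sum>b\<in>Basis. frechet_derivative (\<lambda>z. \<sigma> *\<^sub>R ham_field L z) (at z) b \<bullet> b) = 0" if z: "z \<in> phase_dom" for z
    proof -
      have "((\<lambda>z. \<sigma> *\<^sub>R ham_field L z) has_derivative (\<lambda>v. \<sigma> *\<^sub>R frechet_derivative (ham_field L) (at z) v)) (at z)"
        by (rule has_derivative_scaleR_right[OF C1_has_derivative[OF C1_ham_field[OF L] z]])
      then have "frechet_derivative (\<lambda>z. \<sigma> *\<^sub>R ham_field L z) (at z) = (\<lambda>v. \<sigma> *\<^sub>R frechet_derivative (ham_field L) (at z) v)"
        by (rule frechet_derivative_eqI)
      then show ?thesis using ham_field_divergence_free[OF z L] by (simp add: sum_distrib_left[symmetric])
    qed
    show "0 \<le> G (t, z)" if "0 \<le> t" "z \<in> phase_dom" for t z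
      unfolding G_def using J0 F_avg_nonneg[OF that(2) L] that(2) by simp
    show "frechet_derivative G (at (t, z)) (1, \<sigma> *\<^sub>R ham_field L z) \<le> 0" if t: "0 \<le> t" and z: "z \<in> phase_dom" for t z
    proof -
      let ?v = "(1, \<sigma> *\<^sub>R ham_field L z)"
      have snd: "((\<lambda>x. g (snd x)) has_derivative (\<lambda>v. frechet_derivative g (at z) (snd v))) (at (t, z))"
        if "Ck_on (Suc 0) g phase_dom" for g :: "real \<times> real \<times> real \<times> real \<Rightarrow> real"
      proof (rule has_derivative_compose[of snd snd])
        show "(snd has_derivative snd) (at (t, z))" by (rule has_derivative_snd) (rule has_derivative_ident)
        show "(g has_derivative frechet_derivative g (at z)) (at (snd (t, z)))"
          using C1_has_derivative[OF that z] by simp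
      qed
      have lin: "linear (frechet_derivative g (at z))" if "Ck_on (Suc 0) g phase_dom" for g :: "real \<times> real \<times> real \<times> real \<Rightarrow> real"
        by (rule has_derivative_linear[OF C1_has_derivative[OF that z]])
      have dFb: "(F_avg L has_derivative frechet_derivative (F_avg L) (at (\<sigma> * t, z))) (at (\<sigma> * t, z))"
        by (rule C1_has_derivative[OF C1_F_avg[OF L]]) (use z in simp)
      have "((\<lambda>x. (\<sigma> * fst x, snd x)) has_derivative (\<lambda>v. (\<sigma> * fst v, snd v))) (at (t, z))"
        by (auto intro!: derivative_eq_intros)
      then have dA: "((\<lambda>x. F_avg L (\<sigma> * fst x, snd x)) has_derivative
          (\<lambda>v. frechet_derivative (F_avg L) (at (\<sigma> * t, z)) (\<sigma> * fst v, snd v))) (at (t, z))"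
        by (rule has_derivative_compose) (use dFb in simp)
      have A0: "frechet_derivative (F_avg L) (at (\<sigma> * t, z)) (\<sigma> * fst ?v, snd ?v) = 0"
        using linear_scale[OF has_derivative_linear[OF dFb], of \<sigma> "(1, ham_field L z)"] F_avg_transport[OF z L, of "\<sigma> * t"] by simp
      have sY: "frechet_derivative g (at z) (snd ?v) = \<sigma> * frechet_derivative g (at z) (ham_field L z)"
        if "Ck_on (Suc 0) g phase_dom" for g :: "real \<times> real \<times> real \<times> real \<Rightarrow> real"
        using linear_scale[OF lin[OF that], of \<sigma> "ham_field L z"] by simp
      have du: "(u has_derivative (\<lambda>v. frechet_derivative escape (at z) (snd v) + 2 / M * fst v
          + frechet_derivative (carter L) (at z) (snd v) + M\<^sup>2 * (2 * ham L z * frechet_derivative (ham L) (at z) (snd v)))) (at (t, z))"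
        (is "(u has_derivative ?du) _")
        unfolding u_def
        by (rule has_derivative_eq_rhs, (rule derivative_eq_intros refl snd[OF C1_escape] snd[OF C1_carter[OF L]] snd[OF C1_ham[OF L]])+)
          (simp add: fun_eq_iff algebra_simps)
      have u0: "0 \<le> ?du ?v"
      proof -
        have "\<bar>\<sigma> * frechet_derivative escape (at z) (ham_field L z)\<bar> \<le> 2 / M"
          using escape_rate[OF z L] \<sigma> by (simp add: abs_mult)
        then show ?thesis
          unfolding sY[OF C1_escape] sY[OF C1_carter[OF L]] sY[OF C1_ham[OF L]] carter_conserved[OF z L] ham_conserved[OF z L] by auto
      qed
      from du u0 obtain d where d: "(u has_derivative d) (at (t, z))" "0 \<le> d ?v" by blast
      let ?m = "max 0 (1 - u (t, z) / n)"
      have "((\<lambda>x. 1 - u x / n) has_derivative (\<lambda>v. - d v / n)) (at (t, z))"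
        by (rule has_derivative_eq_rhs, (rule derivative_intros d(1))+)
          (use n in \<open>auto simp: fun_eq_iff\<close>)
      from has_derivative_compose[OF this has_real_derivative_pos_square[unfolded has_field_derivative_def]]
      have dC: "((\<lambda>x. (max 0 (1 - u x / n))\<^sup>2) has_derivative (\<lambda>v. 2 * ?m * (- d v / n))) (at (t, z))" .
      have "frechet_derivative G (at (t, z)) = (\<lambda>v. (J z * F_avg L (\<sigma> * t, z)) * (2 * ?m * (- d v / n))
          + (J z * frechet_derivative (F_avg L) (at (\<sigma> * t, z)) (\<sigma> * fst v, snd v)
             + frechet_derivative J (at z) (snd v) * F_avg L (\<sigma> * t, z)) * ?m\<^sup>2)"
        unfolding G_def
        by (rule frechet_derivative_eqI, rule has_derivative_eq_rhs[OF has_derivative_mult[OF has_derivative_mult[OF snd[OF J] dA] dC]]) simp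
      then have "frechet_derivative G (at (t, z)) ?v = - ((J z * F_avg L (\<sigma> * t, z)) * (2 * ?m * (d ?v / n)))"
        using A0 sY[OF J] JY[OF z] by (simp only:) simp
      moreover have "0 \<le> (J z * F_avg L (\<sigma> * t, z)) * (2 * ?m * (d ?v / n))"
        using d(2) n J0[OF z] F_avg_nonneg[OF z L] by (intro mult_nonneg_nonneg divide_nonneg_nonneg) auto
      ultimately show ?thesis by linarith
    qed
  qed
  then show ?thesis by (simp add: G_def)
qed

text \<open>As n grows the cut-offs increase to 1, since \<open>u\<close> >= 0. Monotone convergence
  is needed at time t only; at time 0 they are just bounded by 1. Infinite integrals are allowed
  throughout.\<close>

lemma conserved_estimate:
  assumes L: "L \<noteq> 0" and J: "Ck_on (Suc 0) J phase_dom" and J0: "\<And>z. z \<in> phase_dom \<Longrightarrow> 0 \<le> J z"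
    and JY: "\<And>z. z \<in> phase_dom \<Longrightarrow> frechet_derivative J (at z) (ham_field L z) = 0"
  shows "(\<integral>\<^sup>+z\<in>phase_dom. (J z * F_avg L (t, z)) \<partial>lborel) \<le> (\<integral>\<^sup>+z\<in>phase_dom. (J z * F_avg L (0, z)) \<partial>lborel)"
proof -
  define \<sigma> where "\<sigma> = (if t < 0 then - 1 else 1 :: real)"
  define T where "T = \<bar>t\<bar>"
  have t: "t = \<sigma> * T" "0 \<le> T" "\<bar>\<sigma>\<bar> = 1" by (auto simp: \<sigma>_def T_def)
  define u where "u = (\<lambda>x. escape (snd x) + 2 / M * fst x + carter L (snd x) + M\<^sup>2 * (ham L (snd x))\<^sup>2)"
  define cut where "cut n \<tau> z = (max 0 (1 - u (\<tau>, z) / real (Suc n)))\<^sup>2" for n \<tau> z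
  have u0: "0 \<le> u (\<tau>, z)" if "0 \<le> \<tau>" "z \<in> phase_dom" for \<tau> z
  proof -
    have "0 \<le> carter L z" by (simp add: carter_def)
    then show ?thesis using escape_ge[OF that(2)] that(1) M_pos by (simp add: u_def)
  qed
  have m1: "max 0 (1 - u (\<tau>, z) / real (Suc n)) \<le> 1" if "0 \<le> \<tau>" "z \<in> phase_dom" for \<tau> z n
    using u0[OF that] by simp
  have cutle: "cut n \<tau> z \<le> 1" if "0 \<le> \<tau>" "z \<in> phase_dom" for \<tau> z n
    unfolding cut_def using m1[OF that, of n] by (intro power_le_one) auto
  have inc: "cut n \<tau> z \<le> cut (Suc n) \<tau> z" if "0 \<le> \<tau>" "z \<in> phase_dom" for \<tau> z n
    unfolding cut_def using u0[OF that] by (intro power_mono max.mono diff_left_mono divide_left_mono) auto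
  have lim: "(\<lambda>n. cut n \<tau> z) \<longlonglongrightarrow> 1" for \<tau> z
  proof -
    have "(\<lambda>n. u (\<tau>, z) / real (Suc n)) \<longlonglongrightarrow> 0"
      using LIMSEQ_Suc[OF lim_const_over_n[of "u (\<tau>, z)"]] by simp
    then have "(\<lambda>n. (max 0 (1 - u (\<tau>, z) / real (Suc n)))\<^sup>2) \<longlonglongrightarrow> (max 0 (1 - 0))\<^sup>2"
      by (intro tendsto_intros)
    then show ?thesis by (simp add: cut_def)
  qed
  have cont: "continuous_on phase_dom (\<lambda>z. J z * F_avg L (\<tau>, z) * cut n \<tau>' z)" for n \<tau> \<tau>'
  proof -
    have "continuous_on phase_dom (\<lambda>z. F_avg L (\<tau>, z))"
      by (rule continuous_on_compose2[OF C1_continuous_on[OF C1_F_avg[OF L]]]) (auto intro!: continuous_intros)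
    then show ?thesis
      unfolding cut_def u_def fst_conv snd_conv
      by (intro continuous_intros C1_continuous_on[OF J] C1_continuous_on[OF C1_escape]
          C1_continuous_on[OF C1_carter[OF L]] C1_continuous_on[OF C1_ham[OF L]]) auto
  qed
  have "(\<integral>\<^sup>+z\<in>phase_dom. (J z * F_avg L (t, z)) \<partial>lborel) = (SUP n. \<integral>\<^sup>+z\<in>phase_dom. (J z * F_avg L (\<sigma> * T, z) * cut n T z) \<partial>lborel)"
  proof -
    have "(\<integral>\<^sup>+z\<in>phase_dom. (J z * F_avg L (t, z)) \<partial>lborel) = (\<integral>\<^sup>+z. (SUP n. ennreal (J z * F_avg L (\<sigma> * T, z) * cut n T z) * indicator phase_dom z) \<partial>lborel)"
    proof (rule nn_integral_cong)
      fix z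
      show "ennreal (J z * F_avg L (t, z)) * indicator phase_dom z = (SUP n. ennreal (J z * F_avg L (\<sigma> * T, z) * cut n T z) * indicator phase_dom z)"
      proof (cases "z \<in> phase_dom")
        case True
        have JF: "0 \<le> J z * F_avg L (\<sigma> * T, z)" using J0[OF True] F_avg_nonneg[OF True L] by simp
        have "(\<lambda>n. ennreal (J z * F_avg L (\<sigma> * T, z) * cut n T z)) \<longlonglongrightarrow> ennreal (J z * F_avg L (\<sigma> * T, z) * 1)"
          by (intro tendsto_ennrealI tendsto_mult tendsto_const lim)
        moreover have "incseq (\<lambda>n. ennreal (J z * F_avg L (\<sigma> * T, z) * cut n T z))"
          using inc[OF t(2) True] JF by (intro incseq_SucI ennreal_leI mult_left_mono)
        ultimately have "(SUP n. ennreal (J z * F_avg L (\<sigma> * T, z) * cut n T z)) = ennreal (J z * F_avg L (\<sigma> * T, z) * 1)"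
          using LIMSEQ_SUP LIMSEQ_unique by blast
        then show ?thesis using True by (simp add: t(1)[symmetric])
      qed simp
    qed
    also have "\<dots> = (SUP n. \<integral>\<^sup>+z\<in>phase_dom. (J z * F_avg L (\<sigma> * T, z) * cut n T z) \<partial>lborel)"
    proof (rule nn_integral_monotone_convergence_SUP)
      show "incseq (\<lambda>n z. ennreal (J z * F_avg L (\<sigma> * T, z) * cut n T z) * indicator phase_dom z)"
      proof (intro incseq_SucI le_funI)
        fix n z
        show "ennreal (J z * F_avg L (\<sigma> * T, z) * cut n T z) * indicator phase_dom z \<le> ennreal (J z * F_avg L (\<sigma> * T, z) * cut (Suc n) T z) * indicator phase_dom z"
        proof (cases "z \<in> phase_dom")
          case True
          then show ?thesis
            using inc[OF t(2) True, of n] J0[OF True] F_avg_nonneg[OF True L] by (auto intro!: ennreal_leI mult_left_mono)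
        qed simp
      qed
      fix n
      have "(\<lambda>z. indicator phase_dom z *\<^sub>R (J z * F_avg L (\<sigma> * T, z) * cut n T z)) \<in> borel_measurable borel"
        using open_phase_dom by (intro borel_measurable_continuous_on_indicator cont) auto
      then have "(\<lambda>z. ennreal (indicator phase_dom z *\<^sub>R (J z * F_avg L (\<sigma> * T, z) * cut n T z))) \<in> borel_measurable borel"
        by measurable
      moreover have "(\<lambda>z. ennreal (indicator phase_dom z *\<^sub>R (J z * F_avg L (\<sigma> * T, z) * cut n T z))) = (\<lambda>z. ennreal (J z * F_avg L (\<sigma> * T, z) * cut n T z) * indicator phase_dom z)"
        by (auto simp: indicator_def fun_eq_iff)
      ultimately show "(\<lambda>z. ennreal (J z * F_avg L (\<sigma> * T, z) * cut n T z) * indicator phase_dom z) \<in> borel_measurable lborel" by simp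
    qed
    finally show ?thesis .
  qed
  also have "\<dots> \<le> (\<integral>\<^sup>+z\<in>phase_dom. (J z * F_avg L (0, z)) \<partial>lborel)"
  proof (rule SUP_least)
    fix n
    have "(\<integral>\<^sup>+z\<in>phase_dom. (J z * F_avg L (\<sigma> * T, z) * cut n T z) \<partial>lborel) \<le> (\<integral>\<^sup>+z\<in>phase_dom. (J z * F_avg L (0, z) * cut n 0 z) \<partial>lborel)"
      unfolding cut_def u_def by (rule conserved_estimate_cutoff[OF L J J0 JY t(2) _ t(3)]) auto
    also have "\<dots> \<le> (\<integral>\<^sup>+z\<in>phase_dom. (J z * F_avg L (0, z)) \<partial>lborel)"
    proof (rule nn_integral_mono)
      fix z
      show "ennreal (J z * F_avg L (0, z) * cut n 0 z) * indicator phase_dom z \<le> ennreal (J z * F_avg L (0, z)) * indicator phase_dom z"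
      proof (cases "z \<in> phase_dom")
        case True
        then show ?thesis
          using cutle[OF order_refl True, of n] J0[OF True] F_avg_nonneg[OF True L] by (auto intro!: ennreal_leI mult_left_le)
      qed simp
    qed
    finally show "(\<integral>\<^sup>+z\<in>phase_dom. (J z * F_avg L (\<sigma> * T, z) * cut n T z) \<partial>lborel) \<le> (\<integral>\<^sup>+z\<in>phase_dom. (J z * F_avg L (0, z)) \<partial>lborel)" .
  qed
  finally show ?thesis .
qed

end

section \<open>The weight on phase space and its conserved substitute\<close>

context kerr_bl begin

definition weight :: "real \<Rightarrow> real \<times> real \<times> real \<times> real \<Rightarrow> real" where
  "weight L z = ((zr z)\<^sup>2 + a\<^sup>2)\<^sup>2 / De (zr z) * (ham L z)\<^sup>2 + De (zr z) * (zp z)\<^sup>2 + (zb z)\<^sup>2 + 1 / (sin (z\<theta> z))\<^sup>2 * L\<^sup>2"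

definition weight_norm :: "real \<Rightarrow> real \<times> real \<times> real \<times> real \<Rightarrow> real" where
  "weight_norm L z = M\<^sup>2 * (ham L z)\<^sup>2 + (zb z)\<^sup>2 + 1 / (sin (z\<theta> z))\<^sup>2 * L\<^sup>2"

text \<open>The last factor is what remains of sin theta d^3v, with sin theta taken from d^3x, once
  the velocities are replaced by the momenta p, b and L.\<close>

definition phase_weight :: "real \<Rightarrow> real \<times> real \<times> real \<times> real \<Rightarrow> real" where
  "phase_weight L z = weight L z * (weight_norm L z)\<^sup>2 * ((zr z)\<^sup>2 * De (zr z) / (Sg (zr z) (z\<theta> z) * ham_root L z))"

text \<open>Delta times \<open>weight\<close>, with p and b eliminated by the null condition. The
  Delta cancels against the one in \<open>phase_weight\<close>, so no singular factor is left at the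
  horizon.\<close>

definition weight_num :: "real \<Rightarrow> real \<times> real \<times> real \<times> real \<Rightarrow> real" where
  "weight_num L z = 2 * ((zr z)\<^sup>2 + a\<^sup>2)\<^sup>2 * (ham L z)\<^sup>2 - 4 * M * a * zr z * ham L z * L + a\<^sup>2 * L\<^sup>2
     - De (zr z) * a\<^sup>2 * (sin (z\<theta> z))\<^sup>2 * (ham L z)\<^sup>2"

lemma weight_weight_num:
  assumes z: "(r, \<theta>, p, b) \<in> phase_dom"
  shows "weight L (r, \<theta>, p, b) = weight_num L (r, \<theta>, p, b) / De r"
proof -
  have r: "rp < r" "0 < \<theta>" "\<theta> < pi" and D: "De r \<noteq> 0" using z ext_pos[of r] by (auto simp: phase_dom_iff)
  define E where "E = ham L (r, \<theta>, p, b)"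
  let ?P = "(r\<^sup>2 + a\<^sup>2) * E - a * L"
  have "De r * p\<^sup>2 + b\<^sup>2 + 1 / (sin \<theta>)\<^sup>2 * L\<^sup>2 = ?P\<^sup>2 / De r - a\<^sup>2 * (sin \<theta>)\<^sup>2 * E\<^sup>2 + 2 * a * E * L"
    using null_form_zero[OF r, of L p b] unfolding null_form_def E_def[symmetric] by simp
  then have "weight L (r, \<theta>, p, b) = (r\<^sup>2 + a\<^sup>2)\<^sup>2 / De r * E\<^sup>2 + (?P\<^sup>2 / De r - a\<^sup>2 * (sin \<theta>)\<^sup>2 * E\<^sup>2 + 2 * a * E * L)"
    by (simp add: weight_def E_def)
  also have "\<dots> = ((r\<^sup>2 + a\<^sup>2)\<^sup>2 * E\<^sup>2 + ?P\<^sup>2 + De r * (2 * a * E * L - a\<^sup>2 * (sin \<theta>)\<^sup>2 * E\<^sup>2)) / De r"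
    using D by (simp add: field_simps)
  also have "(r\<^sup>2 + a\<^sup>2)\<^sup>2 * E\<^sup>2 + ?P\<^sup>2 + De r * (2 * a * E * L - a\<^sup>2 * (sin \<theta>)\<^sup>2 * E\<^sup>2) = weight_num L (r, \<theta>, p, b)"
    by (simp add: weight_num_def E_def[symmetric] kerr_Delta_def algebra_simps power2_eq_square)
  finally show ?thesis .
qed

text \<open>\<open>J3\<close> in general units. For given \<open>L\<close> it depends on the energy
  h alone, hence is constant along the flow.\<close>

definition near_cons :: "real \<Rightarrow> real \<Rightarrow> real" where
  "near_cons L h = h + 230400 * (a / M)\<^sup>2 * (max 0 (\<bar>L / M\<bar> / 40 - h))\<^sup>2 / (2 * (rp / M) * h - a / M * (L / M))"

text \<open>The two expressions agree in a neighbourhood of \<open>r = 3 M\<close>, so \<open>cons L\<close> is continuously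
  differentiable, and it is locally a function of \<open>ham L\<close> alone, hence conserved.\<close>

definition cons :: "real \<Rightarrow> real \<times> real \<times> real \<times> real \<Rightarrow> real" where
  "cons L z = (if zr z < 3 * M then near_cons L (ham L z) else ham L z)"

end

locale kerr_slow = kerr_bl +
  assumes a_slow: "\<bar>a\<bar> \<le> M / 1000"
begin

text \<open>Passage to M = 1: lengths and \<open>L\<close> are divided by M, Delta by M^2 and
  \<open>ham_root\<close> by M^4, while the energy keeps its value.\<close>

lemma scaled_ineq:
  assumes z: "(r, \<theta>, p, b) \<in> phase_dom" and L: "L \<noteq> 0"
  shows "kerr_ineq (r / M) (a / M) (ham L (r, \<theta>, p, b)) (L / M) (ham_root L (r, \<theta>, p, b) / M ^ 4) (De r / M\<^sup>2) ((sin \<theta>)\<^sup>2) (rp / M)"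
proof
  have r: "rp < r" using z by (simp add: phase_dom_iff)
  show "\<bar>a / M\<bar> \<le> 1 / 1000" using a_slow M_pos by (simp add: abs_divide field_simps)
  show "3 / 2 \<le> rp / M" "rp / M \<le> 2" using rp_bounds M_pos by (simp_all add: field_simps)
  have "(rp / M)\<^sup>2 - 2 * (rp / M) + (a / M)\<^sup>2 = (rp\<^sup>2 - 2 * M * rp + a\<^sup>2) / M\<^sup>2"
    using M_pos by (simp add: power_divide field_simps power2_eq_square)
  then show "(rp / M)\<^sup>2 - 2 * (rp / M) + (a / M)\<^sup>2 = 0" using rp_root by simp
  show "rp / M < r / M" using r M_pos by (simp add: divide_strict_right_mono)
  show "De r / M\<^sup>2 = (r / M)\<^sup>2 - 2 * (r / M) + (a / M)\<^sup>2"
    using M_pos by (simp add: kerr_Delta_def power_divide field_simps power2_eq_square)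
  show "0 \<le> (sin \<theta>)\<^sup>2" "(sin \<theta>)\<^sup>2 \<le> 1" by (simp_all add: abs_square_le_1)
  have "ham_root L (r, \<theta>, p, b) / M ^ 4 = (((r\<^sup>2 + a\<^sup>2)\<^sup>2 - a\<^sup>2 * De r * (sin \<theta>)\<^sup>2) * ham L (r, \<theta>, p, b) - 2 * M * a * r * L) / M ^ 4"
    unfolding ham_root_eq[OF r] by (simp add: kerr_Pi_def sin_squared_eq)
  also have "\<dots> = (((r / M)\<^sup>2 + (a / M)\<^sup>2)\<^sup>2 - (a / M)\<^sup>2 * (De r / M\<^sup>2) * (sin \<theta>)\<^sup>2) * ham L (r, \<theta>, p, b) - 2 * (a / M) * (r / M) * (L / M)"
    using M_pos by (simp add: power_divide field_simps power2_eq_square power4_eq_xxxx)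
  finally show "ham_root L (r, \<theta>, p, b) / M ^ 4 = (((r / M)\<^sup>2 + (a / M)\<^sup>2)\<^sup>2 - (a / M)\<^sup>2 * (De r / M\<^sup>2) * (sin \<theta>)\<^sup>2) * ham L (r, \<theta>, p, b) - 2 * (a / M) * (r / M) * (L / M)" .
  show "0 < ham_root L (r, \<theta>, p, b) / M ^ 4" using ham_root_pos[OF z L] M_pos by simp
  have "De r / M\<^sup>2 * (r / M) ^ 4 * (L / M)\<^sup>2 = De r * r ^ 4 * L\<^sup>2 / (M ^ 4)\<^sup>2"
    using M_pos by (simp add: power_divide power2_eq_square power4_eq_xxxx)
  also have "\<dots> \<le> (ham_root L (r, \<theta>, p, b))\<^sup>2 / (M ^ 4)\<^sup>2" by (intro divide_right_mono ham_root_ge_L z) simp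
  finally show "De r / M\<^sup>2 * (r / M) ^ 4 * (L / M)\<^sup>2 \<le> (ham_root L (r, \<theta>, p, b) / M ^ 4)\<^sup>2" by (simp add: power_divide)
qed

lemma weight_num_scale:
  assumes "(r, \<theta>, p, b) \<in> phase_dom" "L \<noteq> 0"
  shows "kerr_ineq.NW (r / M) (a / M) (ham L (r, \<theta>, p, b)) (L / M) (De r / M\<^sup>2) ((sin \<theta>)\<^sup>2) = weight_num L (r, \<theta>, p, b) / M ^ 4"
  unfolding kerr_ineq.NW_def[OF scaled_ineq[OF assms]] kerr_ineq.R_def[OF scaled_ineq[OF assms]] weight_num_def
  using M_pos by (simp add: power_divide field_simps power2_eq_square power4_eq_xxxx)

lemma J3_eq:
  assumes "(r, \<theta>, p, b) \<in> phase_dom" "L \<noteq> 0"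
  shows "kerr_ineq.J3 (a / M) (ham L (r, \<theta>, p, b)) (L / M) (rp / M) = near_cons L (ham L (r, \<theta>, p, b))"
  unfolding kerr_ineq.J3_def[OF scaled_ineq[OF assms]] kerr_ineq.\<delta>_def[OF scaled_ineq[OF assms]] kerr_ineq.y_def[OF scaled_ineq[OF assms]] near_cons_def by simp

text \<open>For 5/2 M <= r < 3M the barrier gives |L| / M <= 9 E, so the cut-off at 1/40 is
  inactive. This overlap is what permits gluing at r = 3M.\<close>

lemma near_cons_far:
  assumes z: "(r, \<theta>, p, b) \<in> phase_dom" and L: "L \<noteq> 0" and r: "5 / 2 * M \<le> r" "r < 3 * M"
  shows "near_cons L (ham L (r, \<theta>, p, b)) = ham L (r, \<theta>, p, b)"
proof -
  let ?E = "ham L (r, \<theta>, p, b)"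
  have "5 / 2 \<le> r / M" using r M_pos by (simp add: field_simps)
  note f = kerr_ineq.far_region[OF scaled_ineq[OF z L] this]
  have "\<bar>L / M\<bar> \<le> 3 * (r / M) * ?E" by (rule f(2))
  also have "\<dots> \<le> 3 * 3 * ?E" using r M_pos f(1) by (intro mult_right_mono mult_left_mono) (auto simp: field_simps)
  finally have le: "\<bar>L / M\<bar> \<le> 3 * 3 * ?E" .
  have "x / 40 - e \<le> 0" if "x \<le> 3 * 3 * e" "0 < e" for x e :: real using that by simp
  from this[OF le f(1)] have "\<bar>L / M\<bar> / 40 - ?E \<le> 0" .
  then have "max 0 (\<bar>L / M\<bar> / 40 - ?E) = 0" by (rule max_absorb1)
  then show ?thesis unfolding near_cons_def by simp
qed

lemma cons_bounds:
  assumes z: "(r, \<theta>, p, b) \<in> phase_dom" and L: "L \<noteq> 0"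
  shows "weight_num L (r, \<theta>, p, b) \<le> 30 * (ham_root L (r, \<theta>, p, b) * cons L (r, \<theta>, p, b))"
    "ham_root L (r, \<theta>, p, b) * cons L (r, \<theta>, p, b) \<le> 15000 * weight_num L (r, \<theta>, p, b)"
    "0 < cons L (r, \<theta>, p, b)"
proof -
  have M4: "0 < M ^ 4" using M_pos by simp
  have "weight_num L (r, \<theta>, p, b) \<le> 30 * (ham_root L (r, \<theta>, p, b) * cons L (r, \<theta>, p, b))
    \<and> ham_root L (r, \<theta>, p, b) * cons L (r, \<theta>, p, b) \<le> 15000 * weight_num L (r, \<theta>, p, b) \<and> 0 < cons L (r, \<theta>, p, b)"
  proof (cases "r < 3 * M")
    case True
    then have "r / M < 3" using M_pos by (simp add: field_simps)
    from kerr_ineq.near_region[OF scaled_ineq[OF z L] this] show ?thesis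
      using True M4 unfolding weight_num_scale[OF z L] J3_eq[OF z L] by (simp add: cons_def field_simps)
  next
    case False
    then have "5 / 2 \<le> r / M" using M_pos by (simp add: field_simps)
    note f = kerr_ineq.far_region[OF scaled_ineq[OF z L] this, unfolded weight_num_scale[OF z L]]
    have S: "0 < ham_root L (r, \<theta>, p, b)" using ham_root_pos[OF z L] .
    have SE: "0 < ham_root L (r, \<theta>, p, b) * ham L (r, \<theta>, p, b)" using S f(1) by simp
    have "weight_num L (r, \<theta>, p, b) \<le> 6 * (ham_root L (r, \<theta>, p, b) * ham L (r, \<theta>, p, b))"
      "ham_root L (r, \<theta>, p, b) * ham L (r, \<theta>, p, b) \<le> 6 * weight_num L (r, \<theta>, p, b)"
      using f(3,4) M4 by (simp_all add: field_simps)
    then show ?thesis using f(1) SE False by (simp add: cons_def)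
  qed
  then show "weight_num L (r, \<theta>, p, b) \<le> 30 * (ham_root L (r, \<theta>, p, b) * cons L (r, \<theta>, p, b))"
    "ham_root L (r, \<theta>, p, b) * cons L (r, \<theta>, p, b) \<le> 15000 * weight_num L (r, \<theta>, p, b)"
    "0 < cons L (r, \<theta>, p, b)" by blast+
qed

text \<open>The common source of regularity and conservation: near each point \<open>cons L\<close>
  is a C1 function g of \<open>ham L\<close>. In the near region positivity of
  \<open>\<delta>\<close> keeps the denominator of g away from 0.\<close>

lemma cons_local:
  assumes z: "z \<in> phase_dom" and L: "L \<noteq> 0"
  obtains U g g' T where "open U" "z \<in> U" "U \<subseteq> phase_dom" "\<And>x. x \<in> U \<Longrightarrow> cons L x = g (ham L x)" "\<And>x. x \<in> U \<Longrightarrow> ham L x \<in> T"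
    "\<And>h. h \<in> T \<Longrightarrow> (g has_real_derivative g' h) (at h)" "continuous_on T g'"
proof (cases "zr z < 3 * M")
  case True
  let ?U = "phase_dom \<inter> {z. zr z < 3 * M}"
  let ?d = "\<lambda>h. 2 * (rp / M) * h - a / M * (L / M)"
  let ?m = "\<lambda>h. max 0 (\<bar>L / M\<bar> / 40 - h)"
  show thesis
  proof (rule that[of ?U "near_cons L" "{h. ?d h > 0}" "\<lambda>h. 1 + (230400 * (a / M)\<^sup>2 * (2 * ?m h * (- 1)) * ?d h
        - 230400 * (a / M)\<^sup>2 * (?m h)\<^sup>2 * (2 * (rp / M))) / (?d h * ?d h)"])
    show "open ?U" by (intro open_Int open_phase_dom open_Collect_less continuous_intros)
    show "z \<in> ?U" using z True by simp
    show "cons L x = near_cons L (ham L x)" if "x \<in> ?U" for x using that by (simp add: cons_def)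
    show "ham L x \<in> {h. ?d h > 0}" if "x \<in> ?U" for x
    proof -
      obtain r \<theta> p b where x: "x = (r, \<theta>, p, b)" by (cases x)
      with that have x': "(r, \<theta>, p, b) \<in> phase_dom" and "r / M < 3" using M_pos by (auto simp: field_simps)
      from kerr_ineq.\<delta>_pos[OF scaled_ineq[OF x' L] this(2)] show ?thesis
        unfolding kerr_ineq.\<delta>_def[OF scaled_ineq[OF x' L]] kerr_ineq.y_def[OF scaled_ineq[OF x' L]] x by simp
    qed
    fix h assume "h \<in> {h. ?d h > 0}"
    then have d0: "?d h \<noteq> 0" by simp
    have m: "((\<lambda>h. (?m h)\<^sup>2) has_real_derivative 2 * ?m h * (- 1)) (at h)"
      by (rule DERIV_chain2[OF has_real_derivative_pos_square]) (auto intro!: derivative_eq_intros)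
    have n: "((\<lambda>h. 230400 * (a / M)\<^sup>2 * (?m h)\<^sup>2) has_real_derivative 230400 * (a / M)\<^sup>2 * (2 * ?m h * (- 1))) (at h)"
      by (rule DERIV_cmult[OF m])
    have d: "(?d has_real_derivative 2 * (rp / M)) (at h)" using M_pos by (auto intro!: derivative_eq_intros)
    show "(near_cons L has_real_derivative 1 + (230400 * (a / M)\<^sup>2 * (2 * ?m h * (- 1)) * ?d h
        - 230400 * (a / M)\<^sup>2 * (?m h)\<^sup>2 * (2 * (rp / M))) / (?d h * ?d h)) (at h)"
      unfolding near_cons_def[abs_def] by (rule DERIV_add[OF DERIV_ident DERIV_divide[OF n d d0]])
  next
    show "continuous_on {h. ?d h > 0} (\<lambda>h. 1 + (230400 * (a / M)\<^sup>2 * (2 * ?m h * (- 1)) * ?d h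
        - 230400 * (a / M)\<^sup>2 * (?m h)\<^sup>2 * (2 * (rp / M))) / (?d h * ?d h))"
      by (intro continuous_intros) auto
  qed auto
next
  case False
  let ?U = "phase_dom \<inter> {z. 5 / 2 * M < zr z}"
  show thesis
  proof (rule that[of ?U "\<lambda>h. h" UNIV "\<lambda>h. 1"])
    show "open ?U" by (intro open_Int open_phase_dom open_Collect_less continuous_intros)
    show "z \<in> ?U" using z False M_pos by auto
    show "cons L x = ham L x" if "x \<in> ?U" for x
    proof -
      obtain r \<theta> p b where x: "x = (r, \<theta>, p, b)" by (cases x)
      then show ?thesis using that near_cons_far[OF _ L, of r \<theta> p b] by (auto simp: cons_def)
    qed
  qed auto
qed

lemma C1_cons:
  assumes L: "L \<noteq> 0" shows "Ck_on (Suc 0) (cons L) phase_dom"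
proof (rule C1_local)
  fix z assume z: "z \<in> phase_dom"
  obtain U g g' T where U: "open U" "z \<in> U" "U \<subseteq> phase_dom" "\<And>x. x \<in> U \<Longrightarrow> cons L x = g (ham L x)" "\<And>x. x \<in> U \<Longrightarrow> ham L x \<in> T"
    "\<And>h. h \<in> T \<Longrightarrow> (g has_real_derivative g' h) (at h)" "continuous_on T g'"
    using cons_local[OF z L] by metis
  have "Ck_on (Suc 0) (\<lambda>x. g (ham L x)) U"
    by (rule C1_real_compose[OF C1_subset[OF C1_ham[OF L] U(3)] U(5-7)])
  then have "Ck_on (Suc 0) (cons L) U" by (rule C1_cong[OF U(1), rotated]) (simp add: U(4))
  then show "\<exists>T. open T \<and> z \<in> T \<and> Ck_on (Suc 0) (cons L) T" using U by blast
qed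

lemma cons_conserved:
  assumes z: "z \<in> phase_dom" and L: "L \<noteq> 0"
  shows "frechet_derivative (cons L) (at z) (ham_field L z) = 0"
proof -
  obtain U g g' T where U: "open U" "z \<in> U" "U \<subseteq> phase_dom" "\<And>x. x \<in> U \<Longrightarrow> cons L x = g (ham L x)" "\<And>x. x \<in> U \<Longrightarrow> ham L x \<in> T"
    "\<And>h. h \<in> T \<Longrightarrow> (g has_real_derivative g' h) (at h)" "continuous_on T g'"
    using cons_local[OF z L] by metis
  have "((\<lambda>x. g (ham L x)) has_derivative (\<lambda>v. g' (ham L z) * frechet_derivative (ham L) (at z) v)) (at z)"
    by (rule has_derivative_compose[OF C1_has_derivative[OF C1_ham[OF L] z] U(6)[OF U(5)[OF U(2)], unfolded has_field_derivative_def]])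
  then have "(cons L has_derivative (\<lambda>v. g' (ham L z) * frechet_derivative (ham L) (at z) v)) (at z)"
    by (rule has_derivative_transform_within_open[OF _ U(1,2)]) (simp add: U(4))
  from frechet_derivative_eqI[OF this] show ?thesis by (simp add: ham_conserved[OF z L])
qed

text \<open>\<open>weight_norm\<close> itself is not conserved in general. Adding a^2 sin^2 theta
  v_t^2 completes it to M^2 v_t^2 plus Carter's constant and at most doubles it.\<close>

definition cons_weight :: "real \<Rightarrow> real \<times> real \<times> real \<times> real \<Rightarrow> real" where
  "cons_weight L z = cons L z * (M\<^sup>2 * (ham L z)\<^sup>2 + carter L z)\<^sup>2"

lemma C1_cons_weight: "L \<noteq> 0 \<Longrightarrow> Ck_on (Suc 0) (cons_weight L) phase_dom"
  unfolding cons_weight_def[abs_def] by (intro C1_intros C1_cons C1_ham C1_carter)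

lemma cons_weight_conserved:
  assumes z: "z \<in> phase_dom" and L: "L \<noteq> 0"
  shows "frechet_derivative (cons_weight L) (at z) (ham_field L z) = 0"
proof -
  note dJ = C1_has_derivative[OF C1_cons[OF L] z] and dH = C1_has_derivative[OF C1_ham[OF L] z] and dK = C1_has_derivative[OF C1_carter[OF L] z]
  have "(cons_weight L has_derivative (\<lambda>v. cons L z * (2 * (M\<^sup>2 * (ham L z)\<^sup>2 + carter L z) * (M\<^sup>2 * (2 * ham L z * frechet_derivative (ham L) (at z) v)
      + frechet_derivative (carter L) (at z) v)) + frechet_derivative (cons L) (at z) v * (M\<^sup>2 * (ham L z)\<^sup>2 + carter L z)\<^sup>2)) (at z)"
    unfolding cons_weight_def[abs_def]
    by (rule has_derivative_eq_rhs, (rule derivative_eq_intros refl dJ dH dK)+) (simp add: fun_eq_iff algebra_simps)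
  from frechet_derivative_eqI[OF this] show ?thesis by (simp add: ham_conserved[OF z L] carter_conserved[OF z L] cons_conserved[OF z L])
qed

text \<open>Three factors are compared separately: \<open>weight_num\<close> /
  \<open>ham_root\<close> with \<open>cons\<close>, the squared norms with a factor up to 4, and r^2
  / Sigma, which lies between 1/2 and 1. Hence 120000 = 15000 * 4 * 2.\<close>

lemma cons_weight_bounds:
  assumes z: "z \<in> phase_dom" and L: "L \<noteq> 0"
  shows "0 \<le> cons_weight L z" "phase_weight L z \<le> 30 * cons_weight L z" "cons_weight L z \<le> 120000 * phase_weight L z"
proof -
  obtain r \<theta> p b where z': "z = (r, \<theta>, p, b)" by (cases z)
  note zz = z[unfolded z']
  note pos = phase_dom_simps(1-6)[OF zz, simplified]
  define N S J Q k where "N = weight_num L z" and "S = ham_root L z" and "J = cons L z" and "Q = (weight_norm L z)\<^sup>2"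
    and "k = (M\<^sup>2 * (ham L z)\<^sup>2 + carter L z)\<^sup>2"
  have b: "N \<le> 30 * (S * J)" "S * J \<le> 15000 * N" "0 < J" "0 < S"
    using cons_bounds[OF zz L] ham_root_pos[OF zz L] by (simp_all add: N_def S_def J_def z')
  have N0: "0 \<le> N" using b mult_pos_pos[OF b(4,3)] by linarith
  have q0: "0 \<le> weight_norm L z" by (simp add: weight_norm_def)
  have ex: "M\<^sup>2 * (ham L z)\<^sup>2 + carter L z = weight_norm L z + (a\<^sup>2 * (sin \<theta>)\<^sup>2) * (ham L z)\<^sup>2"
    by (simp add: weight_norm_def carter_def z')
  have "a\<^sup>2 * (sin \<theta>)\<^sup>2 \<le> M\<^sup>2 * 1"
  proof (intro mult_mono)
    show "a\<^sup>2 \<le> M\<^sup>2" using a2_le zero_le_power2[of M] by linarith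
  qed (simp_all add: abs_square_le_1)
  then have "(a\<^sup>2 * (sin \<theta>)\<^sup>2) * (ham L z)\<^sup>2 \<le> M\<^sup>2 * (ham L z)\<^sup>2" by (intro mult_right_mono) auto
  moreover have "M\<^sup>2 * (ham L z)\<^sup>2 \<le> weight_norm L z" by (simp add: weight_norm_def)
  moreover have "0 \<le> (a\<^sup>2 * (sin \<theta>)\<^sup>2) * (ham L z)\<^sup>2" by simp
  ultimately have "weight_norm L z \<le> M\<^sup>2 * (ham L z)\<^sup>2 + carter L z" "M\<^sup>2 * (ham L z)\<^sup>2 + carter L z \<le> 2 * weight_norm L z" unfolding ex by linarith+
  then have "Q \<le> k" "k \<le> (2 * weight_norm L z)\<^sup>2" unfolding Q_def k_def using q0 by - (rule power_mono; linarith)+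
  then have k: "Q \<le> k" "k \<le> 4 * Q" "0 \<le> Q" by (simp_all add: Q_def power_mult_distrib)
  define s where "s = r\<^sup>2 / Sg r \<theta>"
  have "a\<^sup>2 * (cos \<theta>)\<^sup>2 \<le> r\<^sup>2 * 1"
  proof (intro mult_mono)
    have "a\<^sup>2 \<le> M\<^sup>2" using a2_le zero_le_power2[of M] by linarith
    also have "\<dots> \<le> r\<^sup>2" using ext_pos(3)[OF pos(6)] M_pos by (intro power_mono) auto
    finally show "a\<^sup>2 \<le> r\<^sup>2" .
  qed (simp_all add: abs_square_le_1)
  then have s: "1 / 2 \<le> s" "s \<le> 1"
    using pos(3) unfolding s_def by (simp_all add: kerr_Sigma_def divide_simps)
  have w: "phase_weight L z = s * (N / S * Q)"
    unfolding phase_weight_def s_def N_def S_def Q_def z' weight_weight_num[OF zz] using pos(1) by simp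
  have NS: "N / S \<le> 30 * J" "J \<le> 15000 * (N / S)" "0 \<le> N / S"
    using b N0 by (simp_all add: field_simps)
  have cons_weight: "cons_weight L z = J * k" by (simp add: cons_weight_def J_def k_def)
  show "0 \<le> cons_weight L z" unfolding cons_weight using b k by simp
  have nsq: "0 \<le> N / S * Q" using NS(3) k(3) by (rule mult_nonneg_nonneg)
  have "s * (N / S * Q) \<le> 1 * (N / S * Q)" using s(2) nsq by (rule mult_right_mono)
  also have "\<dots> \<le> 30 * J * k" using NS k b by (simp only: mult_1) (intro mult_mono; simp)
  finally show "phase_weight L z \<le> 30 * cons_weight L z" unfolding w cons_weight by simp
  have "J * k \<le> 15000 * (N / S) * (4 * Q)" using NS k b by (intro mult_mono) auto
  also have "\<dots> = 120000 * (1 / 2 * (N / S * Q))" by simp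
  also have "\<dots> \<le> 120000 * (s * (N / S * Q))"
    using mult_right_mono[OF s(1) nsq] by (intro mult_left_mono) simp_all
  finally show "cons_weight L z \<le> 120000 * phase_weight L z" unfolding w cons_weight .
qed

end

context kerr_vlasov begin

lemma continuous_on_F_avg_phase_weight:
  assumes L: "L \<noteq> 0" shows "continuous_on phase_dom (\<lambda>z. phase_weight L z * F_avg L (t, z))"
proof -
  have "continuous_on phase_dom (\<lambda>z. F_avg L (t, z))"
    by (rule continuous_on_compose2[OF C1_continuous_on[OF C1_F_avg[OF L]]]) (auto intro!: continuous_intros)
  moreover have "continuous_on phase_dom (phase_weight L)"
  proof -
    have "De (zr z) \<noteq> 0" "(sin (z\<theta> z))\<^sup>2 \<noteq> 0" "Sg (zr z) (z\<theta> z) * ham_root L z \<noteq> 0" if "z \<in> phase_dom" for z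
      using phase_dom_simps(1-6)[OF that] phase_dom_simps(7)[OF that L] by auto
    then have "Ck_on (Suc 0) (phase_weight L) phase_dom"
      unfolding phase_weight_def[abs_def] weight_def weight_norm_def by (intro C1_intros C1_ham C1_ham_root L) auto
    then show ?thesis by (rule C1_continuous_on)
  qed
  ultimately show ?thesis by (intro continuous_intros)
qed

lemma phase_weight_F_avg_borel:
  assumes L: "L \<noteq> 0" shows "(\<lambda>z. ennreal (phase_weight L z * F_avg L (t, z)) * indicator phase_dom z) \<in> borel_measurable borel"
proof -
  have "(\<lambda>z. indicator phase_dom z *\<^sub>R (phase_weight L z * F_avg L (t, z))) \<in> borel_measurable borel"
    using open_phase_dom by (intro borel_measurable_continuous_on_indicator continuous_on_F_avg_phase_weight L) auto
  then have "(\<lambda>z. ennreal (indicator phase_dom z *\<^sub>R (phase_weight L z * F_avg L (t, z)))) \<in> borel_measurable borel"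
    by measurable
  moreover have "(\<lambda>z. ennreal (indicator phase_dom z *\<^sub>R (phase_weight L z * F_avg L (t, z)))) = (\<lambda>z. ennreal (phase_weight L z * F_avg L (t, z)) * indicator phase_dom z)"
    by (auto simp: indicator_def fun_eq_iff)
  ultimately show ?thesis by simp
qed

lemma phase_weight_nonneg: "z \<in> phase_dom \<Longrightarrow> L \<noteq> 0 \<Longrightarrow> 0 \<le> phase_weight L z"
  using phase_dom_simps(1-6)[of z] phase_dom_simps(7)[of z L] by (simp add: phase_weight_def weight_def)

end

locale kerr_slow_vlasov = kerr_slow + kerr_vlasov
begin

text \<open>Trade the weight for the conserved one, propagate, and trade back; 3600000 = 30 *
  120000.\<close>

lemma weighted_estimate:
  assumes L: "L \<noteq> 0"
  shows "(\<integral>\<^sup>+z\<in>phase_dom. (phase_weight L z * F_avg L (t, z)) \<partial>lborel) \<le> 3600000 * (\<integral>\<^sup>+z\<in>phase_dom. (phase_weight L z * F_avg L (0, z)) \<partial>lborel)"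
proof -
  have "(\<integral>\<^sup>+z\<in>phase_dom. (phase_weight L z * F_avg L (t, z)) \<partial>lborel) \<le> (\<integral>\<^sup>+z\<in>phase_dom. (30 * cons_weight L z * F_avg L (t, z)) \<partial>lborel)"
    using cons_weight_bounds(2)[OF _ L] F_avg_nonneg[OF _ L]
    by (intro nn_integral_mono) (auto simp: indicator_def intro!: ennreal_leI mult_right_mono)
  also have "\<dots> \<le> (\<integral>\<^sup>+z\<in>phase_dom. (30 * cons_weight L z * F_avg L (0, z)) \<partial>lborel)"
  proof (rule conserved_estimate[OF L])
    show "Ck_on (Suc 0) (\<lambda>z. 30 * cons_weight L z) phase_dom" by (intro C1_intros C1_cons_weight L)
    show "0 \<le> 30 * cons_weight L z" if "z \<in> phase_dom" for z using cons_weight_bounds(1)[OF that L] by simp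
    show "frechet_derivative (\<lambda>z. 30 * cons_weight L z) (at z) (ham_field L z) = 0" if "z \<in> phase_dom" for z
    proof -
      have "((\<lambda>z. 30 * cons_weight L z) has_derivative (\<lambda>v. 30 * frechet_derivative (cons_weight L) (at z) v)) (at z)"
        by (rule has_derivative_mult_right[OF C1_has_derivative[OF C1_cons_weight[OF L] that]])
      from frechet_derivative_eqI[OF this] show ?thesis using cons_weight_conserved[OF that L] by simp
    qed
  qed
  also have "\<dots> \<le> (\<integral>\<^sup>+z. ennreal 3600000 * (ennreal (phase_weight L z * F_avg L (0, z)) * indicator phase_dom z) \<partial>lborel)"
  proof (rule nn_integral_mono)
    fix z
    show "ennreal (30 * cons_weight L z * F_avg L (0, z)) * indicator phase_dom z \<le> ennreal 3600000 * (ennreal (phase_weight L z * F_avg L (0, z)) * indicator phase_dom z)"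
    proof (cases "z \<in> phase_dom")
      case True
      have "30 * cons_weight L z * F_avg L (0, z) \<le> 3600000 * (phase_weight L z * F_avg L (0, z))"
        using mult_right_mono[OF cons_weight_bounds(3)[OF True L] F_avg_nonneg[OF True L, of 0]] by simp
      then have "ennreal (30 * cons_weight L z * F_avg L (0, z)) \<le> ennreal (3600000 * (phase_weight L z * F_avg L (0, z)))" by (rule ennreal_leI)
      then show ?thesis using True by (simp add: ennreal_mult')
    qed simp
  qed
  also have "\<dots> = ennreal 3600000 * (\<integral>\<^sup>+z\<in>phase_dom. (phase_weight L z * F_avg L (0, z)) \<partial>lborel)"
    by (rule nn_integral_cmult) (use phase_weight_F_avg_borel[OF L] in simp)
  finally show ?thesis by simp
qed

end

section \<open>The energy as an integral over phase space\<close>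

lemma lborel_nn_integral_swap:
  fixes f :: "real \<Rightarrow> real \<Rightarrow> ennreal"
  assumes "(\<lambda>x. f (fst x) (snd x)) \<in> borel_measurable (lborel \<Otimes>\<^sub>M lborel)"
  shows "(\<integral>\<^sup>+x. \<integral>\<^sup>+y. f x y \<partial>lborel \<partial>lborel) = (\<integral>\<^sup>+y. \<integral>\<^sup>+x. f x y \<partial>lborel \<partial>lborel)"
  using lborel_pair.Fubini'[of f] assms by (simp add: case_prod_unfold)

lemma lborel_nn_integral_pair:
  fixes f :: "'a::euclidean_space \<times> 'b::euclidean_space \<Rightarrow> ennreal"
  assumes "f \<in> borel_measurable borel"
  shows "(\<integral>\<^sup>+x. f x \<partial>lborel) = (\<integral>\<^sup>+x. \<integral>\<^sup>+y. f (x, y) \<partial>lborel \<partial>lborel)"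
proof -
  have "(\<integral>\<^sup>+x. f x \<partial>lborel) = (\<integral>\<^sup>+x. f x \<partial>(lborel \<Otimes>\<^sub>M lborel))" by (simp add: lborel_prod)
  also have "\<dots> = (\<integral>\<^sup>+x. \<integral>\<^sup>+y. f (x, y) \<partial>lborel \<partial>lborel)"
    by (rule lborel.nn_integral_fst[symmetric]) (use assms in \<open>simp add: lborel_prod\<close>)
  finally show ?thesis .
qed

lemma borel_measurable_pair_section:
  fixes f :: "'a::euclidean_space \<times> 'b::euclidean_space \<Rightarrow> ennreal"
  assumes "f \<in> borel_measurable borel"
  shows "(\<lambda>y. f (x, y)) \<in> borel_measurable borel"
proof -
  have "(\<lambda>y. (x, y)) \<in> borel_measurable borel"
    by (intro borel_measurable_continuous_onI continuous_intros)
  from measurable_compose[OF this assms] show ?thesis .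
qed

text \<open>The change of variables for absolutely integrable functions is an equivalence, so both
  sides are infinite together. This gives the formula for nonnegative functions without assuming
  finiteness.\<close>

lemma nn_integral_substitution_inj:
  fixes g g' F :: "real \<Rightarrow> real"
  assumes A: "open A" and inj: "inj_on g A" and der: "\<And>x. x \<in> A \<Longrightarrow> (g has_real_derivative g' x) (at x)"
    and F: "F \<in> borel_measurable borel" "\<And>y. 0 \<le> F y" "\<And>y. y \<notin> g ` A \<Longrightarrow> F y = 0"
    and m: "(\<lambda>x. indicator A x * (\<bar>g' x\<bar> * F (g x))) \<in> borel_measurable borel"
  shows "(\<integral>\<^sup>+y. F y \<partial>lborel) = (\<integral>\<^sup>+x. indicator A x * (\<bar>g' x\<bar> * F (g x)) \<partial>lborel)"
proof -
  let ?G = "\<lambda>x. \<bar>g' x\<bar> * F (g x)"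
  have G0: "0 \<le> indicator A x * ?G x" for x using F(2) by (simp add: indicator_def)
  have L: "(\<integral>\<^sup>+x. ennreal (f x) \<partial>lborel) = (\<integral>\<^sup>+x. ennreal (f x) \<partial>lebesgue)" for f :: "real \<Rightarrow> real"
    by (simp add: nn_integral_completion)
  have F_cone: "F \<in> borel_measurable lebesgue" using F(1) by (simp add: measurable_completion)
  have Gm: "(\<lambda>x. indicator A x * ?G x) \<in> borel_measurable lebesgue" using m by (simp add: measurable_completion)
  have eqF: "(\<lambda>y. indicator (g ` A) y *\<^sub>R F y) = F" using F(3) by (auto simp: indicator_def fun_eq_iff)
  have eqG: "(\<lambda>x. indicator A x *\<^sub>R ?G x) = (\<lambda>x. indicator A x * ?G x)" by (simp add: fun_eq_iff)
  have bl_comp: "?G absolutely_integrable_on A \<and> integral A ?G = b \<longleftrightarrow> F absolutely_integrable_on (g ` A) \<and> integral (g ` A) F = b" for b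
    by (rule has_absolute_integral_change_of_variables_1'[OF _ _ inj]) (use A der in \<open>auto intro: has_field_derivative_at_within\<close>)
  have iF: "F absolutely_integrable_on (g ` A) \<longleftrightarrow> integrable lebesgue F"
    by (simp only: set_integrable_def eqF)
  have iG: "?G absolutely_integrable_on A \<longleftrightarrow> integrable lebesgue (\<lambda>x. indicator A x * ?G x)"
    by (simp only: set_integrable_def eqG)
  have fF: "integrable lebesgue F \<longleftrightarrow> (\<integral>\<^sup>+y. F y \<partial>lebesgue) < \<infinity>"
    using F_cone F(2) by (simp add: integrable_iff_bounded)
  have fG: "integrable lebesgue (\<lambda>x. indicator A x * ?G x) \<longleftrightarrow> (\<integral>\<^sup>+x. indicator A x * ?G x \<partial>lebesgue) < \<infinity>"
  proof -
    have "(\<integral>\<^sup>+x. norm (indicator A x * ?G x) \<partial>lebesgue) = (\<integral>\<^sup>+x. indicator A x * ?G x \<partial>lebesgue)"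
      by (intro nn_integral_cong) (simp only: real_norm_def abs_of_nonneg[OF G0])
    then show ?thesis using Gm by (simp only: integrable_iff_bounded simp_thms)
  qed
  show ?thesis
  proof (cases "integrable lebesgue F")
    case True
    with bl_comp[of "integral (g ` A) F"] iF iG
    have G: "integrable lebesgue (\<lambda>x. indicator A x * ?G x)" "?G absolutely_integrable_on A" "integral A ?G = integral (g ` A) F" by blast+
    have "F absolutely_integrable_on (g ` A)" using True iF by blast
    then have "integral (g ` A) F = (LINT y|lebesgue. F y)"
      using set_lebesgue_integral_eq_integral(2)[of "g ` A" F] unfolding set_lebesgue_integral_def eqF by simp
    moreover have "integral A ?G = (LINT x|lebesgue. indicator A x * ?G x)"
      using set_lebesgue_integral_eq_integral(2)[OF G(2)] unfolding set_lebesgue_integral_def eqG by simp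
    moreover have "(\<integral>\<^sup>+y. F y \<partial>lebesgue) = ennreal (LINT y|lebesgue. F y)"
      by (rule nn_integral_eq_integral[OF True]) (use F(2) in simp)
    moreover have "(\<integral>\<^sup>+x. indicator A x * ?G x \<partial>lebesgue) = ennreal (LINT x|lebesgue. indicator A x * ?G x)"
      by (rule nn_integral_eq_integral[OF G(1)]) (use G0 in simp)
    ultimately show ?thesis unfolding L using G(3) by simp
  next
    case False
    then have "\<not> integrable lebesgue (\<lambda>x. indicator A x * ?G x)" using bl_comp[of "integral A ?G"] iF iG by blast
    then show ?thesis unfolding L using False fF fG by (metis infinity_ennreal_def less_top)
  qed
qed

lemma borel_measurable_linear_vec:
  fixes f :: "'a::euclidean_space \<Rightarrow> 'b::euclidean_space"
  shows "linear f \<Longrightarrow> f \<in> borel_measurable borel"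
  by (intro borel_measurable_continuous_onI linear_continuous_on linear_conv_bounded_linear[THEN iffD1])

lemma borel_measurable_vec4:
  fixes f g h k :: "'a \<Rightarrow> real"
  assumes "f \<in> borel_measurable N" "g \<in> borel_measurable N" "h \<in> borel_measurable N" "k \<in> borel_measurable N"
  shows "(\<lambda>x. vector [f x, g x, h x, k x] :: real^4) \<in> borel_measurable N"
proof -
  have *: "(\<lambda>x. (vector [f x, g x, h x, k x] :: real^4) $ i) \<in> borel_measurable N" for i
    using exhaust_4[of i] assms by (elim disjE) (simp_all only: vector_4)
  have "(\<lambda>x. (vector [f x, g x, h x, k x] :: real^4) \<bullet> b) \<in> borel_measurable N" if B: "b \<in> Basis" for b
  proof -
    from B obtain i where b: "b = axis i 1" unfolding Basis_vec_def by auto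
    show ?thesis unfolding b inner_axis using *[of i] by simp
  qed
  then show ?thesis by (subst borel_measurable_euclidean_space) blast
qed

lemma kerr_metric_borel: 
  assumes V: "\<And>i. (\<lambda>p. V p $ i) \<in> borel_measurable borel" and W: "\<And>i. (\<lambda>p. W p $ i) \<in> borel_measurable borel"
    and X: "\<And>i. (\<lambda>p. X p $ i) \<in> borel_measurable borel"
  shows "(\<lambda>p. kerr_metric M a (X p) (V p) (W p)) \<in> borel_measurable borel"
proof -
  note [measurable] = V W X
  show ?thesis
    unfolding kerr_metric_def Let_def dr_form_def sin2_dphi_form_def round_metric_def cos_polar_def rad_def kerr_Sigma_def kerr_Delta_def
    by measurable
qed

text \<open>Needed because \<open>f\<close> is constrained only on the cone; its zero extension is
  measurable once the cone is.\<close>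

lemma future_cone_borel: "future_cone M a \<in> sets borel"
proof -
  have [measurable]: "(\<lambda>p :: (real^4) \<times> (real^4). fst p $ i) \<in> borel_measurable borel" "(\<lambda>p :: (real^4) \<times> (real^4). snd p $ i) \<in> borel_measurable borel" for i
    by (auto intro!: borel_measurable_continuous_onI continuous_intros)
  have T: "(\<lambda>p :: (real^4) \<times> (real^4). T_perp M a (fst p) $ i) \<in> borel_measurable borel" for i
    using exhaust_4[of i]
    unfolding T_perp_def d_phi_def rad_def cos_polar_def kerr_Pi_def kerr_Delta_def
    by (elim disjE; simp only: vector_4 vector_add_component vector_scaleR_component; measurable)
  have [measurable]: "(\<lambda>p. kerr_metric M a (fst p) (snd p) (snd p)) \<in> borel_measurable borel"
    by (rule kerr_metric_borel) measurable
  have [measurable]: "(\<lambda>p. kerr_metric M a (fst p) (snd p) (T_perp M a (fst p))) \<in> borel_measurable borel"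
    by (rule kerr_metric_borel) (measurable, rule T, measurable)
  have [measurable]: "(\<lambda>p :: (real^4) \<times> (real^4). rad (fst p)) \<in> borel_measurable borel"
    unfolding rad_def by measurable
  have "future_cone M a = {p \<in> space borel. r_plus M a < rad (fst p) \<and> kerr_metric M a (fst p) (snd p) (snd p) = 0
      \<and> kerr_metric M a (fst p) (snd p) (T_perp M a (fst p)) < 0}"
    by (auto simp: future_cone_def kerr_exterior_def)
  also have "\<dots> \<in> sets borel" by measurable
  finally show ?thesis .
qed

context kerr_vlasov begin

text \<open>With \<open>f\<close> extended by zero, integrals over a sheet of the cone become integrals over all
  velocities; on the fold \<open>v\<^sub>t = 0\<close> the density vanishes because \<open>x / 0 = 0\<close>.\<close>

definition f_ext :: "(real^4) \<times> (real^4) \<Rightarrow> real" where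
  "f_ext p = indicator (future_cone M a) p * f p"

lemma f_ext_borel: "f_ext \<in> borel_measurable borel"
proof -
  have "continuous_on (future_cone M a) f"
    by (rule differentiable_imp_continuous_on)
      (auto simp: differentiable_on_def differentiable_def intro: smooth_on_submanifold_has_derivative[OF f_smooth])
  from borel_measurable_continuous_on_indicator[OF future_cone_borel this]
  show ?thesis by (simp add: f_ext_def[abs_def])
qed

lemma f_ext_nonneg: "0 \<le> f_ext p"
  using f_nonneg[of p] by (simp add: f_ext_def indicator_def)

end

section \<open>The two sheets of the cone over given spatial components\<close>

context kerr_bl begin

text \<open>At given \<open>(v\<^sup>r, v\<^sup>\<theta>, v\<^sup>\<phi>)\<close> the null condition is quadratic in \<open>v\<^sup>t\<close> and equivalent to
  \<open>v\<^sub>t\<^sup>2 = vt_disc r \<theta> v\<^sup>r v\<^sup>\<theta> v\<^sup>\<phi>\<close>; \<open>vt_sheet r \<theta> e v\<^sup>\<phi>\<close> is the \<open>v\<^sup>t\<close> for which \<open>v\<^sub>t = - e\<close>.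
  In the ergoregion, where \<open>ergo < 0\<close>, both roots can be future directed.\<close>

definition ergo :: "real \<Rightarrow> real \<Rightarrow> real" where
  "ergo r \<theta> = De r - a\<^sup>2 * (sin \<theta>)\<^sup>2"

definition vt_disc :: "real \<Rightarrow> real \<Rightarrow> real \<Rightarrow> real \<Rightarrow> real \<Rightarrow> real" where
  "vt_disc r \<theta> vr vt vp = De r * (sin \<theta>)\<^sup>2 * vp\<^sup>2 + ergo r \<theta> * (vr\<^sup>2 / De r + vt\<^sup>2)"

definition vt_sheet :: "real \<Rightarrow> real \<Rightarrow> real \<Rightarrow> real \<Rightarrow> real" where
  "vt_sheet r \<theta> e vp = (a * (sin \<theta>)\<^sup>2 * (De r - (r\<^sup>2 + a\<^sup>2)) * vp + Sg r \<theta> * e) / ergo r \<theta>"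

lemma lower_t:
  fixes q c :: "real^4"
  assumes z: "(q $ 2, q $ 3, p, b) \<in> phase_dom"
  shows "Sg (q $ 2) (q $ 3) * bl_lower M a q c 1 = - De (q $ 2) * frame_t (q $ 2) (q $ 3) c - a * (sin (q $ 3))\<^sup>2 * frame_\<phi> (q $ 2) c"
proof -
  have r: "rp < q $ 2" using z by (simp add: phase_dom_iff)
  have "Sg (q $ 2) (q $ 3) \<noteq> 0" using phase_dom_simps[OF z] by auto
  then show ?thesis unfolding bl_lower_def metric_carter[OF r] by (simp add: axis_def)
qed

lemma lower_t_vt_sheet:
  fixes q c :: "real^4"
  assumes z: "(q $ 2, q $ 3, p, b) \<in> phase_dom" and G: "ergo (q $ 2) (q $ 3) \<noteq> 0"
  shows "c $ 1 = vt_sheet (q $ 2) (q $ 3) e (c $ 4) \<longleftrightarrow> bl_lower M a q c 1 = - e"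
proof -
  have S: "Sg (q $ 2) (q $ 3) \<noteq> 0" using phase_dom_simps[OF z] by auto
  have eq: "Sg (q $ 2) (q $ 3) * bl_lower M a q c 1 = a * (sin (q $ 3))\<^sup>2 * (De (q $ 2) - ((q $ 2)\<^sup>2 + a\<^sup>2)) * c $ 4 - ergo (q $ 2) (q $ 3) * c $ 1"
    unfolding lower_t[OF z] ergo_def by (simp add: algebra_simps power2_eq_square)
  have "c $ 1 = vt_sheet (q $ 2) (q $ 3) e (c $ 4) \<longleftrightarrow> Sg (q $ 2) (q $ 3) * bl_lower M a q c 1 = Sg (q $ 2) (q $ 3) * (- e)"
    unfolding eq vt_sheet_def eq_divide_eq using G by (auto simp: algebra_simps)
  then show ?thesis using S by (metis mult_left_cancel)
qed

text \<open>Writing Sigma v_t in the tetrad components, (Delta tau + a s^2 sigma)^2 splits, with s =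
  sin theta, as Delta s^2 (a tau + sigma)^2 plus \<open>ergo\<close> times Delta tau^2 - s^2
  sigma^2. The first bracket is Sigma v^phi, and the null condition evaluates the second.\<close>

lemma null_vt_disc:
  fixes q c :: "real^4"
  assumes z: "(q $ 2, q $ 3, p, b) \<in> phase_dom" and n: "kerr_metric M a (bl_point q) (bl_vec q c) (bl_vec q c) = 0"
  shows "(bl_lower M a q c 1)\<^sup>2 = vt_disc (q $ 2) (q $ 3) (c $ 2) (c $ 3) (c $ 4)"
proof -
  define r \<theta> where "r = q $ 2" and "\<theta> = q $ 3"
  have r: "rp < r" using z by (simp add: phase_dom_iff r_def)
  have pos: "De r \<noteq> 0" "Sg r \<theta> \<noteq> 0" using phase_dom_simps[OF z] by (auto simp: r_def \<theta>_def)
  define \<tau> where "\<tau> = frame_t r \<theta> c"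
  define \<sigma> where "\<sigma> = frame_\<phi> r c"
  have 1: "Sg r \<theta> * bl_lower M a q c 1 = - De r * \<tau> - a * (sin \<theta>)\<^sup>2 * \<sigma>"
    using lower_t[OF z, of c] by (simp add: r_def \<theta>_def \<tau>_def \<sigma>_def)
  have 4: "Sg r \<theta> * c $ 4 = a * \<tau> + \<sigma>"
    unfolding \<tau>_def \<sigma>_def Sigma_s by (simp add: algebra_simps power2_eq_square)
  have "(- De r * \<tau> * \<tau> + (sin \<theta>)\<^sup>2 * \<sigma> * \<sigma>) / Sg r \<theta> + Sg r \<theta> / De r * (c $ 2 * c $ 2) + Sg r \<theta> * (c $ 3 * c $ 3) = 0"
    using n unfolding metric_carter[OF r[unfolded r_def]] by (simp add: r_def \<theta>_def \<tau>_def \<sigma>_def)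
  then have "Sg r \<theta> * ((- De r * \<tau> * \<tau> + (sin \<theta>)\<^sup>2 * \<sigma> * \<sigma>) / Sg r \<theta> + Sg r \<theta> / De r * (c $ 2 * c $ 2) + Sg r \<theta> * (c $ 3 * c $ 3)) = Sg r \<theta> * 0"
    by (rule arg_cong)
  then have "- De r * \<tau> * \<tau> + (sin \<theta>)\<^sup>2 * \<sigma> * \<sigma> + Sg r \<theta> * (Sg r \<theta> / De r * (c $ 2 * c $ 2)) + Sg r \<theta> * (Sg r \<theta> * (c $ 3 * c $ 3)) = 0"
    using pos by (simp only: distrib_left) simp
  then have n': "De r * \<tau>\<^sup>2 - (sin \<theta>)\<^sup>2 * \<sigma>\<^sup>2 = (Sg r \<theta>)\<^sup>2 * ((c $ 2)\<^sup>2 / De r + (c $ 3)\<^sup>2)"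
    by (simp add: power2_eq_square algebra_simps)
  have "(Sg r \<theta>)\<^sup>2 * (bl_lower M a q c 1)\<^sup>2 = (Sg r \<theta> * bl_lower M a q c 1)\<^sup>2" by (simp add: power_mult_distrib)
  also have "\<dots> = De r * (sin \<theta>)\<^sup>2 * (a * \<tau> + \<sigma>)\<^sup>2 + ergo r \<theta> * (De r * \<tau>\<^sup>2 - (sin \<theta>)\<^sup>2 * \<sigma>\<^sup>2)"
    unfolding 1 ergo_def by (simp add: algebra_simps power2_eq_square)
  also have "\<dots> = (Sg r \<theta>)\<^sup>2 * vt_disc r \<theta> (c $ 2) (c $ 3) (c $ 4)"
    unfolding n' 4[symmetric] vt_disc_def by (simp add: algebra_simps power2_eq_square)
  finally show ?thesis using pos by (simp add: r_def \<theta>_def)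
qed

text \<open>For the substitution in \<open>L\<close> the whole real line is needed, including 0, so
  here b different from 0 supplies positivity.\<close>

lemma ham_root_pos': "(r, \<theta>, p, b) \<in> phase_dom \<Longrightarrow> b \<noteq> 0 \<Longrightarrow> 0 < ham_root L (r, \<theta>, p, b)"
proof -
  assume z: "(r, \<theta>, p, b) \<in> phase_dom" and b: "b \<noteq> 0"
  note pos = phase_dom_simps(1-4)[OF z, simplified]
  have "0 < PI r \<theta> * (De r * p\<^sup>2 + b\<^sup>2)" using pos b by (simp add: add_nonneg_pos)
  then have "0 < (Sg r \<theta>)\<^sup>2 * L\<^sup>2 / (sin \<theta>)\<^sup>2 + PI r \<theta> * (De r * p\<^sup>2 + b\<^sup>2)" by (simp add: add_nonneg_pos)
  then have "0 < De r * ((Sg r \<theta>)\<^sup>2 * L\<^sup>2 / (sin \<theta>)\<^sup>2 + PI r \<theta> * (De r * p\<^sup>2 + b\<^sup>2))" using pos by simp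
  then show "0 < ham_root L (r, \<theta>, p, b)" unfolding ham_root_def by simp
qed

text \<open>The second formula is the Jacobian dv^phi / dL. It is a positive factor times -v_t: its
  modulus cancels the 1 / |v_t| of the cone measure, and it changes sign exactly at the
  fold.\<close>

lemma bl_comp_L_deriv:
  assumes z: "(r, \<theta>, p, b) \<in> phase_dom" and b: "b \<noteq> 0"
  shows "((\<lambda>L. ham L (r, \<theta>, p, b)) has_real_derivative
      (2 * M * a * r + De r * (Sg r \<theta>)\<^sup>2 * L / ((sin \<theta>)\<^sup>2 * ham_root L (r, \<theta>, p, b))) / PI r \<theta>) (at L)"
    "((\<lambda>L. bl_comp L (r, \<theta>, p, b) $ 4) has_real_derivative
      ham L (r, \<theta>, p, b) * Sg r \<theta> / ((sin \<theta>)\<^sup>2 * ham_root L (r, \<theta>, p, b))) (at L)"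
proof -
  let ?z = "(r, \<theta>, p, b)"
  have r: "rp < r" using z by (simp add: phase_dom_iff)
  note pos = phase_dom_simps(1-4)[OF z, simplified]
  have nz: "De r \<noteq> 0" "sin \<theta> \<noteq> 0" "Sg r \<theta> \<noteq> 0" "PI r \<theta> \<noteq> 0" "(sin \<theta>)\<^sup>2 \<noteq> 0" using pos by auto
  have S: "0 < ham_root L ?z" using ham_root_pos'[OF z b] .
  let ?R = "\<lambda>L. De r * ((Sg r \<theta>)\<^sup>2 * L\<^sup>2 / (sin \<theta>)\<^sup>2 + PI r \<theta> * (De r * p\<^sup>2 + b\<^sup>2))"
  have R: "0 < ?R L" using S by (simp add: ham_root_def)
  have dR: "(?R has_real_derivative De r * ((Sg r \<theta>)\<^sup>2 * (2 * L) / (sin \<theta>)\<^sup>2)) (at L)"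
    by (rule DERIV_cong, (rule derivative_eq_intros refl nz)+) (use nz in \<open>simp add: field_simps power2_eq_square\<close>)
  have Seq: "ham_root L ?z = sqrt (?R L)" for L by (simp add: ham_root_def)
  have dS: "((\<lambda>L. ham_root L ?z) has_real_derivative De r * (Sg r \<theta>)\<^sup>2 * L / ((sin \<theta>)\<^sup>2 * ham_root L ?z)) (at L)"
    unfolding Seq
    by (rule DERIV_cong[OF DERIV_chain2[OF DERIV_real_sqrt[OF R] dR]]) (use nz in \<open>simp add: field_simps\<close>)
  show dH: "((\<lambda>L. ham L ?z) has_real_derivative (2 * M * a * r + De r * (Sg r \<theta>)\<^sup>2 * L / ((sin \<theta>)\<^sup>2 * ham_root L ?z)) / PI r \<theta>) (at L)"
    unfolding ham_def fst_conv snd_conv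
    by (rule DERIV_cong, (rule derivative_eq_intros refl nz dS)+) (use nz in \<open>simp add: field_simps\<close>)
  define E' where "E' = (2 * M * a * r + De r * (Sg r \<theta>)\<^sup>2 * L / ((sin \<theta>)\<^sup>2 * ham_root L ?z)) / PI r \<theta>"
  have "((\<lambda>L. bl_comp L ?z $ 4) has_real_derivative
      (a * ((r\<^sup>2 + a\<^sup>2) * E' - a) / De r + 1 / (sin \<theta>)\<^sup>2 - a * E') / Sg r \<theta>) (at L)"
    unfolding bl_comp_def fst_conv snd_conv vector_4
    by (rule DERIV_cong, (rule derivative_eq_intros refl nz dH[folded E'_def])+) (use nz in \<open>simp add: field_simps\<close>)
  moreover have "(a * ((r\<^sup>2 + a\<^sup>2) * E' - a) / De r + 1 / (sin \<theta>)\<^sup>2 - a * E') / Sg r \<theta> = ham L ?z * Sg r \<theta> / ((sin \<theta>)\<^sup>2 * ham_root L ?z)"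
  proof -
    define s2 where "s2 = (sin \<theta>)\<^sup>2"
    define S' where "S' = ham_root L ?z"
    have c2: "(cos \<theta>)\<^sup>2 = 1 - s2" by (simp add: s2_def cos_squared_eq)
    have nz': "s2 \<noteq> 0" "S' \<noteq> 0" using nz S by (simp_all add: s2_def S'_def)
    have id1: "4 * M\<^sup>2 * a\<^sup>2 * r\<^sup>2 * s2 + PI r \<theta> * (De r - a\<^sup>2 * s2) = De r * (Sg r \<theta>)\<^sup>2"
      unfolding kerr_Pi_def kerr_Sigma_def kerr_Delta_def c2 by algebra
    have E1: "PI r \<theta> * (s2 * S' * E') = 2 * M * a * r * s2 * S' + De r * (Sg r \<theta>)\<^sup>2 * L"
      using nz nz' unfolding E'_def s2_def[symmetric] S'_def[symmetric] by (simp add: field_simps)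
    have E2: "PI r \<theta> * ham L ?z = S' + 2 * M * a * r * L" using ham_root_eq[OF r, of L \<theta> p b] by (simp add: S'_def)
    have X: "(a * ((r\<^sup>2 + a\<^sup>2) * E' - a) / De r + 1 / s2 - a * E') * (De r * s2) = 2 * M * a * r * s2 * E' + (De r - a\<^sup>2 * s2)"
      using nz nz' by (simp add: field_simps) (simp add: kerr_Delta_def algebra_simps power2_eq_square)
    have "PI r \<theta> * ((a * ((r\<^sup>2 + a\<^sup>2) * E' - a) / De r + 1 / s2 - a * E') * (De r * s2) * S')
      = 2 * M * a * r * (PI r \<theta> * (s2 * S' * E')) + PI r \<theta> * (De r - a\<^sup>2 * s2) * S'"
      unfolding X by (simp add: algebra_simps)
    also have "\<dots> = (4 * M\<^sup>2 * a\<^sup>2 * r\<^sup>2 * s2 + PI r \<theta> * (De r - a\<^sup>2 * s2)) * S' + De r * (Sg r \<theta>)\<^sup>2 * (2 * M * a * r * L)"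
      unfolding E1 by (simp add: algebra_simps power2_eq_square)
    also have "\<dots> = De r * (Sg r \<theta>)\<^sup>2 * (PI r \<theta> * ham L ?z)" unfolding id1 E2 by (simp add: algebra_simps)
    finally have "PI r \<theta> * ((a * ((r\<^sup>2 + a\<^sup>2) * E' - a) / De r + 1 / s2 - a * E') * (De r * s2) * S') = PI r \<theta> * (De r * (Sg r \<theta>)\<^sup>2 * ham L ?z)"
      by (simp add: algebra_simps)
    then have "(a * ((r\<^sup>2 + a\<^sup>2) * E' - a) / De r + 1 / s2 - a * E') * (De r * s2) * S' = De r * (Sg r \<theta>)\<^sup>2 * ham L ?z"
      using nz(4) by (metis mult_left_cancel)
    moreover have "x / Sg r \<theta> = H * Sg r \<theta> / (s2 * S')" if "x * (De r * s2) * S' = De r * (Sg r \<theta>)\<^sup>2 * H" for x H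
    proof -
      have "De r * (x * (s2 * S')) = De r * (H * (Sg r \<theta>)\<^sup>2)" using that by (simp add: algebra_simps)
      then have "x * (s2 * S') = H * (Sg r \<theta>)\<^sup>2" using nz(1) by (metis mult_left_cancel)
      then show ?thesis using nz nz' by (simp add: frac_eq_eq power2_eq_square)
    qed
    ultimately show ?thesis unfolding s2_def S'_def by blast
  qed
  ultimately show "((\<lambda>L. bl_comp L ?z $ 4) has_real_derivative ham L ?z * Sg r \<theta> / ((sin \<theta>)\<^sup>2 * ham_root L ?z)) (at L)" by simp
qed

text \<open>Squaring \<open>ham_root\<close> = -2 M a r L gives k L^2 = m with m > 0, so at most two
  values of \<open>L\<close> lie on the fold.\<close>

lemma ham_zero_finite:
  assumes z: "(r, \<theta>, p, b) \<in> phase_dom" and b: "b \<noteq> 0"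
  shows "finite {L. ham L (r, \<theta>, p, b) = 0}"
proof -
  note pos = phase_dom_simps(1-4)[OF z, simplified]
  define k where "k = 4 * M\<^sup>2 * a\<^sup>2 * r\<^sup>2 - De r * (Sg r \<theta>)\<^sup>2 / (sin \<theta>)\<^sup>2"
  define m where "m = De r * (PI r \<theta> * (De r * p\<^sup>2 + b\<^sup>2))"
  have m: "0 < m" using pos b by (simp add: m_def add_nonneg_pos)
  have "{L. ham L (r, \<theta>, p, b) = 0} \<subseteq> {sqrt (m / k), - sqrt (m / k)}"
  proof
    fix L assume "L \<in> {L. ham L (r, \<theta>, p, b) = 0}"
    then have "ham_root L (r, \<theta>, p, b) = - (2 * M * a * r * L)" using pos by (simp add: ham_def)
    then have "(ham_root L (r, \<theta>, p, b))\<^sup>2 = (2 * M * a * r * L)\<^sup>2" by simp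
    then have "k * L\<^sup>2 = m"
      unfolding ham_root_square[OF z] k_def m_def by (simp add: algebra_simps power_mult_distrib)
    then have "k \<noteq> 0" "L\<^sup>2 = m / k" using m by (auto simp: field_simps)
    then show "L \<in> {sqrt (m / k), - sqrt (m / k)}" by (metis insertCI abs_if minus_minus real_sqrt_abs)
  qed
  then show ?thesis by (rule finite_subset) simp
qed

end

context kerr_vlasov begin

definition cone_integrand :: "real^4 \<Rightarrow> real^4 \<Rightarrow> real" where
  "cone_integrand q c = model_weight M a q c * weighted_norm_2 M a f_ext q c"

definition fibre_density :: "real^4 \<Rightarrow> real^4 \<Rightarrow> real" where
  "fibre_density q c = cone_integrand q c * ((q $ 2)\<^sup>2 * sin (q $ 3) / \<bar>bl_lower M a q c 1\<bar>)"

lemma bl_lower_borel: "(\<lambda>c. bl_lower M a q c i) \<in> borel_measurable borel"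
proof (rule borel_measurable_linear_vec)
  show "linear (\<lambda>c. bl_lower M a q c i)"
    unfolding bl_lower_def
    using linear_compose[OF bl_vec_linear kerr_metric_linear(1)] by (simp add: o_def)
qed

lemma cone_integrand_borel: "cone_integrand q \<in> borel_measurable borel"
proof -
  note [measurable] = bl_lower_borel
  have "(\<lambda>c. (bl_point q, bl_vec q c)) \<in> borel_measurable borel"
    by (intro borel_measurable_Pair borel_measurable_const borel_measurable_linear_vec[OF bl_vec_linear])
  from measurable_compose[OF this f_ext_borel]
  have [measurable]: "(\<lambda>c. f_ext (bl_point q, bl_vec q c)) \<in> borel_measurable borel" .
  show ?thesis unfolding cone_integrand_def[abs_def] model_weight_def weighted_norm_2_def by measurable
qed

lemma fibre_density_borel: "fibre_density q \<in> borel_measurable borel"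
proof -
  note [measurable] = bl_lower_borel cone_integrand_borel
  show ?thesis unfolding fibre_density_def[abs_def] by measurable
qed

lemma cone_integrand_nonneg: "rp < q $ 2 \<Longrightarrow> 0 \<le> cone_integrand q c"
  using ext_pos(1)[of "q $ 2"] f_ext_nonneg by (simp add: cone_integrand_def model_weight_def weighted_norm_2_def)

lemma fibre_density_nonneg: "(q $ 2, q $ 3, p, b) \<in> phase_dom \<Longrightarrow> 0 \<le> fibre_density q c"
  using cone_integrand_nonneg[of q c] phase_dom_simps(2,6)[of "(q $ 2, q $ 3, p, b)"] by (simp add: fibre_density_def)

lemma fibre_density_cone: "fibre_density q c \<noteq> 0 \<Longrightarrow> (bl_point q, bl_vec q c) \<in> future_cone M a \<and> bl_lower M a q c 1 \<noteq> 0"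
  by (auto simp: fibre_density_def cone_integrand_def weighted_norm_2_def f_ext_def indicator_def split: if_splits)

lemma sheet_sum:
  fixes q :: "real^4" and vr v\<theta> v\<phi> :: real
  assumes z: "(q $ 2, q $ 3, p, b) \<in> phase_dom" and G: "ergo (q $ 2) (q $ 3) \<noteq> 0"
  defines "e \<equiv> sqrt (vt_disc (q $ 2) (q $ 3) vr v\<theta> v\<phi>)"
  shows "(\<integral>\<^sup>+vt. ennreal (fibre_density q (vector [vt, vr, v\<theta>, v\<phi>])) \<partial>count_space {vt. (bl_point q, bl_vec q (vector [vt, vr, v\<theta>, v\<phi>])) \<in> future_cone M a})
    = ennreal (fibre_density q (vector [vt_sheet (q $ 2) (q $ 3) e v\<phi>, vr, v\<theta>, v\<phi>])) + ennreal (fibre_density q (vector [vt_sheet (q $ 2) (q $ 3) (- e) v\<phi>, vr, v\<theta>, v\<phi>]))"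
proof -
  let ?c = "\<lambda>vt. vector [vt, vr, v\<theta>, v\<phi>] :: real^4"
  let ?C = "{vt. (bl_point q, bl_vec q (?c vt)) \<in> future_cone M a}"
  let ?p = "vt_sheet (q $ 2) (q $ 3) e v\<phi>" and ?m = "vt_sheet (q $ 2) (q $ 3) (- e) v\<phi>"
  have sub: "?C \<subseteq> {?p, ?m}"
  proof
    fix vt assume "vt \<in> ?C"
    then have "kerr_metric M a (bl_point q) (bl_vec q (?c vt)) (bl_vec q (?c vt)) = 0" using cone_iff[OF z] by auto
    from null_vt_disc[OF z this] have "(bl_lower M a q (?c vt) 1)\<^sup>2 = vt_disc (q $ 2) (q $ 3) vr v\<theta> v\<phi>" by simp
    then have "\<bar>bl_lower M a q (?c vt) 1\<bar> = e" unfolding e_def by (metis real_sqrt_abs)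
    then have "bl_lower M a q (?c vt) 1 = - e \<or> bl_lower M a q (?c vt) 1 = - (- e)" by auto
    then show "vt \<in> {?p, ?m}" using lower_t_vt_sheet[OF z G, of "?c vt"] by auto
  qed
  have "(\<integral>\<^sup>+vt. ennreal (fibre_density q (?c vt)) \<partial>count_space ?C) = (\<Sum>vt\<in>?C. ennreal (fibre_density q (?c vt)))"
    by (rule nn_integral_count_space_finite) (rule finite_subset[OF sub], simp)
  also have "\<dots> = (\<Sum>vt\<in>{?p, ?m}. ennreal (fibre_density q (?c vt)))"
  proof (rule sum.mono_neutral_left)
    show "\<forall>vt\<in>{?p, ?m} - ?C. ennreal (fibre_density q (?c vt)) = 0"
    proof
      fix vt assume "vt \<in> {?p, ?m} - ?C"
      then have "fibre_density q (?c vt) = 0" using fibre_density_cone[of q "?c vt"] by blast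
      then show "ennreal (fibre_density q (?c vt)) = 0" by simp
    qed
  qed (use sub in auto)
  also have "\<dots> = ennreal (fibre_density q (?c ?p)) + ennreal (fibre_density q (?c ?m))"
  \<comment> \<open>If the two candidates coincide, the point is counted twice on the right; this is
    harmless, since then v_t = 0 and the density is 0.\<close>
  proof (cases "?p = ?m")
    case True
    have "bl_lower M a q (?c ?p) 1 = - e" using lower_t_vt_sheet[OF z G, of "?c ?p" e] by simp
    moreover have "bl_lower M a q (?c ?p) 1 = - (- e)" using lower_t_vt_sheet[OF z G, of "?c ?p" "- e"] True by simp
    ultimately have "fibre_density q (?c ?p) = 0" by (simp add: fibre_density_def)
    then show ?thesis using True by simp
  qed simp
  finally show ?thesis .
qed

text \<open>On each sheet \<open>v\<^sub>t\<close> has a fixed sign and \<open>L \<mapsto> v\<^sup>\<phi>\<close> is injective, which permits substitution.\<close>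

lemma single_sheet:
  fixes q :: "real^4" and p b s :: real
  assumes z: "(q $ 2, q $ 3, p, b) \<in> phase_dom" and G: "ergo (q $ 2) (q $ 3) \<noteq> 0" and b: "b \<noteq> 0" and s: "\<bar>s\<bar> = 1"
  defines "z \<equiv> (q $ 2, q $ 3, p, b)"
  defines "vr \<equiv> De (q $ 2) * p / Sg (q $ 2) (q $ 3)" and "v\<theta> \<equiv> b / Sg (q $ 2) (q $ 3)"
  shows "(\<integral>\<^sup>+v\<phi>. fibre_density q (vector [vt_sheet (q $ 2) (q $ 3) (s * sqrt (vt_disc (q $ 2) (q $ 3) vr v\<theta> v\<phi>)) v\<phi>, vr, v\<theta>, v\<phi>]) \<partial>lborel)
    = (\<integral>\<^sup>+L. indicator {L. 0 < s * ham L z} L * (cone_integrand q (bl_comp L z) * ((q $ 2)\<^sup>2 * Sg (q $ 2) (q $ 3) / (sin (q $ 3) * ham_root L z))) \<partial>lborel)"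
proof -
  define r \<theta> where "r = q $ 2" and "\<theta> = q $ 3"
  define A where "A = {L. 0 < s * ham L z}"
  define g where "g L = bl_comp L z $ 4" for L
  define g' where "g' L = ham L z * Sg r \<theta> / ((sin \<theta>)\<^sup>2 * ham_root L z)" for L
  define e where "e v\<phi> = sqrt (vt_disc r \<theta> vr v\<theta> v\<phi>)" for v\<phi>
  define C where "C v\<phi> = (vector [vt_sheet r \<theta> (s * e v\<phi>) v\<phi>, vr, v\<theta>, v\<phi>] :: real^4)" for v\<phi>
  have zd: "z \<in> phase_dom" using z by (simp add: z_def)
  have zq: "(r, \<theta>, p, b) \<in> phase_dom" using z by (simp add: r_def \<theta>_def)
  have zz: "z = (r, \<theta>, p, b)" by (simp add: z_def r_def \<theta>_def)
  note pos = phase_dom_simps(1-6)[OF zq, simplified]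
  have Sp: "0 < ham_root L z" for L using ham_root_pos'[OF z b] by (simp add: z_def)
  have ss: "s * s = 1" using s by (metis abs_mult_self_eq mult_1)
  have cv23: "bl_comp L z $ 2 = vr" "bl_comp L z $ 3 = v\<theta>" for L by (simp_all add: bl_comp_def zz vr_def v\<theta>_def r_def \<theta>_def)
  have cone: "(bl_point q, bl_vec q (bl_comp L z)) \<in> future_cone M a" for L
    using bl_comp_cone[OF z Sp[unfolded z_def]] by (simp add: z_def)
  have low: "bl_lower M a q (bl_comp L z) 1 = - ham L z" for L using bl_comp_lower(1)[OF z] by (simp add: z_def)
  have H2: "(ham L z)\<^sup>2 = vt_disc r \<theta> vr v\<theta> (g L)" for L
  proof -
    have "kerr_metric M a (bl_point q) (bl_vec q (bl_comp L z)) (bl_vec q (bl_comp L z)) = 0"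
      using cone cone_iff[OF z] by auto
    from null_vt_disc[OF z this] show ?thesis by (simp add: low cv23 g_def r_def \<theta>_def)
  qed
  have He: "ham L z = s * e (g L)" if "L \<in> A" for L
  proof -
    have "\<bar>ham L z\<bar> = e (g L)" unfolding e_def H2[symmetric] by simp
    moreover have "\<bar>ham L z\<bar> = s * ham L z" using that s by (auto simp: A_def abs_if split: if_splits)
    ultimately show ?thesis using ss by (metis mult.assoc mult_1)
  qed
  have CL: "C (g L) = bl_comp L z" if "L \<in> A" for L
  proof -
    have "bl_comp L z $ 1 = vt_sheet r \<theta> (s * e (g L)) (bl_comp L z $ 4)"
      using lower_t_vt_sheet[OF z G, of "bl_comp L z" "s * e (g L)"] low He[OF that] by (simp add: r_def \<theta>_def)
    then show ?thesis by (simp add: C_def vec_eq_iff forall_4 cv23 g_def)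
  qed
  \<comment> \<open>On a fixed sheet v^phi determines the whole null vector, and lowering it returns
    \<open>L\<close>.\<close>
  have inj: "inj_on g A"
  proof (rule inj_onI)
    fix x y assume "x \<in> A" "y \<in> A" "g x = g y"
    then have "bl_comp x z = bl_comp y z" using CL[of x] CL[of y] by simp
    moreover have "bl_lower M a q (bl_comp L z) 4 = L" for L using bl_comp_lower(4)[OF z] by (simp add: z_def)
    ultimately show "x = y" by metis
  qed
  \<comment> \<open>Where the density is nonzero the sheet point lies on the cone off the fold, so
    its own v_phi is a preimage under \<open>g\<close>, with the right sign of
    \<open>ham\<close>.\<close>
  have img: "v\<phi> \<in> g ` A" if "fibre_density q (C v\<phi>) \<noteq> 0" for v\<phi>
  proof -
    have c: "(bl_point q, bl_vec q (C v\<phi>)) \<in> future_cone M a" and l0: "bl_lower M a q (C v\<phi>) 1 \<noteq> 0"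
      using fibre_density_cone[OF that] by auto
    have l1: "bl_lower M a q (C v\<phi>) 1 = - (s * e v\<phi>)"
      using lower_t_vt_sheet[OF z G, of "C v\<phi>" "s * e v\<phi>"] by (simp add: C_def r_def \<theta>_def)
    have l2: "bl_lower M a q (C v\<phi>) 2 = p" "bl_lower M a q (C v\<phi>) 3 = b"
      using lower_inverse(4,5)[OF z, of "C v\<phi>"] pos by (simp_all add: C_def vr_def v\<theta>_def r_def \<theta>_def field_simps)
    define L where "L = bl_lower M a q (C v\<phi>) 4"
    note cc = cone_bl_comp[OF z c, unfolded l2, folded z_def L_def]
    have "kerr_metric M a (bl_point q) (bl_vec q (C v\<phi>)) (bl_vec q (C v\<phi>)) = 0"
      using c cone_iff[OF z] by auto
    from null_vt_disc[OF z this] have "(s * e v\<phi>)\<^sup>2 = vt_disc r \<theta> vr v\<theta> v\<phi>" by (simp add: l1) (simp add: C_def r_def \<theta>_def)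
    then have "0 \<le> vt_disc r \<theta> vr v\<theta> v\<phi>" by (metis zero_le_power2)
    then have "0 < e v\<phi>" using l0 l1 by (auto simp: e_def)
    then have "L \<in> A" using cc(3) ss l1 by (simp add: A_def mult.assoc[symmetric])
    moreover have "g L = v\<phi>" using cc(1) by (simp add: g_def flip: cc(1)) (simp add: C_def)
    ultimately show ?thesis by blast
  qed
  have contH: "continuous_on UNIV (\<lambda>L. ham L z)"
    by (rule continuous_at_imp_continuous_on) (use bl_comp_L_deriv(1)[OF zq b] in \<open>auto simp: zz intro: DERIV_isCont\<close>)
  have A_open: "open A" unfolding A_def by (intro open_Collect_less continuous_intros contH)
  note [measurable] = borel_measurable_continuous_onI[OF contH] fibre_density_borel cone_integrand_borel
  have [measurable]: "(\<lambda>L. ham_root L z) \<in> borel_measurable borel" unfolding ham_root_def by measurable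
  have [measurable]: "(\<lambda>L. bl_comp L z) \<in> borel_measurable borel"
    unfolding bl_comp_def by (intro borel_measurable_vec4; measurable)
  have [measurable]: "A \<in> sets borel" using A_open by simp
  have [measurable]: "C \<in> borel_measurable borel"
    unfolding C_def[abs_def] e_def vt_sheet_def vt_disc_def by (intro borel_measurable_vec4; measurable)
  have gm: "g' \<in> borel_measurable borel" unfolding g'_def[abs_def] by measurable
  have val: "indicator A L * (\<bar>g' L\<bar> * fibre_density q (C (g L))) = indicator A L * (cone_integrand q (bl_comp L z) * (r\<^sup>2 * Sg r \<theta> / (sin \<theta> * ham_root L z)))" for L
  proof (cases "L \<in> A")
    case True
    then have H0: "\<bar>ham L z\<bar> \<noteq> 0" by (auto simp: A_def)
    have "\<bar>g' L\<bar> * fibre_density q (C (g L)) = (\<bar>ham L z\<bar> * Sg r \<theta> / ((sin \<theta>)\<^sup>2 * ham_root L z)) * (cone_integrand q (bl_comp L z) * (r\<^sup>2 * sin \<theta> / \<bar>ham L z\<bar>))"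
      unfolding CL[OF True] fibre_density_def low g'_def using pos Sp[of L] by (simp add: abs_mult abs_divide r_def \<theta>_def)
    also have "\<dots> = cone_integrand q (bl_comp L z) * (r\<^sup>2 * Sg r \<theta> / (sin \<theta> * ham_root L z))"
      using H0 pos Sp[of L] by (simp add: field_simps power2_eq_square)
    finally show ?thesis by simp
  qed simp
  have m: "(\<lambda>L. indicator A L * (\<bar>g' L\<bar> * fibre_density q (C (g L)))) \<in> borel_measurable borel"
    unfolding val by measurable
  have "(\<integral>\<^sup>+v\<phi>. fibre_density q (C v\<phi>) \<partial>lborel) = (\<integral>\<^sup>+L. indicator A L * (\<bar>g' L\<bar> * fibre_density q (C (g L))) \<partial>lborel)"
  proof (rule nn_integral_substitution_inj[OF A_open inj _ _ _ _ m])
    show "(g has_real_derivative g' L) (at L)" if "L \<in> A" for L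
      using bl_comp_L_deriv(2)[OF zq b, of L] by (simp add: g_def[abs_def] g'_def zz)
    show "(\<lambda>v\<phi>. fibre_density q (C v\<phi>)) \<in> borel_measurable borel" by measurable
    show "0 \<le> fibre_density q (C v\<phi>)" for v\<phi> by (rule fibre_density_nonneg[OF z])
    show "fibre_density q (C v\<phi>) = 0" if "v\<phi> \<notin> g ` A" for v\<phi> using img that by blast
  qed
  then show ?thesis unfolding val by (simp only: C_def e_def r_def \<theta>_def A_def)
qed

text \<open>The two sheets correspond to \<open>ham\<close> > 0 and \<open>ham\<close> < 0. These
  conditions exhaust the \<open>L\<close>-line up to finitely many points, and the integrand in
  \<open>L\<close> is the same on both, so the pieces add up to one integral.\<close>

lemma both_sheets:
  fixes q :: "real^4" and p b :: real
  assumes z: "(q $ 2, q $ 3, p, b) \<in> phase_dom" and G: "ergo (q $ 2) (q $ 3) \<noteq> 0" and b: "b \<noteq> 0"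
  defines "z \<equiv> (q $ 2, q $ 3, p, b)"
  defines "vr \<equiv> De (q $ 2) * p / Sg (q $ 2) (q $ 3)" and "v\<theta> \<equiv> b / Sg (q $ 2) (q $ 3)"
  defines "e \<equiv> \<lambda>v\<phi>. sqrt (vt_disc (q $ 2) (q $ 3) vr v\<theta> v\<phi>)"
  shows "(\<integral>\<^sup>+v\<phi>. ennreal (fibre_density q (vector [vt_sheet (q $ 2) (q $ 3) (e v\<phi>) v\<phi>, vr, v\<theta>, v\<phi>]))
      + ennreal (fibre_density q (vector [vt_sheet (q $ 2) (q $ 3) (- e v\<phi>) v\<phi>, vr, v\<theta>, v\<phi>])) \<partial>lborel)
    = (\<integral>\<^sup>+L. cone_integrand q (bl_comp L z) * ((q $ 2)\<^sup>2 * Sg (q $ 2) (q $ 3) / (sin (q $ 3) * ham_root L z)) \<partial>lborel)"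
proof -
  note [measurable] = fibre_density_borel cone_integrand_borel
  have mC: "(\<lambda>v\<phi>. vector [vt_sheet (q $ 2) (q $ 3) (s * e v\<phi>) v\<phi>, vr, v\<theta>, v\<phi>] :: real^4) \<in> borel_measurable borel" for s
    unfolding e_def vt_sheet_def vt_disc_def by (intro borel_measurable_vec4; measurable)
  note [measurable] = mC[of 1, simplified] mC[of "- 1", simplified]
  let ?w = "\<lambda>L. cone_integrand q (bl_comp L z) * ((q $ 2)\<^sup>2 * Sg (q $ 2) (q $ 3) / (sin (q $ 3) * ham_root L z))"
  have [measurable]: "(\<lambda>L. ham_root L z) \<in> borel_measurable borel" unfolding ham_root_def by measurable
  have [measurable]: "(\<lambda>L. ham L z) \<in> borel_measurable borel" unfolding ham_def by measurable
  have [measurable]: "(\<lambda>L. bl_comp L z) \<in> borel_measurable borel"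
    unfolding bl_comp_def by (intro borel_measurable_vec4; measurable)
  have w0: "0 \<le> ?w L" for L
    using cone_integrand_nonneg[of q] phase_dom_simps(2,3,6)[OF z] ham_root_pos'[OF z b, of L] by (simp add: z_def)
  have "(\<integral>\<^sup>+v\<phi>. ennreal (fibre_density q (vector [vt_sheet (q $ 2) (q $ 3) (e v\<phi>) v\<phi>, vr, v\<theta>, v\<phi>]))
      + ennreal (fibre_density q (vector [vt_sheet (q $ 2) (q $ 3) (- e v\<phi>) v\<phi>, vr, v\<theta>, v\<phi>])) \<partial>lborel)
    = (\<integral>\<^sup>+v\<phi>. ennreal (fibre_density q (vector [vt_sheet (q $ 2) (q $ 3) (e v\<phi>) v\<phi>, vr, v\<theta>, v\<phi>])) \<partial>lborel)
      + (\<integral>\<^sup>+v\<phi>. ennreal (fibre_density q (vector [vt_sheet (q $ 2) (q $ 3) (- e v\<phi>) v\<phi>, vr, v\<theta>, v\<phi>])) \<partial>lborel)"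
    by (rule nn_integral_add; measurable)
  also have "\<dots> = (\<integral>\<^sup>+L. ennreal (indicator {L. 0 < 1 * ham L z} L * ?w L) \<partial>lborel) + (\<integral>\<^sup>+L. ennreal (indicator {L. 0 < - 1 * ham L z} L * ?w L) \<partial>lborel)"
    using single_sheet[OF z G b, of 1] single_sheet[OF z G b, of "- 1"]
    by (simp only: e_def vr_def v\<theta>_def z_def mult_1 mult_minus1 abs_one abs_minus_cancel simp_thms)
  also have "\<dots> = (\<integral>\<^sup>+L. ennreal (indicator {L. 0 < 1 * ham L z} L * ?w L) + ennreal (indicator {L. 0 < - 1 * ham L z} L * ?w L) \<partial>lborel)"
    by (rule nn_integral_add[symmetric]; measurable)
  also have "\<dots> = (\<integral>\<^sup>+L. ?w L \<partial>lborel)"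
  proof (rule nn_integral_cong_AE)
    have "{L. ham L z = 0} \<in> null_sets lborel"
      using ham_zero_finite[OF z b] by (intro finite_imp_null_set_lborel) (simp add: z_def)
    from AE_not_in[OF this]
    show "AE L in lborel. ennreal (indicator {L. 0 < 1 * ham L z} L * ?w L) + ennreal (indicator {L. 0 < - 1 * ham L z} L * ?w L) = ennreal (?w L)"
      by eventually_elim (auto simp: indicator_def)
  qed
  finally show ?thesis .
qed

end

lemma borel_measurable_vec_nth' [measurable (raw)]:
  fixes f :: "'a \<Rightarrow> real^'n"
  shows "f \<in> borel_measurable N \<Longrightarrow> (\<lambda>x. f x $ i) \<in> borel_measurable N"
  by (rule measurable_compose[OF _ borel_measurable_continuous_onI]) (auto intro!: continuous_intros)

context kerr_bl begin

lemma kerr_fun_borel: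
  assumes [measurable]: "r \<in> borel_measurable N" "\<theta> \<in> borel_measurable N"
  shows "(\<lambda>x. De (r x)) \<in> borel_measurable N" "(\<lambda>x. Sg (r x) (\<theta> x)) \<in> borel_measurable N" "(\<lambda>x. PI (r x) (\<theta> x)) \<in> borel_measurable N"
  unfolding kerr_Delta_def kerr_Sigma_def kerr_Pi_def by measurable

lemma bl_comp_borel:
  assumes [measurable]: "L \<in> borel_measurable N" "r \<in> borel_measurable N" "\<theta> \<in> borel_measurable N" "p \<in> borel_measurable N" "b \<in> borel_measurable N"
  shows "(\<lambda>x. ham_root (L x) (r x, \<theta> x, p x, b x)) \<in> borel_measurable N" "(\<lambda>x. ham (L x) (r x, \<theta> x, p x, b x)) \<in> borel_measurable N"
    "(\<lambda>x. bl_comp (L x) (r x, \<theta> x, p x, b x)) \<in> borel_measurable N"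
proof -
  note [measurable] = kerr_fun_borel(1)[OF assms(2,3)] kerr_fun_borel(2,3)[OF assms(2,3)]
  show [measurable]: "(\<lambda>x. ham_root (L x) (r x, \<theta> x, p x, b x)) \<in> borel_measurable N"
    unfolding ham_root_def fst_conv snd_conv by measurable
  show [measurable]: "(\<lambda>x. ham (L x) (r x, \<theta> x, p x, b x)) \<in> borel_measurable N"
    unfolding ham_def fst_conv snd_conv by measurable
  show "(\<lambda>x. bl_comp (L x) (r x, \<theta> x, p x, b x)) \<in> borel_measurable N"
    unfolding bl_comp_def fst_conv snd_conv by (intro borel_measurable_vec4; measurable)
qed

lemma phase_weight_borel:
  assumes [measurable]: "L \<in> borel_measurable N" "r \<in> borel_measurable N" "\<theta> \<in> borel_measurable N" "p \<in> borel_measurable N" "b \<in> borel_measurable N"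
  shows "(\<lambda>x. phase_weight (L x) (r x, \<theta> x, p x, b x)) \<in> borel_measurable N"
proof -
  note [measurable] = kerr_fun_borel(1)[OF assms(2,3)] kerr_fun_borel(2,3)[OF assms(2,3)] bl_comp_borel(1,2)[OF assms]
  show ?thesis unfolding phase_weight_def weight_def weight_norm_def fst_conv snd_conv by measurable
qed

text \<open>On the boundary of the ergoregion the quadratic for v^t degenerates and
  \<open>vt_sheet\<close> divides by 0. For each angle this happens at no more than two
  radii.\<close>

lemma ergo_null: "{x. ergo (fst x) (fst (snd x)) = 0} \<in> null_sets (lborel :: (real \<times> real \<times> real) measure)"
proof -
  let ?N = "{x. ergo (fst x) (fst (snd x)) = 0} :: (real \<times> real \<times> real) set"
  have cl: "closed ?N"
    unfolding ergo_def kerr_Delta_def by (intro closed_Collect_eq continuous_intros)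
  then have N: "?N \<in> sets borel" by simp
  have fin: "finite {r. ergo r \<theta> = 0}" for \<theta>
  proof (rule finite_subset)
    define k where "k = M\<^sup>2 - a\<^sup>2 + a\<^sup>2 * (sin \<theta>)\<^sup>2"
    show "{r. ergo r \<theta> = 0} \<subseteq> {M + sqrt k, M - sqrt k}"
    proof
      fix r assume "r \<in> {r. ergo r \<theta> = 0}"
      then have "(r - M)\<^sup>2 = k" by (simp add: ergo_def kerr_Delta_def k_def power2_eq_square algebra_simps)
      then have "\<bar>r - M\<bar> = sqrt k" by (metis real_sqrt_abs)
      then show "r \<in> {M + sqrt k, M - sqrt k}" by (auto simp: abs_if split: if_splits)
    qed
  qed simp
  have m: "(\<lambda>x. indicator ?N x :: ennreal) \<in> borel_measurable borel" using N by simp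
  have "emeasure lborel ?N = (\<integral>\<^sup>+x. indicator ?N x \<partial>(lborel :: (real \<times> real \<times> real) measure))"
    using N by (simp add: nn_integral_indicator)
  also have "\<dots> = (\<integral>\<^sup>+r. \<integral>\<^sup>+w. indicator ?N (r, w) \<partial>lborel \<partial>lborel)"
    by (rule lborel_nn_integral_pair[OF m])
  also have "\<dots> = (\<integral>\<^sup>+w. \<integral>\<^sup>+r. indicator ?N (r, w) \<partial>lborel \<partial>lborel)"
    by (rule lborel_pair.Fubini'[symmetric]) (use m in \<open>simp add: lborel_prod case_prod_unfold\<close>)
  also have "\<dots> = (\<integral>\<^sup>+w. 0 \<partial>(lborel :: (real \<times> real) measure))"
  proof (rule nn_integral_cong)
    fix w :: "real \<times> real"
    have "(\<integral>\<^sup>+r. indicator ?N (r, w) \<partial>lborel) = (\<integral>\<^sup>+r. indicator {r. ergo r (fst w) = 0} r \<partial>lborel)"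
      by (intro nn_integral_cong) (simp add: indicator_def)
    also have "\<dots> = emeasure lborel {r. ergo r (fst w) = 0}"
      by (rule nn_integral_indicator) (rule null_setsD2[OF finite_imp_null_set_lborel[OF fin]])
    also have "\<dots> = 0" using finite_imp_null_set_lborel[OF fin] by auto
    finally show "(\<integral>\<^sup>+r. indicator ?N (r, w) \<partial>lborel) = 0" .
  qed
  finally show ?thesis using N by (auto simp: null_sets_def)
qed

end

context kerr_vlasov begin

lemma sheet_borel:
  assumes [measurable]: "x \<in> borel_measurable N" "y \<in> borel_measurable N" "w \<in> borel_measurable N"
  shows "(\<lambda>v. fibre_density q (vector [vt_sheet r \<theta> (sqrt (vt_disc r \<theta> (x v) (y v) (w v))) (w v), x v, y v, w v])) \<in> borel_measurable N"
    "(\<lambda>v. fibre_density q (vector [vt_sheet r \<theta> (- sqrt (vt_disc r \<theta> (x v) (y v) (w v))) (w v), x v, y v, w v])) \<in> borel_measurable N"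
  unfolding vt_sheet_def vt_disc_def
  by (rule measurable_compose[OF _ fibre_density_borel], intro borel_measurable_vec4; measurable)+

text \<open>For fixed q, v^r and v^theta are multiples of p and b, contributing the factors Delta /
  Sigma and 1 / Sigma; the remaining integration over v^phi is \<open>both_sheets\<close>.\<close>

lemma cone_integral:
  fixes q :: "real^4"
  assumes q: "rp < q $ 2" "0 < q $ 3" "q $ 3 < pi" and G: "ergo (q $ 2) (q $ 3) \<noteq> 0"
  shows "cone_nn_integral M a q (\<lambda>c. model_weight M a q c * weighted_norm_2 M a f q c) =
    (\<integral>\<^sup>+p. \<integral>\<^sup>+b. \<integral>\<^sup>+L. cone_integrand q (bl_comp L (q $ 2, q $ 3, p, b)) *
      ((q $ 2)\<^sup>2 * De (q $ 2) / (Sg (q $ 2) (q $ 3) * sin (q $ 3) * ham_root L (q $ 2, q $ 3, p, b))) \<partial>lborel \<partial>lborel \<partial>lborel)"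
proof -
  define r \<theta> where "r = q $ 2" and "\<theta> = q $ 3"
  have z: "(r, \<theta>, p, b) \<in> phase_dom" for p b using q by (simp add: phase_dom_iff r_def \<theta>_def)
  have z': "(q $ 2, q $ 3, p, b) \<in> phase_dom" for p b using q by (simp add: phase_dom_iff)
  note pos = phase_dom_simps(1-6)[OF z[of 0 0], simplified]
  define I where "I x y w = ennreal (fibre_density q (vector [vt_sheet r \<theta> (sqrt (vt_disc r \<theta> x y w)) w, x, y, w]))
    + ennreal (fibre_density q (vector [vt_sheet r \<theta> (- sqrt (vt_disc r \<theta> x y w)) w, x, y, w]))" for x y w
  have Im [measurable]: "(\<lambda>v. I (x v) (y v) (w v)) \<in> borel_measurable N"
    if [measurable]: "x \<in> borel_measurable N" "y \<in> borel_measurable N" "w \<in> borel_measurable N" for x y w and N :: "'n measure"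
  proof -
    note [measurable] = sheet_borel[OF that]
    show ?thesis unfolding I_def by measurable
  qed
  define W where "W p b L = ennreal (cone_integrand q (bl_comp L (r, \<theta>, p, b)) * (r\<^sup>2 * Sg r \<theta> / (sin \<theta> * ham_root L (r, \<theta>, p, b))))" for p b L
  have Wm [measurable]: "(\<lambda>v. W (x v) (y v) (w v)) \<in> borel_measurable N"
    if [measurable]: "x \<in> borel_measurable N" "y \<in> borel_measurable N" "w \<in> borel_measurable N" for x y w and N :: "'n measure"
  proof -
    note [measurable] = bl_comp_borel[OF that(3) borel_measurable_const borel_measurable_const that(1,2)] cone_integrand_borel
    show ?thesis unfolding W_def by measurable
  qed
  have inner: "(\<integral>\<^sup>+vt. (let c = vector [vt, vr, v\<theta>, v\<phi>] in
        ennreal ((model_weight M a q c * weighted_norm_2 M a f q c) * ((q $ 2)\<^sup>2 * sin (q $ 3) / \<bar>bl_lower M a q c 1\<bar>)))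
      \<partial>count_space {vt. (bl_point q, bl_vec q (vector [vt, vr, v\<theta>, v\<phi>])) \<in> future_cone M a}) = I vr v\<theta> v\<phi>" for vr v\<theta> v\<phi>
  proof -
    have "(\<integral>\<^sup>+vt. (let c = vector [vt, vr, v\<theta>, v\<phi>] in
        ennreal ((model_weight M a q c * weighted_norm_2 M a f q c) * ((q $ 2)\<^sup>2 * sin (q $ 3) / \<bar>bl_lower M a q c 1\<bar>)))
      \<partial>count_space {vt. (bl_point q, bl_vec q (vector [vt, vr, v\<theta>, v\<phi>])) \<in> future_cone M a})
      = (\<integral>\<^sup>+vt. ennreal (fibre_density q (vector [vt, vr, v\<theta>, v\<phi>])) \<partial>count_space {vt. (bl_point q, bl_vec q (vector [vt, vr, v\<theta>, v\<phi>])) \<in> future_cone M a})"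
      by (intro nn_integral_cong) (simp add: Let_def fibre_density_def cone_integrand_def weighted_norm_2_def f_ext_def)
    also have "\<dots> = I vr v\<theta> v\<phi>" unfolding sheet_sum[OF z'[of 0 0] G] I_def r_def \<theta>_def ..
    finally show ?thesis .
  qed
  have Ib: "(\<lambda>v. I (fst v) (fst (snd v)) (snd (snd v))) \<in> borel_measurable (borel :: (real \<times> real \<times> real) measure)"
    by (rule Im) (auto intro!: borel_measurable_continuous_onI continuous_intros)
  have "cone_nn_integral M a q (\<lambda>c. model_weight M a q c * weighted_norm_2 M a f q c)
    = (\<integral>\<^sup>+v. I (fst v) (fst (snd v)) (snd (snd v)) \<partial>(lborel :: (real \<times> real \<times> real) measure))"
    unfolding cone_nn_integral_def inner by (simp add: case_prod_unfold)
  also have "\<dots> = (\<integral>\<^sup>+x. \<integral>\<^sup>+v. I x (fst v) (snd v) \<partial>lborel \<partial>lborel)"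
    by (subst lborel_nn_integral_pair[OF Ib]) simp
  also have "\<dots> = (\<integral>\<^sup>+x. \<integral>\<^sup>+y. \<integral>\<^sup>+w. I x y w \<partial>lborel \<partial>lborel \<partial>lborel)"
  proof (rule nn_integral_cong)
    fix x
    have "(\<lambda>v. I x (fst v) (snd v)) \<in> borel_measurable (borel :: (real \<times> real) measure)"
      by (rule Im) (auto intro!: borel_measurable_continuous_onI continuous_intros)
    from lborel_nn_integral_pair[OF this]
    show "(\<integral>\<^sup>+v. I x (fst v) (snd v) \<partial>lborel) = (\<integral>\<^sup>+y. \<integral>\<^sup>+w. I x y w \<partial>lborel \<partial>lborel)" by simp
  qed
  also have "\<dots> = ennreal \<bar>De r / Sg r \<theta>\<bar> * (\<integral>\<^sup>+p. \<integral>\<^sup>+y. \<integral>\<^sup>+w. I (0 + De r / Sg r \<theta> * p) y w \<partial>lborel \<partial>lborel \<partial>lborel)"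
    by (rule nn_integral_real_affine) (measurable, use pos in simp)
  also have "(\<integral>\<^sup>+p. \<integral>\<^sup>+y. \<integral>\<^sup>+w. I (0 + De r / Sg r \<theta> * p) y w \<partial>lborel \<partial>lborel \<partial>lborel)
    = (\<integral>\<^sup>+p. ennreal \<bar>1 / Sg r \<theta>\<bar> * (\<integral>\<^sup>+b. \<integral>\<^sup>+L. W p b L \<partial>lborel \<partial>lborel) \<partial>lborel)"
  proof (rule nn_integral_cong)
    fix p :: real
    have "(\<integral>\<^sup>+y. \<integral>\<^sup>+w. I (0 + De r / Sg r \<theta> * p) y w \<partial>lborel \<partial>lborel)
      = ennreal \<bar>1 / Sg r \<theta>\<bar> * (\<integral>\<^sup>+b. \<integral>\<^sup>+w. I (0 + De r / Sg r \<theta> * p) (0 + 1 / Sg r \<theta> * b) w \<partial>lborel \<partial>lborel)"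
      by (rule nn_integral_real_affine) (measurable, use pos in simp)
    also have "(\<integral>\<^sup>+b. \<integral>\<^sup>+w. I (0 + De r / Sg r \<theta> * p) (0 + 1 / Sg r \<theta> * b) w \<partial>lborel \<partial>lborel) = (\<integral>\<^sup>+b. \<integral>\<^sup>+L. W p b L \<partial>lborel \<partial>lborel)"
    proof (rule nn_integral_cong_AE)
      have "{0::real} \<in> null_sets lborel" by (rule finite_imp_null_set_lborel) simp
      from AE_not_in[OF this]
      show "AE b in lborel. (\<integral>\<^sup>+w. I (0 + De r / Sg r \<theta> * p) (0 + 1 / Sg r \<theta> * b) w \<partial>lborel) = (\<integral>\<^sup>+L. W p b L \<partial>lborel)"
      proof eventually_elim
        case (elim b)
        then have b: "b \<noteq> 0" by simp
        have e: "0 + De r / Sg r \<theta> * p = De r * p / Sg r \<theta>" "0 + 1 / Sg r \<theta> * b = b / Sg r \<theta>" by simp_all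
        show ?case
          using both_sheets[OF z' G b, of p] unfolding e unfolding I_def W_def r_def \<theta>_def .
      qed
    qed
    finally show "(\<integral>\<^sup>+y. \<integral>\<^sup>+w. I (0 + De r / Sg r \<theta> * p) y w \<partial>lborel \<partial>lborel)
      = ennreal \<bar>1 / Sg r \<theta>\<bar> * (\<integral>\<^sup>+b. \<integral>\<^sup>+L. W p b L \<partial>lborel \<partial>lborel)" .
  qed
  also have "ennreal \<bar>De r / Sg r \<theta>\<bar> * \<dots> = (\<integral>\<^sup>+p. \<integral>\<^sup>+b. \<integral>\<^sup>+L. ennreal \<bar>De r / Sg r \<theta>\<bar> * (ennreal \<bar>1 / Sg r \<theta>\<bar> * W p b L) \<partial>lborel \<partial>lborel \<partial>lborel)"
    by (simp add: nn_integral_cmult)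
  also have "\<dots> = (\<integral>\<^sup>+p. \<integral>\<^sup>+b. \<integral>\<^sup>+L. ennreal (cone_integrand q (bl_comp L (r, \<theta>, p, b)) *
      (r\<^sup>2 * De r / (Sg r \<theta> * sin \<theta> * ham_root L (r, \<theta>, p, b)))) \<partial>lborel \<partial>lborel \<partial>lborel)"
  proof -
    have "ennreal \<bar>De r / Sg r \<theta>\<bar> * (ennreal \<bar>1 / Sg r \<theta>\<bar> * W p b L) = ennreal (cone_integrand q (bl_comp L (r, \<theta>, p, b)) *
      (r\<^sup>2 * De r / (Sg r \<theta> * sin \<theta> * ham_root L (r, \<theta>, p, b))))" for p b L
    proof -
      have "De r / Sg r \<theta> * (1 / Sg r \<theta> * (cone_integrand q (bl_comp L (r, \<theta>, p, b)) * (r\<^sup>2 * Sg r \<theta> / (sin \<theta> * ham_root L (r, \<theta>, p, b)))))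
        = cone_integrand q (bl_comp L (r, \<theta>, p, b)) * (r\<^sup>2 * De r / (Sg r \<theta> * sin \<theta> * ham_root L (r, \<theta>, p, b)))"
        using pos by (simp add: mult_ac)
      then show ?thesis using pos unfolding W_def by (simp add: ennreal_mult'[symmetric])
    qed
    then show ?thesis by simp
  qed
  finally show ?thesis unfolding r_def \<theta>_def .
qed

lemma cone_integrand_bl_comp:
  fixes q :: "real^4"
  assumes z: "(q $ 2, q $ 3, p, b) \<in> phase_dom"
  shows "cone_integrand q (bl_comp L (q $ 2, q $ 3, p, b)) = weight L (q $ 2, q $ 3, p, b) * (weight_norm L (q $ 2, q $ 3, p, b))\<^sup>2
    * f_ext (bl_point q, bl_vec q (bl_comp L (q $ 2, q $ 3, p, b)))"
  unfolding cone_integrand_def model_weight_def weighted_norm_2_def bl_comp_lower[OF z] by (simp add: weight_def weight_norm_def)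

end

lemma nn_integral_continuous_Ioo:
  fixes g :: "real \<Rightarrow> real"
  assumes g: "continuous_on {a..b} g" and nn: "\<And>x. x \<in> {a..b} \<Longrightarrow> 0 \<le> g x" 
  shows "(\<integral>\<^sup>+x\<in>{a<..<b}. g x \<partial>lborel) = ennreal (integral (cbox a b) g)"
proof -
  have int: "set_integrable lborel {a..b} g"
    unfolding set_integrable_def using borel_integrable_compact[OF compact_Icc g] .
  have "(\<integral>\<^sup>+x\<in>{a<..<b}. g x \<partial>lborel) = (\<integral>\<^sup>+x. ennreal (indicator {a..b} x *\<^sub>R g x) \<partial>lborel)"
  proof (rule nn_integral_cong_AE)
    have "{a, b} \<in> null_sets lborel" by (rule finite_imp_null_set_lborel) simp
    from AE_not_in[OF this]
    show "AE x in lborel. ennreal (g x) * indicator {a<..<b} x = ennreal (indicator {a..b} x *\<^sub>R g x)"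
      by eventually_elim (auto simp: indicator_def)
  qed
  also have "\<dots> = ennreal (\<integral>x. indicator {a..b} x *\<^sub>R g x \<partial>lborel)"
    by (rule nn_integral_eq_integral[OF int[unfolded set_integrable_def]]) (auto simp: indicator_def nn)
  also have "(\<integral>x. indicator {a..b} x *\<^sub>R g x \<partial>lborel) = integral (cbox a b) g"
    using set_borel_integral_eq_integral(2)[OF int] by (simp add: set_lebesgue_integral_def)
  finally show ?thesis .
qed

section \<open>Reduction of the energy to slices of constant angular momentum\<close>

context kerr_vlasov begin

text \<open>With the indicators and \<open>f_ext\<close> inside, this is a Borel function of all
  real arguments, so the six integrals can be permuted freely.\<close>

definition phase_density :: "real \<Rightarrow> real \<Rightarrow> real \<Rightarrow> real \<Rightarrow> real \<Rightarrow> real \<Rightarrow> real \<Rightarrow> ennreal" where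
  "phase_density t L r \<theta> p b \<phi> = ennreal (indicator {rp<..} r * indicator {0<..<pi} \<theta> * indicator {0<..<2 * pi} \<phi>
    * (phase_weight L (r, \<theta>, p, b) * f_ext (cone_chart L ((t, r, \<theta>, p, b), \<phi>))))"

lemma cone_chart_borel:
  assumes [measurable]: "L \<in> borel_measurable N" "r \<in> borel_measurable N" "\<theta> \<in> borel_measurable N" "p \<in> borel_measurable N" "b \<in> borel_measurable N"
    "\<phi> \<in> borel_measurable N"
  shows "(\<lambda>x. cone_chart (L x) ((t, r x, \<theta> x, p x, b x), \<phi> x)) \<in> borel_measurable N"
proof -
  note [measurable] = bl_comp_borel(3)[OF assms(1-5)]
  show ?thesis
    unfolding cone_chart_def bl_point_def bl_vec_eq bl_coord_nth fst_conv snd_conv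
    by (intro borel_measurable_Pair borel_measurable_vec4; measurable)
qed

lemma phase_density_borel [measurable (raw)]:
  assumes [measurable]: "L \<in> borel_measurable N" "r \<in> borel_measurable N" "\<theta> \<in> borel_measurable N" "p \<in> borel_measurable N" "b \<in> borel_measurable N"
    "\<phi> \<in> borel_measurable N"
  shows "(\<lambda>x. phase_density t (L x) (r x) (\<theta> x) (p x) (b x) (\<phi> x)) \<in> borel_measurable N"
proof -
  note [measurable] = measurable_compose[OF cone_chart_borel[OF assms] f_ext_borel] phase_weight_borel[OF assms(1-5)]
  show ?thesis unfolding phase_density_def by measurable
qed

lemma energy_iterated:
  "E_model_3 M a f t = (\<integral>\<^sup>+r. \<integral>\<^sup>+\<theta>. \<integral>\<^sup>+\<phi>. \<integral>\<^sup>+p. \<integral>\<^sup>+b. \<integral>\<^sup>+L. phase_density t L r \<theta> p b \<phi> \<partial>lborel \<partial>lborel \<partial>lborel \<partial>lborel \<partial>lborel \<partial>lborel)"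
proof -
  let ?Y = "\<lambda>r \<theta> \<phi>. \<integral>\<^sup>+p. \<integral>\<^sup>+b. \<integral>\<^sup>+L. phase_density t L r \<theta> p b \<phi> \<partial>lborel \<partial>lborel \<partial>lborel"
  have [measurable]: "(\<lambda>v :: real \<times> real \<times> real. fst v) \<in> borel_measurable borel"
    "(\<lambda>v :: real \<times> real \<times> real. fst (snd v)) \<in> borel_measurable borel" "(\<lambda>v :: real \<times> real \<times> real. snd (snd v)) \<in> borel_measurable borel"
    "(\<lambda>v :: real \<times> real. fst v) \<in> borel_measurable borel" "(\<lambda>v :: real \<times> real. snd v) \<in> borel_measurable borel"
    by (auto intro!: borel_measurable_continuous_onI continuous_intros)
  have Y3: "(\<lambda>v. ?Y (fst v) (fst (snd v)) (snd (snd v))) \<in> borel_measurable (borel :: (real \<times> real \<times> real) measure)"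
    by measurable
  have "E_model_3 M a f t = (\<integral>\<^sup>+v. ?Y (fst v) (fst (snd v)) (snd (snd v)) \<partial>(lborel :: (real \<times> real \<times> real) measure))"
    unfolding E_model_3_def
  proof (rule nn_integral_cong_AE)
    show "AE v in (lborel :: (real \<times> real \<times> real) measure). (case v of (r, \<theta>, \<phi>) \<Rightarrow>
        let q = vector [t, r, \<theta>, \<phi>] in ennreal (sin \<theta>) * cone_nn_integral M a q (\<lambda>c. model_weight M a q c * weighted_norm_2 M a f q c))
        * indicator ({rp<..} \<times> {0<..<pi} \<times> {0<..<2 * pi}) v = ?Y (fst v) (fst (snd v)) (snd (snd v))"
      using AE_not_in[OF ergo_null]
    proof eventually_elim
      case (elim v)
      obtain r \<theta> \<phi> where v: "v = (r, \<theta>, \<phi>)" by (cases v)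
      show ?case
      proof (cases "v \<in> {rp<..} \<times> {0<..<pi} \<times> {0<..<2 * pi}")
        case False
        then have "phase_density t L r \<theta> p b \<phi> = 0" for p b L by (auto simp: phase_density_def v indicator_def)
        then show ?thesis using False by (simp add: v)
      next
        case True
        define q where "q = (vector [t, r, \<theta>, \<phi>] :: real^4)"
        have q: "q $ 1 = t" "q $ 2 = r" "q $ 3 = \<theta>" "q $ 4 = \<phi>" by (simp_all add: q_def)
        have rt: "rp < r" "0 < \<theta>" "\<theta> < pi" using True by (auto simp: v)
        have G: "ergo (q $ 2) (q $ 3) \<noteq> 0" using elim by (simp add: v q)
        have s: "0 < sin \<theta>" using rt sin_gt_zero by simp
        have eq: "ennreal (sin \<theta>) * ennreal (cone_integrand q (bl_comp L (r, \<theta>, p, b)) * (r\<^sup>2 * De r / (Sg r \<theta> * sin \<theta> * ham_root L (r, \<theta>, p, b)))) = phase_density t L r \<theta> p b \<phi>" for p b L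
        proof -
          have z: "(q $ 2, q $ 3, p, b) \<in> phase_dom" using rt by (simp add: phase_dom_iff q)
          have "bl_coord ((t, r, \<theta>, p, b), \<phi>) = q" by (simp add: bl_coord_def q_def)
          then have cm: "cone_chart L ((t, r, \<theta>, p, b), \<phi>) = (bl_point q, bl_vec q (bl_comp L (r, \<theta>, p, b)))" by (simp add: cone_chart_def)
          have "sin \<theta> * (cone_integrand q (bl_comp L (r, \<theta>, p, b)) * (r\<^sup>2 * De r / (Sg r \<theta> * sin \<theta> * ham_root L (r, \<theta>, p, b))))
            = phase_weight L (r, \<theta>, p, b) * f_ext (cone_chart L ((t, r, \<theta>, p, b), \<phi>))"
            using s cone_integrand_bl_comp[OF z, of L] unfolding cm q by (simp add: phase_weight_def)
          then show ?thesis
            using True s by (simp add: phase_density_def v ennreal_mult'[symmetric])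
        qed
        have [measurable]: "cone_integrand q \<in> borel_measurable borel" by (rule cone_integrand_borel)
        define g where "g p b L = ennreal (cone_integrand q (bl_comp L (r, \<theta>, p, b)) * (r\<^sup>2 * De r / (Sg r \<theta> * sin \<theta> * ham_root L (r, \<theta>, p, b))))" for p b L
        have gm [measurable (raw)]: "(\<lambda>x. g (p x) (b x) (L x)) \<in> borel_measurable N"
          if [measurable]: "L \<in> borel_measurable N" "p \<in> borel_measurable N" "b \<in> borel_measurable N" for L p b and N :: "'n measure"
        proof -
          note [measurable] = bl_comp_borel[OF that(1) borel_measurable_const borel_measurable_const that(2,3)]
          show ?thesis unfolding g_def by measurable
        qed
        have "ennreal (sin \<theta>) * cone_nn_integral M a q (\<lambda>c. model_weight M a q c * weighted_norm_2 M a f q c)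
          = ennreal (sin \<theta>) * (\<integral>\<^sup>+p. \<integral>\<^sup>+b. \<integral>\<^sup>+L. g p b L \<partial>lborel \<partial>lborel \<partial>lborel)"
          unfolding cone_integral[of q, unfolded q, OF rt G[unfolded q]] g_def ..
        also have "\<dots> = (\<integral>\<^sup>+p. \<integral>\<^sup>+b. \<integral>\<^sup>+L. ennreal (sin \<theta>) * g p b L \<partial>lborel \<partial>lborel \<partial>lborel)"
          by (simp add: nn_integral_cmult)
        also have "\<dots> = ?Y r \<theta> \<phi>" unfolding g_def eq ..
        finally have "ennreal (sin \<theta>) * cone_nn_integral M a q (\<lambda>c. model_weight M a q c * weighted_norm_2 M a f q c) = ?Y r \<theta> \<phi>" .
        then show ?thesis using True by (simp add: v q_def)
      qed
    qed
  qed
  also have "\<dots> = (\<integral>\<^sup>+r. \<integral>\<^sup>+v. ?Y r (fst v) (snd v) \<partial>lborel \<partial>lborel)"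
    by (subst lborel_nn_integral_pair[OF Y3]) simp
  also have "\<dots> = (\<integral>\<^sup>+r. \<integral>\<^sup>+\<theta>. \<integral>\<^sup>+\<phi>. ?Y r \<theta> \<phi> \<partial>lborel \<partial>lborel \<partial>lborel)"
  proof (rule nn_integral_cong)
    fix r
    have "(\<lambda>v. ?Y r (fst v) (snd v)) \<in> borel_measurable (borel :: (real \<times> real) measure)" by measurable
    from lborel_nn_integral_pair[OF this]
    show "(\<integral>\<^sup>+v. ?Y r (fst v) (snd v) \<partial>lborel) = (\<integral>\<^sup>+\<theta>. \<integral>\<^sup>+\<phi>. ?Y r \<theta> \<phi> \<partial>lborel \<partial>lborel)" by simp
  qed
  finally show ?thesis .
qed

text \<open>Adjacent interchanges move \<open>L\<close> outermost, because the estimate holds for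
  each fixed \<open>L\<close>, and phi innermost, because it is to be averaged.\<close>

lemma energy_swapped:
  "E_model_3 M a f t = (\<integral>\<^sup>+L. \<integral>\<^sup>+r. \<integral>\<^sup>+\<theta>. \<integral>\<^sup>+p. \<integral>\<^sup>+b. \<integral>\<^sup>+\<phi>. phase_density t L r \<theta> p b \<phi> \<partial>lborel \<partial>lborel \<partial>lborel \<partial>lborel \<partial>lborel \<partial>lborel)"
proof -
  have "E_model_3 M a f t = (\<integral>\<^sup>+r. \<integral>\<^sup>+\<theta>. \<integral>\<^sup>+\<phi>. \<integral>\<^sup>+p. \<integral>\<^sup>+b. \<integral>\<^sup>+L. phase_density t L r \<theta> p b \<phi> \<partial>lborel \<partial>lborel \<partial>lborel \<partial>lborel \<partial>lborel \<partial>lborel)"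
    by (rule energy_iterated)
  also have "\<dots> = (\<integral>\<^sup>+r. \<integral>\<^sup>+\<theta>. \<integral>\<^sup>+\<phi>. \<integral>\<^sup>+p. \<integral>\<^sup>+L. \<integral>\<^sup>+b. phase_density t L r \<theta> p b \<phi> \<partial>lborel \<partial>lborel \<partial>lborel \<partial>lborel \<partial>lborel \<partial>lborel)"
    by (rule nn_integral_cong, rule nn_integral_cong, rule nn_integral_cong, rule nn_integral_cong, rule lborel_nn_integral_swap, measurable)
  also have "\<dots> = (\<integral>\<^sup>+r. \<integral>\<^sup>+\<theta>. \<integral>\<^sup>+\<phi>. \<integral>\<^sup>+L. \<integral>\<^sup>+p. \<integral>\<^sup>+b. phase_density t L r \<theta> p b \<phi> \<partial>lborel \<partial>lborel \<partial>lborel \<partial>lborel \<partial>lborel \<partial>lborel)"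
    by (rule nn_integral_cong, rule nn_integral_cong, rule nn_integral_cong, rule lborel_nn_integral_swap, measurable)
  also have "\<dots> = (\<integral>\<^sup>+r. \<integral>\<^sup>+\<theta>. \<integral>\<^sup>+L. \<integral>\<^sup>+\<phi>. \<integral>\<^sup>+p. \<integral>\<^sup>+b. phase_density t L r \<theta> p b \<phi> \<partial>lborel \<partial>lborel \<partial>lborel \<partial>lborel \<partial>lborel \<partial>lborel)"
    by (rule nn_integral_cong, rule nn_integral_cong, rule lborel_nn_integral_swap, measurable)
  also have "\<dots> = (\<integral>\<^sup>+r. \<integral>\<^sup>+L. \<integral>\<^sup>+\<theta>. \<integral>\<^sup>+\<phi>. \<integral>\<^sup>+p. \<integral>\<^sup>+b. phase_density t L r \<theta> p b \<phi> \<partial>lborel \<partial>lborel \<partial>lborel \<partial>lborel \<partial>lborel \<partial>lborel)"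
    by (rule nn_integral_cong, rule lborel_nn_integral_swap, measurable)
  also have "\<dots> = (\<integral>\<^sup>+L. \<integral>\<^sup>+r. \<integral>\<^sup>+\<theta>. \<integral>\<^sup>+\<phi>. \<integral>\<^sup>+p. \<integral>\<^sup>+b. phase_density t L r \<theta> p b \<phi> \<partial>lborel \<partial>lborel \<partial>lborel \<partial>lborel \<partial>lborel \<partial>lborel)"
    by (rule lborel_nn_integral_swap, measurable)
  also have "\<dots> = (\<integral>\<^sup>+L. \<integral>\<^sup>+r. \<integral>\<^sup>+\<theta>. \<integral>\<^sup>+p. \<integral>\<^sup>+\<phi>. \<integral>\<^sup>+b. phase_density t L r \<theta> p b \<phi> \<partial>lborel \<partial>lborel \<partial>lborel \<partial>lborel \<partial>lborel \<partial>lborel)"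
    by (rule nn_integral_cong, rule nn_integral_cong, rule nn_integral_cong, rule lborel_nn_integral_swap, measurable)
  also have "\<dots> = (\<integral>\<^sup>+L. \<integral>\<^sup>+r. \<integral>\<^sup>+\<theta>. \<integral>\<^sup>+p. \<integral>\<^sup>+b. \<integral>\<^sup>+\<phi>. phase_density t L r \<theta> p b \<phi> \<partial>lborel \<partial>lborel \<partial>lborel \<partial>lborel \<partial>lborel \<partial>lborel)"
    by (rule nn_integral_cong, rule nn_integral_cong, rule nn_integral_cong, rule nn_integral_cong, rule lborel_nn_integral_swap, measurable)
  finally show ?thesis .
qed

text \<open>\<open>phase_weight\<close> does not involve phi, so the inner integral only averages
  \<open>F_cone\<close>; the other four assemble to an integral over \<open>phase_dom\<close>. For
  \<open>L\<close> different from 0 every chart point lies on the cone, so \<open>f_ext\<close> may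
  be replaced by \<open>f\<close>.\<close>

lemma energy_slice:
  assumes L: "L \<noteq> 0"
  shows "(\<integral>\<^sup>+r. \<integral>\<^sup>+\<theta>. \<integral>\<^sup>+p. \<integral>\<^sup>+b. \<integral>\<^sup>+\<phi>. phase_density t L r \<theta> p b \<phi> \<partial>lborel \<partial>lborel \<partial>lborel \<partial>lborel \<partial>lborel)
    = (\<integral>\<^sup>+z\<in>phase_dom. (phase_weight L z * F_avg L (t, z)) \<partial>lborel)"
proof -
  let ?G = "\<lambda>z. ennreal (phase_weight L z * F_avg L (t, z)) * indicator phase_dom z"
  have in0: "(\<integral>\<^sup>+\<phi>. phase_density t L r \<theta> p b \<phi> \<partial>lborel) = ?G (r, \<theta>, p, b)" for r \<theta> p b
  proof (cases "(r, \<theta>, p, b) \<in> phase_dom")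
    case False
    then have "phase_density t L r \<theta> p b \<phi> = 0" for \<phi> by (auto simp: phase_density_def phase_dom_iff indicator_def)
    then show ?thesis using False by simp
  next
    case True
    let ?z = "(r, \<theta>, p, b)"
    have w: "0 \<le> phase_weight L ?z" by (rule phase_weight_nonneg[OF True L])
    have X: "phase_density t L r \<theta> p b \<phi> = ennreal (phase_weight L ?z * F_cone L ((t, ?z), \<phi>)) * indicator {0<..<2 * pi} \<phi>" for \<phi>
      using True cone_chart_cone[OF True L, of t \<phi>] by (auto simp: phase_density_def phase_dom_iff F_cone_def f_ext_def indicator_def)
    have "(\<integral>\<^sup>+\<phi>. phase_density t L r \<theta> p b \<phi> \<partial>lborel) = ennreal (integral (cbox 0 (2 * pi)) (\<lambda>\<phi>. phase_weight L ?z * F_cone L ((t, ?z), \<phi>)))"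
      unfolding X
      by (rule nn_integral_continuous_Ioo)
        (intro continuous_on_mult continuous_on_const F_cone_continuous[OF True L], simp add: w F_cone_nonneg[OF True L])
    also have "\<dots> = ennreal (phase_weight L ?z * F_avg L (t, ?z))" unfolding F_avg_def by (subst integral_mult_right) (rule refl)
    finally show ?thesis using True by simp
  qed
  note m = phase_weight_F_avg_borel[OF L, of t]
  have "(\<integral>\<^sup>+z. ?G z \<partial>lborel) = (\<integral>\<^sup>+r. \<integral>\<^sup>+v. ?G (r, v) \<partial>lborel \<partial>lborel)" by (rule lborel_nn_integral_pair[OF m])
  also have "\<dots> = (\<integral>\<^sup>+r. \<integral>\<^sup>+\<theta>. \<integral>\<^sup>+v. ?G (r, \<theta>, v) \<partial>lborel \<partial>lborel \<partial>lborel)"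
    by (rule nn_integral_cong, rule lborel_nn_integral_pair[OF borel_measurable_pair_section[OF m]])
  also have "\<dots> = (\<integral>\<^sup>+r. \<integral>\<^sup>+\<theta>. \<integral>\<^sup>+p. \<integral>\<^sup>+b. ?G (r, \<theta>, p, b) \<partial>lborel \<partial>lborel \<partial>lborel \<partial>lborel)"
    by (rule nn_integral_cong, rule nn_integral_cong,
        rule lborel_nn_integral_pair[OF borel_measurable_pair_section[OF borel_measurable_pair_section[OF m]]])
  finally show ?thesis unfolding in0 by simp
qed

end

context kerr_slow_vlasov begin

lemma energy_estimate: "E_model_3 M a f t \<le> ennreal 3600000 * E_model_3 M a f 0"
proof -
  let ?A = "\<lambda>t L. \<integral>\<^sup>+r. \<integral>\<^sup>+\<theta>. \<integral>\<^sup>+p. \<integral>\<^sup>+b. \<integral>\<^sup>+\<phi>. phase_density t L r \<theta> p b \<phi> \<partial>lborel \<partial>lborel \<partial>lborel \<partial>lborel \<partial>lborel"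
  have "E_model_3 M a f t = (\<integral>\<^sup>+L. ?A t L \<partial>lborel)" by (rule energy_swapped)
  also have "\<dots> \<le> (\<integral>\<^sup>+L. ennreal 3600000 * ?A 0 L \<partial>lborel)"
  proof (rule nn_integral_mono_AE)
    \<comment> \<open>The excluded value \<open>L\<close> = 0, for which no estimate is available,
      is discarded here.\<close>
    have "{0::real} \<in> null_sets lborel" by (rule finite_imp_null_set_lborel) simp
    from AE_not_in[OF this] show "AE L in lborel. ?A t L \<le> ennreal 3600000 * ?A 0 L"
    proof eventually_elim
      case (elim L)
      then have "L \<noteq> 0" by simp
      from weighted_estimate[OF this, of t] show ?case unfolding energy_slice[OF \<open>L \<noteq> 0\<close>] by simp
    qed
  qed
  also have "\<dots> = ennreal 3600000 * (\<integral>\<^sup>+L. ?A 0 L \<partial>lborel)"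
    by (rule nn_integral_cmult) measurable
  also have "(\<integral>\<^sup>+L. ?A 0 L \<partial>lborel) = E_model_3 M a f 0" by (rule energy_swapped[symmetric])
  finally show ?thesis .
qed

end

theorem theorem1:
  shows "\<exists>(C::real) > 0. \<exists>(\<epsilon>::real) > 0. \<forall>(M::real) (a::real) (f :: (real ^ 4) \<times> (real ^ 4) \<Rightarrow> real).
    M > 0 \<and> \<bar>a\<bar> \<le> \<epsilon> * M \<and>
    smooth_on_submanifold f (future_cone M a) \<and>
    (\<forall>p \<in> future_cone M a. f p \<ge> 0) \<and>
    massless_vlasov M a f \<longrightarrow>
    (\<forall>t. E_model_3 M a f t \<le> ennreal C * E_model_3 M a f 0)"
\<comment> \<open>C is the comparison constant of \<open>weighted_estimate\<close> and 1/1000 the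
  rotation bound of \<open>kerr_ineq\<close>; neither is optimised.\<close>
proof (rule exI[of _ "3600000 :: real"], rule conjI, simp, rule exI[of _ "1 / 1000 :: real"], intro conjI allI impI)
  fix M a t :: real and f :: "(real ^ 4) \<times> (real ^ 4) \<Rightarrow> real"
  assume *: "M > 0 \<and> \<bar>a\<bar> \<le> 1 / 1000 * M \<and> smooth_on_submanifold f (future_cone M a) \<and>
    (\<forall>p \<in> future_cone M a. f p \<ge> 0) \<and> massless_vlasov M a f"
  interpret kerr_slow_vlasov M a f
    by unfold_locales (use * in auto)
  show "E_model_3 M a f t \<le> ennreal 3600000 * E_model_3 M a f 0" by (rule energy_estimate)
qed simp_all

end
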